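(* There exist a function $f$ with $f(n)=o(n)$ and a constant $C$ such that every $k$-ary cardinal tree with $n$ nodes can be represented using at most $\mathcal{C}(n,k)+f(n)+C\lg\lg k$ bits, with the nodes numbered by $0,\dots,n-1$, such that, on the word RAM with word size $\Theta(\lg(k+n))$, given (the number of) a node one can in constant time: go to its $i$-th child, go to its child labeled $j$, go to its parent (each if it exists), determine its degree, and determine its ordinal position among its siblings.
   Context: A $k$-ary cardinal tree is a rooted tree in which each node has $k$ positions labeled $0,\dots,k-1$, each of which may contain an edge to a child; the child labeled $j$ of $x$ is the child reached via the edge in position $j$, and the $i$-th child is the $i$-th child in increasing order of labels. $\mathcal{C}(n,k)=\left\lceil \lg\left(\frac{1}{kn+1}\binom{kn+1}{n}\right)\right\rceil$, the number of bits needed to distinguish all $k$-ary cardinal trees on $n$ nodes; $\lg=\log_2$. The word RAM has words of $w$ bits with constant-time arithmetic and bitwise operations; constant time means a bound independent of $n,k$ and the tree. *)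

theory Defs
  imports Complex_Main "HOL-Library.Landau_Symbols"
begin

section \<open>Cardinal trees\<close>

text \<open>
  A node is identified with the list of edge labels on the path from the root to it. A tree is the
  set of its nodes; the root is the empty list and the child of \<open>x\<close> labeled \<open>j\<close> is \<open>x @ [j]\<close>.
\<close>

definition cardinal_tree :: "nat \<Rightarrow> nat list set \<Rightarrow> bool" where
  "cardinal_tree k Tr \<longleftrightarrow>
     finite Tr \<and> [] \<in> Tr \<and> (\<forall>x j. x @ [j] \<in> Tr \<longrightarrow> x \<in> Tr \<and> j < k)"

definition child_labels :: "nat list set \<Rightarrow> nat list \<Rightarrow> nat set" where
  "child_labels Tr x = {j. x @ [j] \<in> Tr}"

definition degree :: "nat list set \<Rightarrow> nat list \<Rightarrow> nat" where
  "degree Tr x = card (child_labels Tr x)"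

definition child_labeled :: "nat list set \<Rightarrow> nat list \<Rightarrow> nat \<Rightarrow> nat list option" where
  "child_labeled Tr x j = (if j \<in> child_labels Tr x then Some (x @ [j]) else None)"

text \<open>Children are counted from 1.\<close>

definition ith_child :: "nat list set \<Rightarrow> nat list \<Rightarrow> nat \<Rightarrow> nat list option" where
  "ith_child Tr x i =
     (if 1 \<le> i \<and> i \<le> degree Tr x
      then Some (x @ [sorted_list_of_set (child_labels Tr x) ! (i - 1)]) else None)"

definition parent :: "nat list \<Rightarrow> nat list option" where
  "parent x = (if x = [] then None else Some (butlast x))"

definition left_siblings :: "nat list set \<Rightarrow> nat list \<Rightarrow> nat list set" where
  "left_siblings Tr x = {y \<in> Tr. \<exists>p j j'. x = p @ [j] \<and> y = p @ [j'] \<and> j' < j}"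

text \<open>Positions are counted from 1, like children; the root, having no siblings, has position 1.\<close>

definition ordinal_position :: "nat list set \<Rightarrow> nat list \<Rightarrow> nat" where
  "ordinal_position Tr x = card (left_siblings Tr x) + 1"

definition tree_bits :: "nat \<Rightarrow> nat \<Rightarrow> int" where
  "tree_bits n k = \<lceil>log 2 (1 / real (k * n + 1) * real ((k * n + 1) choose n))\<rceil>"


section \<open>The word RAM\<close>

text \<open>
  A word of \<open>w\<close> bits is a natural number below \<open>2 ^ w\<close>. Since \<open>w\<close> is a parameter of the semantics
  only, one program can be run at every word size. The machine halts when the program counter
  leaves the program.
\<close>

datatype binop = Add | Sub | Mul | Div | Mod | And | Or | Xor | Shl | Shr

datatype instr =
    Const nat nat             (* r0 := c *)
  | Op binop nat nat nat      (* r0 := r1 op r2 *)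
  | Not nat nat               (* r0 := bitwise complement of r1 *)
  | Load nat nat              (* r0 := mem[r1] *)
  | Store nat nat             (* mem[r0] := r1 *)
  | Jump_less nat nat nat     (* if r0 < r1 then go to line l *)
  | Jump nat

record state =
  pc :: nat
  regs :: "nat \<Rightarrow> nat"
  mem :: "nat \<Rightarrow> nat"

fun binop_val :: "nat \<Rightarrow> binop \<Rightarrow> nat \<Rightarrow> nat \<Rightarrow> nat" where
  "binop_val w Add x y = (x + y) mod 2 ^ w"
| "binop_val w Sub x y = (x + (2 ^ w - y)) mod 2 ^ w"
| "binop_val w Mul x y = (x * y) mod 2 ^ w"
| "binop_val w Div x y = x div y"
| "binop_val w Mod x y = x mod y"
| "binop_val w And x y = Bit_Operations.and x y"
| "binop_val w Or x y = Bit_Operations.or x y"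
| "binop_val w Xor x y = Bit_Operations.xor x y"
| "binop_val w Shl x y = push_bit y x mod 2 ^ w"
| "binop_val w Shr x y = drop_bit y x"

definition set_reg :: "nat \<Rightarrow> nat \<Rightarrow> state \<Rightarrow> state" where
  "set_reg r v s = s\<lparr>pc := pc s + 1, regs := (regs s)(r := v)\<rparr>"

fun exec :: "nat \<Rightarrow> instr \<Rightarrow> state \<Rightarrow> state" where
  "exec w (Const r c) s = set_reg r (c mod 2 ^ w) s"
| "exec w (Op b r r1 r2) s = set_reg r (binop_val w b (regs s r1) (regs s r2)) s"
| "exec w (Not r r1) s = set_reg r (2 ^ w - 1 - regs s r1) s"
| "exec w (Load r r1) s = set_reg r (mem s (regs s r1)) s"
| "exec w (Store r r1) s = s\<lparr>pc := pc s + 1, mem := (mem s)(regs s r := regs s r1)\<rparr>"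
| "exec w (Jump_less r r1 l) s = s\<lparr>pc := (if regs s r < regs s r1 then l else pc s + 1)\<rparr>"
| "exec w (Jump l) s = s\<lparr>pc := l\<rparr>"

definition halted :: "instr list \<Rightarrow> state \<Rightarrow> bool" where
  "halted P s \<longleftrightarrow> pc s \<ge> length P"

definition step :: "nat \<Rightarrow> instr list \<Rightarrow> state \<Rightarrow> state" where
  "step w P s = (if halted P s then s else exec w (P ! pc s) s)"

text \<open>
  Memory word \<open>a\<close> holds bits \<open>a * w, \<dots>, a * w + w - 1\<close> of the representation, least significant bit
  first; everything beyond the representation is zero.
\<close>

definition packed :: "nat \<Rightarrow> bool list \<Rightarrow> nat \<Rightarrow> nat" where
  "packed w bs a = horner_sum of_bool 2 (take w (drop (a * w) bs))"

definition initial :: "nat \<Rightarrow> bool list \<Rightarrow> nat list \<Rightarrow> state" where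
  "initial w bs args =
     \<lparr>pc = 0, regs = (\<lambda>r. if r < length args then args ! r else 0), mem = packed w bs\<rparr>"

text \<open>
  Register 0 of the final state tells whether the requested value exists, register 1 contains it.
  A query must leave the memory as it found it, so that queries can be asked repeatedly.
\<close>

definition outputs :: "state \<Rightarrow> nat option \<Rightarrow> bool" where
  "outputs s res = (case res of None \<Rightarrow> regs s 0 = 0 | Some v \<Rightarrow> regs s 0 = 1 \<and> regs s 1 = v)"

definition answers ::
  "nat \<Rightarrow> nat \<Rightarrow> bool list \<Rightarrow> instr list \<Rightarrow> nat list \<Rightarrow> nat option \<Rightarrow> bool" where
  "answers w t bs P args res \<longleftrightarrow>
     (let s = (step w P ^^ t) (initial w bs args)
      in halted P s \<and> mem s = packed w bs \<and> outputs s res)"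

end

theory Submission
 imports Defs "HOL-Library.Log_Nat" "HOL-Real_Asymp.Real_Asymp"
begin

text \<open>
 The nodes are numbered in breadth-first order: the children of a node are consecutive, and the
 nodes other than the root are sorted by the pair (parent, label). A label is split into a high
 part with about \<open>log log n\<close> values and \<open>b\<close> low bits; the cell of a node is its parent together with
 the high part of its label. The set of nonempty cells and the set of the first nodes of cells are
 compressed bit vectors with rank and select, which answer all queries but the search for a label.
 Each node has a record of \<open>b\<close> bits. If its cell has just one element, these are the low bits of its
 label. In a heavy cell the elements are distributed by a displacement hash function, so that the
 bucket determines some of the low bits; their room in the record holds the rank of the element in
 its cell. Every element of a cell beyond the first one saves about \<open>log log log n\<close> bits in the bit
 vector of the cells, which pays for the perfect hash tables; their seeds are shared by all cells,
 and two moduli first reduce the keys to \<open>O(log n + log log log k)\<close> bits, so that the seeds are short.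

 The program learns the word size from a self-delimiting header of \<open>O(log w)\<close> bits. This is
 affordable only if \<open>w\<close> is large compared to \<open>c\<close>; the finitely many queries with a smaller word
 size are answered from a table inside the program. For the smallest word sizes the representation
 need not fit into the addressable memory, and the number of the tree in a list of all trees with
 \<open>k + n \<le> 2^w\<close> takes its place.
\<close>

section \<open>Loop-free programs\<close>

text \<open>The budget leaves no room for lg k bits or for a constant multiple of n: a scalar may
  have O(lg lg k) bits plus o(n), a directory o(n) bits. This fixes the number K of high parts.
  Rounding the arity up to K * 2^b and paying the hash tables loses O(n / K) bits, so K must grow;
  the directories over n * K cells take about n * K * lg lg n / lg n bits, so K must grow slowly.
  The saving comes from counting: a cell vector with E ones fewer among n * K positions has about
  K^E times fewer values, so for large n any constant number of bits per excess element is
  affordable, however large the constants of the hashing. Seeds of lg k bits would be too long, and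
  after only one reduction the keys still have about lg lg k bits while all seeds together take the
  square of the key length; the second reduction brings this down to lg lg lg k, whose square is
  O(lg lg k). As f and C are chosen before c, the header must not pay for lg c, whence a threshold
  on the word size. Since n may be close to 2^w, the entropy itself comes close to the w * 2^w
  addressable bits.\<close>

datatype exp = Arg nat | Cst nat | Bin binop exp exp | Mem exp | Iflt exp exp exp exp

fun ev :: "nat \<Rightarrow> (nat \<Rightarrow> nat) \<Rightarrow> (nat \<Rightarrow> nat) \<Rightarrow> exp \<Rightarrow> nat" where
 "ev w m a (Arg i) = (if i < 3 then a i else 0)"
| "ev w m a (Cst c) = c mod 2^w"
| "ev w m a (Bin b x y) = binop_val w b (ev w m a x) (ev w m a y)"
| "ev w m a (Mem x) = m (ev w m a x)"
| "ev w m a (Iflt x y u v) = (if ev w m a x < ev w m a y then ev w m a u else ev w m a v)"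

text \<open>Jump targets are absolute, so the address \<open>p\<close> of the code is passed along.
  The value ends up in register \<open>r\<close>, registers from \<open>r\<close> on are scratch,
  and those below \<open>r\<close> survive; the three argument registers are therefore intact as
  long as \<open>3 \<le> r\<close>. The code of the false branch comes first, because the jump is
  taken when the comparison holds.\<close>

fun cmp :: "exp \<Rightarrow> nat \<Rightarrow> nat \<Rightarrow> instr list" where
 "cmp (Arg i) p r = [if i < 3 then Op Or r i i else Const r 0]"
| "cmp (Cst c) p r = [Const r c]"
| "cmp (Bin b x y) p r =
   (let c1 = cmp x p r; c2 = cmp y (p + length c1) (r + 1) in c1 @ c2 @ [Op b r r (r + 1)])"
| "cmp (Mem x) p r = cmp x p r @ [Load r r]"
| "cmp (Iflt x y u v) p r =
   (let c1 = cmp x p r; c2 = cmp y (p + length c1) (r + 1);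
     q = p + length c1 + length c2; cv = cmp v (q + 1) r;
     cu = cmp u (q + 2 + length cv) r
   in c1 @ c2 @ [Jump_less r (r + 1) (q + 2 + length cv)] @ cv @
     [Jump (q + 2 + length cv + length cu)] @ cu)"

definition reach :: "nat \<Rightarrow> instr list \<Rightarrow> nat \<Rightarrow> state \<Rightarrow> state \<Rightarrow> bool" where
 "reach w P N s s' \<longleftrightarrow> (\<exists>n\<le>N. (step w P ^^ n) s = s')"

lemma reach_trans: "reach w P N s s' \<Longrightarrow> reach w P M s' s'' \<Longrightarrow> reach w P (N + M) s s''"
 unfolding reach_def
proof(elim exE conjE)
 fix n n' assume "n \<le> N" "(step w P ^^ n) s = s'" "n' \<le> M" "(step w P ^^ n') s' = s''"
 thus "\<exists>n\<le>N + M. (step w P ^^ n) s = s''"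
  by(intro exI[of _ "n' + n"]) (auto simp: funpow_add)
qed

lemma reach_exec:
 assumes "P = pre @ i # post" "pc s = length pre"
 shows "reach w P 1 s (exec w i s)"
 unfolding reach_def by(rule exI[of _ 1]) (simp add: step_def halted_def assms)

lemma reach_mono: "reach w P N s s' \<Longrightarrow> N \<le> M \<Longrightarrow> reach w P M s s'"
 unfolding reach_def using le_trans by blast

text \<open>Every jump leads forward, so no instruction runs twice and the length of the code bounds
  the number of steps. This is the source of the time bound: a query takes constant time because it
  is the value of a fixed expression.\<close>

lemma cmp_correct:
 assumes "P = pre @ cmp e (length pre) r @ post" "pc s = length pre" "3 \<le> r"
  "\<forall>i<3. regs s i = a i" "mem s = m"
 shows "\<exists>s'. reach w P (length (cmp e (length pre) r)) s s' \<and>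
  pc s' = length pre + length (cmp e (length pre) r) \<and>
  regs s' r = ev w m a e \<and> (\<forall>i<r. regs s' i = regs s i) \<and> mem s' = m"
 using assms
proof(induction e arbitrary: pre r post s)
 case (Arg i)
 let ?i = "if i < 3 then Op Or r i i else Const r 0"
 have "reach w P 1 s (exec w ?i s)"
  by(rule reach_exec[of _ pre _ post]) (use Arg in auto)
 thus ?case
  using Arg by(intro exI[of _ "exec w ?i s"]) (auto simp: set_reg_def)
next
 case (Cst c)
 have "reach w P 1 s (exec w (Const r c) s)"
  by(rule reach_exec[of _ pre _ post]) (use Cst in auto)
 thus ?case
  using Cst by(intro exI[of _ "exec w (Const r c) s"]) (auto simp: set_reg_def)
next
 case (Bin b x y)
 define c1 where "c1 = cmp x (length pre) r"
 define c2 where "c2 = cmp y (length pre + length c1) (r + 1)"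
 have P: "P = pre @ c1 @ c2 @ [Op b r r (r + 1)] @ post"
  using Bin.prems(1) by(simp add: c1_def c2_def Let_def)
 obtain s1 where s1: "reach w P (length c1) s s1" "pc s1 = length pre + length c1"
  "regs s1 r = ev w m a x" "\<forall>i<r. regs s1 i = regs s i" "mem s1 = m"
  using Bin.IH(1)[of pre r "c2 @ [Op b r r (r + 1)] @ post" s] Bin.prems(2-) P
  unfolding c1_def by auto
 obtain s2 where s2: "reach w P (length c2) s1 s2" "pc s2 = length pre + length c1 + length c2"
  "regs s2 (r + 1) = ev w m a y" "\<forall>i<r + 1. regs s2 i = regs s1 i" "mem s2 = m"
  using Bin.IH(2)[of "pre @ c1" "r + 1" "[Op b r r (r + 1)] @ post" s1] Bin.prems(2-) P s1
  unfolding c2_def by auto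
 have "reach w P 1 s2 (exec w (Op b r r (r + 1)) s2)"
  by(rule reach_exec[of _ "pre @ c1 @ c2" _ post]) (auto simp: P s2)
 from reach_trans[OF reach_trans[OF s1(1) s2(1)] this] show ?case
  using s1 s2 by(intro exI) (auto simp: set_reg_def Let_def c1_def c2_def)
next
 case (Mem x)
 define c1 where "c1 = cmp x (length pre) r"
 have P: "P = pre @ c1 @ [Load r r] @ post"
  using Mem.prems(1) by(simp add: c1_def Let_def)
 obtain s1 where s1: "reach w P (length c1) s s1" "pc s1 = length pre + length c1"
  "regs s1 r = ev w m a x" "\<forall>i<r. regs s1 i = regs s i" "mem s1 = m"
  using Mem.IH[of pre r "[Load r r] @ post" s] Mem.prems(2-) P
  unfolding c1_def by auto
 have "reach w P 1 s1 (exec w (Load r r) s1)"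
  by(rule reach_exec[of _ "pre @ c1" _ post]) (auto simp: P s1)
 from reach_trans[OF s1(1) this] show ?case
  using s1 by(intro exI) (auto simp: set_reg_def c1_def)
next
 case (Iflt x y u v)
 define c1 where "c1 = cmp x (length pre) r"
 define c2 where "c2 = cmp y (length pre + length c1) (r + 1)"
 define q where "q = length pre + length c1 + length c2"
 define cv where "cv = cmp v (q + 1) r"
 define cu where "cu = cmp u (q + 2 + length cv) r"
 define j1 where "j1 = Jump_less r (r + 1) (q + 2 + length cv)"
 define j2 where "j2 = Jump (q + 2 + length cv + length cu)"
 have C: "cmp (Iflt x y u v) (length pre) r = c1 @ c2 @ [j1] @ cv @ [j2] @ cu"
  by(simp add: c1_def c2_def q_def cv_def cu_def j1_def j2_def Let_def)
 have P: "P = pre @ c1 @ c2 @ [j1] @ cv @ [j2] @ cu @ post"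
  using Iflt.prems(1) unfolding C by simp
 obtain s1 where s1: "reach w P (length c1) s s1" "pc s1 = length pre + length c1"
  "regs s1 r = ev w m a x" "\<forall>i<r. regs s1 i = regs s i" "mem s1 = m"
  using Iflt.IH(1)[of pre r "c2 @ [j1] @ cv @ [j2] @ cu @ post" s] Iflt.prems(2-) P
  unfolding c1_def by auto
 obtain s2 where s2: "reach w P (length c2) s1 s2" "pc s2 = q"
  "regs s2 (r + 1) = ev w m a y" "\<forall>i<r + 1. regs s2 i = regs s1 i" "mem s2 = m"
  using Iflt.IH(2)[of "pre @ c1" "r + 1" "[j1] @ cv @ [j2] @ cu @ post" s1] Iflt.prems(2-) P s1
  unfolding c2_def q_def by auto
 define s3 where "s3 = exec w j1 s2"
 have s3: "reach w P 1 s2 s3" unfolding s3_def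
  by(rule reach_exec[of _ "pre @ c1 @ c2"]) (auto simp: P s2 q_def)
 have s3': "regs s3 = regs s2" "mem s3 = m"
  "pc s3 = (if ev w m a x < ev w m a y then q + 2 + length cv else q + 1)"
  using s1 s2 by(auto simp: s3_def j1_def)
 have r3: "reach w P (length c1 + length c2 + 1) s s3"
  using reach_trans[OF reach_trans[OF s1(1) s2(1)] s3] .
 show ?case
 proof(cases "ev w m a x < ev w m a y")
  case True
  hence pc3: "pc s3 = length (pre @ c1 @ c2 @ [j1] @ cv @ [j2])"
   using s3' by(simp add: q_def)
  have L: "length (pre @ c1 @ c2 @ [j1] @ cv @ [j2]) = q + 2 + length cv"
   by(simp add: q_def)
  obtain s4 where s4: "reach w P (length cu) s3 s4" "pc s4 = q + 2 + length cv + length cu"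
   "regs s4 r = ev w m a u" "\<forall>i<r. regs s4 i = regs s3 i" "mem s4 = m"
   using Iflt.IH(3)[of "pre @ c1 @ c2 @ [j1] @ cv @ [j2]" r post s3, OF _ pc3]
    Iflt.prems(2-) P s1 s2 s3' unfolding L cu_def[symmetric] by auto
  have "reach w P (length c1 + length c2 + 1 + length cu) s s4"
   using reach_trans[OF r3 s4(1)] .
  hence "reach w P (length (c1 @ c2 @ [j1] @ cv @ [j2] @ cu)) s s4"
   by(rule reach_mono) simp
  thus ?thesis unfolding C using s1 s2 s3' s4 True
   by(intro exI[of _ s4]) (auto simp: q_def)
 next
  case False
  hence pc3: "pc s3 = length (pre @ c1 @ c2 @ [j1])"
   using s3' by(simp add: q_def)
  have L: "length (pre @ c1 @ c2 @ [j1]) = q + 1"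
   by(simp add: q_def)
  obtain s4 where s4: "reach w P (length cv) s3 s4" "pc s4 = q + 1 + length cv"
   "regs s4 r = ev w m a v" "\<forall>i<r. regs s4 i = regs s3 i" "mem s4 = m"
   using Iflt.IH(4)[of "pre @ c1 @ c2 @ [j1]" r "[j2] @ cu @ post" s3, OF _ pc3]
    Iflt.prems(2-) P s1 s2 s3' unfolding L cv_def[symmetric] by auto
  have s5: "reach w P 1 s4 (exec w j2 s4)"
   by(rule reach_exec[of _ "pre @ c1 @ c2 @ [j1] @ cv"]) (auto simp: P s4 q_def)
  have "reach w P (length c1 + length c2 + 1 + length cv + 1) s (exec w j2 s4)"
   using reach_trans[OF reach_trans[OF r3 s4(1)] s5] .
  hence "reach w P (length (c1 @ c2 @ [j1] @ cv @ [j2] @ cu)) s (exec w j2 s4)"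
   by(rule reach_mono) simp
  thus ?thesis unfolding C using s1 s2 s3' s4 False
   by(intro exI[of _ "exec w j2 s4"]) (auto simp: q_def j2_def)
 qed
qed

lemma step_halted: "halted P s \<Longrightarrow> (step w P ^^ n) s = s"
 by(induction n) (auto simp: step_def)

text \<open>Registers 0 and 1 receive the output but hold arguments until both expressions have been
  evaluated; hence the values wait in registers 3 and 4. \<open>Op Or\<close> with equal operands
  serves as a move instruction.\<close>

definition prog :: "exp \<Rightarrow> exp \<Rightarrow> instr list" where
 "prog e0 e1 = (let c1 = cmp e1 0 3; c0 = cmp e0 (length c1) 4 in c1 @ c0 @ [Op Or 0 4 4, Op Or 1 3 3])"

definition arg_regs :: "nat list \<Rightarrow> nat \<Rightarrow> nat" where
 "arg_regs args i = (if i < length args then args ! i else 0)"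

lemma prog_answers:
 assumes "case res of None \<Rightarrow> ev w (packed w bs) (arg_regs args) e0 = 0
   | Some v \<Rightarrow> ev w (packed w bs) (arg_regs args) e0 = 1 \<and> ev w (packed w bs) (arg_regs args) e1 = v"
  and t: "length (prog e0 e1) \<le> t"
 shows "answers w t bs (prog e0 e1) args res"
proof -
 define P where "P = prog e0 e1"
 define m where "m = packed w bs"
 define c1 where "c1 = cmp e1 0 3"
 define c0 where "c0 = cmp e0 (length c1) 4"
 have P: "P = c1 @ c0 @ [Op Or 0 4 4, Op Or 1 3 3]"
  by(simp add: P_def prog_def c1_def c0_def Let_def)
 define s where "s = initial w bs args"
 have s: "pc s = 0" "regs s = arg_regs args" "mem s = m"
  by(auto simp: s_def initial_def arg_regs_def m_def)
 obtain s1 where s1: "reach w P (length c1) s s1" "pc s1 = length c1"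
  "regs s1 3 = ev w m (arg_regs args) e1" "\<forall>i<3. regs s1 i = regs s i" "mem s1 = m"
  using cmp_correct[of P "[]" e1 3 "c0 @ [Op Or 0 4 4, Op Or 1 3 3]" s "arg_regs args" m w] s
  by(auto simp: P c1_def)
 obtain s2 where s2: "reach w P (length c0) s1 s2" "pc s2 = length c1 + length c0"
  "regs s2 4 = ev w m (arg_regs args) e0" "\<forall>i<4. regs s2 i = regs s1 i" "mem s2 = m"
  using cmp_correct[of P "c1" e0 4 "[Op Or 0 4 4, Op Or 1 3 3]" s1 "arg_regs args" m w] s s1
  by(auto simp: P c0_def)
 have s3: "reach w P 1 s2 (exec w (Op Or 0 4 4) s2)"
  by(rule reach_exec[of _ "c1 @ c0"]) (auto simp: P s2)
 have s4: "reach w P 1 (exec w (Op Or 0 4 4) s2) (exec w (Op Or 1 3 3) (exec w (Op Or 0 4 4) s2))"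
  by(rule reach_exec[of _ "c1 @ c0 @ [Op Or 0 4 4]"]) (auto simp: P s2 set_reg_def)
 define s' where "s' = exec w (Op Or 1 3 3) (exec w (Op Or 0 4 4) s2)"
 have "reach w P (length P) s s'"
  using reach_trans[OF reach_trans[OF reach_trans[OF s1(1) s2(1)] s3] s4] unfolding s'_def
  by(rule reach_mono) (simp add: P)
 then obtain n where n: "n \<le> length P" "(step w P ^^ n) s = s'"
  unfolding reach_def by blast
 have h: "halted P s'" "mem s' = m" "regs s' 0 = ev w m (arg_regs args) e0"
  "regs s' 1 = ev w m (arg_regs args) e1"
  using s1 s2 by(auto simp: s'_def halted_def set_reg_def P)
 \<comment> \<open>A halted machine idles, so every number of steps from the code length on is as
   good.\<close>
 have "t = (t - n) + n" using n t unfolding P_def[symmetric] by simp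
 hence "(step w P ^^ t) s = (step w P ^^ (t - n)) ((step w P ^^ n) s)"
  by(metis funpow_add comp_apply)
 also have "... = s'" using step_halted[OF h(1)] n by simp
 finally have "(step w P ^^ t) s = s'" .
 thus ?thesis
  using h assms(1) unfolding answers_def Let_def P_def[symmetric] s_def[symmetric] m_def[symmetric]
  by(auto simp: outputs_def split: option.splits)
qed

section \<open>Functions computable in constant time\<close>

text \<open>The memory is regarded as the binary expansion of one number \<open>B\<close>, so that
  bit addresses can ignore word boundaries; this is the field of \<open>l\<close> bits at bit
  \<open>p\<close>.\<close>

definition fld :: "nat \<Rightarrow> nat \<Rightarrow> nat \<Rightarrow> nat" where
 "fld B p l = B div 2^p mod 2^l"

lemma fld_less: "fld B p l < 2^l"
 by(simp add: fld_def)

lemma packed_eq_fld: "packed w bs a = fld (horner_sum of_bool 2 bs) (a * w) w"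
proof -
 have "packed w bs a = take_bit w (drop_bit (a * w) (horner_sum of_bool 2 bs))"
  unfolding packed_def
  by(auto simp: bit_eq_iff bit_simps possible_bit_def add.commute)
 thus ?thesis by(simp add: fld_def take_bit_eq_mod drop_bit_eq_div)
qed

text \<open>An unaligned field is assembled from the word that contains its first bit and the next
  word. \<open>Y\<close> stays arbitrary if the field ends within the first word, since the next
  address may then have wrapped around.\<close>

lemma two_word_window:
 fixes D Y :: nat
 assumes "l \<le> w" "r < w" and Y: "r + l \<le> w \<or> Y = D div 2^w mod 2^w"
 shows "(D mod 2^w div 2^r + (Y * 2^(w - r)) mod 2^w) mod 2^l = D div 2^r mod 2^l"
proof -
 have dl: "(2::nat)^l dvd 2^w" using assms by(simp add: le_imp_power_dvd)
 have *: "(x + (Z * 2^(w - r)) mod 2^w) mod 2^l = (x + Z * 2^(w - r)) mod 2^l" for x Z :: nat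
  using mod_mod_cancel[OF dl, of "Z * 2^(w - r)"]
   mod_add_right_eq[of x "Z * 2^(w - r) mod 2^w" "2^l"] mod_add_right_eq[of x "Z * 2^(w - r)" "2^l"]
  by simp
 have D: "D div 2^r = D mod 2^w div 2^r + (D div 2^w) * 2^(w - r)"
 proof -
  have "D = D mod 2^w + 2^r * ((D div 2^w) * 2^(w - r))"
   using assms(2) by(metis (no_types, lifting) less_imp_le add.commute div_mult_mod_eq le_add_diff_inverse
     mult.assoc mult.commute power_add)
  hence "D div 2^r = (D mod 2^w + 2^r * ((D div 2^w) * 2^(w - r))) div 2^r" by simp
  also have "... = D mod 2^w div 2^r + (D div 2^w) * 2^(w - r)" by simp
  finally show ?thesis .
 qed
 show ?thesis
 proof(cases "r + l \<le> w")
  case True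
  hence dd: "(2::nat)^l dvd 2^(w - r)" by(simp add: le_imp_power_dvd)
  obtain c where c: "(2::nat)^(w - r) = 2^l * c" using dd by(rule dvdE)
  have "(x + Z * 2^(w - r)) mod 2^l = x mod 2^l" for x Z :: nat
   unfolding c by(simp add: mult.left_commute[of Z])
  thus ?thesis unfolding * D by simp
 next
  case False
  hence Y: "Y = D div 2^w mod 2^w" using assms by simp
  have m: "(Z mod 2^w * c) mod 2^l = Z * c mod 2^l" for Z c :: nat
   using mod_mod_cancel[OF dl, of Z] mod_mult_left_eq[of "Z mod 2^w" "2^l" c] mod_mult_left_eq[of Z "2^l" c]
   by simp
  have "(x + Z mod 2^w * 2^(w - r)) mod 2^l = (x + Z * 2^(w - r)) mod 2^l" for x Z :: nat
   using mod_add_right_eq[of x "Z mod 2^w * 2^(w - r)" "2^l"] mod_add_right_eq[of x "Z * 2^(w - r)" "2^l"]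
   unfolding m by simp
  thus ?thesis unfolding * D Y by simp
 qed
qed

lemma fld_split: "fld B p (l + l') = fld B p l + 2^l * fld B (p + l) l'"
 unfolding fld_def power_add div_mult2_eq mod_mult2_eq by(simp add: mult.commute)

section \<open>Functions of a query that are computable by a single expression\<close>

locale ram =
 fixes Wd :: "'g \<Rightarrow> nat" and Bm :: "'g \<Rightarrow> nat" and Ar :: "'g \<Rightarrow> nat \<Rightarrow> nat"
begin

text \<open>Forty bits hold every constant that enters through \<open>c1_const\<close> and make the
  square of the word size representable in half a word (\<open>word_small\<close>).\<close>

definition ok :: "'g set \<Rightarrow> bool" where
 "ok G \<longleftrightarrow> (\<forall>g\<in>G. 40 \<le> Wd g \<and> (\<forall>i. Ar g i < 2^Wd g))"

definition evg :: "exp \<Rightarrow> 'g \<Rightarrow> nat" where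
 "evg e g = ev (Wd g) (\<lambda>a. fld (Bm g) (a * Wd g) (Wd g)) (Ar g) e"

text \<open>\<open>'g\<close> is a type of queries, each with its own word size, memory and
  arguments; one expression must serve all of \<open>G\<close>. Functions are shown computable by
  closure properties instead of being programmed. Restricting to a set \<open>G\<close> lets a
  branch of a conditional be computed only where its condition holds, which is where its operands
  are defined and in range.\<close>

definition c1 :: "'g set \<Rightarrow> ('g \<Rightarrow> nat) \<Rightarrow> bool" where
 "c1 G F \<longleftrightarrow> ok G \<and> (\<exists>e. \<forall>g\<in>G. evg e g = F g)"

lemma evg_less:
 assumes "ok G" "g \<in> G"
 shows "evg e g < 2^Wd g"
proof(induction e)
 case (Bin b x y)
 let ?x = "ev (Wd g) (\<lambda>a. fld (Bm g) (a * Wd g) (Wd g)) (Ar g) x"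
 let ?y = "ev (Wd g) (\<lambda>a. fld (Bm g) (a * Wd g) (Wd g)) (Ar g) y"
 have xy: "?x < 2^Wd g" "?y < 2^Wd g" using Bin unfolding evg_def .
 have *: "take_bit (Wd g) ?x = ?x" "take_bit (Wd g) ?y = ?y" using xy by(simp_all add: take_bit_nat_eq_self)
 have a: "Bit_Operations.and ?x ?y < 2^Wd g" "Bit_Operations.or ?x ?y < 2^Wd g"
   "Bit_Operations.xor ?x ?y < 2^Wd g"
  using take_bit_nat_less_exp[of "Wd g" "Bit_Operations.and ?x ?y"]
   take_bit_nat_less_exp[of "Wd g" "Bit_Operations.or ?x ?y"]
   take_bit_nat_less_exp[of "Wd g" "Bit_Operations.xor ?x ?y"]
  by(simp_all only: take_bit_and take_bit_or take_bit_xor *)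
 have d: "?x div ?y < 2^Wd g" "?x mod ?y < 2^Wd g" "drop_bit ?y ?x < 2^Wd g"
  using xy(1) by(auto simp: drop_bit_eq_div intro: le_less_trans[OF div_le_dividend] le_less_trans[OF mod_less_eq_dividend])
 show ?case
  unfolding evg_def by(cases b) (use a d in auto)
qed (use assms in \<open>auto simp: evg_def ok_def fld_less\<close>)

lemma c1_ok: "c1 G F \<Longrightarrow> ok G"
 by(simp add: c1_def)

lemma c1_less: "c1 G F \<Longrightarrow> g \<in> G \<Longrightarrow> F g < 2^Wd g"
 unfolding c1_def using evg_less by metis

lemma c1_mono: "c1 G F \<Longrightarrow> H \<subseteq> G \<Longrightarrow> c1 H F"
 unfolding c1_def ok_def by blast

lemma c1_cong: "c1 G F \<Longrightarrow> (\<And>g. g \<in> G \<Longrightarrow> F g = F' g) \<Longrightarrow> c1 G F'"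
 unfolding c1_def by fastforce

lemma c1_arg: "ok G \<Longrightarrow> i < 3 \<Longrightarrow> c1 G (\<lambda>g. Ar g i)"
 unfolding c1_def by(auto simp: evg_def intro!: exI[of _ "Arg i"])

lemma c1_const: "ok G \<Longrightarrow> c < 2^40 \<Longrightarrow> c1 G (\<lambda>g. c)"
 unfolding c1_def
proof(intro conjI exI[of _ "Cst c"] ballI)
 fix g assume "ok G" "c < 2^40" "g \<in> G"
 moreover from this have "(2::nat)^40 \<le> 2^Wd g" by(intro power_increasing) (auto simp: ok_def)
 ultimately show "evg (Cst c) g = c" by(simp add: evg_def)
qed

lemma c1_bin:
 assumes "c1 G F" "c1 G F'"
 shows "c1 G (\<lambda>g. binop_val (Wd g) b (F g) (F' g))"
proof -
 obtain e e' where "\<forall>g\<in>G. evg e g = F g" "\<forall>g\<in>G. evg e' g = F' g"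
  using assms unfolding c1_def by blast
 thus ?thesis using assms(1) unfolding c1_def
  by(intro conjI exI[of _ "Bin b e e'"]) (auto simp: evg_def)
qed

lemma c1_addmod: "c1 G F \<Longrightarrow> c1 G F' \<Longrightarrow> c1 G (\<lambda>g. (F g + F' g) mod 2^Wd g)"
 using c1_bin[of G F F' Add] by simp

lemma c1_add:
 "c1 G F \<Longrightarrow> c1 G F' \<Longrightarrow> (\<And>g. g \<in> G \<Longrightarrow> F g + F' g < 2^Wd g) \<Longrightarrow> c1 G (\<lambda>g. F g + F' g)"
 by(rule c1_cong[OF c1_addmod[of G F F']]) auto

lemma c1_sub:
 assumes "c1 G F" "c1 G F'" "\<And>g. g \<in> G \<Longrightarrow> F' g \<le> F g"
 shows "c1 G (\<lambda>g. F g - F' g)"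
proof(rule c1_cong[OF c1_bin[of G F F' Sub, OF assms(1,2)]])
 fix g assume g: "g \<in> G"
 have "F g + (2^Wd g - F' g) = (F g - F' g) + 2^Wd g"
  using c1_less[OF assms(2) g] assms(3)[OF g] by simp
 moreover have "(F g - F' g + 2^Wd g) mod 2^Wd g = F g - F' g"
  using c1_less[OF assms(1) g] by simp
 ultimately show "binop_val (Wd g) Sub (F g) (F' g) = F g - F' g"
  by(simp only: binop_val.simps)
qed

lemma c1_mulmod: "c1 G F \<Longrightarrow> c1 G F' \<Longrightarrow> c1 G (\<lambda>g. (F g * F' g) mod 2^Wd g)"
 using c1_bin[of G F F' Mul] by simp

lemma c1_mul:
 "c1 G F \<Longrightarrow> c1 G F' \<Longrightarrow> (\<And>g. g \<in> G \<Longrightarrow> F g * F' g < 2^Wd g) \<Longrightarrow> c1 G (\<lambda>g. F g * F' g)"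
 by(rule c1_cong[OF c1_mulmod[of G F F']]) auto

lemma c1_div: "c1 G F \<Longrightarrow> c1 G F' \<Longrightarrow> c1 G (\<lambda>g. F g div F' g)"
 using c1_bin[of G F F' Div] by simp

lemma c1_mod: "c1 G F \<Longrightarrow> c1 G F' \<Longrightarrow> c1 G (\<lambda>g. F g mod F' g)"
 using c1_bin[of G F F' Mod] by simp

lemma c1_shlmod: "c1 G F \<Longrightarrow> c1 G F' \<Longrightarrow> c1 G (\<lambda>g. F g * 2^F' g mod 2^Wd g)"
 using c1_bin[of G F F' Shl] by(simp add: push_bit_eq_mult)

lemma c1_shl:
 "c1 G F \<Longrightarrow> c1 G F' \<Longrightarrow> (\<And>g. g \<in> G \<Longrightarrow> F g * 2^F' g < 2^Wd g) \<Longrightarrow> c1 G (\<lambda>g. F g * 2^F' g)"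
 by(rule c1_cong[OF c1_shlmod[of G F F']]) auto

lemma c1_pow2:
 assumes "c1 G F" "\<And>g. g \<in> G \<Longrightarrow> F g < Wd g"
 shows "c1 G (\<lambda>g. 2^F g)"
proof -
 have "c1 G (\<lambda>g. 1)" by(rule c1_const[OF c1_ok[OF assms(1)]]) simp
 from c1_shl[OF this assms(1)] assms(2) show ?thesis by simp
qed

lemma c1_shr: "c1 G F \<Longrightarrow> c1 G F' \<Longrightarrow> c1 G (\<lambda>g. F g div 2^F' g)"
 using c1_bin[of G F F' Shr] by(simp add: drop_bit_eq_div)

lemma c1_modpow:
 assumes "c1 G F" "c1 G l" "\<And>g. g \<in> G \<Longrightarrow> l g \<le> Wd g"
 shows "c1 G (\<lambda>g. F g mod 2^l g)"
proof -
 have 1: "c1 G (\<lambda>g. 1)" by(rule c1_const[OF c1_ok[OF assms(1)]]) simp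
 show ?thesis
 proof(rule c1_cong[OF c1_mod[OF assms(1) c1_shlmod[OF 1 assms(2)]]])
  fix g assume g: "g \<in> G"
  \<comment> \<open>for \<open>l = w\<close> the shifted one vanishes, and \<open>x mod 0 = x\<close>\<close>
  show "F g mod (1 * 2^l g mod 2^Wd g) = F g mod 2^l g"
   using assms(3)[OF g] c1_less[OF assms(1) g] by(cases "l g = Wd g") (auto simp: le_less)
 qed
qed

lemma c1_if:
 assumes "c1 G a" "c1 G b" "c1 {g \<in> G. a g < b g} F" "c1 {g \<in> G. \<not> a g < b g} F'"
 shows "c1 G (\<lambda>g. if a g < b g then F g else F' g)"
proof -
 obtain ea eb e e' where "\<forall>g\<in>G. evg ea g = a g" "\<forall>g\<in>G. evg eb g = b g"
  "\<forall>g\<in>{g \<in> G. a g < b g}. evg e g = F g" "\<forall>g\<in>{g \<in> G. \<not> a g < b g}. evg e' g = F' g"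
  using assms unfolding c1_def by meson
 thus ?thesis using assms(1) unfolding c1_def
  by(intro conjI exI[of _ "Iflt ea eb e e'"]) (auto simp: evg_def)
qed

lemma c1_mem: "c1 G F \<Longrightarrow> c1 G (\<lambda>g. fld (Bm g) (F g * Wd g) (Wd g))"
 unfolding c1_def
 by(elim conjE exE, rule conjI, assumption, rule_tac x = "Mem e" in exI) (auto simp: evg_def)

definition cb :: "'g set \<Rightarrow> ('g \<Rightarrow> bool) \<Rightarrow> bool" where
 "cb G P \<longleftrightarrow> c1 G (\<lambda>g. of_bool (P g))"

lemma cb_mono: "cb G P \<Longrightarrow> H \<subseteq> G \<Longrightarrow> cb H P"
 unfolding cb_def by(rule c1_mono)

lemma cb_cong: "cb G P \<Longrightarrow> (\<And>g. g \<in> G \<Longrightarrow> P g = P' g) \<Longrightarrow> cb G P'"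
 unfolding cb_def by(erule c1_cong) auto

lemma cb_ok: "cb G P \<Longrightarrow> ok G"
 unfolding cb_def by(rule c1_ok)

lemma c1_ite:
 assumes "cb G P" "c1 {g \<in> G. P g} F" "c1 {g \<in> G. \<not> P g} F'"
 shows "c1 G (\<lambda>g. if P g then F g else F' g)"
proof -
 have 0: "c1 G (\<lambda>g. 0)" by(rule c1_const[OF cb_ok[OF assms(1)]]) simp
 have "c1 G (\<lambda>g. if 0 < (of_bool (P g) :: nat) then F g else F' g)"
  by(rule c1_if[OF 0 assms(1)[unfolded cb_def]]) (use assms(2,3) in auto)
 thus ?thesis by(rule c1_cong) auto
qed

lemma cb_less1: "c1 G F \<Longrightarrow> c1 G F' \<Longrightarrow> cb G (\<lambda>g. F g < F' g)"
 unfolding cb_def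
 by(rule c1_cong[OF c1_if[of G F F' "\<lambda>_. 1" "\<lambda>_. 0"]])
  (auto intro!: c1_const c1_ok[of _ F] elim: c1_mono)

lemma cb_true: "ok G \<Longrightarrow> cb G (\<lambda>_. True)"
 unfolding cb_def by(simp add: c1_const)

lemma cb_false: "ok G \<Longrightarrow> cb G (\<lambda>_. False)"
 unfolding cb_def by(simp add: c1_const)

lemma cb_ite:
 assumes "cb G P" "cb {g \<in> G. P g} Q" "cb {g \<in> G. \<not> P g} R"
 shows "cb G (\<lambda>g. if P g then Q g else R g)"
 using c1_ite[of G P "\<lambda>g. of_bool (Q g)" "\<lambda>g. of_bool (R g)"] assms unfolding cb_def
 by(auto elim: c1_cong)

lemma cb_and: "cb G P \<Longrightarrow> cb {g \<in> G. P g} Q \<Longrightarrow> cb G (\<lambda>g. P g \<and> Q g)"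
 by(rule cb_cong[OF cb_ite[of G P Q "\<lambda>_. False"]])
  (auto intro!: cb_false dest!: cb_ok simp: ok_def)

lemma cb_not: "cb G P \<Longrightarrow> cb G (\<lambda>g. \<not> P g)"
 by(rule cb_cong[OF cb_ite[of G P "\<lambda>_. False" "\<lambda>_. True"]])
  (auto intro!: cb_false cb_true dest!: cb_ok simp: ok_def)

lemma cb_or: "cb G P \<Longrightarrow> cb {g \<in> G. \<not> P g} Q \<Longrightarrow> cb G (\<lambda>g. P g \<or> Q g)"
 by(rule cb_cong[OF cb_ite[of G P "\<lambda>_. True" Q]])
  (auto intro!: cb_true dest!: cb_ok simp: ok_def)

lemma cb_eq1:
 assumes "c1 G F" "c1 G F'"
 shows "cb G (\<lambda>g. F g = F' g)"
proof -
 have "cb G (\<lambda>g. \<not> F g < F' g \<and> \<not> F' g < F g)"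
  by(intro cb_and cb_not cb_less1 c1_mono[OF assms(1)] c1_mono[OF assms(2)]) auto
 thus ?thesis by(rule cb_cong) auto
qed

text \<open>
 Bit addresses and ranks can exceed one word when \<open>n\<close> is close to \<open>2^w\<close>; \<open>c2\<close> is
 computability of numbers that occupy two words.
\<close>

definition c2 :: "'g set \<Rightarrow> ('g \<Rightarrow> nat) \<Rightarrow> bool" where
 "c2 G F \<longleftrightarrow> c1 G Wd \<and> c1 G (\<lambda>g. F g mod 2^Wd g) \<and> c1 G (\<lambda>g. F g div 2^Wd g)"

lemma c2_wd: "c2 G F \<Longrightarrow> c1 G Wd"
 by(simp add: c2_def)

lemma c2_ok: "c2 G F \<Longrightarrow> ok G"
 unfolding c2_def using c1_ok by blast

lemma c2_mono: "c2 G F \<Longrightarrow> H \<subseteq> G \<Longrightarrow> c2 H F"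
 unfolding c2_def using c1_mono by blast

lemma c2_cong: assumes "c2 G F" "\<And>g. g \<in> G \<Longrightarrow> F g = F' g" shows "c2 G F'"
 using assms(1) unfolding c2_def by(auto intro: c1_cong simp: assms(2))

lemma c2_of_c1: assumes "c1 G Wd" "c1 G F" shows "c2 G F"
proof -
 have "c1 G (\<lambda>g. 0)" by(rule c1_const[OF c1_ok[OF assms(1)]]) simp
 hence "c1 G (\<lambda>g. F g div 2^Wd g)" by(rule c1_cong) (use c1_less[OF assms(2)] in auto)
 moreover have "c1 G (\<lambda>g. F g mod 2^Wd g)"
  by(rule c1_cong[OF assms(2)]) (use c1_less[OF assms(2)] in auto)
 ultimately show ?thesis using assms by(simp add: c2_def)
qed

lemma c1_of_c2: assumes "c2 G F" "\<And>g. g \<in> G \<Longrightarrow> F g < 2^Wd g" shows "c1 G F"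
 using assms unfolding c2_def by(auto intro: c1_cong)

lemma c2_pair: assumes "c1 G Wd" "c1 G a" "c1 G b" shows "c2 G (\<lambda>g. a g * 2^Wd g + b g)"
 unfolding c2_def
proof(intro conjI)
 show "c1 G (\<lambda>g. (a g * 2^Wd g + b g) mod 2^Wd g)"
  by(rule c1_cong[OF assms(3)]) (use c1_less[OF assms(3)] in auto)
 show "c1 G (\<lambda>g. (a g * 2^Wd g + b g) div 2^Wd g)"
  by(rule c1_cong[OF assms(2)]) (use c1_less[OF assms(3)] in auto)
qed (rule assms(1))

lemma c2_const: "c1 G Wd \<Longrightarrow> c < 2^40 \<Longrightarrow> c2 G (\<lambda>g. c)"
 by(intro c2_of_c1 c1_const c1_ok)

lemma cb_less: assumes "c2 G F" "c2 G F'" shows "cb G (\<lambda>g. F g < F' g)"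
proof -
 have *: "(F g < F' g) = (F g div 2^Wd g < F' g div 2^Wd g \<or>
   F g div 2^Wd g = F' g div 2^Wd g \<and> F g mod 2^Wd g < F' g mod 2^Wd g)" for g
 proof -
  have "F g = (F g div 2^Wd g) * 2^Wd g + F g mod 2^Wd g"
   by(rule div_mult_mod_eq[symmetric])
  moreover have "F' g = (F' g div 2^Wd g) * 2^Wd g + F' g mod 2^Wd g"
   by(rule div_mult_mod_eq[symmetric])
  moreover have "F g div 2^Wd g \<le> F' g div 2^Wd g" if "F g \<le> F' g" using that by(rule div_le_mono)
  moreover have "F' g div 2^Wd g \<le> F g div 2^Wd g" if "F' g \<le> F g" using that by(rule div_le_mono)
  ultimately show ?thesis
   by(smt (verit, ccfv_threshold) add_less_cancel_left nat_less_le not_le)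
 qed
 show ?thesis unfolding *
  by(intro cb_or cb_and cb_less1 cb_eq1)
   (use assms in \<open>auto simp: c2_def elim!: c1_mono\<close>)
qed

lemma cb_le: assumes "c2 G F" "c2 G F'" shows "cb G (\<lambda>g. F g \<le> F' g)"
 using cb_not[OF cb_less[OF assms(2,1)]] by(simp add: not_less)

lemma cb_eq: assumes "c2 G F" "c2 G F'" shows "cb G (\<lambda>g. F g = F' g)"
 by(rule cb_cong[OF cb_and[OF cb_le[OF assms] cb_mono[OF cb_le[OF assms(2,1)]]]]) auto

lemma c2_ite:
 assumes "cb G P" "c1 G Wd" "c2 {g \<in> G. P g} F" "c2 {g \<in> G. \<not> P g} F'"
 shows "c2 G (\<lambda>g. if P g then F g else F' g)"
proof -
 have "c1 G (\<lambda>g. if P g then F g mod 2^Wd g else F' g mod 2^Wd g)"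
  "c1 G (\<lambda>g. if P g then F g div 2^Wd g else F' g div 2^Wd g)"
  using assms by(intro c1_ite; simp add: c2_def)+
 thus ?thesis using assms(2) unfolding c2_def by(auto elim: c1_cong)
qed

lemma c2_add:
 assumes F: "c2 G F" and F': "c2 G F'" and b: "\<And>g. g \<in> G \<Longrightarrow> F g + F' g < 2^(2 * Wd g)"
 shows "c2 G (\<lambda>g. F g + F' g)"
proof -
 define lo hi where "lo g = (F g mod 2^Wd g + F' g mod 2^Wd g) mod 2^Wd g"
  and "hi g = (F g + F' g) div 2^Wd g" for g
 have lo: "c1 G lo" unfolding lo_def using F F' by(intro c1_addmod) (auto simp: c2_def)
 \<comment> \<open>A sum modulo \<open>2^Wd g\<close> has overflowed exactly if it is smaller than a
   summand.\<close>
 have cr: "c1 G (\<lambda>g. of_bool (lo g < F g mod 2^Wd g))"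
  using cb_less1[OF lo, of "\<lambda>g. F g mod 2^Wd g"] F by(simp add: cb_def c2_def)
 have hi: "hi g = F g div 2^Wd g + F' g div 2^Wd g + of_bool (lo g < F g mod 2^Wd g)" for g
 proof -
  let ?M = "2^Wd g :: nat"
  have "hi g = F g div ?M + F' g div ?M + (F g mod ?M + F' g mod ?M) div ?M"
   unfolding hi_def by(rule div_add1_eq)
  moreover have "(F g mod ?M + F' g mod ?M) div ?M = of_bool (lo g < F g mod ?M)"
  proof(cases "F g mod ?M + F' g mod ?M < ?M")
   case True thus ?thesis by(simp add: lo_def)
  next
   case False
   have *: "F g mod ?M < ?M" "F' g mod ?M < ?M" by simp_all
   define z where "z = F g mod ?M + F' g mod ?M - ?M"
   have z: "F g mod ?M + F' g mod ?M = z + ?M" "z < F g mod ?M" "z < ?M"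
    using False * unfolding z_def by linarith+
   thus ?thesis by(simp add: lo_def)
  qed
  ultimately show ?thesis by simp
 qed
 have hib: "hi g < 2^Wd g" if "g \<in> G" for g
  using b[OF that] unfolding hi_def by(simp add: div_less_iff_less_mult mult_2 power_add)
 have "c1 G hi" unfolding hi
 proof(intro c1_add cr)
  fix g assume g: "g \<in> G"
  show "F g div 2^Wd g + F' g div 2^Wd g + of_bool (lo g < F g mod 2^Wd g) < 2^Wd g"
   using hib[OF g] unfolding hi .
  thus "F g div 2^Wd g + F' g div 2^Wd g < 2^Wd g" by linarith
 qed (use F F' in \<open>auto simp: c2_def\<close>)
 thus ?thesis using F lo unfolding c2_def hi_def lo_def by(simp add: mod_add_eq)
qed

lemma borrow:
 fixes x y a b M :: nat
 assumes "y < M" "b < M" "a * M + b \<le> x * M + y"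
 shows "x * M + y - (a * M + b) = (x - a - of_bool (y < b)) * M + (y + (M - b)) mod M \<and>
  a + of_bool (y < b) \<le> x"
proof -
 have ax: "a \<le> x"
 proof(rule ccontr)
  assume "\<not> a \<le> x"
  hence "(x + 1) * M \<le> a * M" by(intro mult_le_mono1) simp
  thus False using assms by simp
 qed
 show ?thesis
 proof(cases "y < b")
  case True
  hence "a < x" using assms(3) ax by(cases "a = x") auto
  then obtain d where d: "x = a + Suc d" by(metis add_Suc_right less_imp_Suc_add)
  have "(y + (M - b)) mod M = y + (M - b)" using True assms by simp
  thus ?thesis using True assms d by(simp add: algebra_simps)
 next
  case False
  obtain d where d: "x = a + d" using ax le_Suc_ex by blast
  have "y + (M - b) = (y - b) + M" using False assms by simp
  moreover have "((y - b) + M) mod M = y - b" using assms by simp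
  ultimately have "(y + (M - b)) mod M = y - b" by(simp only:)
  thus ?thesis using False assms d by(simp add: algebra_simps)
 qed
qed

lemma c2_sub:
 assumes F: "c2 G F" and F': "c2 G F'" and b: "\<And>g. g \<in> G \<Longrightarrow> F' g \<le> F g"
 shows "c2 G (\<lambda>g. F g - F' g)"
proof -
 define lo hi where "lo g = (F g - F' g) mod 2^Wd g"
  and "hi g = F g div 2^Wd g - F' g div 2^Wd g - of_bool (F g mod 2^Wd g < F' g mod 2^Wd g)" for g
 have main: "F g - F' g = hi g * 2^Wd g +
   (F g mod 2^Wd g + (2^Wd g - F' g mod 2^Wd g)) mod 2^Wd g \<and>
   F' g div 2^Wd g + of_bool (F g mod 2^Wd g < F' g mod 2^Wd g) \<le> F g div 2^Wd g" if "g \<in> G" for g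
 proof -
  have "(F' g div 2^Wd g) * 2^Wd g + F' g mod 2^Wd g \<le> (F g div 2^Wd g) * 2^Wd g + F g mod 2^Wd g"
   using b[OF that] by(simp only: div_mult_mod_eq)
  from borrow[OF _ _ this] show ?thesis unfolding hi_def by(simp only: div_mult_mod_eq) simp
 qed
 have lo: "c1 G (\<lambda>g. (F g mod 2^Wd g + (2^Wd g - F' g mod 2^Wd g)) mod 2^Wd g)"
  using c1_bin[of G "\<lambda>g. F g mod 2^Wd g" "\<lambda>g. F' g mod 2^Wd g" Sub] F F' by(simp add: c2_def)
 have hi: "c1 G hi" unfolding hi_def
 proof(intro c1_sub)
  show "c1 G (\<lambda>g. of_bool (F g mod 2^Wd g < F' g mod 2^Wd g))"
   using cb_less1[of G "\<lambda>g. F g mod 2^Wd g" "\<lambda>g. F' g mod 2^Wd g"] F F' by(simp add: cb_def c2_def)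
  fix g assume g: "g \<in> G"
  show "F' g div 2^Wd g \<le> F g div 2^Wd g" using b[OF g] by(rule div_le_mono)
  show "of_bool (F g mod 2^Wd g < F' g mod 2^Wd g) \<le> F g div 2^Wd g - F' g div 2^Wd g"
   by(rule add_le_imp_le_diff, subst add.commute, rule conjunct2[OF main[OF g]])
 qed (use F F' in \<open>auto simp: c2_def\<close>)
 show ?thesis
  by(rule c2_cong[OF c2_pair[OF c2_wd[OF F] hi lo]]) (use main in simp)
qed

lemma half_word: "Wd g div 2 + (Wd g - Wd g div 2) = Wd g" "2 * (Wd g div 2) \<le> Wd g"
 by simp_all

text \<open>Long division with three digits: the high word, then \<open>k\<close> bits and
  \<open>h\<close> bits of the low word, where \<open>h + k\<close> is the word size. As the divisor
  is below \<open>2^h\<close>, a remainder followed by the next digit always fits into one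
  word.\<close>

lemma c2_divmod:
 assumes F: "c2 G F" and d: "c1 G d" and b: "\<And>g. g \<in> G \<Longrightarrow> 0 < d g \<and> d g < 2^(Wd g div 2)"
 shows "c2 G (\<lambda>g. F g div d g)" "c1 G (\<lambda>g. F g mod d g)"
proof -
 define M where "M g = (2^Wd g :: nat)" for g
 define h where "h g = Wd g div 2" for g
 define k where "k g = Wd g - Wd g div 2" for g
 define f1 where "f1 g = F g div M g" for g
 define f0 where "f0 g = F g mod M g" for g
 define q1 where "q1 g = f1 g div d g" for g
 define x2 where "x2 g = (f1 g mod d g) * 2^k g + f0 g div 2^h g" for g
 define x3 where "x3 g = (x2 g mod d g) * 2^h g + f0 g mod 2^h g" for g
 have w: "c1 G Wd" "c1 G f0" "c1 G f1" using F by(simp_all add: c2_def M_def f1_def[abs_def] f0_def[abs_def])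
 have two: "c1 G (\<lambda>_. 2)" by(rule c1_const[OF c1_ok[OF d]]) simp
 have h: "c1 G h" unfolding h_def by(rule c1_div[OF w(1) two])
 have k: "c1 G k" unfolding k_def by(intro c1_sub w h[unfolded h_def]) simp
 have Mhk: "M g = 2^h g * 2^k g" for g
  unfolding M_def h_def k_def power_add[symmetric] half_word(1) ..
 have f0: "f0 g div 2^h g < 2^k g" for g
  unfolding f0_def Mhk by(metis Mhk mod_less_divisor mult.commute div_less_iff_less_mult M_def zero_less_numeral zero_less_power)
 have x2b: "x2 g < d g * 2^k g" if "g \<in> G" for g
 proof -
  have "f1 g mod d g + 1 \<le> d g" using b[OF that] by(simp add: Suc_leI)
  hence "(f1 g mod d g + 1) * 2^k g \<le> d g * 2^k g" by(rule mult_le_mono1)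
  thus ?thesis using f0[of g] by(simp add: x2_def)
 qed
 have dk: "d g * 2^k g < M g" if "g \<in> G" for g
  using b[OF that] by(simp add: Mhk h_def)
 have x3b: "x3 g < d g * 2^h g" if "g \<in> G" for g
 proof -
  have "x2 g mod d g + 1 \<le> d g" using b[OF that] by(simp add: Suc_leI)
  hence "(x2 g mod d g + 1) * 2^h g \<le> d g * 2^h g" by(rule mult_le_mono1)
  moreover have "f0 g mod 2^h g < 2^h g" by simp
  ultimately show ?thesis unfolding x3_def by(simp only: add_mult_distrib)
 qed
 have dh: "d g * 2^h g < M g" if "g \<in> G" for g
 proof -
  have "d g * 2^h g < 2^h g * 2^h g" using b[OF that] by(simp add: h_def)
  also have "... = 2^(2 * h g)" by(simp add: mult_2 power_add)
  also have "... \<le> M g" unfolding M_def h_def by(rule power_increasing) auto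
  finally show ?thesis .
 qed
 have x2: "c1 G x2" unfolding x2_def
 proof(intro c1_add c1_shl c1_mod c1_shr w d k h)
  fix g assume g: "g \<in> G"
  show *: "f1 g mod d g * 2^k g + f0 g div 2^h g < 2^Wd g"
   using x2b[OF g] dk[OF g] by(simp add: x2_def M_def)
  thus "f1 g mod d g * 2^k g < 2^Wd g" by simp
 qed
 have x3: "c1 G x3" unfolding x3_def
 proof(intro c1_add c1_shl c1_modpow c1_mod w d x2 h)
  fix g assume g: "g \<in> G"
  show *: "x2 g mod d g * 2^h g + f0 g mod 2^h g < 2^Wd g"
   using x3b[OF g] dh[OF g] by(simp add: x3_def M_def)
  thus "x2 g mod d g * 2^h g < 2^Wd g" by simp
  show "h g \<le> Wd g" by(simp add: h_def)
 qed
 have eq: "F g = d g * (q1 g * M g + (x2 g div d g * 2^h g + x3 g div d g)) + x3 g mod d g" for g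
 proof -
  have "F g = f1 g * M g + f0 g" by(simp add: f1_def f0_def)
  also have "f1 g = d g * q1 g + f1 g mod d g" by(simp add: q1_def)
  also have "(d g * q1 g + f1 g mod d g) * M g + f0 g = d g * q1 g * M g + ((f1 g mod d g) * M g + f0 g)"
   by(simp add: algebra_simps)
  also have "f0 g = (f0 g div 2^h g) * 2^h g + f0 g mod 2^h g" by(rule div_mult_mod_eq[symmetric])
  also have "(f1 g mod d g) * M g + ((f0 g div 2^h g) * 2^h g + f0 g mod 2^h g) = x2 g * 2^h g + f0 g mod 2^h g"
   by(simp add: x2_def Mhk algebra_simps)
  also have "x2 g = d g * (x2 g div d g) + x2 g mod d g" by simp
  also have "(d g * (x2 g div d g) + x2 g mod d g) * 2^h g + f0 g mod 2^h g = d g * (x2 g div d g) * 2^h g + x3 g"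
   by(simp only: x3_def add_mult_distrib add.assoc)
  also have "x3 g = d g * (x3 g div d g) + x3 g mod d g" by simp
  finally show ?thesis by(simp add: algebra_simps)
 qed
 have lo: "x2 g div d g * 2^h g + x3 g div d g < M g" if "g \<in> G" for g
 proof -
  have 1: "x2 g div d g < 2^k g" using x2b[OF that] b[OF that] by(simp add: div_less_iff_less_mult mult.commute)
  have 2: "x3 g div d g < 2^h g" using x3b[OF that] b[OF that] by(simp add: div_less_iff_less_mult mult.commute)
  have "(x2 g div d g + 1) * 2^h g \<le> 2^k g * 2^h g" using 1 by(intro mult_le_mono1) simp
  thus ?thesis using 2 by(simp add: Mhk mult.commute)
 qed
 have md: "F g mod d g = x3 g mod d g" if "g \<in> G" for g
  using eq[of g] by(metis mod_mult_self4 mod_mod_trivial)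
 have dv: "F g div d g = q1 g * M g + (x2 g div d g * 2^h g + x3 g div d g)" if "g \<in> G" for g
 proof -
  have "F g div d g = (d g * (q1 g * M g + (x2 g div d g * 2^h g + x3 g div d g)) + x3 g mod d g) div d g"
   using eq[of g] by simp
  also have "... = q1 g * M g + (x2 g div d g * 2^h g + x3 g div d g)"
   using b[OF that] by(simp add: div_mult_self4)
  finally show ?thesis .
 qed
 show "c1 G (\<lambda>g. F g mod d g)" by(rule c1_cong[OF c1_mod[OF x3 d]]) (use md in simp)
 have "c1 G (\<lambda>g. x2 g div d g * 2^h g + x3 g div d g)"
 proof(intro c1_add c1_shl c1_div x2 x3 d h)
  fix g assume g: "g \<in> G"
  show *: "x2 g div d g * 2^h g + x3 g div d g < 2^Wd g" using lo[OF g] by(simp add: M_def)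
  thus "x2 g div d g * 2^h g < 2^Wd g" by simp
 qed
 moreover have "c1 G q1" unfolding q1_def by(intro c1_div w d)
 ultimately have "c2 G (\<lambda>g. q1 g * 2^Wd g + (x2 g div d g * 2^h g + x3 g div d g))"
  by(intro c2_pair w)
 thus "c2 G (\<lambda>g. F g div d g)" by(rule c2_cong) (use dv in \<open>simp add: M_def\<close>)
qed

text \<open>The low word is cut into pieces of \<open>k\<close> and \<open>h\<close> bits, whose
  products with \<open>d < 2^h\<close> fit into one word each; the bound on the whole product keeps
  the high word from overflowing.\<close>

lemma c2_mul:
 assumes F: "c2 G F" and d: "c1 G d" and b: "\<And>g. g \<in> G \<Longrightarrow> d g < 2^(Wd g div 2)"
  and p: "\<And>g. g \<in> G \<Longrightarrow> F g * d g < 2^(2 * Wd g)"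
 shows "c2 G (\<lambda>g. F g * d g)"
proof -
 define M where "M g = (2^Wd g :: nat)" for g
 define h where "h g = Wd g div 2" for g
 define k where "k g = Wd g - Wd g div 2" for g
 define f1 where "f1 g = F g div M g" for g
 define f0 where "f0 g = F g mod M g" for g
 define u where "u g = f0 g div 2^h g * d g" for g
 define v where "v g = f0 g mod 2^h g * d g" for g
 have w: "c1 G Wd" "c1 G f0" "c1 G f1" using F by(simp_all add: c2_def M_def f1_def[abs_def] f0_def[abs_def])
 have two: "c1 G (\<lambda>_. 2)" by(rule c1_const[OF c1_ok[OF d]]) simp
 have h: "c1 G h" unfolding h_def by(rule c1_div[OF w(1) two])
 have k: "c1 G k" unfolding k_def by(intro c1_sub w h[unfolded h_def]) simp
 have Mhk: "M g = 2^h g * 2^k g" for g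
  unfolding M_def h_def k_def power_add[symmetric] half_word(1) ..
 have f0: "f0 g div 2^h g < 2^k g" for g
  unfolding f0_def Mhk by(metis Mhk mod_less_divisor mult.commute div_less_iff_less_mult M_def zero_less_numeral zero_less_power)
 have ub: "u g < M g" if "g \<in> G" for g
 proof(cases "d g = 0")
  case False
  have "u g < 2^k g * d g" unfolding u_def using f0[of g] False by simp
  also have "... \<le> M g" using b[OF that] unfolding Mhk h_def by(simp add: mult.commute)
  finally show ?thesis .
 qed (simp add: u_def M_def)
 have vb: "v g < M g" if "g \<in> G" for g
 proof -
  have "v g \<le> 2^h g * d g" unfolding v_def by(intro mult_le_mono1 less_imp_le) simp
  also have "... < 2^h g * 2^h g" using b[OF that] unfolding h_def by simp
  also have "... = 2^(2 * h g)" by(simp add: mult_2 power_add)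
  also have "... \<le> M g" unfolding M_def h_def by(rule power_increasing) auto
  finally show ?thesis .
 qed
 have u: "c1 G u" unfolding u_def
  by(intro c1_mul c1_shr w h d) (use ub in \<open>simp add: u_def M_def\<close>)
 have v: "c1 G v" unfolding v_def
  by(intro c1_mul c1_modpow w h d) (use vb in \<open>simp_all add: v_def M_def h_def\<close>)
 have eq: "F g * d g = (f1 g * d g + u g div 2^k g) * M g + (u g mod 2^k g) * 2^h g + v g" for g
 proof -
  have "F g * d g = f1 g * d g * M g + f0 g * d g" by(simp add: f1_def f0_def flip: add_mult_distrib mult.assoc)
    (metis add_mult_distrib div_mult_mod_eq mult.assoc mult.commute)
  also have "f0 g * d g = u g * 2^h g + v g"
   unfolding u_def v_def by(metis add_mult_distrib div_mult_mod_eq mult.assoc mult.commute)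
  also have "u g * 2^h g = (u g div 2^k g) * M g + (u g mod 2^k g) * 2^h g"
  proof -
   have "u g = (u g div 2^k g) * 2^k g + u g mod 2^k g" by(rule div_mult_mod_eq[symmetric])
   hence "u g * 2^h g = ((u g div 2^k g) * 2^k g + u g mod 2^k g) * 2^h g" by simp
   thus ?thesis
    by(simp only: Mhk add_mult_distrib mult.assoc mult.commute[of "2^k g" "2^h g"])
  qed
  finally show ?thesis by(simp add: algebra_simps)
 qed
 have lo: "(u g mod 2^k g) * 2^h g < M g" for g
  unfolding Mhk by(simp add: mult.commute)
 have hib: "f1 g * d g + u g div 2^k g < 2^Wd g" if "g \<in> G" for g
 proof -
  have "(f1 g * d g + u g div 2^k g) * M g < M g * M g"
   using eq[of g] p[OF that] unfolding M_def mult_2 power_add by linarith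
  thus ?thesis by(simp add: M_def)
 qed
 have hi: "c1 G (\<lambda>g. f1 g * d g + u g div 2^k g)"
  by(intro c1_add c1_mul c1_shr w d u k hib) (use hib in \<open>auto intro: le_less_trans\<close>, metis add_lessD1 hib)
 have "c1 G (\<lambda>g. (u g mod 2^k g) * 2^h g)"
  by(intro c1_shl c1_modpow u k h) (use lo in \<open>auto simp: M_def k_def\<close>)
 hence "c2 G (\<lambda>g. (f1 g * d g + u g div 2^k g) * 2^Wd g + (u g mod 2^k g) * 2^h g)"
  by(intro c2_pair w hi)
 hence "c2 G (\<lambda>g. (f1 g * d g + u g div 2^k g) * 2^Wd g + (u g mod 2^k g) * 2^h g + v g)"
  by(rule c2_add[OF _ c2_of_c1[OF w(1) v]]) (use p eq in \<open>simp add: M_def\<close>)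
 thus ?thesis by(rule c2_cong) (simp add: eq M_def)
qed

lemma word_small: "ok G \<Longrightarrow> g \<in> G \<Longrightarrow> Wd g * Wd g < 2^(Wd g div 2)"
proof -
 assume "ok G" "g \<in> G"
 hence "40 \<le> Wd g" by(simp add: ok_def)
 moreover have "(2 * x + 1) * (2 * x + 1) < 2^x" if "20 \<le> x" for x :: nat
  using that
 proof(induction x rule: dec_induct)
  case (step x)
  have "(2 * Suc x + 1) * (2 * Suc x + 1) = (2 * x + 1) * (2 * x + 1) + (8 * x + 8)" by(simp add: algebra_simps)
  also have "8 * x + 8 \<le> (2 * x + 1) * (2 * x + 1)"
  proof -
   have "5 * (2 * x + 1) \<le> (2 * x + 1) * (2 * x + 1)" using step by(intro mult_le_mono1) simp
   moreover have "8 * x + 8 \<le> 5 * (2 * x + 1)" using step by simp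
   ultimately show ?thesis by linarith
  qed
  finally show ?case using step by simp
 qed simp
 moreover have "Wd g \<le> 2 * (Wd g div 2) + 1" by simp
 ultimately have "(2 * (Wd g div 2) + 1) * (2 * (Wd g div 2) + 1) < 2^(Wd g div 2)" by auto
 moreover have "Wd g * Wd g \<le> (2 * (Wd g div 2) + 1) * (2 * (Wd g div 2) + 1)" by(intro mult_le_mono) simp_all
 ultimately show ?thesis by linarith
qed

lemma c1_fld:
 assumes p: "c2 G p" and l: "c1 G l"
  and lW: "\<And>g. g \<in> G \<Longrightarrow> l g \<le> Wd g" and pl: "\<And>g. g \<in> G \<Longrightarrow> p g + l g \<le> Wd g * 2^Wd g \<and> p g < Wd g * 2^Wd g"
 shows "c1 G (\<lambda>g. fld (Bm g) (p g) (l g))"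
proof -
 have w: "c1 G Wd" using p by(rule c2_wd)
 have okG: "ok G" using w by(rule c1_ok)
 have wb: "0 < Wd g \<and> Wd g < 2^(Wd g div 2)" if "g \<in> G" for g
  using word_small[OF okG that] okG that unfolding ok_def
  by(metis (no_types, lifting) gr0I le_square less_le_trans not_less zero_less_numeral le_zero_eq)
 define q where "q g = p g div Wd g" for g
 define r where "r g = p g mod Wd g" for g
 define Y where "Y g = fld (Bm g) ((q g + 1) mod 2^Wd g * Wd g) (Wd g)" for g
 have qb: "q g < 2^Wd g" if "g \<in> G" for g
  using pl[OF that] wb[OF that] unfolding q_def by(simp add: div_less_iff_less_mult mult.commute)
 have q: "c1 G q" unfolding q_def
  by(rule c1_of_c2[OF c2_divmod(1)[OF p w wb]]) (use qb in \<open>auto simp: q_def\<close>)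
 have r: "c1 G r" unfolding r_def by(rule c2_divmod(2)[OF p w wb])
 have one: "c1 G (\<lambda>_. 1)" by(rule c1_const[OF okG]) simp
 have Y: "c1 G Y" unfolding Y_def by(intro c1_mem c1_addmod q one)
 have rW: "r g < Wd g" if "g \<in> G" for g using wb[OF that] by(simp add: r_def)
 have bd: "fld (Bm g) (q g * Wd g) (Wd g) div 2^r g + (Y g * 2^(Wd g - r g)) mod 2^Wd g < 2^Wd g" if "g \<in> G" for g
 proof -
  let ?M = "2^(Wd g - r g) :: nat"
  have M: "2^Wd g = ?M * 2^r g" using rW[OF that] by(simp flip: power_add)
  have "fld (Bm g) (q g * Wd g) (Wd g) div 2^r g < ?M"
   using fld_less[of "Bm g" "q g * Wd g" "Wd g"] unfolding M by(simp add: div_less_iff_less_mult)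
  moreover have "(Y g * ?M) mod 2^Wd g = (Y g mod 2^r g) * ?M"
   unfolding M using mult_mod_right[of ?M "Y g" "2^r g"] by(simp only: mult.commute)
  moreover have "(Y g mod 2^r g + 1) * ?M \<le> 2^r g * ?M" by(intro mult_le_mono1) (simp add: Suc_leI)
  ultimately show ?thesis unfolding M by(simp add: mult.commute)
 qed
 have "c1 G (\<lambda>g. (fld (Bm g) (q g * Wd g) (Wd g) div 2^r g + (Y g * 2^(Wd g - r g)) mod 2^Wd g) mod 2^l g)"
  by(intro c1_modpow c1_add c1_shr c1_shlmod c1_sub c1_mem q r Y w l lW bd) (use rW in \<open>auto intro: less_imp_le\<close>)
 thus ?thesis
 proof(rule c1_cong)
  fix g assume g: "g \<in> G"
  let ?D = "Bm g div 2^(q g * Wd g)"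
  have pq: "p g = q g * Wd g + r g" by(simp add: q_def r_def)
  \<comment> \<open>After the last address the successor wraps to 0; the bound on
    \<open>p g + l g\<close> then confines the field to the word \<open>q g\<close>.\<close>
  have "r g + l g \<le> Wd g \<or> Y g = ?D div 2^Wd g mod 2^Wd g"
  proof(cases "q g + 1 < 2^Wd g")
   case True
   hence "Y g = ?D div 2^Wd g mod 2^Wd g"
    by(simp add: Y_def fld_def add.commute power_add flip: div_mult2_eq) (simp add: mult.commute)
   thus ?thesis ..
  next
   case False
   hence "q g + 1 = 2^Wd g" using qb[OF g] by simp
   hence "Wd g * 2^Wd g = q g * Wd g + Wd g" by(metis add.commute mult.commute mult_Suc plus_1_eq_Suc)
   hence "r g + l g \<le> Wd g" using pl[OF g] unfolding pq by linarith
   thus ?thesis ..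
  qed
  from two_word_window[OF lW[OF g] rW[OF g] this]
  have "(fld (Bm g) (q g * Wd g) (Wd g) div 2^r g + (Y g * 2^(Wd g - r g)) mod 2^Wd g) mod 2^l g = ?D div 2^r g mod 2^l g"
   unfolding fld_def .
  also have "... = fld (Bm g) (p g) (l g)"
   unfolding fld_def pq power_add by(simp add: div_mult2_eq)
  finally show "(fld (Bm g) (q g * Wd g) (Wd g) div 2^r g + (Y g * 2^(Wd g - r g)) mod 2^Wd g) mod 2^l g = fld (Bm g) (p g) (l g)" .
 qed
qed

lemma c2_fld:
 assumes p: "c2 G p" and l: "c1 G l"
  and lW: "\<And>g. g \<in> G \<Longrightarrow> l g \<le> 2 * Wd g" and pl: "\<And>g. g \<in> G \<Longrightarrow> p g + l g \<le> Wd g * 2^Wd g \<and> p g < Wd g * 2^Wd g"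
 shows "c2 G (\<lambda>g. fld (Bm g) (p g) (l g))"
proof -
 have w: "c1 G Wd" using p by(rule c2_wd)
 have cb: "cb G (\<lambda>g. Wd g < l g)" by(intro cb_less1 w l)
 have W2: "Wd g * 2^Wd g < 2^(2 * Wd g)" if "g \<in> G" for g
  by(simp add: mult_2 power_add)
 let ?G = "{g \<in> G. Wd g < l g}"
 have G: "c2 ?G p" "c1 ?G l" "c1 ?G Wd" by(auto intro: c2_mono[OF p] c1_mono[OF l] c1_mono[OF w])
 have a: "c1 ?G (\<lambda>g. fld (Bm g) (p g) (Wd g))"
 proof(rule c1_fld[where p = p and l = Wd])
  fix g assume "g \<in> ?G"
  thus "p g + Wd g \<le> Wd g * 2^Wd g \<and> p g < Wd g * 2^Wd g" using pl[of g] by auto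
 qed (use G in auto)
 have b: "c1 ?G (\<lambda>g. fld (Bm g) (p g + Wd g) (l g - Wd g))"
 proof(rule c1_fld[where p = "\<lambda>g. p g + Wd g" and l = "\<lambda>g. l g - Wd g"])
  show "c2 ?G (\<lambda>g. p g + Wd g)"
  proof(intro c2_add[OF G(1) c2_of_c1] G)
   fix g assume "g \<in> ?G" thus "p g + Wd g < 2^(2 * Wd g)"
    using pl[of g] W2[of g] by auto
  qed
  show "c1 ?G (\<lambda>g. l g - Wd g)" by(intro c1_sub G) auto
  fix g assume g: "g \<in> ?G"
  thus "l g - Wd g \<le> Wd g" using lW[of g] by auto
  show "p g + Wd g + (l g - Wd g) \<le> Wd g * 2^Wd g \<and> p g + Wd g < Wd g * 2^Wd g"
   using g pl[of g] by auto
 qed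
 have 1: "c2 ?G (\<lambda>g. fld (Bm g) (p g) (l g))"
 proof(rule c2_cong[OF c2_pair[OF G(3) b a]])
  fix g assume "g \<in> ?G"
  hence "l g = Wd g + (l g - Wd g)" by simp
  thus "fld (Bm g) (p g + Wd g) (l g - Wd g) * 2^Wd g + fld (Bm g) (p g) (Wd g) = fld (Bm g) (p g) (l g)"
   using fld_split[of "Bm g" "p g" "Wd g" "l g - Wd g"] by(simp add: mult.commute)
 qed
 have 2: "c2 {g \<in> G. \<not> Wd g < l g} (\<lambda>g. fld (Bm g) (p g) (l g))"
  by(rule c2_of_c1[OF _ c1_fld[where p = p and l = l]]) (use w p l pl in \<open>auto intro: c1_mono c2_mono\<close>)
 show ?thesis using c2_ite[OF cb w 1 2] by simp
qed

end

section \<open>Memory layout\<close>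

text \<open>A memory layout: pairs of a width and a value, the first pair occupying the lowest
  bits.\<close>

type_synonym seg = "(nat \<times> nat) list"

fun tot :: "seg \<Rightarrow> nat" where
 "tot [] = 0"
| "tot ((l, v) # xs) = l + tot xs"

fun enc :: "seg \<Rightarrow> nat" where
 "enc [] = 0"
| "enc ((l, v) # xs) = v mod 2^l + 2^l * enc xs"

lemma tot_append [simp]: "tot (xs @ ys) = tot xs + tot ys"
 by(induction xs rule: tot.induct) auto

lemma enc_append: "enc (xs @ ys) = enc xs + 2^tot xs * enc ys"
 by(induction xs rule: tot.induct) (auto simp: algebra_simps power_add)

lemma enc_less: "enc xs < 2^tot xs"
proof(induction xs rule: tot.induct)
 case (2 l v xs)
 have "v mod 2^l < 2^l" by simp
 moreover have "2^l * (enc xs + 1) \<le> (2::nat)^l * 2^tot xs" using 2 by(intro mult_le_mono) auto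
 ultimately have "v mod 2^l + 2^l * enc xs < 2^l * 2^tot xs"
  by(simp only: add_mult_distrib2 mult_1_right)
 thus ?case by(simp add: power_add)
qed simp

definition holds :: "nat \<Rightarrow> nat \<Rightarrow> seg \<Rightarrow> bool" where
 "holds B p xs \<longleftrightarrow> fld B p (tot xs) = enc xs"

lemma holds_append: "holds B p (xs @ ys) \<longleftrightarrow> holds B p xs \<and> holds B (p + tot xs) ys"
proof -
 have *: "(a + M * b = c + M * d) = (a = c \<and> b = d)" if "a < M" "c < M" for a b c d M :: nat
 proof
  assume e: "a + M * b = c + M * d"
  hence "(a + M * b) mod M = (c + M * d) mod M" by simp
  hence "a = c" using that by simp
  thus "a = c \<and> b = d" using e that by simp
 qed simp
 show ?thesis
  unfolding holds_def tot_append enc_append fld_split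
  using *[OF fld_less[of B p "tot xs"] enc_less[of xs], of "fld B (p + tot xs) (tot ys)" "enc ys"] by simp
qed

lemma holds_Cons: "holds B p ((l, v) # xs) \<longleftrightarrow> fld B p l = v mod 2^l \<and> holds B (p + l) xs"
 using holds_append[of B p "[(l, v)]" xs] by(simp add: holds_def)

lemma holds_nth:
 assumes "holds B p xs" "i < length xs"
 shows "fld B (p + tot (take i xs)) (fst (xs ! i)) = snd (xs ! i) mod 2^fst (xs ! i)"
proof -
 have "xs = take i xs @ (fst (xs ! i), snd (xs ! i)) # drop (Suc i) xs"
  using assms(2) by(simp add: id_take_nth_drop[symmetric])
 hence "holds B p (take i xs @ (fst (xs ! i), snd (xs ! i)) # drop (Suc i) xs)" using assms(1) by simp
 thus ?thesis unfolding holds_append holds_Cons by simp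
qed

definition arr :: "nat \<Rightarrow> nat list \<Rightarrow> seg" where
 "arr l vs = map (Pair l) vs"

lemma tot_arr [simp]: "tot (arr l vs) = l * length vs"
 by(induction vs) (auto simp: arr_def)

text \<open>The length of \<open>xs\<close> is written in front of it in \<open>m\<close> bits, so
  that \<open>ys\<close> can be found although the length of a compressed part is not known in
  advance.\<close>

definition pack :: "nat \<Rightarrow> seg \<Rightarrow> seg \<Rightarrow> seg" where
 "pack m xs ys = (m, tot xs) # xs @ ys"

lemma tot_pack [simp]: "tot (pack m xs ys) = m + tot xs + tot ys"
 by(simp add: pack_def)

lemma tot_sum: "tot (map (\<lambda>i. (f i, g i)) [0..<n]) = (\<Sum>i<n. f i)"
 by(induction n) (auto simp: lessThan_Suc)

context ram
begin

text \<open>The layout ends strictly inside the \<open>Wd g * 2^Wd g\<close> addressable bits, so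
  every bit address in it is a two-word number.\<close>

definition stored :: "'g \<Rightarrow> nat \<Rightarrow> seg \<Rightarrow> bool" where
 "stored g p xs \<longleftrightarrow> holds (Bm g) p xs \<and> p + tot xs < Wd g * 2^Wd g"

lemma stored_append: "stored g p (xs @ ys) \<Longrightarrow> stored g p xs \<and> stored g (p + tot xs) ys"
 by(auto simp: stored_def holds_append)

lemma stored_pack:
 assumes "stored g p (pack m xs ys)" "tot xs < 2^m"
 shows "fld (Bm g) p m = tot xs" "stored g (p + m) xs" "stored g (p + m + tot xs) ys"
  "p + m + tot xs + tot ys < Wd g * 2^Wd g"
 using assms by(auto simp: stored_def pack_def holds_append holds_Cons)

lemma stored_arr:
 assumes "stored g p (arr l vs)" "i < length vs"
 shows "fld (Bm g) (p + i * l) l = vs ! i mod 2^l" "p + i * l + l < Wd g * 2^Wd g"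
proof -
 have t: "take i (arr l vs) = arr l (take i vs)" by(simp add: arr_def take_map)
 show "fld (Bm g) (p + i * l) l = vs ! i mod 2^l"
  using holds_nth[of "Bm g" p "arr l vs" i] assms unfolding t
  by(simp add: stored_def arr_def mult.commute tot_arr[unfolded arr_def])
 have "i * l + l \<le> l * length vs" using assms(2) mult_le_mono2[of "Suc i" "length vs" l] by(simp add: mult.commute)
 thus "p + i * l + l < Wd g * 2^Wd g" using assms(1) by(simp add: stored_def)
qed

lemma word_bound: "Wd g * 2^Wd g < 2^(2 * Wd g)"
 by(simp add: mult_2 power_add)

lemma small_two_words: "ok G \<Longrightarrow> g \<in> G \<Longrightarrow> l \<le> 2 * Wd g \<Longrightarrow> l < 2^(Wd g div 2)"
proof -
 assume a: "ok G" "g \<in> G" "l \<le> 2 * Wd g"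
 hence "2 * Wd g \<le> Wd g * Wd g" by(intro mult_le_mono1) (auto simp: ok_def)
 thus ?thesis using word_small[OF a(1,2)] a(3) by linarith
qed

lemma c2_arr:
 assumes p: "c2 G p" and l: "c1 G l" and i: "c2 G i"
  and a: "\<And>g. g \<in> G \<Longrightarrow> stored g (p g) (arr (l g) (vs g)) \<and> i g < length (vs g) \<and> vs g ! i g < 2^l g \<and> l g \<le> 2 * Wd g"
 shows "c2 G (\<lambda>g. vs g ! i g)"
proof -
 have okG: "ok G" using p by(rule c2_ok)
 have b: "p g + i g * l g + l g < Wd g * 2^Wd g" if "g \<in> G" for g
  using stored_arr(2) a[OF that] by blast
 have m: "c2 G (\<lambda>g. i g * l g)"
 proof(rule c2_mul[OF i l])
  fix g assume g: "g \<in> G"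
  show "l g < 2^(Wd g div 2)" using small_two_words[OF okG g] a[OF g] by blast
  show "i g * l g < 2^(2 * Wd g)" using b[OF g] word_bound[of g] by linarith
 qed
 have q: "c2 G (\<lambda>g. p g + i g * l g)"
 proof(rule c2_add[OF p m])
  fix g assume g: "g \<in> G"
  show "p g + i g * l g < 2^(2 * Wd g)" using b[OF g] word_bound[of g] by linarith
 qed
 show ?thesis
 proof(rule c2_cong[OF c2_fld[OF q l]])
  fix g assume g: "g \<in> G"
  show "l g \<le> 2 * Wd g" using a[OF g] by blast
  show "p g + i g * l g + l g \<le> Wd g * 2^Wd g \<and> p g + i g * l g < Wd g * 2^Wd g" using b[OF g] by linarith
  show "fld (Bm g) (p g + i g * l g) (l g) = vs g ! i g" using stored_arr(1)[of g "p g" "l g" "vs g" "i g"] a[OF g] by simp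
 qed
qed

lemma c2_pack:
 assumes p: "c2 G p" and m: "c1 G m"
  and a: "\<And>g. g \<in> G \<Longrightarrow> stored g (p g) (pack (m g) (xs g) (ys g)) \<and> tot (xs g) < 2^m g \<and> m g \<le> 2 * Wd g"
 shows "c2 G (\<lambda>g. p g + m g)" "c2 G (\<lambda>g. p g + m g + tot (xs g))"
proof -
 have b: "p g + m g + tot (xs g) + tot (ys g) < Wd g * 2^Wd g" if "g \<in> G" for g
  using stored_pack(4) a[OF that] by blast
 show 1: "c2 G (\<lambda>g. p g + m g)"
 proof(rule c2_add[OF p c2_of_c1[OF c2_wd[OF p] m]])
  fix g assume g: "g \<in> G"
  show "p g + m g < 2^(2 * Wd g)" using b[OF g] word_bound[of g] by linarith
 qed
 have "c2 G (\<lambda>g. fld (Bm g) (p g) (m g))"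
 proof(rule c2_fld[OF p m])
  fix g assume g: "g \<in> G"
  show "m g \<le> 2 * Wd g" using a[OF g] by blast
  show "p g + m g \<le> Wd g * 2^Wd g \<and> p g < Wd g * 2^Wd g" using b[OF g] by linarith
 qed
 hence 2: "c2 G (\<lambda>g. tot (xs g))"
  by(rule c2_cong) (use a stored_pack(1) in blast)
 show "c2 G (\<lambda>g. p g + m g + tot (xs g))"
 proof(rule c2_add[OF 1 2])
  fix g assume g: "g \<in> G"
  show "p g + m g + tot (xs g) < 2^(2 * Wd g)" using b[OF g] word_bound[of g] by linarith
 qed
qed

end

section \<open>Rank\<close>

definition rank :: "nat set \<Rightarrow> nat \<Rightarrow> nat" where
 "rank S i = card (S \<inter> {..<i})"

lemma rank_0 [simp]: "rank S 0 = 0"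
 by(simp add: rank_def)

lemma rank_mono: "i \<le> j \<Longrightarrow> rank S i \<le> rank S j"
 unfolding rank_def by(intro card_mono) auto

lemma rank_add: "rank S (i + d) = rank S i + card {j. j < d \<and> i + j \<in> S}"
proof -
 have "S \<inter> {..<i + d} = (S \<inter> {..<i}) \<union> (\<lambda>j. i + j) ` {j. j < d \<and> i + j \<in> S}"
 proof(intro equalityI subsetI)
  fix x assume x: "x \<in> S \<inter> {..<i + d}"
  show "x \<in> (S \<inter> {..<i}) \<union> (\<lambda>j. i + j) ` {j. j < d \<and> i + j \<in> S}"
  proof(cases "x < i")
   case False
   hence "x = i + (x - i)" by simp
   thus ?thesis using x False by(intro UnI2 image_eqI[of _ _ "x - i"]) auto
  qed (use x in auto)
 qed auto
 moreover have "card ((S \<inter> {..<i}) \<union> (\<lambda>j. i + j) ` {j. j < d \<and> i + j \<in> S}) =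
   card (S \<inter> {..<i}) + card ((\<lambda>j. i + j) ` {j. j < d \<and> i + j \<in> S})"
  by(rule card_Un_disjoint) auto
 ultimately show ?thesis unfolding rank_def by(simp add: card_image)
qed

lemma rank_diff_le: "rank S (i + d) \<le> rank S i + d"
 using rank_add[of S i d] card_mono[of "{..<d}" "{j. j < d \<and> i + j \<in> S}"] by auto

lemma rank_Suc: "rank S (Suc i) = rank S i + of_bool (i \<in> S)"
proof -
 have "{j. j < 1 \<and> i + j \<in> S} = (if i \<in> S then {0} else {})" by auto
 thus ?thesis using rank_add[of S i 1] by auto
qed

lemma rank_card: "S \<subseteq> {..<N} \<Longrightarrow> N \<le> i \<Longrightarrow> rank S i = card S"
 unfolding rank_def by(rule arg_cong[of _ _ card]) auto

lemma rank_le_card: "finite S \<Longrightarrow> rank S i \<le> card S"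
 unfolding rank_def by(intro card_mono) auto

section \<open>Blocks of a bit vector and the lookup table\<close>

definition popc :: "nat \<Rightarrow> nat" where
 "popc v = card {i. bit v i}"

definition bval :: "nat \<Rightarrow> nat set \<Rightarrow> nat \<Rightarrow> nat" where
 "bval s S bi = horner_sum of_bool 2 (map (\<lambda>j. bi * s + j \<in> S) [0..<s])"

lemma bit_bval: "bit (bval s S bi) j \<longleftrightarrow> j < s \<and> bi * s + j \<in> S"
 by(auto simp: bval_def bit_horner_sum_bit_iff)

lemma bval_less: "bval s S bi < 2^s"
 unfolding bval_def using horner_sum_of_bool_2_less[of "map (\<lambda>j. bi * s + j \<in> S) [0..<s]"] by simp

lemma popc_bval: "i \<le> s \<Longrightarrow> popc (bval s S bi mod 2^i) = rank S (bi * s + i) - rank S (bi * s)"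
proof -
 assume "i \<le> s"
 hence "{j. bit (bval s S bi mod 2^i) j} = {j. j < i \<and> bi * s + j \<in> S}"
  by(auto simp: bit_bval bit_take_bit_iff simp flip: take_bit_eq_mod)
 thus ?thesis by(simp add: popc_def rank_add)
qed

lemma popc_bval_full: "popc (bval s S bi) = rank S (Suc bi * s) - rank S (bi * s)"
 using popc_bval[of s s S bi] bval_less[of s S bi] by(simp add: add.commute)

lemma popc_le: "v < 2^s \<Longrightarrow> popc v \<le> s"
proof -
 assume "v < 2^s"
 hence "{i. bit v i} \<subseteq> {..<s}"
  using bit_take_bit_iff[of s v] by(auto simp: take_bit_nat_eq_self)
 thus ?thesis unfolding popc_def using card_mono[of "{..<s}"] by fastforce
qed

definition class_list :: "nat \<Rightarrow> nat \<Rightarrow> nat list" where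
 "class_list s c = filter (\<lambda>v. popc v = c) [0..<2^s]"

lemma length_class_list: "length (class_list s c) = s choose c"
proof -
 have "length (class_list s c) = card {v. v < 2^s \<and> popc v = c}"
  unfolding class_list_def
  by(subst distinct_card[symmetric]) (auto intro: arg_cong[of _ _ card])
 also have "... = card {A. A \<subseteq> {..<s} \<and> card A = c}"
 proof(rule bij_betw_same_card[of "\<lambda>v. {i. bit v i}"], rule bij_betw_byWitness[where f' = "\<lambda>A. horner_sum of_bool 2 (map (\<lambda>i. i \<in> A) [0..<s])"])
  show "\<forall>v\<in>{v. v < 2^s \<and> popc v = c}. horner_sum of_bool 2 (map (\<lambda>i. i \<in> {i. bit v i}) [0..<s]) = v"
   by(simp add: horner_sum_bit_eq_take_bit take_bit_nat_eq_self)
  show "\<forall>A\<in>{A. A \<subseteq> {..<s} \<and> card A = c}. {i. bit (horner_sum of_bool 2 (map (\<lambda>i. i \<in> A) [0..<s]) :: nat) i} = A"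
   by(auto simp: bit_horner_sum_bit_iff)
  show "(\<lambda>v. {i. bit v i}) ` {v. v < 2^s \<and> popc v = c} \<subseteq> {A. A \<subseteq> {..<s} \<and> card A = c}"
   by(auto simp: popc_def) (metis bit_take_bit_iff take_bit_nat_eq_self)
  show "(\<lambda>A. horner_sum of_bool 2 (map (\<lambda>i. i \<in> A) [0..<s])) ` {A. A \<subseteq> {..<s} \<and> card A = c} \<subseteq> {v. v < 2^s \<and> popc v = c}"
  proof(clarify, intro conjI)
   fix A assume A: "A \<subseteq> {..<s}"
   show "horner_sum of_bool 2 (map (\<lambda>i. i \<in> A) [0..<s]) < (2::nat)^s"
    using horner_sum_of_bool_2_less[of "map (\<lambda>i. i \<in> A) [0..<s]"] by simp
   have "{i. bit (horner_sum of_bool 2 (map (\<lambda>i. i \<in> A) [0..<s]) :: nat) i} = A"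
    using A by(auto simp: bit_horner_sum_bit_iff)
   thus "popc (horner_sum of_bool 2 (map (\<lambda>i. i \<in> A) [0..<s])) = card A" by(simp add: popc_def)
  qed
 qed
 also have "... = s choose c" using n_subsets[of "{..<s}" c] by simp
 finally show ?thesis .
qed

text \<open>Enumerative coding: given its number of ones, a block is named by its index among the
  blocks with equally many ones. The lengths of these codes add up to about the entropy of the whole
  vector (\<open>sum_blen_log\<close>).\<close>

definition block_code :: "nat \<Rightarrow> nat \<Rightarrow> nat" where
 "block_code s v = (LEAST i. i < length (class_list s (popc v)) \<and> class_list s (popc v) ! i = v)"

lemma block_code:
 assumes "v < 2^s"
 shows "block_code s v < s choose popc v" "class_list s (popc v) ! block_code s v = v"
proof -
 have "v \<in> set (class_list s (popc v))" using assms by(simp add: class_list_def)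
 hence "\<exists>i. i < length (class_list s (popc v)) \<and> class_list s (popc v) ! i = v" by(metis in_set_conv_nth)
 from LeastI_ex[OF this] show "block_code s v < s choose popc v" "class_list s (popc v) ! block_code s v = v"
  unfolding block_code_def length_class_list by auto
qed

definition in_select :: "nat \<Rightarrow> nat \<Rightarrow> nat" where
 "in_select v j = (THE x. bit v x \<and> popc (v mod 2^x) = j)"

text \<open>One table with \<open>2^s\<close> columns holds all functions of a block: rows 0 to
  \<open>s\<close> decode the blocks with \<open>r\<close> ones, the next two rows hold the number
  of ones and the rounded logarithm, and row \<open>s + 3 + j\<close> holds the position of the one
  that has \<open>j\<close> ones before it.\<close>

definition tabval :: "nat \<Rightarrow> nat \<Rightarrow> nat \<Rightarrow> nat" where
 "tabval s r v = (if r \<le> s then (if v < length (class_list s r) then class_list s r ! v else 0)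
   else if r = s + 1 then popc v
   else if r = s + 2 then ceillog2 v
   else in_select v (r - s - 3))"

definition tabs :: "nat \<Rightarrow> nat list" where
 "tabs s = map (\<lambda>i. tabval s (i div 2^s) (i mod 2^s)) [0..<(2 * s + 3) * 2^s]"

text \<open>Directory of an increasing sequence: every \<open>lam\<close>-th value in full, all
  values relative to the preceding full one. \<open>lam\<close> is both the width and the distance
  of the full values, so these cost about one bit per entry; a sequence growing by at most
  \<open>s\<close> per step has differences of \<open>mu\<close> bits when
  \<open>s * lam < 2^mu\<close>.\<close>

definition seqd :: "nat \<Rightarrow> nat \<Rightarrow> (nat \<Rightarrow> nat) \<Rightarrow> nat \<Rightarrow> seg" where
 "seqd lam mu y m = pack lam (arr lam (map (\<lambda>i. y (i * lam)) [0..<m div lam + 1]))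
   (arr mu (map (\<lambda>i. y i - y (i div lam * lam)) [0..<m + 1]))"

definition blen :: "nat \<Rightarrow> nat set \<Rightarrow> nat \<Rightarrow> nat" where
 "blen s S bi = ceillog2 (s choose popc (bval s S bi))"

text \<open>Ranks at the block boundaries, addresses of the block codes, and the codes themselves.
  Neither the number of ones of a block nor the length of its code is stored: both are differences
  of neighbouring directory entries. With \<open>N div s + 1\<close> blocks even the position
  \<open>N\<close> lies in a block.\<close>

definition rankd :: "nat \<Rightarrow> nat \<Rightarrow> nat \<Rightarrow> nat set \<Rightarrow> nat \<Rightarrow> seg" where
 "rankd s lam mu S N = (let m = N div s + 1 in
   pack lam (seqd lam mu (\<lambda>bi. rank S (bi * s)) m)
    (pack lam (seqd lam mu (\<lambda>bi. \<Sum>i<bi. blen s S i) m)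
     (map (\<lambda>bi. (blen s S bi, block_code s (bval s S bi))) [0..<m])))"

lemma blen_le: "blen s S bi \<le> s"
proof -
 have "s choose popc (bval s S bi) \<le> 2^s"
  using length_class_list[of s "popc (bval s S bi)"] length_filter_le[of "\<lambda>v. popc v = popc (bval s S bi)" "[0..<2^s]"]
  unfolding class_list_def by simp
 thus ?thesis unfolding blen_def by(metis ceillog2_2_power ceillog2_mono)
qed

lemma sum_blen_le: "(\<Sum>i\<in>A. blen s S i) \<le> card A * s"
 using sum_bounded_above[of A "blen s S" s] blen_le by auto

lemma tot_seqd: "tot (seqd lam mu y m) = lam + lam * (m div lam + 1) + mu * (m + 1)"
 by(simp add: seqd_def)

lemma tot_rankd: "tot (rankd s lam mu S N) =
 2 * lam + 2 * (lam + lam * ((N div s + 1) div lam + 1) + mu * (N div s + 2)) + (\<Sum>i<N div s + 1. blen s S i)"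
 by(simp add: rankd_def Let_def tot_seqd tot_sum[where f = "blen s S"])

text \<open>A generous bound under which all lengths and addresses inside a directory for the
  universe \<open>N\<close> fit into \<open>lam\<close> bits.\<close>

definition cap :: "nat \<Rightarrow> nat \<Rightarrow> nat \<Rightarrow> bool" where
 "cap lam mu N \<longleftrightarrow> 4 * (N + 4) * (lam + mu + 1) < 2^lam"

lemma cap_mono: "cap lam mu N \<Longrightarrow> M \<le> N \<Longrightarrow> cap lam mu M"
 unfolding cap_def by(erule le_less_trans[rotated]) (intro mult_le_mono; simp)

lemma tot_seqd_less:
 assumes "cap lam mu N" "m \<le> N + 1"
 shows "tot (seqd lam mu y m) \<le> (N + 3) * (lam + mu)" "tot (seqd lam mu y m) < 2^lam"
proof -
 have "tot (seqd lam mu y m) \<le> lam + lam * (m + 1) + mu * (m + 1)"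
  unfolding tot_seqd by(intro add_mono mult_le_mono) auto
 also have "... \<le> (m + 2) * (lam + mu)" by(simp add: algebra_simps)
 also have "... \<le> (N + 3) * (lam + mu)" using assms(2) by(intro mult_le_mono1) simp
 finally show 1: "tot (seqd lam mu y m) \<le> (N + 3) * (lam + mu)" .
 have "(N + 3) * (lam + mu) \<le> 4 * (N + 4) * (lam + mu + 1)" by(intro mult_le_mono) simp_all
 thus "tot (seqd lam mu y m) < 2^lam" using 1 assms(1) unfolding cap_def by linarith
qed

lemma tot_rankd_less:
 assumes "cap lam mu N" "0 < s" "s \<le> lam"
 shows "tot (rankd s lam mu S N) < 2^lam"
proof -
 have m: "N div s + 1 \<le> N + 1" by simp
 have a: "(N div s + 1) * s \<le> (N + 1) * (lam + mu)"
  using assms by(intro mult_le_mono) auto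
 have "tot (rankd s lam mu S N) \<le> 2 * lam + 2 * ((N + 3) * (lam + mu)) + (N + 1) * (lam + mu)"
  unfolding rankd_def Let_def tot_pack tot_sum[where f = "blen s S"]
  using tot_seqd_less(1)[OF assms(1) m, of "\<lambda>bi. rank S (bi * s)"]
   tot_seqd_less(1)[OF assms(1) m, of "\<lambda>bi. \<Sum>i<bi. blen s S i"] sum_blen_le[of s S "{..<N div s + 1}"] a
  by simp
 also have "... \<le> 4 * (N + 4) * (lam + mu + 1)" by(simp add: algebra_simps)
 also have "... < 2^lam" using assms(1) by(simp add: cap_def)
 finally show ?thesis .
qed

locale fid = ram Wd Bm Ar for Wd :: "'g \<Rightarrow> nat" and Bm Ar +
 fixes s lam mu :: "'g \<Rightarrow> nat" and tb :: "'g \<Rightarrow> nat"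
begin

definition par :: "'g set \<Rightarrow> bool" where
 "par G \<longleftrightarrow> c1 G Wd \<and> c1 G s \<and> c1 G lam \<and> c1 G mu \<and> c2 G tb \<and>
   (\<forall>g\<in>G. 3 \<le> s g \<and> 4 * s g \<le> Wd g \<and> s g \<le> lam g \<and> lam g \<le> 2 * Wd g \<and> mu g \<le> Wd g \<and>
    s g * lam g < 2^mu g \<and> stored g (tb g) (arr (s g) (tabs (s g))))"

lemma par_mono: "par G \<Longrightarrow> H \<subseteq> G \<Longrightarrow> par H"
 unfolding par_def by(meson c1_mono c2_mono subsetD)

lemma parD:
 assumes "par G"
 shows "c1 G Wd" "c1 G s" "c1 G lam" "c1 G mu" "c2 G tb" "ok G"
 using assms c1_ok unfolding par_def by auto

lemma parB:
 assumes "par G" "g \<in> G"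
 shows "3 \<le> s g" "4 * s g \<le> Wd g" "s g \<le> lam g" "lam g \<le> 2 * Wd g" "mu g \<le> Wd g"
  "s g * lam g < 2^mu g" "stored g (tb g) (arr (s g) (tabs (s g)))" "0 < s g" "0 < lam g" "s g < Wd g"
  "40 \<le> Wd g"
 using assms c1_ok unfolding par_def ok_def by fastforce+

lemma c1_row:
 assumes P: "par G" and r: "c1 G r" and v: "c1 G v"
  and b: "\<And>g. g \<in> G \<Longrightarrow> r g < 2 * s g + 3 \<and> v g < 2^s g \<and> tabval (s g) (r g) (v g) < 2^s g"
 shows "c1 G (\<lambda>g. tabval (s g) (r g) (v g))"
proof -
 note p = parD[OF P]
 have i: "r g * 2^s g + v g < (2 * s g + 3) * 2^s g" if "g \<in> G" for g
 proof -
  have "(r g + 1) * 2^s g \<le> (2 * s g + 3) * 2^s g" using b[OF that] by(intro mult_le_mono1) simp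
  thus ?thesis using b[OF that] by simp
 qed
 have W: "(2 * s g + 3) * 2^s g < 2^Wd g" if g: "g \<in> G" for g
 proof -
  have "2 * s g + 3 \<le> Wd g" using parB[OF P g] by simp
  also have "... \<le> Wd g * Wd g" by simp
  also have "... < 2^(Wd g div 2)" by(rule word_small[OF p(6) g])
  finally have "(2 * s g + 3) * 2^s g < 2^(Wd g div 2) * 2^s g" by simp
  also have "... = 2^(Wd g div 2 + s g)" by(simp add: power_add)
  also have "... \<le> 2^Wd g" using parB[OF P g] by(intro power_increasing) auto
  finally show ?thesis .
 qed
 have ix: "c1 G (\<lambda>g. r g * 2^s g + v g)"
 proof(intro c1_add c1_shl r v p(2))
  fix g assume g: "g \<in> G"
  show "r g * 2^s g + v g < 2^Wd g" using i[OF g] W[OF g] by simp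
  thus "r g * 2^s g < 2^Wd g" by simp
 qed
 have e: "tabs (s g) ! (r g * 2^s g + v g) = tabval (s g) (r g) (v g)" if "g \<in> G" for g
  unfolding tabs_def using i[OF that] b[OF that] by simp
 have "c2 G (\<lambda>g. tabs (s g) ! (r g * 2^s g + v g))"
 proof(rule c2_arr[OF p(5) p(2) c2_of_c1[OF p(1) ix]])
  fix g assume g: "g \<in> G"
  show "stored g (tb g) (arr (s g) (tabs (s g))) \<and> r g * 2^s g + v g < length (tabs (s g)) \<and>
   tabs (s g) ! (r g * 2^s g + v g) < 2^s g \<and> s g \<le> 2 * Wd g"
   using parB[OF P g] i[OF g] b[OF g] unfolding e[OF g] by(auto simp: tabs_def)
 qed
 thus ?thesis
 proof(rule c1_cong[OF c1_of_c2])
  fix g assume g: "g \<in> G"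
  have "(2::nat)^s g \<le> 2^Wd g" using parB[OF P g] by(intro power_increasing) auto
  thus "tabs (s g) ! (r g * 2^s g + v g) < 2^Wd g"
   using b[OF g] unfolding e[OF g] by linarith
 qed (rule e)
qed

lemma small_le_2W: "par G \<Longrightarrow> g \<in> G \<Longrightarrow> l \<le> 2 * Wd g \<Longrightarrow> l < 2^(Wd g div 2)"
 using small_two_words parD(6) by blast

lemma c2_seq:
 assumes P: "par G" and p: "c2 G p" and i: "c2 G i"
  and a: "\<And>g. g \<in> G \<Longrightarrow> stored g (p g) (seqd (lam g) (mu g) (y g) (m g)) \<and> i g \<le> m g \<and>
   tot (seqd (lam g) (mu g) (y g) (m g)) < 2^lam g \<and>
   mono (y g) \<and> y g (m g) < 2^lam g \<and> (\<forall>i d. y g (i + d) \<le> y g i + d * s g)"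
 shows "c2 G (\<lambda>g. y g (i g))"
proof -
 note pp = parD[OF P]
 define xs where "xs g = arr (lam g) (map (\<lambda>i. y g (i * lam g)) [0..<m g div lam g + 1])" for g
 define ys where "ys g = arr (mu g) (map (\<lambda>j. y g j - y g (j div lam g * lam g)) [0..<m g + 1])" for g
 have sq: "seqd (lam g) (mu g) (y g) (m g) = pack (lam g) (xs g) (ys g)" for g
  by(simp add: seqd_def xs_def ys_def)
 have xb: "tot (xs g) < 2^lam g" if "g \<in> G" for g
  using a[OF that] unfolding sq by simp
 have A: "stored g (p g) (pack (lam g) (xs g) (ys g)) \<and> tot (xs g) < 2^lam g \<and> lam g \<le> 2 * Wd g" if "g \<in> G" for g
  using a[OF that] xb[OF that] parB[OF P that] unfolding sq by auto
 note b = c2_pack[OF p pp(3) A]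
 have l: "0 < lam g \<and> lam g < 2^(Wd g div 2)" if "g \<in> G" for g
  using parB[OF P that] small_le_2W[OF P that] by blast
 have q: "c2 G (\<lambda>g. i g div lam g)" by(rule c2_divmod(1)[OF i pp(3) l])
 have im: "i g div lam g < m g div lam g + 1" if "g \<in> G" for g
  using a[OF that] by(simp add: div_le_mono le_imp_less_Suc)
 have Y: "y g (i g div lam g * lam g) \<le> y g (i g)" if "g \<in> G" for g
  using a[OF that] by(auto intro: monoD)
 have Ym: "y g (i g) < 2^lam g" if "g \<in> G" for g
  using a[OF that] monoD[of "y g" "i g" "m g"] by fastforce
 have Yd: "y g (i g) - y g (i g div lam g * lam g) < 2^mu g" if "g \<in> G" for g
 proof -
  have "y g (i g) \<le> y g (i g div lam g * lam g) + (i g mod lam g) * s g"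
   using a[OF that] by(metis div_mult_mod_eq)
  also have "(i g mod lam g) * s g \<le> lam g * s g" using l[OF that] by(intro mult_le_mono1) (simp add: less_imp_le)
  finally show ?thesis using parB(6)[OF P that] by(simp add: mult.commute)
 qed
 have 1: "c2 G (\<lambda>g. map (\<lambda>i. y g (i * lam g)) [0..<m g div lam g + 1] ! (i g div lam g))"
 proof(rule c2_arr[OF b(1) pp(3) q])
  fix g assume g: "g \<in> G"
  show "stored g (p g + lam g) (arr (lam g) (map (\<lambda>i. y g (i * lam g)) [0..<m g div lam g + 1])) \<and>
     i g div lam g < length (map (\<lambda>i. y g (i * lam g)) [0..<m g div lam g + 1]) \<and>
     map (\<lambda>i. y g (i * lam g)) [0..<m g div lam g + 1] ! (i g div lam g) < 2^lam g \<and> lam g \<le> 2 * Wd g"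
   using stored_pack(2)[of g "p g" "lam g" "xs g" "ys g"] A[OF g] im[OF g] Y[OF g] Ym[OF g]
   unfolding xs_def by(auto simp del: upt_Suc)
 qed
 have 2: "c2 G (\<lambda>g. map (\<lambda>j. y g j - y g (j div lam g * lam g)) [0..<m g + 1] ! i g)"
 proof(rule c2_arr[OF b(2) pp(4) i])
  fix g assume g: "g \<in> G"
  show "stored g (p g + lam g + tot (xs g)) (arr (mu g) (map (\<lambda>j. y g j - y g (j div lam g * lam g)) [0..<m g + 1])) \<and>
     i g < length (map (\<lambda>j. y g j - y g (j div lam g * lam g)) [0..<m g + 1]) \<and>
     map (\<lambda>j. y g j - y g (j div lam g * lam g)) [0..<m g + 1] ! i g < 2^mu g \<and> mu g \<le> 2 * Wd g"
   using stored_pack(3)[of g "p g" "lam g" "xs g" "ys g"] A[OF g] a[OF g] Yd[OF g] parB(5)[OF P g]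
   unfolding ys_def by(auto simp del: upt_Suc)
 qed
 have 3: "c2 G (\<lambda>g. y g (i g div lam g * lam g))"
  by(rule c2_cong[OF 1]) (use im in \<open>auto simp del: upt_Suc\<close>)
 have 4: "c2 G (\<lambda>g. y g (i g) - y g (i g div lam g * lam g))"
 proof(rule c2_cong[OF 2])
  fix g assume "g \<in> G"
  hence "i g < m g + 1" using a by fastforce
  thus "map (\<lambda>j. y g j - y g (j div lam g * lam g)) [0..<m g + 1] ! i g = y g (i g) - y g (i g div lam g * lam g)"
   by(simp del: upt_Suc)
 qed
 have "c2 G (\<lambda>g. y g (i g div lam g * lam g) + (y g (i g) - y g (i g div lam g * lam g)))"
 proof(rule c2_add[OF 3 4])
  fix g assume g: "g \<in> G"
  have "y g (i g) < 2^lam g" by(rule Ym[OF g])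
  also have "... \<le> 2^(2 * Wd g)" using parB[OF P g] by(intro power_increasing) auto
  finally show "y g (i g div lam g * lam g) + (y g (i g) - y g (i g div lam g * lam g)) < 2^(2 * Wd g)"
   using Y[OF g] by simp
 qed
 thus ?thesis by(rule c2_cong) (use Y in auto)
qed

end

section \<open>Select\<close>

definition sel :: "nat set \<Rightarrow> nat \<Rightarrow> nat" where
 "sel S i = sorted_list_of_set S ! i"

lemma rank_nth_sorted_list:
 assumes "finite S" "i < card S"
 shows "rank S (sorted_list_of_set S ! i) = i"
proof -
 define xs where "xs = sorted_list_of_set S"
 have xs: "sorted_wrt (<) xs" "set xs = S" "length xs = card S" "distinct xs"
  using assms by(auto simp: xs_def)
 have "S \<inter> {..<xs ! i} = set (take i xs)"
 proof(intro equalityI subsetI)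
  fix y assume "y \<in> S \<inter> {..<xs ! i}"
  then obtain j where j: "j < length xs" "y = xs ! j" "xs ! j < xs ! i" using xs(2) by(auto simp: in_set_conv_nth)
  hence "j < i"
   using sorted_wrt_nth_less[OF xs(1), of i j] assms xs by(metis not_less_iff_gr_or_eq less_asym)
  thus "y \<in> set (take i xs)" using j by(auto simp: in_set_conv_nth)
 next
  fix y assume "y \<in> set (take i xs)"
  then obtain j where "j < i" "y = xs ! j" using assms xs by(auto simp: in_set_conv_nth)
  thus "y \<in> S \<inter> {..<xs ! i}"
   using sorted_wrt_nth_less[OF xs(1), of j i] assms xs nth_mem[of j xs] by auto
 qed
 thus ?thesis
  using xs assms distinct_card[of "take i xs"] by(simp add: rank_def xs_def[symmetric])
qed

lemma sel_props:
 assumes "finite S" "i < card S"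
 shows "sel S i \<in> S" "rank S (sel S i) = i"
 using rank_nth_sorted_list[OF assms] assms nth_mem[of i "sorted_list_of_set S"]
 by(auto simp: sel_def)

lemma rank_strict: "x \<in> S \<Longrightarrow> x < y \<Longrightarrow> rank S x < rank S y"
 using rank_Suc[of S x] rank_mono[of "Suc x" y S] by simp

lemma rank_inj: "x \<in> S \<Longrightarrow> y \<in> S \<Longrightarrow> rank S x = rank S y \<Longrightarrow> x = y"
 using rank_strict[of x S y] rank_strict[of y S x] by(metis less_irrefl nat_neq_iff)

lemma sel_eqI:
 assumes "finite S" "x \<in> S" "rank S x = i"
 shows "sel S i = x"
proof -
 have "rank S x < rank S (Suc x)" by(rule rank_strict[OF assms(2)]) simp
 also have "... \<le> card S" by(rule rank_le_card[OF assms(1)])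
 finally have "i < card S" using assms by simp
 from sel_props[OF assms(1) this] show ?thesis using assms rank_inj by metis
qed

definition Occ :: "nat \<Rightarrow> nat set \<Rightarrow> nat set" where
 "Occ s S = (\<lambda>x. x div s) ` S"

text \<open>In the enumeration of \<open>S\<close>, the indices at which a new block begins. Rank in
  this set leads from an index to the ordinal of its nonempty block, and select in
  \<open>Occ s S\<close> from there to the block itself.\<close>

definition Wset :: "nat \<Rightarrow> nat set \<Rightarrow> nat set" where
 "Wset s S = (\<lambda>bi. rank S (bi * s)) ` Occ s S"

lemma Occ_iff: "0 < s \<Longrightarrow> bi \<in> Occ s S \<longleftrightarrow> rank S (bi * s) < rank S (Suc bi * s)"
proof
 assume s: "0 < s" "bi \<in> Occ s S"
 then obtain x where x: "x \<in> S" "bi = x div s" by(auto simp: Occ_def)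
 have "rank S (bi * s) \<le> rank S x" by(rule rank_mono) (simp add: x)
 also have "rank S x < rank S (Suc bi * s)"
  by(rule rank_strict[OF x(1)]) (use s x dividend_less_div_times[of s x] in simp)
 finally show "rank S (bi * s) < rank S (Suc bi * s)" .
next
 assume s: "0 < s" "rank S (bi * s) < rank S (Suc bi * s)"
 have "rank S (Suc bi * s) = rank S (bi * s) + card {j. j < s \<and> bi * s + j \<in> S}"
  using rank_add[of S "bi * s" s] by(simp add: add.commute)
 hence "card {j. j < s \<and> bi * s + j \<in> S} \<noteq> 0" using s by linarith
 hence "{j. j < s \<and> bi * s + j \<in> S} \<noteq> {}" by(metis card.empty)
 then obtain j where "j < s" "bi * s + j \<in> S" by blast
 thus "bi \<in> Occ s S" unfolding Occ_def by(intro image_eqI[of _ _ "bi * s + j"]) auto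
qed

lemma Occ_sub: "S \<subseteq> {..<N} \<Longrightarrow> Occ s S \<subseteq> {..<N div s + 1}"
proof
 fix y assume S: "S \<subseteq> {..<N}" and "y \<in> Occ s S"
 then obtain x where "x \<in> S" "y = x div s" by(auto simp: Occ_def)
 moreover from this S have "x \<le> N" by auto
 ultimately have "y \<le> N div s" using div_le_mono by blast
 thus "y \<in> {..<N div s + 1}" by simp
qed

lemma Wset_sub: "finite S \<Longrightarrow> 0 < s \<Longrightarrow> Wset s S \<subseteq> {..<card S}"
 unfolding Wset_def using Occ_iff[of s _ S] rank_le_card[of S] by(auto intro: less_le_trans)

lemma rank_block_inj: "0 < s \<Longrightarrow> inj_on (\<lambda>bi. rank S (bi * s)) (Occ s S)"
proof -
 assume s: "0 < s"
 have *: "rank S (bi * s) < rank S (bi' * s)" if "bi \<in> Occ s S" "bi < bi'" for bi bi'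
 proof -
  have "rank S (bi * s) < rank S (Suc bi * s)" using that Occ_iff[OF s] by blast
  also have "... \<le> rank S (bi' * s)" by(rule rank_mono) (use that in \<open>intro mult_le_mono1, simp\<close>)
  finally show ?thesis .
 qed
 show ?thesis by(rule inj_onI) (metis * less_irrefl nat_neq_iff)
qed

lemma card_Wset: "0 < s \<Longrightarrow> card (Wset s S) = card (Occ s S)"
 unfolding Wset_def by(intro card_image rank_block_inj)

text \<open>The blocks that begin at an index up to \<open>i\<close> are the nonempty blocks up to
  the one containing the element with index \<open>i\<close>, which itself is counted, hence the
  \<open>- 1\<close>. Select in \<open>S\<close> is thereby reduced to select in
  \<open>Occ s S\<close>, a set in a universe smaller by the factor \<open>s\<close>.\<close>

lemma sel_step:
 assumes fS: "finite S" and s: "0 < s" and i: "i < card S"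
 defines "bi \<equiv> sel (Occ s S) (rank (Wset s S) (i + 1) - 1)"
 shows "bi \<in> Occ s S" "rank S (bi * s) \<le> i" "i < rank S (bi * s) + s"
  "sel S i = bi * s + in_select (bval s S bi) (i - rank S (bi * s))"
  "1 \<le> rank (Wset s S) (i + 1)" "rank (Wset s S) (i + 1) - 1 < card (Occ s S)"
  "in_select (bval s S bi) (i - rank S (bi * s)) < s"
proof -
 define x where "x = sel S i"
 have x: "x \<in> S" "rank S x = i" using sel_props[OF fS i] by(auto simp: x_def)
 define b where "b = x div s"
 have fO: "finite (Occ s S)" using fS by(simp add: Occ_def)
 have b: "b \<in> Occ s S" using x by(auto simp: b_def Occ_def)
 have xb: "x = b * s + x mod s" by(simp add: b_def)
 have b1: "rank S (b * s) \<le> i" unfolding x(2)[symmetric] by(rule rank_mono) (simp add: b_def)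
 have b2: "i < rank S (Suc b * s)"
  unfolding x(2)[symmetric] by(rule rank_strict[OF x(1)]) (use s dividend_less_div_times[of s x] in \<open>simp add: b_def\<close>)
 have "Wset s S \<inter> {..<i + 1} = (\<lambda>bi. rank S (bi * s)) ` (Occ s S \<inter> {..<b + 1})"
 proof(intro equalityI subsetI)
  fix y assume "y \<in> Wset s S \<inter> {..<i + 1}"
  then obtain c where c: "c \<in> Occ s S" "y = rank S (c * s)" "rank S (c * s) \<le> i" by(auto simp: Wset_def)
  have "c \<le> b"
  proof(rule ccontr)
   assume "\<not> c \<le> b"
   hence "rank S (Suc b * s) \<le> rank S (c * s)" by(intro rank_mono mult_le_mono1) simp
   thus False using b2 c by linarith
  qed
  thus "y \<in> (\<lambda>bi. rank S (bi * s)) ` (Occ s S \<inter> {..<b + 1})" using c by auto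
 next
  fix y assume "y \<in> (\<lambda>bi. rank S (bi * s)) ` (Occ s S \<inter> {..<b + 1})"
  then obtain c where c: "c \<in> Occ s S" "c \<le> b" "y = rank S (c * s)" by auto
  have "rank S (c * s) \<le> rank S (b * s)" using c by(intro rank_mono mult_le_mono1) simp
  thus "y \<in> Wset s S \<inter> {..<i + 1}" using c b1 by(auto simp: Wset_def)
 qed
 hence "rank (Wset s S) (i + 1) = rank (Occ s S) (b + 1)"
  using card_image[OF inj_on_subset[OF rank_block_inj[OF s, of S]], of "Occ s S \<inter> {..<b + 1}"]
  by(simp only: rank_def[of "Wset s S"] rank_def[of "Occ s S"] Int_lower1)
 hence r: "rank (Wset s S) (i + 1) = rank (Occ s S) b + 1" using b by(simp add: rank_Suc)
 have bi: "bi = b" unfolding bi_def r using sel_eqI[OF fO b] by simp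
 show "bi \<in> Occ s S" "rank S (bi * s) \<le> i" "1 \<le> rank (Wset s S) (i + 1)" using b b1 r unfolding bi by auto
 show "i < rank S (bi * s) + s" using b2 rank_diff_le[of S "b * s" s] unfolding bi by(simp add: add.commute)
 have "rank (Occ s S) b < rank (Occ s S) (Suc b)" by(rule rank_strict[OF b]) simp
 also have "... \<le> card (Occ s S)" by(rule rank_le_card[OF fO])
 finally show "rank (Wset s S) (i + 1) - 1 < card (Occ s S)" using r by simp
 have "in_select (bval s S b) (i - rank S (b * s)) = x mod s"
  unfolding in_select_def
 proof(rule the_equality)
  have "x mod s \<le> s" using s by(simp add: less_imp_le)
  thus "bit (bval s S b) (x mod s) \<and> popc (bval s S b mod 2^(x mod s)) = i - rank S (b * s)"
   using popc_bval[of "x mod s" s S b] x s by(simp add: bit_bval xb[symmetric])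
 next
  fix y assume y: "bit (bval s S b) y \<and> popc (bval s S b mod 2^y) = i - rank S (b * s)"
  hence "y < s" "b * s + y \<in> S" by(auto simp: bit_bval)
  moreover from this have "rank S (b * s + y) = i"
   using popc_bval[of y s S b] y b1 rank_mono[of "b * s" "b * s + y" S] by simp
  ultimately have "b * s + y = x" using rank_inj[of "b * s + y" S x] x by simp
  thus "y = x mod s" using \<open>y < s\<close> by auto
 qed
 thus "sel S i = bi * s + in_select (bval s S bi) (i - rank S (bi * s))"
  "in_select (bval s S bi) (i - rank S (bi * s)) < s" using s unfolding bi x_def[symmetric]
  using xb by auto
qed

text \<open>Each level shrinks the universe by the factor \<open>s\<close>. At depth 2 at most about
  \<open>N / s^2\<close> elements remain, and listing them in \<open>lam\<close> bits each costs O(N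
  / s) bits, because \<open>lam\<close> is at most a constant multiple of \<open>s\<close>.\<close>

fun seld :: "nat \<Rightarrow> nat \<Rightarrow> nat \<Rightarrow> nat \<Rightarrow> nat set \<Rightarrow> nat \<Rightarrow> seg" where
 "seld s lam mu 0 S N = arr lam (sorted_list_of_set S)"
| "seld s lam mu (Suc d) S N = pack lam (rankd s lam mu S N)
   (pack lam (rankd s lam mu (Wset s S) (card S)) (seld s lam mu d (Occ s S) (N div s + 1)))"

text \<open>Dropping \<open>s\<close> low bits with rounding upwards is exact here:
  \<open>x \<le> 2^(s + l)\<close> holds iff the rounded quotient is at most \<open>2^l\<close>. The
  logarithm of a long number can thus be found by lookups of \<open>s\<close> bits.\<close>

lemma ceillog2_step:
 assumes "2^s \<le> x"
 shows "ceillog2 x = s + ceillog2 ((x + 2^s - 1) div 2^s)"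
proof -
 have x: "0 < x" using assms by(metis gr0I le_zero_eq power_not_zero zero_neq_numeral)
 define y where "y = (x + 2^s - 1) div 2^s"
 have y: "0 < y" using assms x by(simp add: y_def div_greater_zero_iff)
 have iff: "y \<le> 2^l \<longleftrightarrow> x \<le> 2^(s + l)" for l
 proof -
  have "y \<le> 2^l \<longleftrightarrow> x + 2^s - 1 < Suc (2^l) * 2^s"
   unfolding y_def by(subst less_Suc_eq_le[symmetric], subst div_less_iff_less_mult) auto
  also have "... \<longleftrightarrow> x \<le> 2^(s + l)" using x by(auto simp: power_add algebra_simps)
  finally show ?thesis .
 qed
 show ?thesis
 proof(rule antisym)
  have "y \<le> 2^ceillog2 y" by(rule le_two_power_ceillog2)
  hence "x \<le> 2^(s + ceillog2 y)" using iff by blast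
  thus "ceillog2 x \<le> s + ceillog2 ((x + 2^s - 1) div 2^s)"
   using x ceillog2_le_iff unfolding y_def by blast
  have "s \<le> ceillog2 x" using ceillog2_mono[OF assms] by simp
  then obtain l where l: "ceillog2 x = s + l" using le_Suc_ex by blast
  have "x \<le> 2^ceillog2 x" by(rule le_two_power_ceillog2)
  hence "y \<le> 2^l" unfolding l iff .
  hence "ceillog2 y \<le> l" using y ceillog2_le_iff by blast
  thus "s + ceillog2 ((x + 2^s - 1) div 2^s) \<le> ceillog2 x" unfolding l y_def by simp
 qed
qed

context fid
begin

lemma cap_less: "cap (lam g) (mu g) N \<Longrightarrow> N + lam g < 2^lam g"
proof -
 assume c: "cap (lam g) (mu g) N"
 have "N + lam g \<le> 4 * (N + 4) * (lam g + mu g + 1)" by(simp add: algebra_simps)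
 thus ?thesis using c by(simp add: cap_def)
qed

lemma rank_block_bound:
 assumes "par G" "g \<in> G" "cap (lam g) (mu g) N" "S \<subseteq> {..<N}"
 shows "rank S i < 2^lam g" "(\<Sum>i<N div s g + 1. blen (s g) S i) < 2^lam g"
proof -
 have "rank S i \<le> card S" using assms(4) finite_subset by(intro rank_le_card) blast
 also have "... \<le> N" using card_mono[OF _ assms(4)] by simp
 finally show "rank S i < 2^lam g" using cap_less[OF assms(3)] by linarith
 have "(\<Sum>i<N div s g + 1. blen (s g) S i) \<le> (N div s g + 1) * s g" using sum_blen_le[of "s g" S "{..<N div s g + 1}"] by simp
 also have "... \<le> N + s g" by(simp add: add_mult_distrib)
 also have "... < 2^lam g" using cap_less[OF assms(3)] parB(3)[OF assms(1,2)] by linarith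
 finally show "(\<Sum>i<N div s g + 1. blen (s g) S i) < 2^lam g" .
qed

lemma c_block:
 assumes P: "par G" and p: "c2 G p" and bi: "c2 G bi"
  and a: "\<And>g. g \<in> G \<Longrightarrow> stored g (p g) (rankd (s g) (lam g) (mu g) (S g) (N g)) \<and>
   bi g \<le> N g div s g \<and> cap (lam g) (mu g) (N g) \<and> S g \<subseteq> {..<N g}"
 shows "c1 G (\<lambda>g. bval (s g) (S g) (bi g))" "c2 G (\<lambda>g. rank (S g) (bi g * s g))"
proof -
 let ?L = "\<lambda>g. blen (s g) (S g) (bi g)"
 let ?v = "\<lambda>g. bval (s g) (S g) (bi g)"
 note pp = parD[OF P]
 define m where "m g = N g div s g + 1" for g
 define y1 where "y1 g = (\<lambda>bi. rank (S g) (bi * s g))" for g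
 define y2 where "y2 g = (\<lambda>bi. \<Sum>i<bi. blen (s g) (S g) i)" for g
 define X where "X g = seqd (lam g) (mu g) (y1 g) (m g)" for g
 define Y where "Y g = seqd (lam g) (mu g) (y2 g) (m g)" for g
 define Z where "Z g = map (\<lambda>bi. (blen (s g) (S g) bi, block_code (s g) (bval (s g) (S g) bi))) [0..<m g]" for g
 have R: "rankd (s g) (lam g) (mu g) (S g) (N g) = pack (lam g) (X g) (pack (lam g) (Y g) (Z g))" for g
  by(simp add: rankd_def Let_def X_def Y_def Z_def m_def y1_def y2_def)
 have mN: "m g \<le> N g + 1" for g by(simp add: m_def)
 have Xb: "tot (X g) < 2^lam g" "tot (Y g) < 2^lam g" if "g \<in> G" for g
  using tot_seqd_less(2)[of "lam g" "mu g" "N g" "m g"] a[OF that] mN unfolding X_def Y_def by blast+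
 have A1: "stored g (p g) (pack (lam g) (X g) (pack (lam g) (Y g) (Z g))) \<and> tot (X g) < 2^lam g \<and> lam g \<le> 2 * Wd g" if "g \<in> G" for g
  using a[OF that] Xb[OF that] parB(4)[OF P that] unfolding R by blast
 note q = c2_pack[OF p pp(3) A1]
 have A2: "stored g (p g + lam g + tot (X g)) (pack (lam g) (Y g) (Z g)) \<and> tot (Y g) < 2^lam g \<and> lam g \<le> 2 * Wd g" if "g \<in> G" for g
  using A1[OF that] stored_pack(3) Xb[OF that] by blast
 note r = c2_pack[OF q(2) pp(3) A2]
 have sX: "stored g (p g + lam g) (X g)" "stored g (p g + lam g + tot (X g) + lam g) (Y g)"
  "stored g (p g + lam g + tot (X g) + lam g + tot (Y g)) (Z g)" if "g \<in> G" for g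
  using A1[OF that] A2[OF that] stored_pack(2,3) by blast+
 have one: "c2 G (\<lambda>_. 1)" by(rule c2_const[OF pp(1)]) simp
 have Nb: "N g + lam g < 2^(2 * Wd g)" if "g \<in> G" for g
 proof -
  have "N g + lam g < 2^lam g" using cap_less a[OF that] by blast
  also have "... \<le> 2^(2 * Wd g)" using parB(4)[OF P that] by(intro power_increasing) auto
  finally show ?thesis .
 qed
 have bi1: "c2 G (\<lambda>g. bi g + 1)"
 proof(rule c2_add[OF bi one])
  fix g assume g: "g \<in> G"
  have "bi g \<le> N g" using a[OF g] by(meson div_le_dividend le_trans)
  thus "bi g + 1 < 2^(2 * Wd g)" using Nb[OF g] parB(9)[OF P g] by linarith
 qed
 have c1a: "mono (y1 g) \<and> y1 g (m g) < 2^lam g \<and> (\<forall>i d. y1 g (i + d) \<le> y1 g i + d * s g)" if "g \<in> G" for g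
  using rank_block_bound(1)[OF P that] a[OF that] rank_diff_le[of "S g"]
  by(auto simp: y1_def mono_def add_mult_distrib intro: rank_mono)
 have c2a: "mono (y2 g) \<and> y2 g (m g) < 2^lam g \<and> (\<forall>i d. y2 g (i + d) \<le> y2 g i + d * s g)" if "g \<in> G" for g
 proof(intro conjI allI)
  show "mono (y2 g)" unfolding y2_def by(intro monoI sum_mono2) auto
  show "y2 g (m g) < 2^lam g" using rank_block_bound(2)[OF P that] a[OF that] by(simp add: y2_def m_def)
  fix i d
  have "y2 g (i + d) = y2 g i + (\<Sum>j\<in>{i..<i + d}. blen (s g) (S g) j)"
   unfolding y2_def lessThan_atLeast0 by(rule sum.atLeastLessThan_concat[symmetric]) auto
  thus "y2 g (i + d) \<le> y2 g i + d * s g" using sum_blen_le[of "s g" "S g" "{i..<i + d}"] by simp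
 qed
 have bim: "bi g \<le> m g" "bi g + 1 \<le> m g" if "g \<in> G" for g using a[OF that] by(auto simp: m_def)
 have B1: "stored g (p g + lam g) (seqd (lam g) (mu g) (y1 g) (m g)) \<and> i \<le> m g \<and>
   tot (seqd (lam g) (mu g) (y1 g) (m g)) < 2^lam g \<and> mono (y1 g) \<and> y1 g (m g) < 2^lam g \<and>
   (\<forall>i d. y1 g (i + d) \<le> y1 g i + d * s g)" if "g \<in> G" "i \<le> m g" for g i
  using sX(1)[OF that(1)] Xb(1)[OF that(1)] c1a[OF that(1)] that(2) unfolding X_def by blast
 have B2: "stored g (p g + lam g + tot (X g) + lam g) (seqd (lam g) (mu g) (y2 g) (m g)) \<and> i \<le> m g \<and>
   tot (seqd (lam g) (mu g) (y2 g) (m g)) < 2^lam g \<and> mono (y2 g) \<and> y2 g (m g) < 2^lam g \<and>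
   (\<forall>i d. y2 g (i + d) \<le> y2 g i + d * s g)" if "g \<in> G" "i \<le> m g" for g i
  using sX(2)[OF that(1)] Xb(2)[OF that(1)] c2a[OF that(1)] that(2) unfolding Y_def by blast
 have rk: "c2 G (\<lambda>g. y1 g (bi g))" "c2 G (\<lambda>g. y1 g (bi g + 1))"
  using c2_seq[OF P q(1) bi B1] c2_seq[OF P q(1) bi1 B1] bim by blast+
 have pt: "c2 G (\<lambda>g. y2 g (bi g))" "c2 G (\<lambda>g. y2 g (bi g + 1))"
  using c2_seq[OF P r(1) bi B2] c2_seq[OF P r(1) bi1 B2] bim by blast+
 show "c2 G (\<lambda>g. rank (S g) (bi g * s g))" using rk(1) by(simp add: y1_def)
 have cl: "c1 G (\<lambda>g. popc (?v g))"
 proof(rule c1_cong[OF c1_of_c2[OF c2_sub[OF rk(2,1)]]])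
  fix g assume g: "g \<in> G"
  show le: "y1 g (bi g) \<le> y1 g (bi g + 1)" unfolding y1_def by(intro rank_mono) simp
  show e: "y1 g (bi g + 1) - y1 g (bi g) = popc (?v g)"
   by(simp add: popc_bval_full y1_def)
  have "popc (?v g) \<le> s g" by(rule popc_le[OF bval_less])
  also have "s g < Wd g" by(rule parB(10)[OF P g])
  also have "Wd g < 2^Wd g" by(rule less_exp)
  finally show "y1 g (bi g + 1) - y1 g (bi g) < 2^Wd g" unfolding e .
 qed
 have len: "c1 G (\<lambda>g. ?L g)"
 proof(rule c1_cong[OF c1_of_c2[OF c2_sub[OF pt(2,1)]]])
  fix g assume g: "g \<in> G"
  show le: "y2 g (bi g) \<le> y2 g (bi g + 1)" by(simp add: y2_def)
  show e: "y2 g (bi g + 1) - y2 g (bi g) = ?L g" by(simp add: y2_def)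
  have "?L g \<le> s g" by(rule blen_le)
  also have "s g < Wd g" by(rule parB(10)[OF P g])
  also have "Wd g < 2^Wd g" by(rule less_exp)
  finally show "y2 g (bi g + 1) - y2 g (bi g) < 2^Wd g" unfolding e .
 qed
 define z where "z g = p g + lam g + tot (X g) + lam g + tot (Y g)" for g
 have bm: "bi g < m g" if "g \<in> G" for g using a[OF that] by(simp add: m_def)
 have zb: "z g + y2 g (bi g) + ?L g < Wd g * 2^Wd g" if g: "g \<in> G" for g
 proof -
  have "tot (Z g) = y2 g (m g)" by(simp add: Z_def y2_def tot_sum[where f = "blen (s g) (S g)"])
  moreover have "y2 g (bi g) + ?L g = y2 g (Suc (bi g))" by(simp add: y2_def)
  moreover have "y2 g (Suc (bi g)) \<le> y2 g (m g)" using c2a[OF g] bm[OF g] by(auto intro: monoD)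
  ultimately show ?thesis using sX(3)[OF g] by(simp add: stored_def z_def)
 qed
 have zp: "c2 G (\<lambda>g. z g + y2 g (bi g))"
 proof(rule c2_add[OF r(2)[folded z_def] pt(1)])
  fix g assume g: "g \<in> G"
  show "z g + y2 g (bi g) < 2^(2 * Wd g)" using zb[OF g] word_bound[of g] by linarith
 qed
 have code: "c1 G (\<lambda>g. block_code (s g) (?v g))"
 proof(rule c1_cong[OF c1_fld[OF zp len]])
  fix g assume g: "g \<in> G"
  show "?L g \<le> Wd g" using blen_le[of "s g" "S g" "bi g"] parB(10)[OF P g] by linarith
  show "z g + y2 g (bi g) + ?L g \<le> Wd g * 2^Wd g \<and> z g + y2 g (bi g) < Wd g * 2^Wd g"
   using zb[OF g] by linarith
  have tk: "take (bi g) (Z g) = map (\<lambda>bi. (blen (s g) (S g) bi, block_code (s g) (bval (s g) (S g) bi))) [0..<bi g]"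
   using bm[OF g] by(simp add: Z_def take_map)
  have "tot (take (bi g) (Z g)) = y2 g (bi g)" unfolding tk tot_sum by(simp add: y2_def)
  hence "fld (Bm g) (z g + y2 g (bi g)) (?L g) =
    block_code (s g) (?v g) mod 2^?L g"
   using holds_nth[of "Bm g" "z g" "Z g" "bi g"] sX(3)[OF g] bm[OF g] by(simp add: stored_def z_def Z_def)
  moreover have "block_code (s g) (?v g) < 2^?L g"
   using block_code(1)[OF bval_less[of "s g" "S g" "bi g"]] le_two_power_ceillog2
   unfolding blen_def by(rule less_le_trans)
  ultimately show "fld (Bm g) (z g + y2 g (bi g)) (?L g) = block_code (s g) (?v g)"
   by simp
 qed
 have tv: "tabval (s g) (popc (?v g)) (block_code (s g) (?v g)) = ?v g" for g
  using block_code[OF bval_less[of "s g" "S g" "bi g"]] popc_le[OF bval_less[of "s g" "S g" "bi g"]]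
  by(simp add: tabval_def length_class_list)
 show "c1 G (\<lambda>g. ?v g)"
 proof(rule c1_cong[OF c1_row[OF P cl code]])
  fix g assume g: "g \<in> G"
  have "block_code (s g) (?v g) < 2^s g"
  proof -
   have "block_code (s g) (?v g) < 2^?L g"
    using block_code(1)[OF bval_less[of "s g" "S g" "bi g"]] le_two_power_ceillog2
    unfolding blen_def by(rule less_le_trans)
   also have "... \<le> 2^s g" using blen_le by(intro power_increasing) auto
   finally show ?thesis .
  qed
  thus "popc (?v g) < 2 * s g + 3 \<and> block_code (s g) (?v g) < 2^s g \<and>
   tabval (s g) (popc (?v g)) (block_code (s g) (?v g)) < 2^s g"
   unfolding tv using popc_le[OF bval_less[of "s g" "S g" "bi g"]] bval_less[of "s g" "S g" "bi g"] by simp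
 qed (rule tv)
qed

lemma c_rank:
 assumes P: "par G" and p: "c2 G p" and i: "c2 G i"
  and a: "\<And>g. g \<in> G \<Longrightarrow> stored g (p g) (rankd (s g) (lam g) (mu g) (S g) (N g)) \<and>
   i g \<le> N g \<and> cap (lam g) (mu g) (N g) \<and> S g \<subseteq> {..<N g}"
 shows "c2 G (\<lambda>g. rank (S g) (i g))"
proof -
 note pp = parD[OF P]
 have l: "0 < s g \<and> s g < 2^(Wd g div 2)" if "g \<in> G" for g
  using parB[OF P that] small_le_2W[OF P that, of "s g"] by auto
 note d = c2_divmod[OF i pp(2) l]
 have A: "stored g (p g) (rankd (s g) (lam g) (mu g) (S g) (N g)) \<and>
   i g div s g \<le> N g div s g \<and> cap (lam g) (mu g) (N g) \<and> S g \<subseteq> {..<N g}" if "g \<in> G" for g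
  using a[OF that] by(auto intro: div_le_mono)
 note b = c_block[OF P p d(1) A]
 define v where "v g = bval (s g) (S g) (i g div s g) mod 2^(i g mod s g)" for g
 have v: "c1 G v" unfolding v_def
 proof(rule c1_modpow[OF b(1) d(2)])
  fix g assume g: "g \<in> G"
  have "i g mod s g < s g" using l[OF g] by simp
  thus "i g mod s g \<le> Wd g" using parB(10)[OF P g] by linarith
 qed
 have vb: "v g < 2^s g" if g: "g \<in> G" for g
  unfolding v_def using bval_less[of "s g" "S g" "i g div s g"] by(meson le_less_trans mod_less_eq_dividend)
 have one: "c1 G (\<lambda>_. 1)" by(rule c1_const[OF pp(6)]) simp
 have r1: "c1 G (\<lambda>g. s g + 1)"
 proof(rule c1_add[OF pp(2) one])
  fix g assume g: "g \<in> G"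
  have "s g + 1 \<le> Wd g" using parB(10)[OF P g] by simp
  also have "Wd g < 2^Wd g" by(rule less_exp)
  finally show "s g + 1 < 2^Wd g" .
 qed
 have "c1 G (\<lambda>g. tabval (s g) (s g + 1) (v g))"
 proof(rule c1_row[OF P r1 v])
  fix g assume g: "g \<in> G"
  have "popc (v g) \<le> s g" using popc_le[OF vb[OF g]] .
  also have "s g < 2^s g" by(rule less_exp)
  finally show "s g + 1 < 2 * s g + 3 \<and> v g < 2^s g \<and> tabval (s g) (s g + 1) (v g) < 2^s g"
   using vb[OF g] by(simp add: tabval_def)
 qed
 hence pc: "c1 G (\<lambda>g. popc (v g))" by(rule c1_cong) (simp add: tabval_def)
 have e: "rank (S g) (i g) = rank (S g) (i g div s g * s g) + popc (v g)" if "g \<in> G" for g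
 proof -
  have "i g mod s g \<le> s g" using l[OF that] by(simp add: less_imp_le)
  hence "popc (v g) = rank (S g) (i g) - rank (S g) (i g div s g * s g)"
   unfolding v_def using popc_bval[of "i g mod s g" "s g" "S g" "i g div s g"] by simp
  moreover have "rank (S g) (i g div s g * s g) \<le> rank (S g) (i g)" by(intro rank_mono) simp
  ultimately show ?thesis by simp
 qed
 show ?thesis
 proof(rule c2_cong[OF c2_add[OF b(2) c2_of_c1[OF pp(1) pc]]])
  fix g assume g: "g \<in> G"
  show "rank (S g) (i g div s g * s g) + popc (v g) = rank (S g) (i g)" using e[OF g] by simp
  have "rank (S g) (i g) < 2^lam g" using rank_block_bound(1)[OF P g] a[OF g] by blast
  also have "... \<le> 2^(2 * Wd g)" using parB(4)[OF P g] by(intro power_increasing) auto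
  finally show "rank (S g) (i g div s g * s g) + popc (v g) < 2^(2 * Wd g)" using e[OF g] by simp
 qed
qed

lemma cb_mem:
 assumes P: "par G" and p: "c2 G p" and i: "c2 G i"
  and a: "\<And>g. g \<in> G \<Longrightarrow> stored g (p g) (rankd (s g) (lam g) (mu g) (S g) (N g)) \<and>
   i g < N g \<and> cap (lam g) (mu g) (N g) \<and> S g \<subseteq> {..<N g}"
 shows "cb G (\<lambda>g. i g \<in> S g)"
proof -
 note pp = parD[OF P]
 have one: "c2 G (\<lambda>_. 1)" by(rule c2_const[OF pp(1)]) simp
 have "c2 G (\<lambda>g. i g + 1)"
 proof(rule c2_add[OF i one])
  fix g assume g: "g \<in> G"
  have "N g + lam g < 2^lam g" using cap_less a[OF g] by blast
  also have "... \<le> 2^(2 * Wd g)" using parB(4)[OF P g] by(intro power_increasing) auto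
  finally show "i g + 1 < 2^(2 * Wd g)" using a[OF g] by linarith
 qed
 hence "c2 G (\<lambda>g. rank (S g) (i g + 1))" by(rule c_rank[OF P p]) (use a in fastforce)
 moreover have "c2 G (\<lambda>g. rank (S g) (i g))" by(rule c_rank[OF P p i]) (use a in fastforce)
 ultimately have "cb G (\<lambda>g. rank (S g) (i g) < rank (S g) (i g + 1))" by(intro cb_less)
 thus ?thesis by(rule cb_cong) (simp add: rank_Suc)
qed

lemma c_sel:
 assumes "par G" "c2 G p" "c2 G i"
  "\<And>g. g \<in> G \<Longrightarrow> stored g (p g) (seld (s g) (lam g) (mu g) d (S g) (N g)) \<and>
   i g < card (S g) \<and> cap (lam g) (mu g) (N g + d) \<and> S g \<subseteq> {..<N g}"
 shows "c2 G (\<lambda>g. sel (S g) (i g))"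
 using assms
proof(induction d arbitrary: p i S N)
 case 0
 show ?case unfolding sel_def
 proof(rule c2_arr[OF 0(2) parD(3)[OF 0(1)] 0(3)])
  fix g assume g: "g \<in> G"
  have f: "finite (S g)" using 0(4)[OF g] finite_subset by blast
  have "sorted_list_of_set (S g) ! i g \<in> S g" using sel_props(1)[OF f] 0(4)[OF g] by(simp add: sel_def)
  hence "sorted_list_of_set (S g) ! i g < N g" using 0(4)[OF g] by auto
  hence "sorted_list_of_set (S g) ! i g < 2^lam g" using cap_less[of g "N g"] 0(4)[OF g] by simp
  thus "stored g (p g) (arr (lam g) (sorted_list_of_set (S g))) \<and> i g < length (sorted_list_of_set (S g)) \<and>
     sorted_list_of_set (S g) ! i g < 2^lam g \<and> lam g \<le> 2 * Wd g"
   using 0(4)[OF g] f parB(4)[OF 0(1) g] by simp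
 qed
next
 case (Suc d)
 note P = Suc.prems(1) and p = Suc.prems(2) and i = Suc.prems(3) and a = Suc.prems(4)
 note pp = parD[OF P]
 define X where "X g = rankd (s g) (lam g) (mu g) (S g) (N g)" for g
 define Y where "Y g = rankd (s g) (lam g) (mu g) (Wset (s g) (S g)) (card (S g))" for g
 define Z where "Z g = seld (s g) (lam g) (mu g) d (Occ (s g) (S g)) (N g div s g + 1)" for g
 have f: "finite (S g)" if "g \<in> G" for g using a[OF that] finite_subset by blast
 have cN: "card (S g) \<le> N g" if "g \<in> G" for g using a[OF that] card_mono[of "{..<N g}" "S g"] by auto
 have cp: "cap (lam g) (mu g) (N g)" "cap (lam g) (mu g) (card (S g))" "cap (lam g) (mu g) (N g div s g + 1 + d)" if "g \<in> G" for g
 proof -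
  have c: "cap (lam g) (mu g) (N g + Suc d)" using a[OF that] by blast
  show "cap (lam g) (mu g) (N g)" by(rule cap_mono[OF c]) simp
  show "cap (lam g) (mu g) (card (S g))" by(rule cap_mono[OF c]) (use cN[OF that] in simp)
  show "cap (lam g) (mu g) (N g div s g + 1 + d)" by(rule cap_mono[OF c]) simp
 qed
 have Xb: "tot (X g) < 2^lam g" "tot (Y g) < 2^lam g" if "g \<in> G" for g
  unfolding X_def Y_def using tot_rankd_less cp[OF that] parB[OF P that] by blast+
 have A1: "stored g (p g) (pack (lam g) (X g) (pack (lam g) (Y g) (Z g))) \<and> tot (X g) < 2^lam g \<and> lam g \<le> 2 * Wd g" if "g \<in> G" for g
  using a[OF that] Xb[OF that] parB(4)[OF P that] by(simp add: X_def Y_def Z_def)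
 note q = c2_pack[OF p pp(3) A1]
 have A2: "stored g (p g + lam g + tot (X g)) (pack (lam g) (Y g) (Z g)) \<and> tot (Y g) < 2^lam g \<and> lam g \<le> 2 * Wd g" if "g \<in> G" for g
  using A1[OF that] stored_pack(3) Xb[OF that] by blast
 note r = c2_pack[OF q(2) pp(3) A2]
 have sX: "stored g (p g + lam g) (X g)" "stored g (p g + lam g + tot (X g) + lam g) (Y g)"
  "stored g (p g + lam g + tot (X g) + lam g + tot (Y g)) (Z g)" if "g \<in> G" for g
  using A1[OF that] A2[OF that] stored_pack(2,3) by blast+
 have s0: "0 < s g" if "g \<in> G" for g using parB(8)[OF P that] .
 have lamW: "N g + lam g < 2^(2 * Wd g)" if "g \<in> G" for g
 proof -
  have "N g + lam g < 2^lam g" using cap_less cp(1)[OF that] by blast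
  also have "... \<le> 2^(2 * Wd g)" using parB(4)[OF P that] by(intro power_increasing) auto
  finally show ?thesis .
 qed
 have one: "c2 G (\<lambda>_. 1)" by(rule c2_const[OF pp(1)]) simp
 have i1: "c2 G (\<lambda>g. i g + 1)"
 proof(rule c2_add[OF i one])
  fix g assume g: "g \<in> G"
  show "i g + 1 < 2^(2 * Wd g)" using a[OF g] cN[OF g] lamW[OF g] parB(9)[OF P g] by linarith
 qed
 have rW: "c2 G (\<lambda>g. rank (Wset (s g) (S g)) (i g + 1))"
 proof(rule c_rank[OF P r(1) i1])
  fix g assume g: "g \<in> G"
  show "stored g (p g + lam g + tot (X g) + lam g) (rankd (s g) (lam g) (mu g) (Wset (s g) (S g)) (card (S g))) \<and>
     i g + 1 \<le> card (S g) \<and> cap (lam g) (mu g) (card (S g)) \<and> Wset (s g) (S g) \<subseteq> {..<card (S g)}"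
   using sX(2)[OF g] a[OF g] cp(2)[OF g] Wset_sub[OF f[OF g] s0[OF g]] by(auto simp: Y_def)
 qed
 note st = sel_step[OF f s0]
 have ia: "i g < card (S g)" if "g \<in> G" for g using a[OF that] by blast
 have rW1: "c2 G (\<lambda>g. rank (Wset (s g) (S g)) (i g + 1) - 1)"
  by(rule c2_sub[OF rW one]) (use st(5)[OF _ _ ia] in blast)
 define bi where "bi g = sel (Occ (s g) (S g)) (rank (Wset (s g) (S g)) (i g + 1) - 1)" for g
 have bi: "c2 G bi" unfolding bi_def
 proof(rule Suc.IH[OF P r(2) rW1])
  fix g assume g: "g \<in> G"
  have "Occ (s g) (S g) \<subseteq> {..<N g div s g + 1}"
   using Occ_sub a[OF g] by blast
  thus "stored g (p g + lam g + tot (X g) + lam g + tot (Y g)) (seld (s g) (lam g) (mu g) d (Occ (s g) (S g)) (N g div s g + 1)) \<and>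
     rank (Wset (s g) (S g)) (i g + 1) - 1 < card (Occ (s g) (S g)) \<and>
     cap (lam g) (mu g) (N g div s g + 1 + d) \<and> Occ (s g) (S g) \<subseteq> {..<N g div s g + 1}"
   using sX(3)[OF g] st(6)[OF g g ia[OF g]] cp(3)[OF g] by(simp add: Z_def)
 qed
 have biN: "bi g \<le> N g div s g" if g: "g \<in> G" for g
 proof -
  have "bi g \<in> Occ (s g) (S g)" using st(1)[OF g g ia[OF g]] by(simp add: bi_def)
  moreover have "Occ (s g) (S g) \<subseteq> {..<N g div s g + 1}" using Occ_sub a[OF g] by blast
  ultimately show ?thesis by auto
 qed
 have B: "stored g (p g + lam g) (rankd (s g) (lam g) (mu g) (S g) (N g)) \<and>
   bi g \<le> N g div s g \<and> cap (lam g) (mu g) (N g) \<and> S g \<subseteq> {..<N g}" if "g \<in> G" for g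
  using sX(1)[OF that] biN[OF that] cp(1)[OF that] a[OF that] by(simp add: X_def)
 note bl = c_block[OF P q(1) bi B]
 define j where "j g = i g - rank (S g) (bi g * s g)" for g
 have jb: "rank (S g) (bi g * s g) \<le> i g" "j g < s g" if g: "g \<in> G" for g
  using st(2,3)[OF g g ia[OF g]] by(auto simp: bi_def j_def)
 have j: "c1 G j" unfolding j_def
 proof(rule c1_of_c2[OF c2_sub[OF i bl(2)]])
  fix g assume g: "g \<in> G"
  show "rank (S g) (bi g * s g) \<le> i g" using jb(1)[OF g] .
  have "Wd g < 2^Wd g" by(rule less_exp)
  thus "i g - rank (S g) (bi g * s g) < 2^Wd g" using jb(2)[OF g] parB(10)[OF P g] unfolding j_def by linarith
 qed
 have three: "c1 G (\<lambda>_. 3)" by(rule c1_const[OF pp(6)]) simp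
 have rw: "c1 G (\<lambda>g. s g + 3 + j g)"
 proof(intro c1_add pp(2) three j)
  fix g assume g: "g \<in> G"
  have "s g + 3 + j g < 2 * s g + 3" using jb(2)[OF g] by simp
  also have "... \<le> Wd g" using parB[OF P g] by simp
  also have "Wd g < 2^Wd g" by(rule less_exp)
  finally show "s g + 3 + j g < 2^Wd g" .
  thus "s g + 3 < 2^Wd g" by simp
 qed
 have "c1 G (\<lambda>g. tabval (s g) (s g + 3 + j g) (bval (s g) (S g) (bi g)))"
 proof(rule c1_row[OF P rw bl(1)])
  fix g assume g: "g \<in> G"
  have "in_select (bval (s g) (S g) (bi g)) (j g) < s g" using st(7)[OF g g ia[OF g]] by(simp add: bi_def j_def)
  also have "s g < 2^s g" by(rule less_exp)
  finally show "s g + 3 + j g < 2 * s g + 3 \<and> bval (s g) (S g) (bi g) < 2^s g \<and>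
    tabval (s g) (s g + 3 + j g) (bval (s g) (S g) (bi g)) < 2^s g"
   using jb(2)[OF g] bval_less[of "s g" "S g" "bi g"] by(simp add: tabval_def)
 qed
 hence ins: "c1 G (\<lambda>g. in_select (bval (s g) (S g) (bi g)) (j g))"
  by(rule c1_cong) (simp add: tabval_def)
 have se: "sel (S g) (i g) = bi g * s g + in_select (bval (s g) (S g) (bi g)) (j g)" if g: "g \<in> G" for g
  using st(4)[OF g g ia[OF g]] by(simp add: bi_def j_def)
 have sN: "sel (S g) (i g) < 2^(2 * Wd g)" if g: "g \<in> G" for g
  using sel_props(1)[OF f[OF g] ia[OF g]] a[OF g] lamW[OF g] by fastforce
 have "c2 G (\<lambda>g. bi g * s g)"
 proof(rule c2_mul[OF bi pp(2)])
  fix g assume g: "g \<in> G"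
  show "s g < 2^(Wd g div 2)" using small_le_2W[OF P g, of "s g"] parB[OF P g] by auto
  show "bi g * s g < 2^(2 * Wd g)" using sN[OF g] se[OF g] by simp
 qed
 thus ?case
  by(rule c2_cong[OF c2_add[OF _ c2_of_c1[OF pp(1) ins]]]) (use sN se in auto)
qed

lemma c_rank_of_seld:
 assumes P: "par G" and p: "c2 G p" and i: "c2 G i"
  and a: "\<And>g. g \<in> G \<Longrightarrow> stored g (p g) (seld (s g) (lam g) (mu g) (Suc d) (S g) (N g)) \<and>
   i g \<le> N g \<and> cap (lam g) (mu g) (N g) \<and> S g \<subseteq> {..<N g}"
 shows "c2 G (\<lambda>g. rank (S g) (i g))"
proof -
 have t: "tot (rankd (s g) (lam g) (mu g) (S g) (N g)) < 2^lam g" if "g \<in> G" for g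
  using tot_rankd_less a[OF that] parB[OF P that] by blast
 have A: "stored g (p g) (pack (lam g) (rankd (s g) (lam g) (mu g) (S g) (N g)) (pack (lam g) (rankd (s g) (lam g) (mu g) (Wset (s g) (S g)) (card (S g)))
   (seld (s g) (lam g) (mu g) d (Occ (s g) (S g)) (N g div s g + 1)))) \<and>
   tot (rankd (s g) (lam g) (mu g) (S g) (N g)) < 2^lam g \<and> lam g \<le> 2 * Wd g" if "g \<in> G" for g
  using a[OF that] t[OF that] parB(4)[OF P that] by simp
 show ?thesis
 proof(rule c_rank[OF P c2_pack(1)[OF p parD(3)[OF P] A] i, where N = N])
  fix g assume g: "g \<in> G"
  show "stored g (p g + lam g) (rankd (s g) (lam g) (mu g) (S g) (N g)) \<and>
   i g \<le> N g \<and> cap (lam g) (mu g) (N g) \<and> S g \<subseteq> {..<N g}"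
   using stored_pack(2)[OF conjunct1[OF A[OF g]] t[OF g]] a[OF g] by blast
 qed
qed

text \<open>\<open>j\<close> does not depend on the query: the induction builds one expression of
  \<open>j\<close> nested conditionals with one table lookup each. \<open>G\<close> varies in the
  induction because the recursion takes place only where \<open>x\<close> has more than
  \<open>s\<close> bits.\<close>

lemma c_ceillog2:
 assumes "par G" "c1 G x" "\<And>g. g \<in> G \<Longrightarrow> x g \<le> 2^(s g * j)"
 shows "c1 G (\<lambda>g. ceillog2 (x g))"
 using assms
proof(induction j arbitrary: G x)
 case 0
 thus ?case
  by(intro c1_cong[OF c1_const[OF parD(6)[OF 0(1)], of 0]]) auto
next
 case (Suc j)
 note P = Suc.prems(1) and x = Suc.prems(2)
 note pp = parD[OF P]
 have two: "c1 G (\<lambda>_. 2)" "c1 G (\<lambda>_. 1)" by(rule c1_const[OF pp(6)], simp)+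
 have p2: "c1 G (\<lambda>g. 2^s g)" by(rule c1_pow2[OF pp(2) parB(10)[OF P]])
 let ?A = "{g \<in> G. x g < 2^s g}" and ?B = "{g \<in> G. \<not> x g < 2^s g}"
 have PA: "par ?A" "par ?B" using par_mono[OF P] by auto
 have rowi: "c1 ?A (\<lambda>g. s g + 2)"
 proof(rule c1_add[OF parD(2)[OF PA(1)] c1_mono[OF two(1)]])
  fix g assume g: "g \<in> ?A"
  hence "s g + 2 \<le> Wd g" using parB[OF P, of g] by simp
  also have "Wd g < 2^Wd g" by(rule less_exp)
  finally show "s g + 2 < 2^Wd g" .
 qed auto
 have "c1 ?A (\<lambda>g. tabval (s g) (s g + 2) (x g))"
 proof(rule c1_row[OF PA(1) rowi c1_mono[OF x]])
  fix g assume g: "g \<in> ?A"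
  hence "ceillog2 (x g) \<le> s g" using ceillog2_mono[of "x g" "2^s g"] by simp
  also have "s g < 2^s g" by(rule less_exp)
  finally show "s g + 2 < 2 * s g + 3 \<and> x g < 2^s g \<and> tabval (s g) (s g + 2) (x g) < 2^s g"
   using g by(simp add: tabval_def)
 qed auto
 hence A: "c1 ?A (\<lambda>g. ceillog2 (x g))" by(rule c1_cong) (simp add: tabval_def)
 define y where "y g = (x g - 1) div 2^s g + 1" for g
 have y: "c1 ?B y" unfolding y_def
 proof(intro c1_add c1_shr c1_sub)
  show "c1 ?B x" "c1 ?B (\<lambda>_. 1)" "c1 ?B s" "c1 ?B (\<lambda>_. 1)"
   using c1_mono[OF x] c1_mono[OF two(2)] c1_mono[OF pp(2)] by auto
  fix g assume g: "g \<in> ?B"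
  have "2^s g \<le> x g" "(1::nat) \<le> 2^s g" using g by auto
  thus "1 \<le> x g" by linarith
  have "(x g - 1) div 2^s g \<le> x g - 1" by(rule div_le_dividend)
  moreover have "x g < 2^Wd g" using c1_less[OF x, of g] g by simp
  ultimately show "(x g - 1) div 2^s g + 1 < 2^Wd g" using \<open>1 \<le> x g\<close> by linarith
 qed
 have ye: "y g = (x g + 2^s g - 1) div 2^s g" if "g \<in> ?B" for g
 proof -
  have "2^s g \<le> x g" "(1::nat) \<le> 2^s g" using that by auto
  hence "x g + 2^s g - 1 = (x g - 1) + 2^s g" by simp
  thus ?thesis by(simp add: y_def)
 qed
 have "c1 ?B (\<lambda>g. ceillog2 (y g))"
 proof(rule Suc.IH[OF PA(2) y])
  fix g assume g: "g \<in> ?B"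
  have "x g \<le> 2^(s g * j) * 2^s g" using Suc.prems(3)[of g] g by(simp add: power_add mult.commute)
  moreover have "0 < (2::nat)^(s g * j) * 2^s g" by simp
  ultimately have "x g - 1 < 2^(s g * j) * 2^s g" by linarith
  hence "(x g - 1) div 2^s g < 2^(s g * j)" by(simp add: div_less_iff_less_mult)
  thus "y g \<le> 2^(s g * j)" by(simp add: y_def)
 qed
 hence "c1 ?B (\<lambda>g. s g + ceillog2 (y g))"
 proof(rule c1_add[OF parD(2)[OF PA(2)]])
  fix g assume g: "g \<in> ?B"
  have e: "ceillog2 (x g) = s g + ceillog2 (y g)" using ceillog2_step[of "s g" "x g"] ye[OF g] g by simp
  have "ceillog2 (x g) \<le> Wd g" using ceillog2_mono[of "x g" "2^Wd g"] c1_less[OF x, of g] g by simp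
  also have "Wd g < 2^Wd g" by(rule less_exp)
  finally show "s g + ceillog2 (y g) < 2^Wd g" unfolding e .
 qed
 hence B: "c1 ?B (\<lambda>g. ceillog2 (x g))"
 proof(rule c1_cong)
  fix g assume g: "g \<in> ?B"
  thus "s g + ceillog2 (y g) = ceillog2 (x g)"
   using ceillog2_step[of "s g" "x g"] ye[OF g] by simp
 qed
 show ?case using c1_if[OF x p2 A B] by simp
qed

end

section \<open>Hashing\<close>

text \<open>If \<open>D\<close> equals both \<open>m * (n - 1 choose m) * a\<close> and
  \<open>m * (n choose m) * b\<close>, then \<open>a - b\<close> is the quotient of \<open>D\<close>
  by \<open>Suc m * (n choose Suc m)\<close>. With the central binomial coefficient this is the
  known route to an exponential lower bound for the least common multiple of 1 to n.\<close>

lemma binomial_dvd_Lcm: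
 assumes "1 \<le> m" "m \<le> n"
 shows "m * (n choose m) dvd Lcm {1..n}"
 using assms
proof(induction m arbitrary: n rule: dec_induct)
 case base
 thus ?case by(auto intro: dvd_Lcm)
next
 case (step m)
 define D where "D = Lcm {1..n}"
 have n: "1 \<le> m" "m < n" "m \<le> n - 1" using step by auto
 have "m * (n - 1 choose m) dvd Lcm {1..n - 1}" by(rule step.IH[OF n(3)])
 also have "Lcm {1..n - 1} dvd D" unfolding D_def by(rule Lcm_subset) auto
 finally obtain a where a: "D = m * (n - 1 choose m) * a" by(rule dvdE)
 have "m * (n choose m) dvd D" unfolding D_def using step.IH[of n] n by simp
 then obtain b where b: "D = m * (n choose m) * b" by(rule dvdE)
 have ab: "(n - m) * (n choose m) = n * (n - 1 choose m)" by(rule binomial_absorb_comp)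
 have S: "Suc m * (n choose Suc m) = (n - m) * (n choose m)"
  using binomial_absorption[of m n] binomial_absorb_comp[of n m] by(simp add: mult.commute)
 have pos: "0 < n choose m" "0 < (n - 1) choose m" using n by simp_all
 have "(n - m) * D = (n - m) * (n choose m) * (m * b)" unfolding b by(simp add: mult_ac)
 also have "... = n * (n - 1 choose m) * (m * b)" unfolding ab ..
 finally have "(n - m) * (m * (n - 1 choose m) * a) = n * (n - 1 choose m) * (m * b)" unfolding a .
 hence eq: "(n - m) * a = n * b" using pos n by(simp add: mult_ac)
 have "Suc m * (n choose Suc m) * (a - b) = (n - m) * (n choose m) * (a - b)" unfolding S ..
 also have "... = (n choose m) * ((n - m) * a - (n - m) * b)"
  unfolding diff_mult_distrib2[symmetric] by(simp only: mult_ac)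
 also have "(n - m) * a - (n - m) * b = m * b" unfolding eq using n by(simp add: diff_mult_distrib[symmetric])
 also have "(n choose m) * (m * b) = D" unfolding b by(simp add: mult_ac)
 finally show ?case unfolding D_def by(metis dvd_triv_left)
qed

lemma Lcm_lower: "2^(2 * m) \<le> 2 * Lcm {1..2 * m}"
proof(cases "m = 0")
 case False
 have "real (4^m) / (2 * real m) \<le> real (2 * m choose m)"
  using central_binomial_lower_bound[of m] False by simp
 hence "real (4^m) \<le> real (2 * (m * (2 * m choose m)))" using False by(simp add: field_simps)
 hence "4^m \<le> 2 * (m * (2 * m choose m))" by(simp only: of_nat_le_iff)
 also have "m * (2 * m choose m) \<le> Lcm {1..2 * m}"
  using binomial_dvd_Lcm[of m "2 * m"] False by(intro dvd_imp_le) (auto simp: Lcm_0_iff_nat intro: Nat.gr0I)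
 finally show ?thesis by(simp add: power_mult)
qed simp

text \<open>If every modulus up to \<open>2 * m\<close> failed, each would divide the product of all
  differences of keys, and so would their least common multiple, which is at least
  \<open>2^(2 * m - 1)\<close>; but the product is at most \<open>2^(L * (n * n))\<close>, and
  \<open>m\<close> is chosen just large enough for a contradiction.\<close>

lemma ex_injective_modulus:
 assumes X: "finite X" "card X \<le> n" "X \<subseteq> {..<2^L}"
 shows "\<exists>p. 0 < p \<and> p \<le> 2 * (L * (n * n)) + 4 \<and> inj_on (\<lambda>x. x mod p) X"
proof(rule ccontr)
 assume neg: "\<not> ?thesis"
 define m where "m = L * (n * n) + 2"
 define PR where "PR = {(x, y) \<in> X \<times> X. x < y}"
 define P where "P = (\<Prod>(x, y)\<in>PR. y - x)"
 have f: "finite PR" unfolding PR_def using X by(auto intro: finite_subset[of _ "X \<times> X"])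
 have "p dvd P" if "p \<in> {1..2 * m}" for p
 proof -
  have "0 < p" "p \<le> 2 * (L * (n * n)) + 4" using that unfolding m_def by simp_all
  hence "\<not> inj_on (\<lambda>x. x mod p) X" using neg by blast
  then obtain x y where xy: "x \<in> X" "y \<in> X" "x \<noteq> y" "x mod p = y mod p" by(auto simp: inj_on_def)
  define x' where "x' = min x y"
  define y' where "y' = max x y"
  have "(x', y') \<in> PR" "x' mod p = y' mod p" using xy by(auto simp: PR_def x'_def y'_def min_def max_def)
  hence "p dvd y' - x'" using mod_eq_dvd_iff_nat[of x' y' p] by(auto simp: PR_def)
  moreover have "y' - x' dvd P"
   unfolding P_def using dvd_prodI[OF f \<open>(x', y') \<in> PR\<close>, of "\<lambda>(x, y). y - x"] by simp
  ultimately show ?thesis by(rule dvd_trans)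
 qed
 hence "Lcm {1..2 * m} dvd P" by(auto intro: Lcm_least)
 moreover have "0 < P" unfolding P_def by(intro prod_pos) (auto simp: PR_def)
 ultimately have "Lcm {1..2 * m} \<le> P" by(rule dvd_imp_le)
 also have "P \<le> (\<Prod>(x, y)\<in>PR. 2^L)"
  unfolding P_def using X(3) by(intro prod_mono) (auto simp: PR_def intro: less_imp_le less_le_trans[of _ "2^L"])
 also have "... = (2^L)^card PR" by(simp add: case_prod_beta)
 also have "... = 2^(L * card PR)" by(simp add: power_mult)
 also have "... \<le> 2^(L * (n * n))"
 proof -
  have "card PR \<le> card (X \<times> X)" unfolding PR_def by(intro card_mono) (use X in auto)
  also have "... \<le> n * n" using X(2) by(simp add: card_cartesian_product mult_le_mono)
  finally show ?thesis by(intro power_increasing mult_le_mono) auto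
 qed
 finally have "Lcm {1..2 * m} \<le> 2^(L * (n * n))" .
 hence "2^(2 * m) \<le> 2 * (2::nat)^(L * (n * n))" using Lcm_lower[of m] by linarith
 hence "2^(2 * m) \<le> (2::nat)^(Suc (L * (n * n)))" by simp
 thus False by(simp only: power_increasing_iff) (simp add: m_def)
qed

section \<open>Multiply-shift hashing with odd multipliers\<close>

definition hsh :: "nat \<Rightarrow> nat \<Rightarrow> nat \<Rightarrow> nat \<Rightarrow> nat" where
 "hsh Q l a x = (a * x mod 2^Q) div 2^(Q - l)"

lemma hsh_less: "l \<le> Q \<Longrightarrow> hsh Q l a x < 2^l"
 unfolding hsh_def by(simp add: div_less_iff_less_mult flip: power_add)

definition odds :: "nat \<Rightarrow> nat set" where
 "odds Q = {a. a < 2^Q \<and> odd a}"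

lemma odds_finite [simp]: "finite (odds Q)"
 by(simp add: odds_def)

lemma card_odds: "0 < Q \<Longrightarrow> card (odds Q) = 2^(Q - 1)"
proof -
 assume "0 < Q"
 hence e: "(2::nat)^Q = 2 * 2^(Q - 1)" by(metis power_eq_if not_gr_zero)
 have "odds Q = (\<lambda>i. 2 * i + 1) ` {..<2^(Q - 1)}"
  unfolding odds_def e by(auto elim!: oddE)
 thus ?thesis by(simp add: card_image inj_on_def)
qed

text \<open>Multiplication by the odd \<open>c\<close> permutes the odd residues. The hash value
  consists of the \<open>l\<close> bits of \<open>a * c\<close> that follow its \<open>m\<close>
  lowest bits; this leaves \<open>t\<close> bits above and \<open>m - 1\<close> bits below, the very
  lowest one being fixed by oddness. \<open>\<phi>\<close> collects these free bits.\<close>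

lemma hsh_count:
 assumes "odd c" "t + l < Q"
 shows "card {a \<in> odds Q. hsh Q l a (2^t * c) = dl} \<le> 2^(Q - 1 - l)"
proof -
 define m where "m = Q - t - l"
 have Q: "Q = t + l + m" "0 < m" using assms(2) by(auto simp: m_def)
 define A where "A = {a \<in> odds Q. hsh Q l a (2^t * c) = dl}"
 define \<phi> where "\<phi> a = (let a' = a * c mod 2^Q in (a' div 2^(m + l), a' mod 2^m div 2))" for a
 have inj1: "inj_on (\<lambda>a. a * c mod 2^Q) {..<2^Q}"
 proof(rule inj_onI)
  fix a b :: nat assume ab: "a \<in> {..<2^Q}" "b \<in> {..<2^Q}" "a * c mod 2^Q = b * c mod 2^Q"
  have "coprime (2^Q) c" using assms(1) by(simp add: coprime_left_2_iff_odd)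
  have *: "x = y" if "x \<le> y" "x * c mod 2^Q = y * c mod 2^Q" "y < 2^Q" for x y :: nat
  proof -
   have "2^Q dvd y * c - x * c"
    using that(2) mod_eq_dvd_iff_nat[of "x * c" "y * c" "2^Q"] that(1) by simp
   hence "2^Q dvd (y - x) * c" by(simp add: diff_mult_distrib)
   hence "2^Q dvd y - x" using coprime_dvd_mult_left_iff[OF \<open>coprime (2^Q) c\<close>] by blast
   moreover have "y - x < 2^Q" using that by simp
   ultimately have "y - x = 0" using nat_dvd_not_less by blast
   thus ?thesis using that by simp
  qed
  show "a = b" using *[of a b] *[of b a] ab by(metis lessThan_iff nat_le_linear)
 qed
 have key: "(a * c mod 2^Q) mod 2^(m + l) div 2^m = hsh Q l a (2^t * c)" for a
 proof -
  have "a * (2^t * c) mod 2^Q = 2^t * (a * c mod 2^(m + l))"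
  proof -
   have "a * (2^t * c) mod 2^Q = (2^t * (a * c)) mod (2^t * 2^(m + l))"
    by(simp add: Q(1) power_add mult_ac)
   thus ?thesis by(simp only: mult_mod_right)
  qed
  moreover have "(a * c mod 2^Q) mod 2^(m + l) = a * c mod 2^(m + l)"
   by(rule mod_mod_cancel) (simp add: Q(1) le_imp_power_dvd)
  moreover have "(2::nat)^(Q - l) = 2^t * 2^m" by(simp add: Q(1) power_add)
  ultimately show ?thesis by(simp add: hsh_def)
 qed
 have oddm: "odd (a * c mod 2^Q)" if "a \<in> odds Q" for a
  using that assms(1) Q by(simp add: odds_def dvd_mod_iff)
 have inj2: "a1 = a2" if "odd a1" "odd a2" "a1 div 2^(m + l) = a2 div 2^(m + l)"
   "a1 mod 2^(m + l) div 2^m = a2 mod 2^(m + l) div 2^m" "a1 mod 2^m div 2 = a2 mod 2^m div 2" for a1 a2 :: nat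
 proof -
  have par: "a mod 2^m = 2 * (a mod 2^m div 2) + 1" if "odd a" for a :: nat
  proof -
   have "odd (a mod 2^m)" using that Q(2) by(simp add: dvd_mod_iff)
   thus ?thesis by(metis odd_two_times_div_two_succ)
  qed
  have "a1 mod 2^m = a2 mod 2^m" using par[OF that(1)] par[OF that(2)] that(5) by simp
  moreover have "a mod 2^(m + l) mod 2^m = a mod 2^m" for a :: nat
   by(rule mod_mod_cancel) (simp add: le_imp_power_dvd)
  ultimately have "a1 mod 2^(m + l) = a2 mod 2^(m + l)" using that(4) by(metis div_mult_mod_eq)
  thus ?thesis using that(3) by(metis div_mult_mod_eq)
 qed
 have "inj_on \<phi> A"
 proof(rule inj_onI)
  fix a b assume ab: "a \<in> A" "b \<in> A" "\<phi> a = \<phi> b"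
  have "a * c mod 2^Q = b * c mod 2^Q"
  proof(rule inj2)
   show "odd (a * c mod 2^Q)" "odd (b * c mod 2^Q)" using ab oddm by(simp_all add: A_def)
   show "a * c mod 2^Q div 2^(m + l) = b * c mod 2^Q div 2^(m + l)"
    "a * c mod 2^Q mod 2^m div 2 = b * c mod 2^Q mod 2^m div 2"
    using ab(3) by(simp_all only: \<phi>_def Let_def prod.inject)
   show "a * c mod 2^Q mod 2^(m + l) div 2^m = b * c mod 2^Q mod 2^(m + l) div 2^m"
    unfolding key using ab(1,2) by(simp add: A_def)
  qed
  moreover have "a \<in> {..<2^Q}" "b \<in> {..<2^Q}" using ab by(auto simp: A_def odds_def)
  ultimately show "a = b" by(rule inj_onD[OF inj1])
 qed
 moreover have "\<phi> ` A \<subseteq> {..<2^t} \<times> {..<2^(m - 1)}"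
 proof -
  have "a * c mod 2^Q div 2^(m + l) < 2^t" for a
  proof -
   have "a * c mod 2^Q < 2^t * 2^(m + l)" by(simp add: Q(1) add_ac flip: power_add)
   thus ?thesis by(simp only: div_less_iff_less_mult zero_less_power zero_less_numeral)
  qed
  moreover have "a' mod 2^m div 2 < 2^(m - 1)" for a' :: nat
  proof -
   have "(2::nat)^m = 2^(m - 1) * 2" using Q(2) by(metis power_eq_if mult.commute not_gr_zero)
   thus ?thesis by(simp add: div_less_iff_less_mult)
  qed
  ultimately show ?thesis by(auto simp: \<phi>_def Let_def)
 qed
 ultimately have "card A \<le> card ({..<2^t} \<times> {..<2^(m - 1)} :: (nat \<times> nat) set)"
  by(intro card_inj_on_le) auto
 also have "... = 2^(Q - 1 - l)" using Q by(simp flip: power_add)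
 finally show ?thesis unfolding A_def .
qed

text \<open>The high bits of a sum are the sum of the high bits up to a carry out of the low part,
  and there is no carry if the low bits of \<open>a * d\<close> vanish.\<close>

lemma hsh_carry:
 assumes "l \<le> Q"
 shows "\<exists>c\<in>{0, 1}. hsh Q l a (y + d) = (hsh Q l a y + hsh Q l a d + c) mod 2^l \<and>
  (2^(Q - l) dvd a * d mod 2^Q \<longrightarrow> c = 0)"
proof -
 define m where "m = (2::nat)^(Q - l)"
 define A where "A = a * y mod 2^Q"
 define D where "D = a * d mod 2^Q"
 have M: "2^Q = m * 2^l" using assms by(simp add: m_def flip: power_add)
 have m: "0 < m" by(simp add: m_def)
 define c where "c = (A mod m + D mod m) div m"
 have "a * (y + d) mod 2^Q = (A + D) mod 2^Q" by(simp add: A_def D_def add_mult_distrib2 mod_add_eq)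
 hence "hsh Q l a (y + d) = ((A + D) mod (m * 2^l)) div m" by(simp add: hsh_def M m_def)
 also have "... = (A + D) div m mod 2^l" using m by(simp add: mod_mult2_eq)
 also have "(A + D) div m = A div m + D div m + c" unfolding c_def by(rule div_add1_eq)
 finally have 1: "hsh Q l a (y + d) = (hsh Q l a y + hsh Q l a d + c) mod 2^l"
  by(simp add: hsh_def A_def D_def m_def)
 have "A mod m < m" "D mod m < m" using m by auto
 hence "A mod m + D mod m < 2 * m" by linarith
 hence "c < 2" unfolding c_def using m by(simp add: div_less_iff_less_mult)
 hence "c \<in> {0, 1}" by auto
 moreover have "c = 0" if "m dvd D" using that m by(simp add: c_def)
 ultimately show ?thesis using 1 by(auto simp: m_def D_def)
qed

text \<open>Applied with the carries 0 and 1: a coincidence leaves two possible hash values for the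
  difference of two keys, whatever the hash value \<open>h\<close> of one of them is.\<close>

lemma two_values:
 fixes u u' h D R :: nat
 assumes "0 < R"
 shows "\<exists>dl. \<forall>h D. D < R \<longrightarrow> (u + (h + D + c)) mod R = (u' + h) mod R \<longrightarrow> D = dl"
proof(intro exI[of _ "nat ((int u' - int u - int c) mod int R)"] allI impI)
 fix h D assume D: "D < R" and e: "(u + (h + D + c)) mod R = (u' + h) mod R"
 hence "int (u + (h + D + c)) mod int R = int (u' + h) mod int R" by(simp only: zmod_int[symmetric])
 hence "(int (u + (h + D + c)) - int (u + h + c)) mod int R = (int (u' + h) - int (u + h + c)) mod int R"
  by(metis mod_diff_left_eq)
 hence "int D mod int R = (int u' - int u - int c) mod int R" by(simp add: algebra_simps)
 hence "int D = (int u' - int u - int c) mod int R" using D by simp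
 thus "D = nat ((int u' - int u - int c) mod int R)" by simp
qed

lemma odd_part: "0 < d \<Longrightarrow> \<exists>t c. d = 2^t * c \<and> odd (c::nat)"
proof(induction d rule: less_induct)
 case (less d)
 show ?case
 proof(cases "odd d")
  case True thus ?thesis by(intro exI[of _ 0] exI[of _ d]) auto
 next
  case False
  then obtain e where e: "d = 2 * e" by(auto elim: evenE)
  hence "e < d" "0 < e" using less.prems by auto
  from less.IH[OF this] obtain t c where "e = 2^t * c" "odd c" by blast
  thus ?thesis using e by(intro exI[of _ "Suc t"] exI[of _ c]) auto
 qed
qed

text \<open>Each of the two values that the hash of the difference may take accounts for at most
  \<open>2^(Q - 1 - l)\<close> multipliers.\<close>

lemma hsh_delta_count_odd:
 assumes x: "x = y + 2^t * c" and c: "odd c" and t: "t + l < Q"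
 shows "card {a \<in> odds Q. (u + hsh Q l a x) mod 2^l = (u' + hsh Q l a y) mod 2^l} \<le> 2^(Q - l)"
proof -
 let ?D = "{a \<in> odds Q. hsh Q l a d = dl}"
 define d where "d = 2^t * c"
 obtain dl0 where dl0: "\<forall>h D. D < 2^l \<longrightarrow> (u + (h + D + 0)) mod 2^l = (u' + h) mod 2^l \<longrightarrow> D = dl0"
  using two_values[of "2^l" u 0 u'] by auto
 obtain dl1 where dl1: "\<forall>h D. D < 2^l \<longrightarrow> (u + (h + D + 1)) mod 2^l = (u' + h) mod 2^l \<longrightarrow> D = dl1"
  using two_values[of "2^l" u 1 u'] by auto
 have lQ: "l \<le> Q" using t by simp
 have "{a \<in> odds Q. (u + hsh Q l a x) mod 2^l = (u' + hsh Q l a y) mod 2^l} \<subseteq>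
  {a \<in> odds Q. hsh Q l a d = dl0} \<union> {a \<in> odds Q. hsh Q l a d = dl1}"
 proof
  fix a assume a: "a \<in> {a \<in> odds Q. (u + hsh Q l a x) mod 2^l = (u' + hsh Q l a y) mod 2^l}"
  obtain e where e: "e \<in> {0, 1}" "hsh Q l a x = (hsh Q l a y + hsh Q l a d + e) mod 2^l"
   using hsh_carry[OF lQ, of a y d] unfolding x d_def by blast
  have "(u + (hsh Q l a y + hsh Q l a d + e)) mod 2^l = (u' + hsh Q l a y) mod 2^l"
  proof -
   have "(u + hsh Q l a x) mod 2^l = (u' + hsh Q l a y) mod 2^l" using a by simp
   thus ?thesis unfolding e(2) by(simp add: mod_add_right_eq)
  qed
  thus "a \<in> {a \<in> odds Q. hsh Q l a d = dl0} \<union> {a \<in> odds Q. hsh Q l a d = dl1}"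
   using a e(1) dl0[rule_format, OF hsh_less[OF lQ]] dl1[rule_format, OF hsh_less[OF lQ]] by auto
 qed
 hence "card {a \<in> odds Q. (u + hsh Q l a x) mod 2^l = (u' + hsh Q l a y) mod 2^l} \<le>
  card ({a \<in> odds Q. hsh Q l a d = dl0} \<union> {a \<in> odds Q. hsh Q l a d = dl1})"
  by(intro card_mono) auto
 also have "... \<le> card {a \<in> odds Q. hsh Q l a d = dl0} + card {a \<in> odds Q. hsh Q l a d = dl1}" by(rule card_Un_le)
 also have "... \<le> 2^(Q - 1 - l) + 2^(Q - 1 - l)"
  using hsh_count[OF c t] unfolding d_def by(intro add_mono) auto
 also have "... = 2^(Q - l)"
 proof -
  have "Q - l = Suc (Q - 1 - l)" using t by simp
  thus ?thesis by simp
 qed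
 finally show ?thesis .
qed

text \<open>The displacements \<open>u\<close> and \<open>u'\<close> stand for the upper label bits
  of two elements. Keys of at most \<open>Q - l\<close> bits have a difference with fewer than
  \<open>Q - l\<close> trailing zeros, so the bits read by the hash function lie above its lowest
  one.\<close>

lemma hsh_delta_count:
 assumes "x \<noteq> y" "x < 2^T" "y < 2^T" "T + l \<le> Q"
 shows "card {a \<in> odds Q. (u + hsh Q l a x) mod 2^l = (u' + hsh Q l a y) mod 2^l} \<le> 2^(Q - l)"
proof -
 have main: "card {a \<in> odds Q. (u + hsh Q l a x) mod 2^l = (u' + hsh Q l a y) mod 2^l} \<le> 2^(Q - l)"
  if xy: "y < x" "x < 2^T" for x y u u'
 proof -
  obtain t c where tc: "x - y = 2^t * c" "odd c" using odd_part[of "x - y"] xy by auto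
  have "2^t \<le> x - y" using tc by(cases c) auto
  hence "(2::nat)^t < 2^T" using xy by linarith
  hence "t < T" by simp
  thus ?thesis using xy tc assms(4) by(intro hsh_delta_count_odd[of _ _ t c]) auto
 qed
 show ?thesis
 proof(cases "y < x")
  case False
  hence "x < y" using assms by simp
  from main[OF this assms(3), of u' u] show ?thesis by(simp add: eq_commute)
 qed (use main assms in auto)
qed

text \<open>Without displacements the keys may use all \<open>Q\<close> bits: if the difference
  \<open>d\<close> is divisible by \<open>2^(Q - l)\<close>, there is no carry, and a collision
  would make \<open>a * d\<close> vanish modulo \<open>2^Q\<close>, which is impossible for odd
  \<open>a\<close>.\<close>

lemma hsh_coll_count:
 assumes "x \<noteq> y" "x < 2^Q" "y < 2^Q" "l \<le> Q"
 shows "card {a \<in> odds Q. hsh Q l a x = hsh Q l a y} \<le> 2^(Q - l)"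
proof -
 have main: "card {a \<in> odds Q. hsh Q l a x = hsh Q l a y} \<le> 2^(Q - l)" if xy: "y < x" "x < 2^Q" for x y
 proof(cases "2^(Q - l) dvd x - y")
  case True
  have False if a: "odd a" "hsh Q l a x = hsh Q l a y" for a
  proof -
   define d where "d = x - y"
   have d: "x = y + d" "0 < d" "d < 2^Q" using xy by(auto simp: d_def)
   have dv: "2^(Q - l) dvd a * d mod 2^Q"
    using True by(intro dvd_mod) (auto simp: d_def le_imp_power_dvd)
   obtain c where c: "hsh Q l a x = (hsh Q l a y + hsh Q l a d + c) mod 2^l" "c = 0"
    using hsh_carry[OF assms(4), of a y d] d(1) dv by auto
   obtain dl where dl: "\<And>h D::nat. D < 2^l \<Longrightarrow> (0 + (h + D + 0)) mod 2^l = (0 + h) mod 2^l \<Longrightarrow> D = dl"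
    using two_values[of "2^l" 0 0 0] by auto
   have "hsh Q l a d = dl"
    by(rule dl[where h = "hsh Q l a y"])
     (use c a hsh_less[OF assms(4), of a y] hsh_less[OF assms(4), of a d] in simp_all)
   moreover have "0 = dl" by(rule dl[where h = 0]) auto
   ultimately have "hsh Q l a d = 0" by simp
   hence "a * d mod 2^Q < 2^(Q - l)" by(simp add: hsh_def div_eq_0_iff)
   hence "a * d mod 2^Q = 0" using dv by(meson dvd_imp_le gr0I not_less)
   hence "2^Q dvd a * d" by auto
   moreover have co: "coprime (2^Q) a" using a(1) by(simp add: coprime_left_2_iff_odd)
   ultimately have "2^Q dvd d" using coprime_dvd_mult_right_iff[OF co] by blast
   thus False using d by(meson dvd_imp_le not_less)
  qed
  hence "{a \<in> odds Q. hsh Q l a x = hsh Q l a y} = {}" by(auto simp: odds_def)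
  thus ?thesis by(simp only: card.empty zero_le)
 next
  case False
  obtain t c where tc: "x - y = 2^t * c" "odd c" using odd_part[of "x - y"] xy by auto
  have tT: "t + l < Q"
  proof(rule ccontr)
   assume "\<not> t + l < Q"
   hence "(2::nat)^(Q - l) dvd 2^t" by(intro le_imp_power_dvd) simp
   thus False using False unfolding tc(1) by simp
  qed
  have "card {a \<in> odds Q. (0 + hsh Q l a x) mod 2^l = (0 + hsh Q l a y) mod 2^l} \<le> 2^(Q - l)"
   using xy tc tT by(intro hsh_delta_count_odd[of _ _ t c]) auto
  thus ?thesis using hsh_less[OF assms(4)] by simp
 qed
 show ?thesis
 proof(cases "y < x")
  case False
  hence "x < y" using assms by simp
  from main[OF this assms(3)] show ?thesis by(simp add: eq_commute)
 qed (use main assms in auto)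
qed

text \<open>The first moment method by double counting: if every element of \<open>Os\<close>
  exceeded the expected number of bad items, so would their average.\<close>

lemma averaging:
 fixes q :: "'p \<Rightarrow> real"
 assumes "finite Os" "Os \<noteq> {}" "finite P"
  and "\<And>\<pi>. \<pi> \<in> P \<Longrightarrow> real (card {a \<in> Os. bad a \<pi>}) \<le> q \<pi> * real (card Os)"
 shows "\<exists>a\<in>Os. real (card {\<pi> \<in> P. bad a \<pi>}) \<le> (\<Sum>\<pi>\<in>P. q \<pi>)"
proof(rule ccontr)
 assume "\<not> ?thesis"
 hence lt: "(\<Sum>\<pi>\<in>P. q \<pi>) < real (card {\<pi> \<in> P. bad a \<pi>})" if "a \<in> Os" for a using that by force
 have sw: "(\<Sum>a\<in>Os. real (card {\<pi> \<in> P. bad a \<pi>})) = (\<Sum>\<pi>\<in>P. real (card {a \<in> Os. bad a \<pi>}))"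
 proof -
  have "(\<Sum>a\<in>Os. card {\<pi> \<in> P. bad a \<pi>}) = (\<Sum>\<pi>\<in>P. card {a \<in> Os. bad a \<pi>})"
   using sum_multicount_gen[of Os P bad "\<lambda>\<pi>. card {a \<in> Os. bad a \<pi>}"] assms by simp
  thus ?thesis by(simp flip: of_nat_sum)
 qed
 have "(\<Sum>a\<in>Os. \<Sum>\<pi>\<in>P. q \<pi>) < (\<Sum>a\<in>Os. real (card {\<pi> \<in> P. bad a \<pi>}))"
  using assms lt by(intro sum_strict_mono) auto
 also have "... \<le> (\<Sum>\<pi>\<in>P. q \<pi> * real (card Os))" unfolding sw by(intro sum_mono assms)
 also have "... = (\<Sum>a\<in>Os. \<Sum>\<pi>\<in>P. q \<pi>)" by(simp add: sum_distrib_right mult.commute)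
 finally show False by simp
qed

text \<open>One seed per table size, shared by all buckets. The sizes are treated in increasing
  order: some seed for the current size suits all but a quarter of the buckets assigned to it, and
  the rest are promoted to the next size. A promotion doubles the room, so the fraction 1/4 keeps
  the sum within a factor of two. At size \<open>2^Q\<close> the seed 1 is the identity on the
  keys.\<close>

lemma bucket_seeds:
 fixes K :: "'b \<Rightarrow> nat set"
 assumes "0 < Q" "finite Bk" "\<And>b. b \<in> Bk \<Longrightarrow> finite (K b) \<and> K b \<subseteq> {..<2^Q} \<and> Q - d \<le> sg b \<and> sg b \<le> Q \<and>
   (sg b = Q \<or> 8 * (card (K b))\<^sup>2 \<le> 2^sg b)"
 shows "\<exists>a l. (\<forall>j. a j \<in> odds Q) \<and> (\<forall>b\<in>Bk. sg b \<le> l b \<and> l b \<le> Q \<and> inj_on (hsh Q (l b) (a (l b))) (K b)) \<and>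
  (\<Sum>b\<in>Bk. (2::nat)^l b) \<le> 2 * (\<Sum>b\<in>Bk. 2^sg b)"
 using assms(2,3)
proof(induction d arbitrary: Bk sg)
 case 0
 have o: "1 \<in> odds Q" using assms(1) one_less_power[of "2::nat" Q] by(simp add: odds_def)
 have "inj_on (hsh Q Q 1) (K b)" if "b \<in> Bk" for b
  using 0(2)[OF that] by(intro inj_onI) (auto simp: hsh_def subset_iff)
 moreover have "sg b = Q" if "b \<in> Bk" for b using 0(2)[OF that] by simp
 ultimately show ?case
  using o by(rule_tac exI[of _ "\<lambda>_. 1"], rule_tac exI[of _ "\<lambda>_. Q"]) simp
next
 case (Suc d)
 show ?case
 proof(cases "Suc d \<le> Q")
  case False
  hence "Q - d = Q - Suc d" by simp
  thus ?thesis using Suc.IH[of Bk sg] Suc.prems by simp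
 next
  case True
  define l0 where "l0 = Q - Suc d"
  have l0: "l0 < Q" "Q - d = Suc l0" using True by(auto simp: l0_def)
  define B0 where "B0 = {b \<in> Bk. sg b = l0}"
  define bad where "bad a b = (\<not> inj_on (hsh Q l0 a) (K b))" for a b
  have fB0: "finite B0" using Suc.prems by(simp add: B0_def)
  have "1 \<in> odds Q" using assms(1) one_less_power[of "2::nat" Q] by(simp add: odds_def)
  hence ne: "odds Q \<noteq> {}" by blast
  have cO: "real (card (odds Q)) = 2^Q / 2"
  proof -
   have "(2::real)^Q = 2 * 2^(Q - 1)" using assms(1) by(metis power_eq_if not_gr_zero)
   thus ?thesis using card_odds[OF assms(1)] by simp
  qed
  \<comment> \<open>A bucket has at most \<open>(card (K b))^2\<close> ordered pairs of keys, each
    colliding for at most \<open>2^(Q - l0)\<close> of the \<open>2^(Q - 1)\<close> seeds; the room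
    of eight times that square turns this into the fraction 1/4.\<close>
  have "\<exists>a\<in>odds Q. real (card {b \<in> B0. bad a b}) \<le> (\<Sum>b\<in>B0. 1 / 4)"
  proof(rule averaging[OF odds_finite ne fB0])
   fix b assume b: "b \<in> B0"
   have Kb: "finite (K b)" "K b \<subseteq> {..<2^Q}" "8 * (card (K b))\<^sup>2 \<le> 2^l0"
    using Suc.prems(2)[of b] b l0 by(auto simp: B0_def)
   define PR where "PR = {(x, y) \<in> K b \<times> K b. x \<noteq> y}"
   have fP: "finite PR" using Kb by(auto simp: PR_def intro: finite_subset[of _ "K b \<times> K b"])
   have "{a \<in> odds Q. bad a b} \<subseteq> (\<Union>(x, y)\<in>PR. {a \<in> odds Q. hsh Q l0 a x = hsh Q l0 a y})"
    by(auto simp: bad_def inj_on_def PR_def)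
   hence "card {a \<in> odds Q. bad a b} \<le> card (\<Union>(x, y)\<in>PR. {a \<in> odds Q. hsh Q l0 a x = hsh Q l0 a y})"
    using fP by(intro card_mono) auto
   also have "... \<le> (\<Sum>(x, y)\<in>PR. card {a \<in> odds Q. hsh Q l0 a x = hsh Q l0 a y})"
    using card_UN_le[OF fP, of "\<lambda>(x, y). {a \<in> odds Q. hsh Q l0 a x = hsh Q l0 a y}"] by(simp add: case_prod_beta)
   also have "... \<le> (\<Sum>\<pi>\<in>PR. 2^(Q - l0))"
    using Kb l0 by(intro sum_mono) (auto simp: PR_def subset_iff intro!: hsh_coll_count)
   also have "... = card PR * 2^(Q - l0)" by simp
   also have "card PR \<le> (card (K b))\<^sup>2"
   proof -
    have "card PR \<le> card (K b \<times> K b)" using Kb by(intro card_mono) (auto simp: PR_def)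
    thus ?thesis by(simp add: card_cartesian_product power2_eq_square)
   qed
   finally have "card {a \<in> odds Q. bad a b} \<le> (card (K b))\<^sup>2 * 2^(Q - l0)" by simp
   hence "8 * card {a \<in> odds Q. bad a b} \<le> 8 * (card (K b))\<^sup>2 * 2^(Q - l0)" by simp
   also have "... \<le> 2^l0 * 2^(Q - l0)" using Kb(3) by(intro mult_le_mono1)
   also have "... = 2^Q" using l0 by(simp flip: power_add)
   finally have "8 * card {a \<in> odds Q. bad a b} \<le> 2^Q" .
   hence "real (8 * card {a \<in> odds Q. bad a b}) \<le> real (2^Q)" by(rule of_nat_mono)
   thus "real (card {a \<in> odds Q. bad a b}) \<le> 1 / 4 * real (card (odds Q))" unfolding cO by simp
  qed
  then obtain a0 where a0: "a0 \<in> odds Q" "real (card {b \<in> B0. bad a0 b}) \<le> real (card B0) / 4" by auto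
  define F where "F = {b \<in> B0. bad a0 b}"
  have F: "F \<subseteq> B0" "4 * card F \<le> card B0" using a0(2) by(auto simp: F_def)
  have fF: "finite F" using F(1) fB0 finite_subset by blast
  define B' where "B' = (Bk - B0) \<union> F"
  define sg' where "sg' b = (if b \<in> F then Suc l0 else sg b)" for b
  have fB': "finite B'" using Suc.prems(1) fF by(simp add: B'_def)
  have "finite (K b) \<and> K b \<subseteq> {..<2^Q} \<and> Q - d \<le> sg' b \<and> sg' b \<le> Q \<and>
    (sg' b = Q \<or> 8 * (card (K b))\<^sup>2 \<le> 2^sg' b)" if b: "b \<in> B'" for b
  proof(cases "b \<in> F")
   case True
   hence "b \<in> Bk" "sg b = l0" using F by(auto simp: B0_def)
   thus ?thesis using Suc.prems(2)[of b] l0 True by(auto simp: sg'_def)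
  next
   case False
   hence "b \<in> Bk" "sg b \<noteq> l0" using b by(auto simp: B'_def B0_def)
   thus ?thesis using Suc.prems(2)[of b] l0 False by(auto simp: sg'_def l0_def)
  qed
  from Suc.IH[OF fB' this] obtain a' l' where al: "\<forall>j. a' j \<in> odds Q"
   "\<forall>b\<in>B'. sg' b \<le> l' b \<and> l' b \<le> Q \<and> inj_on (hsh Q (l' b) (a' (l' b))) (K b)"
   "(\<Sum>b\<in>B'. (2::nat)^l' b) \<le> 2 * (\<Sum>b\<in>B'. 2^sg' b)" by blast
  define a where "a = a'(l0 := a0)"
  define l where "l b = (if b \<in> B0 - F then l0 else l' b)" for b
  have sp: "Bk = (B0 - F) \<union> B'" "(B0 - F) \<inter> B' = {}" using F by(auto simp: B'_def B0_def)
  have sl: "Suc l0 \<le> sg' b" if "b \<in> B'" for b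
   using that Suc.prems(2)[of b] l0 unfolding sg'_def B'_def B0_def l0_def by(auto simp: Suc_le_eq le_less)
  have 1: "\<forall>j. a j \<in> odds Q" using al a0 by(simp add: a_def)
  have 2: "sg b \<le> l b \<and> l b \<le> Q \<and> inj_on (hsh Q (l b) (a (l b))) (K b)" if b: "b \<in> Bk" for b
  proof(cases "b \<in> B0 - F")
   case True
   hence "sg b = l0" "inj_on (hsh Q l0 a0) (K b)" by(auto simp: B0_def F_def bad_def)
   thus ?thesis using True l0 by(simp add: l_def a_def)
  next
   case False
   hence b': "b \<in> B'" using b sp by blast
   have "sg b \<le> sg' b" using b' F by(auto simp: sg'_def B0_def)
   moreover have "Suc l0 \<le> l' b" using al(2) b' sl[OF b'] by fastforce
   moreover have "l b = l' b" by(simp only: l_def False if_False)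
   ultimately show ?thesis using al(2) b' by(fastforce simp: a_def)
  qed
  have dj: "(\<Sum>b\<in>Bk. f b) = (\<Sum>b\<in>B0 - F. f b) + (\<Sum>b\<in>B'. f b)" for f :: "'b \<Rightarrow> nat"
   unfolding sp(1) using fB0 fB' sp(2) by(intro sum.union_disjoint) auto
  have "(\<Sum>b\<in>Bk. (2::nat)^l b) = card (B0 - F) * 2^l0 + (\<Sum>b\<in>B'. 2^l' b)"
  proof -
   have "(\<Sum>b\<in>B'. (2::nat)^l b) = (\<Sum>b\<in>B'. 2^l' b)" using sp(2) by(intro sum.cong) (auto simp: l_def)
   moreover have "(\<Sum>b\<in>B0 - F. (2::nat)^l b) = card (B0 - F) * 2^l0" by(simp add: l_def)
   ultimately show ?thesis unfolding dj by simp
  qed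
  also have "... \<le> card (B0 - F) * 2^l0 + 2 * (\<Sum>b\<in>B'. 2^sg' b)" using al(3) by simp
  also have "(\<Sum>b\<in>B'. (2::nat)^sg' b) = (\<Sum>b\<in>Bk - B0. 2^sg b) + card F * 2^Suc l0"
  proof -
   have "(\<Sum>b\<in>B'. (2::nat)^sg' b) = (\<Sum>b\<in>Bk - B0. 2^sg' b) + (\<Sum>b\<in>F. 2^sg' b)"
    unfolding B'_def using Suc.prems(1) fF F by(intro sum.union_disjoint) auto
   moreover have "(\<Sum>b\<in>Bk - B0. (2::nat)^sg' b) = (\<Sum>b\<in>Bk - B0. 2^sg b)" using F by(intro sum.cong) (auto simp: sg'_def)
   moreover have "(\<Sum>b\<in>F. (2::nat)^sg' b) = card F * 2^Suc l0" by(simp add: sg'_def)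
   ultimately show ?thesis by simp
  qed
  \<comment> \<open>A bucket in \<open>F\<close> is charged \<open>2 * 2^Suc l0\<close>, that is
    four units of \<open>2^l0\<close>, where two are available per bucket of \<open>B0\<close>;
    \<open>4 * card F \<le> card B0\<close> absorbs this.\<close>
  also have "card (B0 - F) * 2^l0 + 2 * ((\<Sum>b\<in>Bk - B0. 2^sg b) + card F * 2^Suc l0) \<le>
    2 * ((\<Sum>b\<in>Bk - B0. 2^sg b) + card B0 * 2^l0)"
  proof -
   have "card (B0 - F) = card B0 - card F" using fF F(1) by(rule card_Diff_subset)
   hence "card (B0 - F) + 4 * card F \<le> 2 * card B0" using F(2) by linarith
   hence "(card (B0 - F) + 4 * card F) * 2^l0 \<le> 2 * card B0 * 2^l0" by(rule mult_le_mono1)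
   thus ?thesis by(simp add: algebra_simps)
  qed
  also have "(\<Sum>b\<in>Bk - B0. (2::nat)^sg b) + card B0 * 2^l0 = (\<Sum>b\<in>Bk. 2^sg b)"
  proof -
   have "(\<Sum>b\<in>B0. (2::nat)^sg b) = card B0 * 2^l0" by(simp add: B0_def)
   moreover have "(\<Sum>b\<in>Bk. (2::nat)^sg b) = (\<Sum>b\<in>Bk - B0. 2^sg b) + (\<Sum>b\<in>B0. 2^sg b)"
    using Suc.prems(1) by(intro sum.subset_diff) (auto simp: B0_def)
   ultimately show ?thesis by simp
  qed
  finally show ?thesis using 1 2 by blast
 qed
qed

section \<open>Cells\<close>

locale elems =
 fixes n K b :: nat and X J :: "nat \<Rightarrow> nat"
 assumes n_pos: "1 \<le> n"
  and XJ: "\<And>a. a < n - 1 \<Longrightarrow> X a < n \<and> J a < K * 2^b"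
  and lex: "\<And>a a'. a < a' \<Longrightarrow> a' < n - 1 \<Longrightarrow> X a < X a' \<or> X a = X a' \<and> J a < J a'"
begin

text \<open>Element \<open>a\<close> is the node numbered \<open>a + 1\<close>, with parent
  \<open>X a\<close> and label \<open>J a\<close>. \<open>As\<close> are the nonempty cells and
  \<open>Bs\<close> their first elements, with the sentinel \<open>r\<close> as the start of all
  cells behind the last element. \<open>ex c\<close> counts the elements before the cell
  \<open>c\<close> that are not first in their cell, \<open>E\<close> all such elements;
  \<open>ee c\<close> is the number of label bits that a bucket number determines; \<open>H\<close>
  are the elements of heavy cells.\<close>

definition "r = n - 1"
definition "C a = X a * K + J a div 2^b"
definition "lo a = J a mod 2^b"
definition "start c = card {a. a < r \<and> C a < c}"
definition "As = C ` {..<r}"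
definition "Bs = insert r (start ` As)"
definition "cnt c = start (Suc c) - start c"
definition "ex c = start c - rank As c"
definition "E = r - card As"
definition "ee c = ceillog2 (cnt c)"
definition "H = {a. a < r \<and> 2 \<le> cnt (C a)}"

lemma hi_less: "a < r \<Longrightarrow> J a div 2^b < K"
 using XJ[of a] by(simp add: r_def div_less_iff_less_mult)

lemma C_eq_iff: "a < r \<Longrightarrow> h < K \<Longrightarrow> C a = x * K + h \<longleftrightarrow> X a = x \<and> J a div 2^b = h"
proof
 assume a: "a < r" "h < K" "C a = x * K + h"
 have "(X a * K + J a div 2^b) div K = (x * K + h) div K" using a by(simp add: C_def)
 hence "X a = x" using hi_less[OF a(1)] a(2) by simp
 thus "X a = x \<and> J a div 2^b = h" using a(3) by(simp add: C_def)
qed (simp add: C_def)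

lemma C_less: assumes "a < r" shows "C a < n * K"
proof -
 have "(X a + 1) * K \<le> n * K" using XJ[of a] assms by(intro mult_le_mono1) (simp add: r_def)
 thus ?thesis using hi_less[OF assms] by(simp add: C_def)
qed

lemma C_lex: assumes "a < a'" "a' < r" shows "C a < C a' \<or> C a = C a' \<and> lo a < lo a'"
proof -
 have a: "a < r" using assms by simp
 from lex[OF assms(1)] assms(2) consider "X a < X a'" | "X a = X a'" "J a < J a'" by(auto simp: r_def)
 thus ?thesis
 proof cases
  case 1
  hence "(X a + 1) * K \<le> X a' * K" by(intro mult_le_mono1) simp
  hence "C a < C a'" using hi_less[OF a] by(simp add: C_def)
  thus ?thesis ..
 next
  case 2
  have le: "J a div 2^b \<le> J a' div 2^b" using 2(2) by(intro div_le_mono) simp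
  show ?thesis
  proof(cases "J a div 2^b = J a' div 2^b")
   case True
   hence "lo a < lo a'" using 2(2) unfolding lo_def by(metis div_mult_mod_eq nat_add_left_cancel_less)
   thus ?thesis using True 2(1) by(simp add: C_def)
  qed (use le 2 in \<open>simp add: C_def\<close>)
 qed
qed

lemma C_mono: "a \<le> a' \<Longrightarrow> a' < r \<Longrightarrow> C a \<le> C a'"
 using C_lex[of a a'] by(cases "a = a'") (auto simp: le_less)

lemma elem_eqI: "a < r \<Longrightarrow> a' < r \<Longrightarrow> C a = C a' \<Longrightarrow> lo a = lo a' \<Longrightarrow> a = a'"
 using C_lex[of a a'] C_lex[of a' a] by(metis less_irrefl nat_neq_iff)

lemma below_start: "{a. a < r \<and> C a < c} = {..<start c}"
proof -
 define S where "S = {a. a < r \<and> C a < c}"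
 have fS: "finite S" by(simp add: S_def)
 have down: "a' \<in> S" if "a \<in> S" "a' \<le> a" for a a'
  using that C_mono[of a' a] by(auto simp: S_def)
 have "S = {..<card S}"
 proof(cases "S = {}")
  case False
  hence "S = {..Max S}" using down[OF Max_in[OF fS False]] Max_ge[OF fS] by auto
  hence "S = {..<Suc (Max S)}" by(simp add: lessThan_Suc_atMost)
  thus ?thesis by(metis card_lessThan)
 qed simp
 thus ?thesis by(simp add: S_def start_def)
qed

lemma less_start_iff: "a < r \<Longrightarrow> a < start c \<longleftrightarrow> C a < c"
 using below_start[of c] by blast

lemma start_le: "start c \<le> r"
 using card_mono[of "{..<r}" "{a. a < r \<and> C a < c}"] by(auto simp: start_def)

lemma start_mono: "c \<le> c' \<Longrightarrow> start c \<le> start c'"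
 unfolding start_def by(intro card_mono) auto

lemma start_le_self: "a < r \<Longrightarrow> start (C a) \<le> a"
 using less_start_iff[of a "C a"] by simp

lemma less_start_Suc: "a < r \<Longrightarrow> a < start (Suc (C a))"
 using less_start_iff[of a "Suc (C a)"] by simp

lemma cell_elems: "{a. a < r \<and> C a = c} = {start c..<start (Suc c)}"
proof(intro equalityI subsetI)
 fix a assume "a \<in> {a. a < r \<and> C a = c}"
 thus "a \<in> {start c..<start (Suc c)}" using start_le_self[of a] less_start_Suc[of a] by auto
next
 fix a assume a: "a \<in> {start c..<start (Suc c)}"
 hence "a < r" using start_le[of "Suc c"] by simp
 thus "a \<in> {a. a < r \<and> C a = c}" using less_start_iff[of a c] less_start_iff[of a "Suc c"] a by auto
qed

lemma cnt_eq: "cnt c = card {a. a < r \<and> C a = c}"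
 by(simp add: cnt_def cell_elems)

lemma start_Suc: "start (Suc c) = start c + cnt c"
 using start_mono[of c "Suc c"] by(simp add: cnt_def)

lemma cnt_pos_iff: "0 < cnt c \<longleftrightarrow> c \<in> As"
 unfolding cnt_eq As_def by(auto simp: card_gt_0_iff)

lemma cnt_less: "cnt c < n"
proof -
 have "cnt c \<le> r" using start_Suc[of c] start_le[of "Suc c"] by simp
 thus ?thesis using n_pos by(simp add: r_def)
qed

lemma cnt_le: "cnt c \<le> 2^b"
proof -
 have "inj_on lo {a. a < r \<and> C a = c}" by(rule inj_onI) (auto intro: elem_eqI)
 hence "card {a. a < r \<and> C a = c} \<le> card {..<(2::nat)^b}"
  by(rule card_inj_on_le) (auto simp: lo_def)
 thus ?thesis by(simp add: cnt_eq)
qed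

lemma ee_le: "ee c \<le> b" "ee c \<le> ceillog2 n"
 using ceillog2_mono[OF cnt_le[of c]] ceillog2_mono[OF less_imp_le[OF cnt_less[of c]]] by(auto simp: ee_def)

lemma cnt_le_pow: "cnt c \<le> 2^ee c"
 unfolding ee_def by(rule le_two_power_ceillog2)

lemma pow_ee: "2 \<le> cnt c \<Longrightarrow> 2^ee c \<le> 4 * (cnt c - 1)"
 using two_power_ceillog2_gt[of "cnt c"] unfolding ee_def by linarith

lemma As_sub: "As \<subseteq> {..<n * K}"
 unfolding As_def using C_less by auto

lemma As_finite [simp]: "finite As"
 by(simp add: As_def)

lemma card_As: "card As \<le> r"
 unfolding As_def using card_image_le[of "{..<r}" C] by simp

lemma start_strict: "c \<in> As \<Longrightarrow> c < c' \<Longrightarrow> start c < start c'"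
 using cnt_pos_iff[of c] start_Suc[of c] start_mono[of "Suc c" c'] by simp

lemma start_inj: "inj_on start As"
 by(rule inj_onI) (metis start_strict less_irrefl nat_neq_iff)

lemma start_less_r: "c \<in> As \<Longrightarrow> start c < r"
 using start_strict[of c "Suc c"] start_le[of "Suc c"] by simp

lemma Bs_finite [simp]: "finite Bs"
 by(simp add: Bs_def)

lemma Bs_sub: "Bs \<subseteq> {..<n}"
proof
 fix y assume "y \<in> Bs"
 hence "y \<le> r" using start_le by(auto simp: Bs_def)
 thus "y \<in> {..<n}" using n_pos by(simp add: r_def)
qed

lemma card_Bs: "card Bs = card As + 1"
proof -
 have "r \<notin> start ` As" using start_less_r by fastforce
 thus ?thesis unfolding Bs_def by(simp add: card_image start_inj)
qed

lemma start_in_Bs: "start c \<in> Bs"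
proof(cases "start c = r")
 case False
 hence l: "start c < r" using start_le[of c] by simp
 have "\<not> C (start c) < c" using less_start_iff[OF l, of c] by simp
 hence "c \<le> C (start c)" by simp
 hence "start c \<le> start (C (start c))" by(rule start_mono)
 hence "start (C (start c)) = start c" using start_le_self[OF l] by simp
 thus ?thesis using l by(auto simp: Bs_def As_def intro!: image_eqI[of _ start "C (start c)"])
qed (simp add: Bs_def)

lemma rank_Bs_start: "rank Bs (start c) = rank As c"
proof -
 have "Bs \<inter> {..<start c} = start ` (As \<inter> {..<c})"
 proof(intro equalityI subsetI)
  fix y assume "y \<in> Bs \<inter> {..<start c}"
  then obtain c' where c': "c' \<in> As" "y = start c'" "start c' < start c"
   using start_le[of c] by(auto simp: Bs_def)
  hence "c' < c" using start_mono[of c c'] by(meson leD leI)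
  thus "y \<in> start ` (As \<inter> {..<c})" using c' by auto
 next
  fix y assume "y \<in> start ` (As \<inter> {..<c})"
  thus "y \<in> Bs \<inter> {..<start c}" using start_strict by(auto simp: Bs_def)
 qed
 thus ?thesis unfolding rank_def using card_image[OF inj_on_subset[OF start_inj]] by auto
qed

text \<open>This includes empty cells: \<open>start c\<close> is then the start of the next nonempty
  cell, or the sentinel.\<close>

lemma sel_Bs: "sel Bs (rank As c) = start c"
 by(rule sel_eqI) (simp_all add: start_in_Bs rank_Bs_start)

text \<open>The way back from an element to its cell, and hence to its parent: the starts up to
  \<open>a\<close> are those of the nonempty cells up to its own.\<close>

lemma sel_As: assumes "a < r" shows "rank Bs (Suc a) = Suc (rank As (C a))" "sel As (rank Bs (Suc a) - 1) = C a"
proof -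
 have "Bs \<inter> {..<Suc a} = start ` (As \<inter> {..<Suc (C a)})"
 proof(intro equalityI subsetI)
  fix y assume "y \<in> Bs \<inter> {..<Suc a}"
  then obtain c where c: "c \<in> As" "y = start c" "start c \<le> a" using assms by(auto simp: Bs_def)
  hence "c \<le> C a" using less_start_iff[OF assms, of c] by simp
  thus "y \<in> start ` (As \<inter> {..<Suc (C a)})" using c by auto
 next
  fix y assume "y \<in> start ` (As \<inter> {..<Suc (C a)})"
  then obtain c where c: "c \<in> As" "c \<le> C a" "y = start c" by auto
  hence "start c \<le> a" using start_mono[of c "C a"] start_le_self[OF assms] by simp
  thus "y \<in> Bs \<inter> {..<Suc a}" using c by(auto simp: Bs_def)
 qed
 hence "rank Bs (Suc a) = rank As (Suc (C a))"
  unfolding rank_def using card_image[OF inj_on_subset[OF start_inj], of "As \<inter> {..<Suc (C a)}"] by simp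
 moreover have "C a \<in> As" using assms by(simp add: As_def)
 ultimately show 1: "rank Bs (Suc a) = Suc (rank As (C a))" by(simp add: rank_Suc)
 show "sel As (rank Bs (Suc a) - 1) = C a"
  by(rule sel_eqI) (use 1 \<open>C a \<in> As\<close> in auto)
qed

lemma rank_As_le: "rank As c \<le> start c"
proof(induction c)
 case (Suc c)
 thus ?case using cnt_pos_iff[of c] by(cases "c \<in> As") (auto simp: rank_Suc start_Suc)
qed simp

lemma ex_Suc: "c \<in> As \<Longrightarrow> ex (Suc c) = ex c + (cnt c - 1)"
 using cnt_pos_iff[of c] rank_As_le[of c] by(simp add: ex_def rank_Suc start_Suc)

lemma ex_mono: "c \<le> c' \<Longrightarrow> ex c \<le> ex c'"
proof(rule lift_Suc_mono_le[of ex])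
 show "ex c \<le> ex (Suc c)" for c
 proof(cases "c \<in> As")
  case False
  thus ?thesis using cnt_pos_iff[of c] by(simp add: ex_def rank_Suc start_Suc)
 qed (simp add: ex_Suc)
qed

lemma ex_top: "ex (n * K) = E"
proof -
 have "{a. a < r \<and> C a < n * K} = {..<r}" using C_less by auto
 hence "start (n * K) = r" by(simp add: start_def)
 moreover have "rank As (n * K) = card As" by(rule rank_card[OF As_sub]) simp
 ultimately show ?thesis by(simp add: ex_def E_def)
qed

text \<open>
 The cell \<open>c\<close> owns the bucket numbers from \<open>4 * ex c\<close> on: it contributes \<open>cnt c - 1\<close> to the excess,
 so these ranges are disjoint for different cells.
\<close>

lemma bucket_room:
 assumes "c \<in> As" "2 \<le> cnt c" "c < c'"
 shows "4 * ex c + 2^ee c \<le> 4 * ex c'"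
 using pow_ee[OF assms(2)] ex_Suc[OF assms(1)] ex_mono[of "Suc c" c'] assms(3) by simp

lemma bucket_room_top: "c \<in> As \<Longrightarrow> 2 \<le> cnt c \<Longrightarrow> 4 * ex c + 2^ee c \<le> 4 * E"
 using bucket_room[of c "n * K"] As_sub ex_top by auto

lemma H_finite [simp]: "finite H"
 by(simp add: H_def)

lemma card_cells:
 assumes "finite S"
 shows "card {a. a < r \<and> C a \<in> S} = sum cnt S"
proof -
 have "{a. a < r \<and> C a \<in> S} = (\<Union>c\<in>S. {a. a < r \<and> C a = c})" by auto
 moreover have "card (\<Union>c\<in>S. {a. a < r \<and> C a = c}) = (\<Sum>c\<in>S. card {a. a < r \<and> C a = c})"
  using assms by(intro card_UN_disjoint) auto
 ultimately show ?thesis by(simp add: cnt_eq)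
qed

lemma E_eq: "E = (\<Sum>c\<in>As. cnt c - 1)"
proof -
 have "{a. a < r \<and> C a \<in> As} = {..<r}" by(auto simp: As_def)
 hence "r = sum cnt As" using card_cells[of As] by simp
 hence "E = sum cnt As - (\<Sum>c\<in>As. 1)" by(simp add: E_def)
 also have "... = (\<Sum>c\<in>As. cnt c - 1)" using cnt_pos_iff by(intro sum_subtractf_nat[symmetric]) (simp add: Suc_leI)
 finally show ?thesis .
qed

lemma card_H: "card H \<le> 2 * E"
proof -
 define S where "S = {c \<in> As. 2 \<le> cnt c}"
 have fS: "finite S" by(simp add: S_def)
 have "H = {a. a < r \<and> C a \<in> S}" by(auto simp: H_def S_def As_def)
 hence h: "card H = sum cnt S" using card_cells[OF fS] by simp
 have "(\<Sum>c\<in>S. cnt c - 1) \<le> (\<Sum>c\<in>As. cnt c - 1)" by(rule sum_mono2) (auto simp: S_def)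
 moreover have "sum cnt S \<le> (\<Sum>c\<in>S. 2 * (cnt c - 1))" by(rule sum_mono) (auto simp: S_def)
 ultimately show ?thesis unfolding h E_eq by(simp add: sum_distrib_left[symmetric])
qed

lemma b_pos: "0 < E \<Longrightarrow> 0 < b"
proof(rule ccontr)
 assume E: "0 < E" and "\<not> 0 < b"
 hence "cnt c - 1 = 0" for c using cnt_le[of c] by simp
 thus False using E unfolding E_eq by simp
qed

section \<open>The dictionary of the heavy cells\<close>

definition "low c v = v mod (2::nat)^(b - ee c)"
definition "up c v = v div (2::nat)^(b - ee c)"

lemma up_less: "v < 2^b \<Longrightarrow> up c v < 2^ee c"
 unfolding up_def using ee_le(1)[of c] by(simp add: div_less_iff_less_mult flip: power_add)

lemma up_low_inj: "up c v = up c v' \<Longrightarrow> low c v = low c v' \<Longrightarrow> v = v'"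
 unfolding up_def low_def by(metis div_mult_mod_eq)

lemma lo_less: "lo a < 2^b"
 by(simp add: lo_def)

text \<open>Displacement hashing: the upper \<open>ee c\<close> bits of the low label part are
  shifted cyclically by a hash value of the remaining bits. Bucket and remaining bits determine the
  upper bits (\<open>bkt_eqD\<close>), so a record only has to hold the remaining ones.\<close>

definition "bkt Q \<rho> A c v = 4 * ex c + (up c v + hsh Q (ee c) A (\<rho> (low c v))) mod 2^ee c"

definition "lowH = (\<lambda>a. low (C a) (lo a)) ` H"

definition hash_ok :: "nat \<Rightarrow> (nat \<Rightarrow> nat) \<Rightarrow> nat \<Rightarrow> (nat \<Rightarrow> nat) \<Rightarrow> (nat \<Rightarrow> nat) \<Rightarrow> bool" where
 "hash_ok Q \<rho> A sd l \<longleftrightarrow> A < 2^Q \<and> (\<forall>j. sd j < 2^Q) \<and> inj_on \<rho> lowH \<and>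
   (\<forall>c. 2 \<le> cnt c \<longrightarrow> ee c \<le> Q) \<and> (\<forall>g. l g \<le> Q) \<and>
   (\<forall>g. inj_on (\<lambda>a. hsh Q (l g) (sd (l g)) (\<rho> (low (C a) (lo a)))) {a \<in> H. bkt Q \<rho> A (C a) (lo a) = g}) \<and>
   (\<Sum>g<4 * E. (2::nat)^l g) \<le> 200 * E"

lemma heavy_cell: "a \<in> H \<Longrightarrow> a < r \<and> C a \<in> As \<and> 2 \<le> cnt (C a)"
 by(auto simp: H_def As_def)

lemma bkt_range: "4 * ex c \<le> bkt Q \<rho> A c v" "bkt Q \<rho> A c v < 4 * ex c + 2^ee c"
 by(auto simp: bkt_def)

lemma bkt_cell:
 assumes "c \<in> As" "2 \<le> cnt c" "c' \<in> As" "2 \<le> cnt c'" "4 * ex c' \<le> g" "g < 4 * ex c' + 2^ee c'"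
  "4 * ex c \<le> g" "g < 4 * ex c + 2^ee c"
 shows "c = c'"
 using bucket_room[of c c'] bucket_room[of c' c] assms by(metis leD le_less_trans less_le_trans nat_neq_iff)

lemma bkt_eqD:
 assumes "c \<in> As" "2 \<le> cnt c" "c' \<in> As" "2 \<le> cnt c'" "bkt Q \<rho> A c v = bkt Q \<rho> A c' v'" "v < 2^b" "v' < 2^b"
  "low c v = low c v'"
 shows "c = c' \<and> v = v'"
proof -
 have c: "c = c'" using bkt_cell[of c c' "bkt Q \<rho> A c v"] assms
   bkt_range[where c = c and v = v and Q = Q and \<rho> = \<rho> and A = A]
   bkt_range[where c = c' and v = v' and Q = Q and \<rho> = \<rho> and A = A] by simp
 let ?h = "hsh Q (ee c) A (\<rho> (low c v))"
 have "(up c v + ?h) mod 2^ee c = (up c v' + ?h) mod 2^ee c" using assms(5,8) unfolding bkt_def c by simp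
 moreover obtain dl where dl: "\<forall>h D. D < 2^ee c \<longrightarrow> (0 + (h + D + 0)) mod 2^ee c = (up c v' + h) mod 2^ee c \<longrightarrow> D = dl"
  using two_values[of "2^ee c" 0 0 "up c v'"] by auto
 ultimately have "up c v = dl" "up c v' = dl"
  using up_less[OF assms(6), of c] up_less[OF assms(7), of c] dl[rule_format, of "up c v" ?h] dl[rule_format, of "up c v'" ?h]
  by(simp_all add: add.commute)
 hence "up c v = up c v'" by simp
 thus ?thesis using up_low_inj assms c by blast
qed

text \<open>\<open>P1\<close> bounds a modulus that is injective on the keys of \<open>b\<close>
  bits, \<open>P2\<close> a second one for residues up to \<open>P1\<close>. \<open>Qsmall\<close>
  has room for a key up to \<open>P2\<close> and for the at most \<open>ceillog2 n\<close> bits of a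
  bucket number in addition, as \<open>hsh_delta_count\<close> demands.\<close>

definition "P1 = 2 * (b * (n * n)) + 4"
definition "P2 = 2 * (ceillog2 (P1 + 1) * (n * n)) + 4"
definition "Qsmall = ceillog2 (P2 + 1) + ceillog2 n + 1"

definition reduction :: "nat \<Rightarrow> nat \<Rightarrow> nat \<Rightarrow> bool" where
 "reduction p p2 Q \<longleftrightarrow> inj_on (\<lambda>x. x mod p mod p2) lowH \<and> Q \<le> b \<and>
   (\<forall>c. ee c \<le> Q \<and> (\<forall>v. low c v mod p mod p2 < 2^(Q - ee c))) \<and> p \<le> P1 \<and> p2 \<le> P2 \<and> p < 2^b \<and> p2 < 2^b \<and>
   (Q = Qsmall \<or> Q = b \<and> b \<le> ceillog2 (P1 + 1) + Qsmall)"

lemma less_pow_ceillog2: "x \<le> y \<Longrightarrow> x < 2^ceillog2 (y + 1)"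
 using le_two_power_ceillog2[of "y + 1"] by linarith

lemma lowH_sub: "lowH \<subseteq> {..<2^b}"
proof -
 have "low c v < 2^b" for c v
 proof -
  have "low c v < 2^(b - ee c)" by(simp add: low_def)
  also have "... \<le> 2^b" by(rule power_increasing) auto
  finally show ?thesis .
 qed
 thus ?thesis by(auto simp: lowH_def)
qed

lemma ex_reduction: "\<exists>p p2 Q. reduction p p2 Q"
proof(cases "ceillog2 (P1 + 1) + Qsmall \<le> b")
 case False
 \<comment> \<open>As \<open>x mod 0 = x\<close>, the moduli 0 leave the keys as they are; in this
   case \<open>b\<close> is small enough.\<close>
 have "reduction 0 0 b" unfolding reduction_def
 proof(intro conjI allI)
  fix c v
  show "ee c \<le> b" by(rule ee_le)
  show "low c v mod 0 mod 0 < 2^(b - ee c)" by(simp add: low_def)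
  show "b = Qsmall \<or> b = b \<and> b \<le> ceillog2 (P1 + 1) + Qsmall" using False by simp
 qed auto
 thus ?thesis by blast
next
 case True
 have cl: "finite lowH" "card lowH \<le> n"
 proof -
  show "finite lowH" by(simp add: lowH_def)
  have "card lowH \<le> card H" unfolding lowH_def by(rule card_image_le) simp
  also have "... \<le> card {..<r}" by(rule card_mono) (auto simp: H_def)
  finally show "card lowH \<le> n" by(simp add: r_def)
 qed
 obtain p where p: "0 < p" "p \<le> P1" "inj_on (\<lambda>x. x mod p) lowH"
  using ex_injective_modulus[OF cl lowH_sub] by(auto simp: P1_def)
 define Y where "Y = (\<lambda>x. x mod p) ` lowH"
 have Y: "finite Y" "card Y \<le> n" using cl card_image_le[of lowH "\<lambda>x. x mod p"] by(auto simp: Y_def)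
 have "Y \<subseteq> {..<2^ceillog2 (P1 + 1)}"
 proof
  fix y assume "y \<in> Y"
  hence "y < p" using p(1) by(auto simp: Y_def)
  hence "y \<le> P1" using p by simp
  thus "y \<in> {..<2^ceillog2 (P1 + 1)}" using less_pow_ceillog2 by simp
 qed
 from ex_injective_modulus[OF Y this] obtain p2 where p2: "0 < p2" "p2 \<le> P2" "inj_on (\<lambda>x. x mod p2) Y"
  by(auto simp: P2_def)
 have "reduction p p2 Qsmall" unfolding reduction_def
 proof(intro conjI allI)
  show "inj_on (\<lambda>x. x mod p mod p2) lowH"
   using comp_inj_on[OF p(3) p2(3)[unfolded Y_def]] by(simp add: comp_def)
  show "Qsmall \<le> b" using True by simp
  have "(2::nat)^ceillog2 (P1 + 1) \<le> 2^b" "(2::nat)^ceillog2 (P2 + 1) \<le> 2^b"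
   using True by(auto intro!: power_increasing simp: Qsmall_def)
  thus "p < 2^b" "p2 < 2^b"
   using less_pow_ceillog2[OF p(2)] less_pow_ceillog2[OF p2(2)] by linarith+
  fix c v
  show e: "ee c \<le> Qsmall" using ee_le(2)[of c] by(simp add: Qsmall_def)
  have "low c v mod p mod p2 < p2" using p2 by simp
  also have "p2 < 2^ceillog2 (P2 + 1)" by(rule less_pow_ceillog2[OF p2(2)])
  also have "... \<le> 2^(Qsmall - ee c)" using ee_le(2)[of c] by(intro power_increasing) (auto simp: Qsmall_def)
  finally show "low c v mod p mod p2 < 2^(Qsmall - ee c)" .
 qed (use p p2 in auto)
 thus ?thesis by blast
qed

text \<open>Two elements of one cell share a bucket for at most the fraction
  \<open>2 / 2^ee c\<close> of the seeds, and an element has at most \<open>2^ee c\<close> partners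
  in its cell; so on average over the seeds there are at most two colliding partners per
  element.\<close>

lemma ex_top_seed:
 assumes Q: "0 < Q" and inj: "inj_on \<rho> lowH"
  and \<rho>: "\<And>c v. ee c \<le> Q \<and> \<rho> (low c v) < 2^(Q - ee c)"
 shows "\<exists>A\<in>odds Q. card {(a, a') \<in> H \<times> H. a \<noteq> a' \<and> bkt Q \<rho> A (C a) (lo a) = bkt Q \<rho> A (C a') (lo a')} \<le> 2 * card H"
proof -
 define P where "P = {(a, a') \<in> H \<times> H. a \<noteq> a' \<and> C a = C a'}"
 define bad where "bad A \<pi> = (bkt Q \<rho> A (C (fst \<pi>)) (lo (fst \<pi>)) = bkt Q \<rho> A (C (snd \<pi>)) (lo (snd \<pi>)))" for A \<pi>
 have fP: "finite P" by(auto simp: P_def intro: finite_subset[of _ "H \<times> H"])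
 have "1 \<in> odds Q" using Q one_less_power[of "2::nat" Q] by(simp add: odds_def)
 hence ne: "odds Q \<noteq> {}" by blast
 have cO: "real (card (odds Q)) = 2^Q / 2"
 proof -
  have "(2::real)^Q = 2 * 2^(Q - 1)" using Q by(metis power_eq_if not_gr_zero)
  thus ?thesis using card_odds[OF Q] by simp
 qed
 have "\<exists>A\<in>odds Q. real (card {\<pi> \<in> P. bad A \<pi>}) \<le> (\<Sum>\<pi>\<in>P. 2 / 2^ee (C (fst \<pi>)))"
 proof(rule averaging[OF odds_finite ne fP])
  fix \<pi> assume "\<pi> \<in> P"
  then obtain a a' where p: "\<pi> = (a, a')" "a \<in> H" "a' \<in> H" "a \<noteq> a'" "C a = C a'" by(auto simp: P_def)
  let ?c = "C a"
  have eq: "2 / 2^ee ?c * real (card (odds Q)) = real (2^(Q - ee ?c))"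
  proof -
   have "(2::real)^Q = 2^(Q - ee ?c) * 2^ee ?c" using \<rho>[of ?c] by(simp flip: power_add)
   thus ?thesis unfolding cO by simp
  qed
  have ar: "a < r" "a' < r" using p by(auto simp: H_def)
  show "real (card {A \<in> odds Q. bad A \<pi>}) \<le> 2 / 2^ee (C (fst \<pi>)) * real (card (odds Q))"
  proof(cases "\<rho> (low ?c (lo a)) = \<rho> (low ?c (lo a'))")
   \<comment> \<open>Equal reduced keys mean equal remaining bits; the upper bits then differ but
     are shifted by the same amount, so the buckets differ for every seed.\<close>
   case True
   have "low ?c (lo a) \<in> lowH" using p(2) unfolding lowH_def by(rule imageI)
   moreover have "low ?c (lo a') \<in> lowH" using p(3) unfolding lowH_def p(5) by(rule imageI)
   ultimately have ll: "low ?c (lo a) = low ?c (lo a')" using True inj by(auto dest: inj_onD)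
   have "\<not> bad A \<pi>" for A
    using bkt_eqD[of ?c ?c Q \<rho> A "lo a" "lo a'"] heavy_cell[OF p(2)] lo_less ll elem_eqI[OF ar p(5)] p
    unfolding bad_def by auto
   thus ?thesis by simp
  next
   case False
   have "{A \<in> odds Q. bad A \<pi>} \<subseteq> {A \<in> odds Q. (up ?c (lo a) + hsh Q (ee ?c) A (\<rho> (low ?c (lo a)))) mod 2^ee ?c =
     (up ?c (lo a') + hsh Q (ee ?c) A (\<rho> (low ?c (lo a')))) mod 2^ee ?c}"
    using p by(auto simp: bad_def bkt_def)
   hence "card {A \<in> odds Q. bad A \<pi>} \<le> card {A \<in> odds Q. (up ?c (lo a) + hsh Q (ee ?c) A (\<rho> (low ?c (lo a)))) mod 2^ee ?c =
     (up ?c (lo a') + hsh Q (ee ?c) A (\<rho> (low ?c (lo a')))) mod 2^ee ?c}"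
    by(intro card_mono) auto
   also have "... \<le> 2^(Q - ee ?c)"
    using False \<rho>[of ?c] by(intro hsh_delta_count[where T = "Q - ee ?c"]) auto
   finally show ?thesis using eq p by(simp del: of_nat_power)
  qed
 qed
 then obtain A where A: "A \<in> odds Q" "real (card {\<pi> \<in> P. bad A \<pi>}) \<le> (\<Sum>\<pi>\<in>P. 2 / 2^ee (C (fst \<pi>)))" by blast
 have "(\<Sum>\<pi>\<in>P. 2 / 2^ee (C (fst \<pi>))) \<le> (\<Sum>a\<in>H. \<Sum>a'\<in>{a'. a' < r \<and> C a' = C a}. (2::real) / 2^ee (C a))"
 proof -
  have "P \<subseteq> Sigma H (\<lambda>a. {a'. a' < r \<and> C a' = C a})" by(auto simp: P_def H_def)
  hence "(\<Sum>\<pi>\<in>P. (2::real) / 2^ee (C (fst \<pi>))) \<le> (\<Sum>\<pi>\<in>Sigma H (\<lambda>a. {a'. a' < r \<and> C a' = C a}). 2 / 2^ee (C (fst \<pi>)))"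
   by(intro sum_mono2) auto
  also have "... = (\<Sum>a\<in>H. \<Sum>a'\<in>{a'. a' < r \<and> C a' = C a}. (2::real) / 2^ee (C a))"
   by(subst sum.Sigma) (auto simp: case_prod_beta)
  finally show ?thesis .
 qed
 also have "... \<le> (\<Sum>a\<in>H. 2)"
 proof(rule sum_mono)
  fix a assume "a \<in> H"
  have "real (cnt (C a)) \<le> 2^ee (C a)" using cnt_le_pow[of "C a"] by(metis of_nat_le_iff of_nat_numeral of_nat_power)
  thus "(\<Sum>a'\<in>{a'. a' < r \<and> C a' = C a}. (2::real) / 2^ee (C a)) \<le> 2"
   by(simp add: field_simps flip: cnt_eq)
 qed
 finally have "real (card {\<pi> \<in> P. bad A \<pi>}) \<le> real (2 * card H)" using A by simp
 hence "card {\<pi> \<in> P. bad A \<pi>} \<le> 2 * card H" by(simp only: of_nat_le_iff)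
 moreover have "{(a, a') \<in> H \<times> H. a \<noteq> a' \<and> bkt Q \<rho> A (C a) (lo a) = bkt Q \<rho> A (C a') (lo a')} \<subseteq> {\<pi> \<in> P. bad A \<pi>}"
 proof clarify
  fix a a' assume a: "a \<in> H" "a' \<in> H" "a \<noteq> a'" "bkt Q \<rho> A (C a) (lo a) = bkt Q \<rho> A (C a') (lo a')"
  have "C a = C a'"
   using bkt_cell[of "C a" "C a'" "bkt Q \<rho> A (C a) (lo a)"] heavy_cell[OF a(1)] heavy_cell[OF a(2)]
    bkt_range[where c = "C a" and v = "lo a" and Q = Q and \<rho> = \<rho> and A = A]
    bkt_range[where c = "C a'" and v = "lo a'" and Q = Q and \<rho> = \<rho> and A = A] a(4) by simp
  thus "(a, a') \<in> P \<and> bad A (a, a')" using a by(simp add: P_def bad_def)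
 qed
 moreover have "finite {\<pi> \<in> P. bad A \<pi>}" using fP by simp
 ultimately have "card {(a, a') \<in> H \<times> H. a \<noteq> a' \<and> bkt Q \<rho> A (C a) (lo a) = bkt Q \<rho> A (C a') (lo a')} \<le> 2 * card H"
  using card_mono by(meson le_trans)
 thus ?thesis using A(1) by(rule bexI)
qed

lemma ex_hash:
 assumes Q: "0 < Q \<or> E = 0" and inj: "inj_on \<rho> lowH"
  and \<rho>: "\<And>c v. ee c \<le> Q \<and> \<rho> (low c v) < 2^(Q - ee c)"
 shows "\<exists>A sd l. hash_ok Q \<rho> A sd l"
proof(cases "E = 0")
 case True
 hence "H = {}" using card_H by(simp add: card_eq_0_iff)
 hence "hash_ok Q \<rho> 0 (\<lambda>_. 0) (\<lambda>_. 0)" using True \<rho> inj by(auto simp: hash_ok_def)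
 thus ?thesis by blast
next
 case False
 hence Q: "0 < Q" using Q by simp
 from ex_top_seed[OF Q inj \<rho>] obtain A where A: "A \<in> odds Q"
  "card {(a, a') \<in> H \<times> H. a \<noteq> a' \<and> bkt Q \<rho> A (C a) (lo a) = bkt Q \<rho> A (C a') (lo a')} \<le> 2 * card H" by blast
 define bk where "bk a = bkt Q \<rho> A (C a) (lo a)" for a
 define U where "U g = {a \<in> H. bk a = g}" for g
 define kp where "kp a = \<rho> (low (C a) (lo a))" for a
 have fU: "finite (U g)" for g by(simp add: U_def)
 have kpinj: "inj_on kp (U g)" for g
 proof(rule inj_onI)
  fix a a' assume a: "a \<in> U g" "a' \<in> U g" "kp a = kp a'"
  hence h: "a \<in> H" "a' \<in> H" "bk a = bk a'" by(auto simp: U_def)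
  have ll: "low (C a) (lo a) = low (C a') (lo a')"
   by(rule inj_onD[OF inj]) (use a(3) h in \<open>auto simp: kp_def lowH_def\<close>)
  have cc: "C a = C a'"
   using bkt_cell[of "C a" "C a'" "bkt Q \<rho> A (C a) (lo a)"] heavy_cell[OF h(1)] heavy_cell[OF h(2)]
    bkt_range[where c = "C a" and v = "lo a" and Q = Q and \<rho> = \<rho> and A = A]
    bkt_range[where c = "C a'" and v = "lo a'" and Q = Q and \<rho> = \<rho> and A = A] h(3) by(simp add: bk_def)
  have "lo a = lo a'"
   using bkt_eqD[of "C a" "C a'" Q \<rho> A "lo a" "lo a'"] heavy_cell[OF h(1)] heavy_cell[OF h(2)] lo_less ll cc h(3)
   by(simp add: bk_def)
  thus "a = a'" using elem_eqI[of a a'] h cc by(auto simp: H_def)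
 qed
 have kpb: "kp a < 2^Q" for a
 proof -
  have "kp a < 2^(Q - ee (C a))" using \<rho> by(simp add: kp_def)
  also have "... \<le> 2^Q" by(rule power_increasing) auto
  finally show ?thesis .
 qed
 \<comment> \<open>Eight times the square of the bucket size is what \<open>bucket_seeds\<close>
   asks for; \<open>Q\<close> caps the exponent, and an empty bucket gets a table of size
   one.\<close>
 define sg where "sg g = (if U g = {} then 0 else min Q (ceillog2 (8 * (card (U g))\<^sup>2)))" for g
 have cK: "card (kp ` U g) = card (U g)" for g by(rule card_image[OF kpinj])
 have "\<exists>sd l. (\<forall>j. sd j \<in> odds Q) \<and> (\<forall>g\<in>{..<4 * E}. sg g \<le> l g \<and> l g \<le> Q \<and> inj_on (hsh Q (l g) (sd (l g))) (kp ` U g)) \<and>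
  (\<Sum>g\<in>{..<4 * E}. (2::nat)^l g) \<le> 2 * (\<Sum>g\<in>{..<4 * E}. 2^sg g)"
 proof(rule bucket_seeds[OF Q, where d = Q])
  fix g
  show "finite (kp ` U g) \<and> kp ` U g \<subseteq> {..<2^Q} \<and> Q - Q \<le> sg g \<and> sg g \<le> Q \<and>
    (sg g = Q \<or> 8 * (card (kp ` U g))\<^sup>2 \<le> 2^sg g)"
   using fU[of g] kpb le_two_power_ceillog2[of "8 * (card (U g))\<^sup>2"] unfolding cK by(auto simp: sg_def min_def)
 qed simp
 then obtain sd l0 where sl: "\<forall>j. sd j \<in> odds Q"
  "\<forall>g\<in>{..<4 * E}. l0 g \<le> Q \<and> inj_on (hsh Q (l0 g) (sd (l0 g))) (kp ` U g)"
  "(\<Sum>g\<in>{..<4 * E}. (2::nat)^l0 g) \<le> 2 * (\<Sum>g\<in>{..<4 * E}. 2^sg g)" by blast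
 define l where "l g = (if g < 4 * E then l0 g else 0)" for g
 have bk_less: "bk a < 4 * E" if "a \<in> H" for a
  using bkt_range(2)[where c = "C a" and v = "lo a" and Q = Q and \<rho> = \<rho> and A = A] bucket_room_top[of "C a"] heavy_cell[OF that]
  by(simp add: bk_def)
 \<comment> \<open>The sum of the squares counts the ordered pairs within the buckets:
   \<open>card H\<close> diagonal ones and at most \<open>2 * card H\<close> others, where
   \<open>card H \<le> 2 * E\<close>.\<close>
 have sq: "(\<Sum>g<4 * E. (card (U g))\<^sup>2) \<le> 6 * E"
 proof -
  have dj: "g \<noteq> g' \<Longrightarrow> (U g \<times> U g) \<inter> (U g' \<times> U g') = {}" for g g' by(auto simp: U_def)
  have "(\<Sum>g<4 * E. (card (U g))\<^sup>2) = (\<Sum>g<4 * E. card (U g \<times> U g))" by(simp add: card_cartesian_product power2_eq_square)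
  also have "... = card (\<Union>g<4 * E. U g \<times> U g)" using fU dj by(intro card_UN_disjoint[symmetric]) auto
  also have "... \<le> card ((\<lambda>a. (a, a)) ` H \<union> {(a, a') \<in> H \<times> H. a \<noteq> a' \<and> bk a = bk a'})"
   by(intro card_mono) (auto simp: U_def intro: finite_subset[of _ "H \<times> H"])
  also have "... \<le> card ((\<lambda>a. (a, a)) ` H) + card {(a, a') \<in> H \<times> H. a \<noteq> a' \<and> bk a = bk a'}" by(rule card_Un_le)
  also have "... \<le> card H + 2 * card H" using A(2) card_image_le[of H "\<lambda>a. (a, a)"] unfolding bk_def by(intro add_mono) auto
  also have "... \<le> 6 * E" using card_H by simp
  finally show ?thesis .
 qed
 have "2^sg g \<le> 16 * (card (U g))\<^sup>2 + 1" for g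
 proof(cases "U g = {}")
  case False
  have "(2::nat)^sg g \<le> 2^ceillog2 (8 * (card (U g))\<^sup>2)" using False by(intro power_increasing) (auto simp: sg_def)
  also have "... \<le> 2 * (8 * (card (U g))\<^sup>2)"
   using two_power_ceillog2_gt[of "8 * (card (U g))\<^sup>2"] False fU[of g] by(simp add: card_gt_0_iff less_imp_le)
  finally show ?thesis by simp
 qed (simp add: sg_def)
 hence "(\<Sum>g<4 * E. (2::nat)^sg g) \<le> (\<Sum>g<4 * E. 16 * (card (U g))\<^sup>2 + 1)" by(intro sum_mono)
 \<comment> \<open>The constant 200 arises here: \<open>16 * 6 + 4\<close> times \<open>E\<close>,
   doubled by \<open>bucket_seeds\<close>.\<close>
 also have "... = 16 * (\<Sum>g<4 * E. (card (U g))\<^sup>2) + 4 * E"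
  unfolding sum.distrib by(simp add: sum_distrib_left)
 also have "... \<le> 100 * E" using sq by simp
 finally have "(\<Sum>g<4 * E. (2::nat)^l0 g) \<le> 200 * E" using sl(3) by simp
 moreover have "(\<Sum>g<4 * E. (2::nat)^l g) = (\<Sum>g<4 * E. 2^l0 g)" by(simp add: l_def)
 moreover have "inj_on (\<lambda>a. hsh Q (l g) (sd (l g)) (\<rho> (low (C a) (lo a)))) {a \<in> H. bkt Q \<rho> A (C a) (lo a) = g}" for g
 proof(cases "g < 4 * E")
  case True
  hence "inj_on (hsh Q (l g) (sd (l g))) (kp ` U g)" using sl(2) by(simp add: l_def)
  hence "inj_on (hsh Q (l g) (sd (l g)) \<circ> kp) (U g)" using kpinj by(rule comp_inj_on[rotated])
  thus ?thesis by(simp add: comp_def kp_def U_def bk_def)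
 next
  case False
  hence "{a \<in> H. bkt Q \<rho> A (C a) (lo a) = g} = {}" using bk_less by(auto simp: bk_def)
  thus ?thesis by(simp only: inj_on_empty)
 qed
 ultimately have "hash_ok Q \<rho> A sd l"
  using A(1) sl(1,2) inj \<rho> by(auto simp: hash_ok_def odds_def l_def)
 thus ?thesis by blast
qed

end

section \<open>Placement of the records and lookup of a label\<close>

locale elems_hash = elems +
 fixes p p2 Q A :: nat and sd l :: "nat \<Rightarrow> nat"
 assumes red: "reduction p p2 Q" and hok: "hash_ok Q (\<lambda>x. x mod p mod p2) A sd l"
begin

text \<open>The tables of all buckets are laid end to end: \<open>z g\<close> is the start of table
  \<open>g\<close>, \<open>ps c v\<close> the place of a label in it, \<open>Zs\<close> the set of
  occupied places. The elements of a heavy cell fill the slots of the cell in the order of their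
  places, so a record is found by rank in \<open>Zs\<close>. A record consists of the remaining
  label bits and, above them, the index of the element in its cell.\<close>

definition "rho x = x mod p mod p2"
definition "bk c v = bkt Q rho A c v"
definition "z g = (\<Sum>i<g. (2::nat)^l i)"
definition "Ys = z ` {..4 * E}"
definition "ps c v = z (bk c v) + hsh Q (l (bk c v)) (sd (l (bk c v))) (rho (low c v))"
definition "Zs = (\<lambda>a. ps (C a) (lo a)) ` H"
definition "slot a = (if a \<in> H then start (C a) + (rank Zs (ps (C a) (lo a)) - rank Zs (z (4 * ex (C a)))) else a)"
definition "rcd q = (let a = inv_into {..<r} slot q in low (C a) (lo a) + 2^(b - ee (C a)) * (a - start (C a)))"

lemma hok': "A < 2^Q" "sd j < 2^Q" "inj_on rho lowH" "l g \<le> Q"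
 "inj_on (\<lambda>a. hsh Q (l g) (sd (l g)) (rho (low (C a) (lo a)))) {a \<in> H. bk (C a) (lo a) = g}"
 "z (4 * E) \<le> 200 * E"
proof -
 have "(\<lambda>x. x mod p mod p2) = rho" by(simp add: rho_def fun_eq_iff)
 hence "hash_ok Q rho A sd l" using hok by simp
 thus "A < 2^Q" "sd j < 2^Q" "inj_on rho lowH" "l g \<le> Q"
  "inj_on (\<lambda>a. hsh Q (l g) (sd (l g)) (rho (low (C a) (lo a)))) {a \<in> H. bk (C a) (lo a) = g}"
  "z (4 * E) \<le> 200 * E"
  unfolding hash_ok_def bk_def z_def by auto
qed

lemma z_Suc: "z (Suc g) = z g + 2^l g"
 by(simp add: z_def)

lemma z_strict: "g < g' \<Longrightarrow> z g < z g'"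
 by(rule lift_Suc_mono_less[of z]) (simp_all add: z_Suc)

lemma z_mono: "g \<le> g' \<Longrightarrow> z g \<le> z g'"
 using z_strict[of g g'] by(cases "g = g'") auto

lemma z_less_iff: "z g < z g' \<longleftrightarrow> g < g'"
 using z_strict[of g g'] z_mono[of g' g] by(meson leD leI)

lemma Ys_sub: "Ys \<subseteq> {..<z (4 * E) + 1}"
 unfolding Ys_def using z_mono by(auto simp: less_Suc_eq_le)

lemma card_Ys: "card Ys = 4 * E + 1"
proof -
 have "inj_on z {..4 * E}" by(rule inj_onI) (metis z_less_iff less_irrefl nat_neq_iff)
 thus ?thesis by(simp add: Ys_def card_image)
qed

lemma sel_Ys: "g \<le> 4 * E \<Longrightarrow> sel Ys g = z g"
proof(rule sel_eqI)
 assume g: "g \<le> 4 * E"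
 show "finite Ys" by(simp add: Ys_def)
 show "z g \<in> Ys" using g by(simp add: Ys_def)
 have "Ys \<inter> {..<z g} = z ` {..<g}" using g by(auto simp: Ys_def z_less_iff)
 moreover have "inj_on z {..<g}" by(rule inj_onI) (metis z_less_iff less_irrefl nat_neq_iff)
 ultimately show "rank Ys (z g) = g" by(simp add: rank_def card_image)
qed

lemma ps_range: "z (bk c v) \<le> ps c v" "ps c v < z (Suc (bk c v))"
 using hsh_less[OF hok'(4)] by(auto simp: ps_def z_Suc)

lemma ps_bk:
 assumes "ps c v = ps c' v'"
 shows "bk c v = bk c' v'"
proof -
 have "z (bk c v) < z (Suc (bk c' v'))" "z (bk c' v') < z (Suc (bk c v))"
  using ps_range[of c v] ps_range[of c' v'] assms by linarith+
 thus ?thesis unfolding z_less_iff by simp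
qed

lemma bk_range: "4 * ex c \<le> bk c v" "bk c v < 4 * ex c + 2^ee c"
 unfolding bk_def by(rule bkt_range)+

lemma bk_less: "c \<in> As \<Longrightarrow> 2 \<le> cnt c \<Longrightarrow> bk c v < 4 * E"
 using bk_range(2)[of c v] bucket_room_top[of c] by simp

lemma Zs_finite [simp]: "finite Zs"
 by(simp add: Zs_def)

lemma Zs_sub: "Zs \<subseteq> {..<z (4 * E)}"
proof -
 have "ps (C a) (lo a) < z (4 * E)" if "a \<in> H" for a
  using ps_range(2)[of "C a" "lo a"] bk_less[of "C a" "lo a"] heavy_cell[OF that] z_mono[of "Suc (bk (C a) (lo a))" "4 * E"]
  by simp
 thus ?thesis by(auto simp: Zs_def)
qed

lemma ps_inj: "inj_on (\<lambda>a. ps (C a) (lo a)) H"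
proof(rule inj_onI)
 fix a a' assume a: "a \<in> H" "a' \<in> H" "ps (C a) (lo a) = ps (C a') (lo a')"
 hence g: "bk (C a) (lo a) = bk (C a') (lo a')" by(rule_tac ps_bk)
 hence "hsh Q (l (bk (C a) (lo a))) (sd (l (bk (C a) (lo a)))) (rho (low (C a) (lo a))) =
  hsh Q (l (bk (C a) (lo a))) (sd (l (bk (C a) (lo a)))) (rho (low (C a') (lo a')))"
  using a(3) by(simp add: ps_def)
 thus "a = a'" using inj_onD[OF hok'(5)[of "bk (C a) (lo a)"], of a a'] a g by simp
qed

lemma bk_cell: "a \<in> H \<Longrightarrow> c \<in> As \<Longrightarrow> 2 \<le> cnt c \<Longrightarrow> 4 * ex c \<le> bk (C a) (lo a) \<Longrightarrow> bk (C a) (lo a) < 4 * ex c + 2^ee c \<Longrightarrow> C a = c"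
 using bkt_cell[of "C a" c "bk (C a) (lo a)"] heavy_cell[of a] bk_range[of "C a" "lo a"] by blast

text \<open>The tables of a cell lie in an interval of places that starts at
  \<open>z (4 * ex c)\<close> and contains no place of another cell, so the difference of ranks
  counts elements of this cell only.\<close>

lemma slot_offset:
 assumes a: "a \<in> H"
 shows "rank Zs (ps (C a) (lo a)) - rank Zs (z (4 * ex (C a))) =
  card {a'. a' < r \<and> C a' = C a \<and> ps (C a') (lo a') < ps (C a) (lo a)}"
proof -
 let ?c = "C a" and ?\<pi> = "ps (C a) (lo a)"
 note hc = heavy_cell[OF a]
 have le: "z (4 * ex ?c) \<le> ?\<pi>" using z_mono[OF bk_range(1)[of ?c "lo a"]] ps_range(1)[of ?c "lo a"] by simp
 have eq: "Zs \<inter> {..<?\<pi>} - Zs \<inter> {..<z (4 * ex ?c)} =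
   (\<lambda>a. ps (C a) (lo a)) ` {a'. a' < r \<and> C a' = ?c \<and> ps (C a') (lo a') < ?\<pi>}"
 proof(intro equalityI subsetI)
  fix y assume "y \<in> Zs \<inter> {..<?\<pi>} - Zs \<inter> {..<z (4 * ex ?c)}"
  then obtain a' where a': "a' \<in> H" "y = ps (C a') (lo a')" "y < ?\<pi>" "z (4 * ex ?c) \<le> y" by(auto simp: Zs_def)
  have "z (4 * ex ?c) < z (Suc (bk (C a') (lo a')))" using a' ps_range(2)[of "C a'" "lo a'"] by simp
  hence 1: "4 * ex ?c \<le> bk (C a') (lo a')" unfolding z_less_iff by simp
  have "z (bk (C a') (lo a')) < z (Suc (bk ?c (lo a)))"
   using a' ps_range(1)[of "C a'" "lo a'"] ps_range(2)[of ?c "lo a"] by simp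
  hence 2: "bk (C a') (lo a') < 4 * ex ?c + 2^ee ?c" unfolding z_less_iff using bk_range(2)[of ?c "lo a"] by simp
  have "C a' = ?c" using bk_cell[OF a'(1) _ _ 1 2] hc by simp
  thus "y \<in> (\<lambda>a. ps (C a) (lo a)) ` {a'. a' < r \<and> C a' = ?c \<and> ps (C a') (lo a') < ?\<pi>}"
   using a' heavy_cell[OF a'(1)] by auto
 next
  fix y assume "y \<in> (\<lambda>a. ps (C a) (lo a)) ` {a'. a' < r \<and> C a' = ?c \<and> ps (C a') (lo a') < ?\<pi>}"
  then obtain a' where a': "a' < r" "C a' = ?c" "y = ps (C a') (lo a')" "y < ?\<pi>" by auto
  have "z (4 * ex ?c) \<le> y" using z_mono[OF bk_range(1)[of ?c "lo a'"]] ps_range(1)[of ?c "lo a'"] a' by simp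
  moreover have "a' \<in> H" using a' hc by(simp add: H_def)
  hence "y \<in> Zs" unfolding Zs_def a'(3) by(rule imageI)
  ultimately show "y \<in> Zs \<inter> {..<?\<pi>} - Zs \<inter> {..<z (4 * ex ?c)}" using a' by auto
 qed
 have cd: "card (Zs \<inter> {..<?\<pi>} - Zs \<inter> {..<z (4 * ex ?c)}) = rank Zs ?\<pi> - rank Zs (z (4 * ex ?c))"
  unfolding rank_def using le by(intro card_Diff_subset) auto
 have ij: "inj_on (\<lambda>a. ps (C a) (lo a)) {a'. a' < r \<and> C a' = ?c \<and> ps (C a') (lo a') < ?\<pi>}"
  by(rule inj_on_subset[OF ps_inj]) (use hc in \<open>auto simp: H_def\<close>)
 show ?thesis unfolding cd[symmetric] eq by(rule card_image[OF ij])
qed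

lemma slot_bounds:
 assumes a: "a < r"
 shows "start (C a) \<le> slot a" "slot a < start (Suc (C a))"
proof -
 have "start (C a) \<le> slot a \<and> slot a < start (Suc (C a))"
 proof(cases "a \<in> H")
  case True
  have "{a'. a' < r \<and> C a' = C a \<and> ps (C a') (lo a') < ps (C a) (lo a)} \<subset> {a'. a' < r \<and> C a' = C a}"
   using a by blast
  hence "card {a'. a' < r \<and> C a' = C a \<and> ps (C a') (lo a') < ps (C a) (lo a)} < cnt (C a)"
   unfolding cnt_eq by(intro psubset_card_mono) auto
  thus ?thesis unfolding start_Suc slot_def slot_offset[OF True] using True by simp
 next
  case False
  thus ?thesis using start_le_self[OF a] less_start_Suc[OF a] by(simp add: slot_def)
 qed
 thus "start (C a) \<le> slot a" "slot a < start (Suc (C a))" by auto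
qed

lemma slot_less: "a < r \<Longrightarrow> slot a < r"
 using slot_bounds(2)[of a] start_le[of "Suc (C a)"] by simp

lemma slot_inj: "inj_on slot {..<r}"
proof(rule inj_onI)
 fix a a' assume a: "a \<in> {..<r}" "a' \<in> {..<r}" "slot a = slot a'"
 have cc: "C a = C a'"
 proof(rule ccontr)
  assume "C a \<noteq> C a'"
  then consider "C a < C a'" | "C a' < C a" by linarith
  thus False
   using slot_bounds[of a] slot_bounds[of a'] a start_mono[of "Suc (C a)" "C a'"] start_mono[of "Suc (C a')" "C a"]
   by cases auto
 qed
 show "a = a'"
 proof(cases "a \<in> H")
  case True
  hence h': "a' \<in> H" using a cc by(auto simp: H_def)
  have *: "ps (C x) (lo x) \<le> ps (C y) (lo y)" if "x \<in> H" "y \<in> H" "slot x = slot y" "C x = C y" for x y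
  proof(rule ccontr)
   assume "\<not> ?thesis"
   hence lt: "ps (C y) (lo y) < ps (C x) (lo x)" by simp
   have "{a'. a' < r \<and> C a' = C y \<and> ps (C a') (lo a') < ps (C y) (lo y)} \<subset>
     {a'. a' < r \<and> C a' = C x \<and> ps (C a') (lo a') < ps (C x) (lo x)}"
    using lt that heavy_cell[OF that(2)] by fastforce
   hence "card {a'. a' < r \<and> C a' = C y \<and> ps (C a') (lo a') < ps (C y) (lo y)} <
     card {a'. a' < r \<and> C a' = C x \<and> ps (C a') (lo a') < ps (C x) (lo x)}"
    by(intro psubset_card_mono) auto
   thus False using that unfolding slot_def slot_offset[OF that(1)] slot_offset[OF that(2)] by simp
  qed
  have "ps (C a) (lo a) = ps (C a') (lo a')" using *[OF True h' a(3) cc] *[OF h' True a(3)[symmetric] cc[symmetric]] by simp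
  thus ?thesis using inj_onD[OF ps_inj] True h' by blast
 next
  case False
  hence "a' \<notin> H" using a cc by(auto simp: H_def)
  thus ?thesis using False a(3) by(simp add: slot_def)
 qed
qed

lemma rcd_slot: "a < r \<Longrightarrow> rcd (slot a) = low (C a) (lo a) + 2^(b - ee (C a)) * (a - start (C a))"
 by(simp add: rcd_def inv_into_f_f[OF slot_inj])

lemma rcd_parts:
 assumes "a < r"
 shows "rcd (slot a) mod 2^(b - ee (C a)) = low (C a) (lo a)"
  "start (C a) + rcd (slot a) div 2^(b - ee (C a)) = a"
 using start_le_self[OF assms] by(auto simp: rcd_slot[OF assms] low_def)

lemma slot_surj: "slot ` {..<r} = {..<r}"
 using slot_less slot_inj by(intro card_subset_eq) (auto simp: card_image)

lemma rcd_less: "q < r \<Longrightarrow> rcd q < 2^b"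
proof -
 assume "q < r"
 then obtain a where a: "a < r" "q = slot a" using slot_surj by(metis imageE lessThan_iff)
 have "a - start (C a) < 2^ee (C a)"
  using less_start_Suc[OF a(1)] start_Suc[of "C a"] cnt_le_pow[of "C a"] start_le_self[OF a(1)] by linarith
 hence "2^(b - ee (C a)) * (a - start (C a) + 1) \<le> 2^(b - ee (C a)) * 2^ee (C a)" by(intro mult_le_mono2) simp
 also have "... = 2^b" using ee_le(1)[of "C a"] by(simp flip: power_add)
 finally have "2^(b - ee (C a)) * (a - start (C a)) + 2^(b - ee (C a)) \<le> 2^b" by simp
 moreover have "low (C a) (lo a) < 2^(b - ee (C a))" by(simp add: low_def)
 ultimately show ?thesis unfolding a(2) rcd_slot[OF a(1)] by linarith
qed

definition "candidate c v = start c + (rank Zs (ps c v) - rank Zs (z (4 * ex c)))"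

definition "present c v \<longleftrightarrow> (if cnt c = 1 then True else ps c v \<in> Zs)"
definition "place c v = (if cnt c = 1 then start c else candidate c v)"
definition "hit c v \<longleftrightarrow> present c v \<and> rcd (place c v) mod 2^(b - ee c) = low c v"

lemma lookup_complete:
 assumes a: "a < r"
 shows "hit (C a) (lo a)" "place (C a) (lo a) = slot a" "start (C a) + rcd (place (C a) (lo a)) div 2^(b - ee (C a)) = a"
proof -
 have pl: "present (C a) (lo a) \<and> place (C a) (lo a) = slot a"
 proof(cases "a \<in> H")
  case True
  thus ?thesis using heavy_cell[OF True] by(auto simp: present_def place_def slot_def candidate_def Zs_def)
 next
  case False
  have "C a \<in> As" using a by(simp add: As_def)
  hence c1: "cnt (C a) = 1" using cnt_pos_iff[of "C a"] False a by(simp add: H_def)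
  hence "a = start (C a)" using start_le_self[OF a] less_start_Suc[OF a] start_Suc[of "C a"] by simp
  thus ?thesis using c1 False by(simp add: present_def place_def slot_def)
 qed
 thus "hit (C a) (lo a)" "place (C a) (lo a) = slot a" "start (C a) + rcd (place (C a) (lo a)) div 2^(b - ee (C a)) = a"
  using rcd_parts[OF a] by(auto simp: hit_def)
qed

text \<open>An occupied place determines the bucket and the comparison the remaining bits; together
  they determine the whole low part of the label, though its upper bits are stored nowhere. In a
  cell with one element \<open>ee c = 0\<close> and the record is the complete low part.\<close>

lemma lookup_sound:
 assumes c: "c \<in> As" and v: "v < 2^b" and h: "hit c v"
 shows "\<exists>a<r. C a = c \<and> lo a = v"
proof(cases "cnt c = 1")
 case True
 obtain a where a: "a < r" "C a = c" using c by(auto simp: As_def)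
 hence "a = start c" using start_le_self[OF a(1)] less_start_Suc[OF a(1)] start_Suc[of c] True by simp
 moreover have "ee c = 0" using True by(simp add: ee_def)
 moreover have "a \<notin> H" using a True by(simp add: H_def)
 ultimately have "lo a = v"
  using h v rcd_parts(1)[OF a(1)] lo_less[of a] a by(simp add: hit_def place_def slot_def True low_def)
 thus ?thesis using a by blast
next
 case False
 hence c2: "2 \<le> cnt c" using c cnt_pos_iff[of c] by simp
 have "ps c v \<in> Zs" using h False by(simp add: hit_def present_def)
 then obtain a where a: "a \<in> H" "ps c v = ps (C a) (lo a)" by(auto simp: Zs_def)
 have bkeq: "bk (C a) (lo a) = bk c v" using ps_bk[OF a(2)] by simp
 have Ca: "C a = c" using bk_cell[OF a(1) c c2] bk_range[of c v] bkeq by simp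
 have ar: "a < r" using a by(simp add: H_def)
 have "place c v = slot a" using False a Ca by(simp add: place_def candidate_def slot_def)
 hence "low c (lo a) = low c v" using h rcd_parts(1)[OF ar] Ca by(simp add: hit_def)
 hence "lo a = v" using bkt_eqD[of c c Q rho A "lo a" v] c c2 bkeq lo_less v Ca by(simp add: bk_def)
 thus ?thesis using ar Ca by blast
qed

lemma place_less: "c \<in> As \<Longrightarrow> v < 2^b \<Longrightarrow> present c v \<Longrightarrow> place c v < r"
proof -
 assume c: "c \<in> As" and p: "present c v"
 show ?thesis
 proof(cases "cnt c = 1")
  case True thus ?thesis using start_less_r[OF c] by(simp add: place_def)
 next
  case False
  hence c2: "2 \<le> cnt c" using c cnt_pos_iff[of c] by simp
  have "ps c v \<in> Zs" using p False by(simp add: present_def)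
  then obtain a where a: "a \<in> H" "ps c v = ps (C a) (lo a)" by(auto simp: Zs_def)
  have bkeq: "bk (C a) (lo a) = bk c v" using ps_bk[OF a(2)] by simp
  have Ca: "C a = c" using bk_cell[OF a(1) c c2] bk_range[of c v] bkeq by simp
  have "place c v = slot a" using False a Ca by(simp add: place_def candidate_def slot_def)
  thus ?thesis using slot_less[of a] a by(simp add: H_def)
 qed
qed

end

section \<open>The queries\<close>

locale tree_fid = ram Wd Bm Ar for Wd :: "'g \<Rightarrow> nat" and Bm Ar +
 fixes n K b p p2 Q A s lam mu eta off :: "'g \<Rightarrow> nat" and X J sd l :: "'g \<Rightarrow> nat \<Rightarrow> nat"
begin

abbreviation "rr g \<equiv> elems.r (n g)"
abbreviation "CC g \<equiv> elems.C (K g) (b g) (X g) (J g)"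
abbreviation "St g \<equiv> elems.start (n g) (K g) (b g) (X g) (J g)"
abbreviation "SA g \<equiv> elems.As (n g) (K g) (b g) (X g) (J g)"
abbreviation "SB g \<equiv> elems.Bs (n g) (K g) (b g) (X g) (J g)"
abbreviation "Cnt g \<equiv> elems.cnt (n g) (K g) (b g) (X g) (J g)"
abbreviation "Exc g \<equiv> elems.ex (n g) (K g) (b g) (X g) (J g)"
abbreviation "EE g \<equiv> elems.E (n g) (K g) (b g) (X g) (J g)"
abbreviation "Ee g \<equiv> elems.ee (n g) (K g) (b g) (X g) (J g)"
abbreviation "Low g \<equiv> elems.low (n g) (K g) (b g) (X g) (J g)"
abbreviation "Up g \<equiv> elems.up (n g) (K g) (b g) (X g) (J g)"
abbreviation "Rho g \<equiv> elems_hash.rho (p g) (p2 g)"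
abbreviation "Bk g \<equiv> elems_hash.bk (n g) (K g) (b g) (X g) (J g) (p g) (p2 g) (Q g) (A g)"
abbreviation "Zz g \<equiv> elems_hash.z (l g)"
abbreviation "SY g \<equiv> elems_hash.Ys (n g) (K g) (b g) (X g) (J g) (l g)"
abbreviation "Ps g \<equiv> elems_hash.ps (n g) (K g) (b g) (X g) (J g) (p g) (p2 g) (Q g) (A g) (sd g) (l g)"
abbreviation "SZ g \<equiv> elems_hash.Zs (n g) (K g) (b g) (X g) (J g) (p g) (p2 g) (Q g) (A g) (sd g) (l g)"
abbreviation "Rcd g \<equiv> elems_hash.rcd (n g) (K g) (b g) (X g) (J g) (p g) (p2 g) (Q g) (A g) (sd g) (l g)"
abbreviation "Cand g \<equiv> elems_hash.candidate (n g) (K g) (b g) (X g) (J g) (p g) (p2 g) (Q g) (A g) (sd g) (l g)"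
abbreviation "Present g \<equiv> elems_hash.present (n g) (K g) (b g) (X g) (J g) (p g) (p2 g) (Q g) (A g) (sd g) (l g)"
abbreviation "Place g \<equiv> elems_hash.place (n g) (K g) (b g) (X g) (J g) (p g) (p2 g) (Q g) (A g) (sd g) (l g)"
abbreviation "Hit g \<equiv> elems_hash.hit (n g) (K g) (b g) (X g) (J g) (p g) (p2 g) (Q g) (A g) (sd g) (l g)"

definition "tabseg g = arr (s g) (tabs (s g))"
definition "segA g = seld (s g) (lam g) (mu g) 2 (SA g) (n g * K g)"
definition "segB g = seld (s g) (lam g) (mu g) 2 (SB g) (n g)"
definition "segY g = seld (s g) (lam g) (mu g) 2 (SY g) (Zz g (4 * EE g) + 1)"
definition "segZ g = rankd (s g) (lam g) (mu g) (SZ g) (Zz g (4 * EE g))"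
definition "recs g = arr (b g) (map (Rcd g) [0..<rr g])"
definition "hdr g = [s g, lam g, mu g, K g, b g, p g, p2 g, Q g, A g]"
text \<open>A table has at most \<open>2^Q\<close> places, so the exponents 0 to \<open>Q\<close>
  index the seeds.\<close>

definition "seeds g = arr (Q g) (map (sd g) [0..<Q g + 1])"
definition "body g = pack (lam g) (tabseg g) (pack (lam g) (segA g) (pack (lam g) (segB g)
 (pack (lam g) (segY g) (pack (lam g) (segZ g) (recs g)))))"
definition "main g = arr (eta g) (hdr g) @ seeds g @ body g"

definition "good1 g \<longleftrightarrow> elems_hash (n g) (K g) (b g) (X g) (J g) (p g) (p2 g) (Q g) (A g) (sd g) (l g) \<and>
 3 \<le> s g \<and> 4 * s g \<le> Wd g \<and> s g \<le> lam g \<and> lam g \<le> 2 * Wd g \<and> mu g \<le> Wd g \<and> s g * lam g < 2^mu g \<and>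
 cap (lam g) (mu g) (n g * K g + 2) \<and> cap (lam g) (mu g) (200 * n g + 3) \<and> n g \<le> 2^(s g * 8) \<and> n g < 2^Wd g \<and>
 1 \<le> K g \<and> K g \<le> Wd g \<and> b g < Wd g \<and> eta g \<le> Wd g \<and> Q g \<le> b g \<and> (\<forall>v\<in>set (hdr g). v < 2^eta g) \<and>
 tot (tabseg g) < 2^lam g \<and> tot (segA g) < 2^lam g \<and> tot (segB g) < 2^lam g \<and>
 tot (segY g) < 2^lam g \<and> tot (segZ g) < 2^lam g \<and> stored g (off g) (main g)"

definition "good G \<longleftrightarrow> c1 G Wd \<and> c2 G off \<and> c1 G eta \<and> (\<forall>g\<in>G. good1 g)"

definition "o2 g = off g + eta g * 9"
definition "o3 g = off g + eta g * 9 + Q g * (Q g + 1)"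
definition "oT g = o3 g + lam g"
definition "oA g = oT g + tot (tabseg g) + lam g"
definition "oB g = oA g + tot (segA g) + lam g"
definition "oY g = oB g + tot (segB g) + lam g"
definition "oZ g = oY g + tot (segY g) + lam g"
definition "oR g = oZ g + tot (segZ g)"

sublocale fid Wd Bm Ar s lam mu oT .

lemma good_mono: "good G \<Longrightarrow> H \<subseteq> G \<Longrightarrow> good H"
 unfolding good_def by(meson c1_mono c2_mono subsetD)

lemma good1: "good G \<Longrightarrow> g \<in> G \<Longrightarrow> good1 g"
 by(simp add: good_def)

lemma len_hdr [simp]: "length (hdr g) = 9"
 by(simp add: hdr_def)

lemma good_stored:
 assumes "good1 g"
 shows "stored g (off g) (arr (eta g) (hdr g))" "stored g (o2 g) (seeds g)" "stored g (o3 g) (body g)"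
  "stored g (oT g) (tabseg g)" "stored g (oA g) (segA g)" "stored g (oB g) (segB g)" "stored g (oY g) (segY g)"
  "stored g (oZ g) (segZ g)" "stored g (oR g) (recs g)"
  "stored g (o3 g + lam g + tot (tabseg g)) (pack (lam g) (segA g) (pack (lam g) (segB g) (pack (lam g) (segY g) (pack (lam g) (segZ g) (recs g)))))"
  "stored g (oA g + tot (segA g)) (pack (lam g) (segB g) (pack (lam g) (segY g) (pack (lam g) (segZ g) (recs g))))"
  "stored g (oB g + tot (segB g)) (pack (lam g) (segY g) (pack (lam g) (segZ g) (recs g)))"
  "stored g (oY g + tot (segY g)) (pack (lam g) (segZ g) (recs g))"
proof -
 have m: "stored g (off g) (arr (eta g) (hdr g) @ seeds g @ body g)" using assms by(simp add: good1_def main_def)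
 show "stored g (off g) (arr (eta g) (hdr g))" using stored_append[OF m] by simp
 have 2: "stored g (o2 g) (seeds g @ body g)" using stored_append[OF m] by(simp add: o2_def)
 show "stored g (o2 g) (seeds g)" using stored_append[OF 2] by simp
 show 3: "stored g (o3 g) (body g)" using stored_append[OF 2] by(simp add: seeds_def o2_def o3_def)
 have t: "tot (tabseg g) < 2^lam g" "tot (segA g) < 2^lam g" "tot (segB g) < 2^lam g"
  "tot (segY g) < 2^lam g" "tot (segZ g) < 2^lam g" using assms by(auto simp: good1_def)
 note 4 = stored_pack(2,3)[OF 3[unfolded body_def] t(1)]
 note 5 = stored_pack(2,3)[OF 4(2) t(2)]
 note 6 = stored_pack(2,3)[OF 5(2) t(3)]
 note 7 = stored_pack(2,3)[OF 6(2) t(4)]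
 note 8 = stored_pack(2,3)[OF 7(2) t(5)]
 show "stored g (oT g) (tabseg g)" "stored g (oA g) (segA g)" "stored g (oB g) (segB g)" "stored g (oY g) (segY g)"
  "stored g (oZ g) (segZ g)" "stored g (oR g) (recs g)"
  "stored g (o3 g + lam g + tot (tabseg g)) (pack (lam g) (segA g) (pack (lam g) (segB g) (pack (lam g) (segY g) (pack (lam g) (segZ g) (recs g)))))"
  "stored g (oA g + tot (segA g)) (pack (lam g) (segB g) (pack (lam g) (segY g) (pack (lam g) (segZ g) (recs g))))"
  "stored g (oB g + tot (segB g)) (pack (lam g) (segY g) (pack (lam g) (segZ g) (recs g)))"
  "stored g (oY g + tot (segY g)) (pack (lam g) (segZ g) (recs g))"
  using 4 5 6 7 8 by(simp_all add: oT_def oA_def oB_def oY_def oZ_def oR_def)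
qed

lemma good_wd: "good G \<Longrightarrow> c1 G Wd" "good G \<Longrightarrow> ok G"
 using c1_ok by(auto simp: good_def)

lemma good_hdr:
 assumes G: "good G" and i: "i < 9"
 shows "c1 G (\<lambda>g. hdr g ! i)"
proof -
 have c: "c2 G (\<lambda>g. hdr g ! i)"
 proof(rule c2_arr[where p = off and l = eta])
  show "c2 G (\<lambda>_. i)" by(rule c2_const[OF good_wd(1)[OF G]]) (use i in simp)
  fix g assume g: "g \<in> G"
  have "hdr g ! i \<in> set (hdr g)" using i by(intro nth_mem) simp
  thus "stored g (off g) (arr (eta g) (hdr g)) \<and> i < length (hdr g) \<and> hdr g ! i < 2^eta g \<and> eta g \<le> 2 * Wd g"
   using good_stored(1)[OF good1[OF G g]] good1[OF G g] i by(auto simp: good1_def)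
 qed (use G in \<open>auto simp: good_def\<close>)
 thus ?thesis
 proof(rule c1_of_c2)
  fix g assume g: "g \<in> G"
  have "hdr g ! i \<in> set (hdr g)" using i by(intro nth_mem) simp
  hence "hdr g ! i < 2^eta g" "eta g \<le> Wd g" using good1[OF G g] by(auto simp: good1_def)
  moreover from this have "(2::nat)^eta g \<le> 2^Wd g" by(intro power_increasing) auto
  ultimately show "hdr g ! i < 2^Wd g" by linarith
 qed
qed

lemma good_scalars:
 assumes G: "good G"
 shows "c1 G s" "c1 G lam" "c1 G mu" "c1 G K" "c1 G b" "c1 G p" "c1 G p2" "c1 G Q" "c1 G A"
 using good_hdr[OF G, of 0] good_hdr[OF G, of 1] good_hdr[OF G, of 2] good_hdr[OF G, of 3] good_hdr[OF G, of 4]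
  good_hdr[OF G, of 5] good_hdr[OF G, of 6] good_hdr[OF G, of 7] good_hdr[OF G, of 8]
 by(simp_all add: hdr_def numeral_eq_Suc)

lemma stored_bound: "stored g q xs \<Longrightarrow> q + tot xs < 2^(2 * Wd g)"
 using word_bound[of g] by(simp add: stored_def)

lemma good_bases:
 assumes G: "good G"
 shows "c2 G o2" "c2 G o3" "c2 G oT" "c2 G oA" "c2 G oB" "c2 G oY" "c2 G oZ" "c2 G oR"
proof -
 note w = good_wd[OF G] and sc = good_scalars[OF G]
 have o: "c2 G off" "c1 G eta" using G by(auto simp: good_def)
 have st: "stored g (off g) (arr (eta g) (hdr g))" "stored g (o2 g) (seeds g)" "stored g (o3 g) (body g)" if "g \<in> G" for g
  using good_stored(1-3)[OF good1[OF G that]] .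
 have nine: "c1 G (\<lambda>_. 9)" by(rule c1_const[OF w(2)]) simp
 have one: "c1 G (\<lambda>_. 1)" by(rule c1_const[OF w(2)]) simp
 have small: "Q g + 1 < 2^(Wd g div 2)" "9 < (2::nat)^(Wd g div 2)" if "g \<in> G" for g
  using small_two_words[OF w(2) that] good1[OF G that] w(2) that by(auto simp: good1_def ok_def)
 have e9: "c2 G (\<lambda>g. eta g * 9)"
 proof(rule c2_mul[OF c2_of_c1[OF w(1) o(2)] nine])
  fix g assume g: "g \<in> G"
  show "9 < (2::nat)^(Wd g div 2)" using small(2)[OF g] .
  show "eta g * 9 < 2^(2 * Wd g)" using stored_bound[OF st(1)[OF g]] by simp
 qed
 show 2: "c2 G o2" unfolding o2_def
 proof(rule c2_add[OF o(1) e9])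
  fix g assume g: "g \<in> G"
  show "off g + eta g * 9 < 2^(2 * Wd g)" using stored_bound[OF st(1)[OF g]] by simp
 qed
 have Q1: "c1 G (\<lambda>g. Q g + 1)"
 proof(rule c1_add[OF sc(8) one])
  fix g assume g: "g \<in> G"
  have "(2::nat)^(Wd g div 2) \<le> 2^Wd g" by(intro power_increasing) auto
  thus "Q g + 1 < 2^Wd g" using small(1)[OF g] by linarith
 qed
 have QQ: "c2 G (\<lambda>g. Q g * (Q g + 1))"
 proof(rule c2_mul[OF c2_of_c1[OF w(1) sc(8)] Q1 small(1)])
  fix g assume g: "g \<in> G"
  show "Q g * (Q g + 1) < 2^(2 * Wd g)" using stored_bound[OF st(2)[OF g]] by(simp add: seeds_def)
 qed
 show 3: "c2 G o3" unfolding o3_def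
 proof(rule c2_add[OF 2[unfolded o2_def] QQ])
  fix g assume g: "g \<in> G"
  show "off g + eta g * 9 + Q g * (Q g + 1) < 2^(2 * Wd g)" using stored_bound[OF st(2)[OF g]] by(simp add: seeds_def o2_def)
 qed
 have lam2: "lam g \<le> 2 * Wd g" and t: "tot (tabseg g) < 2^lam g" "tot (segA g) < 2^lam g" "tot (segB g) < 2^lam g"
  "tot (segY g) < 2^lam g" "tot (segZ g) < 2^lam g" if "g \<in> G" for g using good1[OF G that] by(auto simp: good1_def)
 note gs = good_stored[OF good1[OF G]]
 show "c2 G oT" unfolding oT_def
  by(rule c2_pack(1)[OF 3 sc(2), of tabseg]) (use gs(3) t(1) lam2 in \<open>auto simp: body_def\<close>)
 have 4: "c2 G (\<lambda>g. o3 g + lam g + tot (tabseg g))"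
  by(rule c2_pack(2)[OF 3 sc(2)]) (use gs(3) t(1) lam2 in \<open>auto simp: body_def\<close>)
 show oA: "c2 G oA" unfolding oA_def oT_def
  by(rule c2_pack(1)[OF 4 sc(2), of segA]) (use gs(10) t(2) lam2 in auto)
 have 5: "c2 G (\<lambda>g. oA g + tot (segA g))" unfolding oA_def oT_def
  by(rule c2_pack(2)[OF 4 sc(2)]) (use gs(10) t(2) lam2 in auto)
 show "c2 G oB" unfolding oB_def
  by(rule c2_pack(1)[OF 5 sc(2), of segB]) (use gs(11) t(3) lam2 in auto)
 have 6: "c2 G (\<lambda>g. oB g + tot (segB g))" unfolding oB_def
  by(rule c2_pack(2)[OF 5 sc(2)]) (use gs(11) t(3) lam2 in auto)
 show "c2 G oY" unfolding oY_def
  by(rule c2_pack(1)[OF 6 sc(2), of segY]) (use gs(12) t(4) lam2 in auto)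
 have 7: "c2 G (\<lambda>g. oY g + tot (segY g))" unfolding oY_def
  by(rule c2_pack(2)[OF 6 sc(2)]) (use gs(12) t(4) lam2 in auto)
 show "c2 G oZ" unfolding oZ_def
  by(rule c2_pack(1)[OF 7 sc(2), of segZ]) (use gs(13) t(5) lam2 in auto)
 show "c2 G oR" unfolding oR_def oZ_def
  by(rule c2_pack(2)[OF 7 sc(2)]) (use gs(13) t(5) lam2 in auto)
qed

lemma good_par: assumes G: "good G" shows "par G"
 unfolding par_def
proof(intro conjI ballI)
 fix g assume g: "g \<in> G"
 note h = good1[OF G g]
 show "stored g (oT g) (arr (s g) (tabs (s g)))" using good_stored(4)[OF h] by(simp add: tabseg_def)
qed (use good_wd[OF G] good_scalars[OF G] good_bases[OF G] good1[OF G] in \<open>auto simp: good1_def\<close>)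

lemma good_eh: "good G \<Longrightarrow> g \<in> G \<Longrightarrow> elems_hash (n g) (K g) (b g) (X g) (J g) (p g) (p2 g) (Q g) (A g) (sd g) (l g)"
 using good1[of G g] by(simp add: good1_def)

lemma good_caps:
 assumes "good G" "g \<in> G"
 shows "cap (lam g) (mu g) (n g * K g)" "cap (lam g) (mu g) (n g * K g + 2)" "cap (lam g) (mu g) (n g)" "cap (lam g) (mu g) (n g + 2)"
  "cap (lam g) (mu g) (Zz g (4 * EE g))" "cap (lam g) (mu g) (Zz g (4 * EE g) + 1)" "cap (lam g) (mu g) (Zz g (4 * EE g) + 1 + 2)"
  "n g * K g + 2 < 2^lam g" "200 * n g + 3 < 2^lam g" "Zz g (4 * EE g) \<le> 200 * n g" "(2::nat)^lam g \<le> 2^(2 * Wd g)"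
proof -
 interpret e: elems_hash "n g" "K g" "b g" "X g" "J g" "p g" "p2 g" "Q g" "A g" "sd g" "l g" by(rule good_eh[OF assms])
 have c: "cap (lam g) (mu g) (n g * K g + 2)" "cap (lam g) (mu g) (200 * n g + 3)" "lam g \<le> 2 * Wd g"
  using good1[OF assms] by(auto simp: good1_def)
 have "e.E \<le> n g" by(simp add: e.E_def e.r_def)
 thus z: "Zz g (4 * EE g) \<le> 200 * n g" using e.hok'(6) by linarith
 show "cap (lam g) (mu g) (n g * K g)" "cap (lam g) (mu g) (n g * K g + 2)" by(rule cap_mono[OF c(1)], simp)+
 show "cap (lam g) (mu g) (n g)" "cap (lam g) (mu g) (n g + 2)"
  "cap (lam g) (mu g) (Zz g (4 * EE g))" "cap (lam g) (mu g) (Zz g (4 * EE g) + 1)" "cap (lam g) (mu g) (Zz g (4 * EE g) + 1 + 2)"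
  by(rule cap_mono[OF c(2)], use z in linarith)+
 show "n g * K g + 2 < 2^lam g" using cap_less[OF c(1)] by linarith
 show "200 * n g + 3 < 2^lam g" using cap_less[OF c(2)] by linarith
 show "(2::nat)^lam g \<le> 2^(2 * Wd g)" using c(3) by(intro power_increasing) auto
qed

lemma c_rank_A:
 assumes G: "good G" and i: "c2 G i" and b: "\<And>g. g \<in> G \<Longrightarrow> i g \<le> n g * K g"
 shows "c2 G (\<lambda>g. rank (SA g) (i g))"
proof(rule c_rank_of_seld[OF good_par[OF G] good_bases(4)[OF G] i, where d = 1 and N = "\<lambda>g. n g * K g"])
 fix g assume g: "g \<in> G"
 interpret e: elems_hash "n g" "K g" "b g" "X g" "J g" "p g" "p2 g" "Q g" "A g" "sd g" "l g" by(rule good_eh[OF G g])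
 show "stored g (oA g) (seld (s g) (lam g) (mu g) (Suc 1) (SA g) (n g * K g)) \<and> i g \<le> n g * K g \<and>
   cap (lam g) (mu g) (n g * K g) \<and> SA g \<subseteq> {..<n g * K g}"
  using good_stored(5)[OF good1[OF G g]] b[OF g] good_caps(1)[OF G g] e.As_sub
  unfolding segA_def by(simp add: numeral_2_eq_2)
qed

lemma c_rank_B:
 assumes G: "good G" and i: "c2 G i" and b: "\<And>g. g \<in> G \<Longrightarrow> i g \<le> n g"
 shows "c2 G (\<lambda>g. rank (SB g) (i g))"
proof(rule c_rank_of_seld[OF good_par[OF G] good_bases(5)[OF G] i, where d = 1 and N = n])
 fix g assume g: "g \<in> G"
 interpret e: elems_hash "n g" "K g" "b g" "X g" "J g" "p g" "p2 g" "Q g" "A g" "sd g" "l g" by(rule good_eh[OF G g])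
 show "stored g (oB g) (seld (s g) (lam g) (mu g) (Suc 1) (SB g) (n g)) \<and> i g \<le> n g \<and>
   cap (lam g) (mu g) (n g) \<and> SB g \<subseteq> {..<n g}"
  using good_stored(6)[OF good1[OF G g]] b[OF g] good_caps(3)[OF G g] e.Bs_sub
  unfolding segB_def by(simp add: numeral_2_eq_2)
qed

lemma c_sel_A:
 assumes G: "good G" and i: "c2 G i" and b: "\<And>g. g \<in> G \<Longrightarrow> i g < card (SA g)"
 shows "c2 G (\<lambda>g. sel (SA g) (i g))"
proof(rule c_sel[OF good_par[OF G] good_bases(4)[OF G] i, where d = 2 and N = "\<lambda>g. n g * K g"])
 fix g assume g: "g \<in> G"
 interpret e: elems_hash "n g" "K g" "b g" "X g" "J g" "p g" "p2 g" "Q g" "A g" "sd g" "l g" by(rule good_eh[OF G g])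
 show "stored g (oA g) (seld (s g) (lam g) (mu g) 2 (SA g) (n g * K g)) \<and> i g < card (SA g) \<and>
   cap (lam g) (mu g) (n g * K g + 2) \<and> SA g \<subseteq> {..<n g * K g}"
  using good_stored(5)[OF good1[OF G g]] b[OF g] good_caps(2)[OF G g] e.As_sub unfolding segA_def by simp
qed

lemma c_sel_B:
 assumes G: "good G" and i: "c2 G i" and b: "\<And>g. g \<in> G \<Longrightarrow> i g < card (SB g)"
 shows "c2 G (\<lambda>g. sel (SB g) (i g))"
proof(rule c_sel[OF good_par[OF G] good_bases(5)[OF G] i, where d = 2 and N = n])
 fix g assume g: "g \<in> G"
 interpret e: elems_hash "n g" "K g" "b g" "X g" "J g" "p g" "p2 g" "Q g" "A g" "sd g" "l g" by(rule good_eh[OF G g])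
 show "stored g (oB g) (seld (s g) (lam g) (mu g) 2 (SB g) (n g)) \<and> i g < card (SB g) \<and>
   cap (lam g) (mu g) (n g + 2) \<and> SB g \<subseteq> {..<n g}"
  using good_stored(6)[OF good1[OF G g]] b[OF g] good_caps(4)[OF G g] e.Bs_sub unfolding segB_def by simp
qed

lemma c_z:
 assumes G: "good G" and i: "c2 G i" and b: "\<And>g. g \<in> G \<Longrightarrow> i g \<le> 4 * EE g"
 shows "c2 G (\<lambda>g. Zz g (i g))"
proof -
 have "c2 G (\<lambda>g. sel (SY g) (i g))"
 proof(rule c_sel[OF good_par[OF G] good_bases(6)[OF G] i, where d = 2 and N = "\<lambda>g. Zz g (4 * EE g) + 1"])
  fix g assume g: "g \<in> G"
  interpret e: elems_hash "n g" "K g" "b g" "X g" "J g" "p g" "p2 g" "Q g" "A g" "sd g" "l g" by(rule good_eh[OF G g])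
  show "stored g (oY g) (seld (s g) (lam g) (mu g) 2 (SY g) (Zz g (4 * EE g) + 1)) \<and> i g < card (SY g) \<and>
    cap (lam g) (mu g) (Zz g (4 * EE g) + 1 + 2) \<and> SY g \<subseteq> {..<Zz g (4 * EE g) + 1}"
   using good_stored(7)[OF good1[OF G g]] b[OF g] good_caps(7)[OF G g] e.Ys_sub e.card_Ys unfolding segY_def by simp
 qed
 thus ?thesis
 proof(rule c2_cong)
  fix g assume g: "g \<in> G"
  interpret e: elems_hash "n g" "K g" "b g" "X g" "J g" "p g" "p2 g" "Q g" "A g" "sd g" "l g" by(rule good_eh[OF G g])
  show "sel (SY g) (i g) = Zz g (i g)" by(rule e.sel_Ys[OF b[OF g]])
 qed
qed

lemma c_rank_Z:
 assumes G: "good G" and i: "c2 G i" and b: "\<And>g. g \<in> G \<Longrightarrow> i g \<le> Zz g (4 * EE g)"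
 shows "c2 G (\<lambda>g. rank (SZ g) (i g))"
proof(rule c_rank[OF good_par[OF G] good_bases(7)[OF G] i, where N = "\<lambda>g. Zz g (4 * EE g)"])
 fix g assume g: "g \<in> G"
 interpret e: elems_hash "n g" "K g" "b g" "X g" "J g" "p g" "p2 g" "Q g" "A g" "sd g" "l g" by(rule good_eh[OF G g])
 show "stored g (oZ g) (rankd (s g) (lam g) (mu g) (SZ g) (Zz g (4 * EE g))) \<and> i g \<le> Zz g (4 * EE g) \<and>
   cap (lam g) (mu g) (Zz g (4 * EE g)) \<and> SZ g \<subseteq> {..<Zz g (4 * EE g)}"
  using good_stored(8)[OF good1[OF G g]] b[OF g] good_caps(5)[OF G g] e.Zs_sub unfolding segZ_def by simp
qed

lemma cb_mem_Z:
 assumes G: "good G" and i: "c2 G i" and b: "\<And>g. g \<in> G \<Longrightarrow> i g < Zz g (4 * EE g)"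
 shows "cb G (\<lambda>g. i g \<in> SZ g)"
proof(rule cb_mem[OF good_par[OF G] good_bases(7)[OF G] i, where N = "\<lambda>g. Zz g (4 * EE g)"])
 fix g assume g: "g \<in> G"
 interpret e: elems_hash "n g" "K g" "b g" "X g" "J g" "p g" "p2 g" "Q g" "A g" "sd g" "l g" by(rule good_eh[OF G g])
 show "stored g (oZ g) (rankd (s g) (lam g) (mu g) (SZ g) (Zz g (4 * EE g))) \<and> i g < Zz g (4 * EE g) \<and>
   cap (lam g) (mu g) (Zz g (4 * EE g)) \<and> SZ g \<subseteq> {..<Zz g (4 * EE g)}"
  using good_stored(8)[OF good1[OF G g]] b[OF g] good_caps(5)[OF G g] e.Zs_sub unfolding segZ_def by simp
qed

lemma c_start_cell:
 assumes G: "good G" and c: "c2 G c" and b: "\<And>g. g \<in> G \<Longrightarrow> c g \<le> n g * K g"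
 shows "c2 G (\<lambda>g. St g (c g))"
proof -
 have "c2 G (\<lambda>g. sel (SB g) (rank (SA g) (c g)))"
 proof(rule c_sel_B[OF G c_rank_A[OF G c b]])
  fix g assume g: "g \<in> G"
  interpret e: elems_hash "n g" "K g" "b g" "X g" "J g" "p g" "p2 g" "Q g" "A g" "sd g" "l g" by(rule good_eh[OF G g])
  show "rank (SA g) (c g) < card (SB g)" using rank_le_card[of "SA g" "c g"] e.card_Bs by simp
 qed
 thus ?thesis
 proof(rule c2_cong)
  fix g assume g: "g \<in> G"
  interpret e: elems_hash "n g" "K g" "b g" "X g" "J g" "p g" "p2 g" "Q g" "A g" "sd g" "l g" by(rule good_eh[OF G g])
  show "sel (SB g) (rank (SA g) (c g)) = St g (c g)" by(rule e.sel_Bs)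
 qed
qed

lemma K_small: "good G \<Longrightarrow> g \<in> G \<Longrightarrow> 0 < K g \<and> K g < 2^(Wd g div 2)"
 using small_two_words[OF good_wd(2), of G g "K g"] good1[of G g] by(auto simp: good1_def)

text \<open>The children of node \<open>x\<close> lie in the cells \<open>x * K\<close> to
  \<open>x * K + K - 1\<close>, so the start of the first of these is the number of nonroot nodes
  whose parent precedes \<open>x\<close>.\<close>

lemma c_first_child:
 assumes G: "good G" and x: "c2 G x" and b: "\<And>g. g \<in> G \<Longrightarrow> x g \<le> n g"
 shows "c2 G (\<lambda>g. x g * K g)" "c2 G (\<lambda>g. St g (x g * K g))"
proof -
 have le: "x g * K g \<le> n g * K g" if "g \<in> G" for g using b[OF that] by(rule mult_le_mono1)
 show m: "c2 G (\<lambda>g. x g * K g)"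
 proof(rule c2_mul[OF x good_scalars(4)[OF G]])
  fix g assume g: "g \<in> G"
  show "K g < 2^(Wd g div 2)" using K_small[OF G g] by blast
  show "x g * K g < 2^(2 * Wd g)" using le[OF g] good_caps(8,11)[OF G g] by linarith
 qed
 show "c2 G (\<lambda>g. St g (x g * K g))" by(rule c_start_cell[OF G m le])
qed

text \<open>Rank in the vector of starts gives the ordinal of the cell, select in the vector of
  cells its number, and division by \<open>K\<close> removes the high part of the label.\<close>

lemma c_parent_elem:
 assumes G: "good G" and a: "c2 G a" and b: "\<And>g. g \<in> G \<Longrightarrow> a g < rr g"
 shows "c2 G (\<lambda>g. X g (a g))"
proof -
 note w = good_wd(1)[OF G]
 have one: "c2 G (\<lambda>_. 1)" by(rule c2_const[OF w]) simp
 have rn: "rr g < n g" if "g \<in> G" for g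
 proof -
  interpret e: elems_hash "n g" "K g" "b g" "X g" "J g" "p g" "p2 g" "Q g" "A g" "sd g" "l g" by(rule good_eh[OF G that])
  show ?thesis using e.n_pos by(simp add: e.r_def)
 qed
 have a1: "c2 G (\<lambda>g. a g + 1)"
 proof(rule c2_add[OF a one])
  fix g assume g: "g \<in> G"
  show "a g + 1 < 2^(2 * Wd g)" using b[OF g] rn[OF g] good_caps(9,11)[OF G g] by linarith
 qed
 have rB: "c2 G (\<lambda>g. rank (SB g) (a g + 1))"
 proof(rule c_rank_B[OF G a1])
  fix g assume g: "g \<in> G"
  show "a g + 1 \<le> n g" using b[OF g] rn[OF g] by linarith
 qed
 have e1: "rank (SB g) (a g + 1) = Suc (rank (SA g) (CC g (a g)))" "sel (SA g) (rank (SB g) (a g + 1) - 1) = CC g (a g)"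
  "rank (SA g) (CC g (a g)) < card (SA g)" "CC g (a g) div K g = X g (a g)" if g: "g \<in> G" for g
 proof -
  interpret e: elems_hash "n g" "K g" "b g" "X g" "J g" "p g" "p2 g" "Q g" "A g" "sd g" "l g" by(rule good_eh[OF G g])
  show "rank (SB g) (a g + 1) = Suc (rank (SA g) (CC g (a g)))" "sel (SA g) (rank (SB g) (a g + 1) - 1) = CC g (a g)"
   using e.sel_As[OF b[OF g]] by simp_all
  have m: "CC g (a g) \<in> SA g" unfolding e.As_def using b[OF g] by blast
  have "rank (SA g) (CC g (a g)) < rank (SA g) (Suc (CC g (a g)))" by(rule rank_strict[OF m]) simp
  also have "... \<le> card (SA g)" by(rule rank_le_card) simp
  finally show "rank (SA g) (CC g (a g)) < card (SA g)" .
  show "CC g (a g) div K g = X g (a g)" using e.hi_less[OF b[OF g]] by(simp add: e.C_def)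
 qed
 have "c2 G (\<lambda>g. rank (SB g) (a g + 1) - 1)"
 proof(rule c2_sub[OF rB one])
  fix g assume g: "g \<in> G"
  show "1 \<le> rank (SB g) (a g + 1)" unfolding e1(1)[OF g] by simp
 qed
 hence "c2 G (\<lambda>g. sel (SA g) (rank (SB g) (a g + 1) - 1))"
 proof(rule c_sel_A[OF G])
  fix g assume g: "g \<in> G"
  show "rank (SB g) (a g + 1) - 1 < card (SA g)" unfolding e1(1)[OF g] using e1(3)[OF g] by simp
 qed
 hence "c2 G (\<lambda>g. CC g (a g))" by(rule c2_cong) (rule e1(2))
 from c2_divmod(1)[OF this good_scalars(4)[OF G] K_small[OF G]]
 show ?thesis by(rule c2_cong) (simp_all add: e1(4))
qed

lemma c1_hsh:
 assumes q: "c1 G q" and l: "c1 G l'" and a: "c1 G a" and x: "c1 G x"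
  and b: "\<And>g. g \<in> G \<Longrightarrow> l' g \<le> q g \<and> q g \<le> Wd g"
 shows "c1 G (\<lambda>g. hsh (q g) (l' g) (a g) (x g))"
proof -
 have "c1 G (\<lambda>g. (a g * x g) mod 2^Wd g mod 2^q g div 2^(q g - l' g))"
  by(intro c1_shr c1_modpow c1_mulmod c1_sub a x q l) (use b in auto)
 thus ?thesis
 proof(rule c1_cong)
  fix g assume g: "g \<in> G"
  have "(a g * x g) mod 2^Wd g mod 2^q g = (a g * x g) mod 2^q g"
   by(rule mod_mod_cancel) (use b[OF g] in \<open>simp add: le_imp_power_dvd\<close>)
  thus "(a g * x g) mod 2^Wd g mod 2^q g div 2^(q g - l' g) = hsh (q g) (l' g) (a g) (x g)"
   by(simp add: hsh_def)
 qed
qed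

lemma c_seed:
 assumes G: "good G" and i: "c1 G i" and b: "\<And>g. g \<in> G \<Longrightarrow> i g \<le> Q g"
 shows "c1 G (\<lambda>g. sd g (i g))"
proof -
 have sb: "sd g (i g) < 2^Q g" "Q g \<le> Wd g" if g: "g \<in> G" for g
 proof -
  interpret e: elems_hash "n g" "K g" "b g" "X g" "J g" "p g" "p2 g" "Q g" "A g" "sd g" "l g" by(rule good_eh[OF G g])
  show "sd g (i g) < 2^Q g" by(rule e.hok'(2))
  show "Q g \<le> Wd g" using good1[OF G g] by(auto simp: good1_def)
 qed
 have "c2 G (\<lambda>g. map (sd g) [0..<Q g + 1] ! i g)"
 proof(rule c2_arr[OF good_bases(1)[OF G] good_scalars(8)[OF G] c2_of_c1[OF good_wd(1)[OF G] i]])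
  fix g assume g: "g \<in> G"
  show "stored g (o2 g) (arr (Q g) (map (sd g) [0..<Q g + 1])) \<and> i g < length (map (sd g) [0..<Q g + 1]) \<and>
   map (sd g) [0..<Q g + 1] ! i g < 2^Q g \<and> Q g \<le> 2 * Wd g"
   using good_stored(2)[OF good1[OF G g]] b[OF g] sb[OF g] unfolding seeds_def by(simp del: upt_Suc)
 qed
 hence "c2 G (\<lambda>g. sd g (i g))" by(rule c2_cong) (use b in \<open>simp add: le_imp_less_Suc del: upt_Suc\<close>)
 thus ?thesis
 proof(rule c1_of_c2)
  fix g assume g: "g \<in> G"
  have "(2::nat)^Q g \<le> 2^Wd g" using sb(2)[OF g] by(intro power_increasing) auto
  thus "sd g (i g) < 2^Wd g" using sb(1)[OF g] by linarith
 qed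
qed

lemma c_rcd:
 assumes G: "good G" and i: "c2 G i" and b: "\<And>g. g \<in> G \<Longrightarrow> i g < rr g"
 shows "c1 G (\<lambda>g. Rcd g (i g))"
proof -
 have sb: "Rcd g (i g) < 2^b g" "b g \<le> Wd g" if g: "g \<in> G" for g
 proof -
  interpret e: elems_hash "n g" "K g" "b g" "X g" "J g" "p g" "p2 g" "Q g" "A g" "sd g" "l g" by(rule good_eh[OF G g])
  show "Rcd g (i g) < 2^b g" by(rule e.rcd_less[OF b[OF g]])
  show "b g \<le> Wd g" using good1[OF G g] by(auto simp: good1_def)
 qed
 have "c2 G (\<lambda>g. map (Rcd g) [0..<rr g] ! i g)"
 proof(rule c2_arr[OF good_bases(8)[OF G] good_scalars(5)[OF G] i])
  fix g assume g: "g \<in> G"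
  show "stored g (oR g) (arr (b g) (map (Rcd g) [0..<rr g])) \<and> i g < length (map (Rcd g) [0..<rr g]) \<and>
   map (Rcd g) [0..<rr g] ! i g < 2^b g \<and> b g \<le> 2 * Wd g"
   using good_stored(9)[OF good1[OF G g]] b[OF g] sb[OF g] unfolding recs_def by simp
 qed
 hence "c2 G (\<lambda>g. Rcd g (i g))" by(rule c2_cong) (use b in simp)
 thus ?thesis
 proof(rule c1_of_c2)
  fix g assume g: "g \<in> G"
  have "(2::nat)^b g \<le> 2^Wd g" using sb(2)[OF g] by(intro power_increasing) auto
  thus "Rcd g (i g) < 2^Wd g" using sb(1)[OF g] by linarith
 qed
qed

lemma c_heavy:
 assumes G: "good G" and c: "c2 G c" and v: "c1 G v"
  and b: "\<And>g. g \<in> G \<Longrightarrow> c g \<in> SA g \<and> 2 \<le> Cnt g (c g) \<and> v g < 2^b g"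
  and st: "c2 G (\<lambda>g. St g (c g))" and ee: "c1 G (\<lambda>g. Ee g (c g))" and lw: "c1 G (\<lambda>g. Low g (c g) (v g))"
 shows "cb G (\<lambda>g. Ps g (c g) (v g) \<in> SZ g)" "c2 G (\<lambda>g. Cand g (c g) (v g))"
proof -
 let ?B = "\<lambda>g. Bk g (c g) (v g)" and ?P = "\<lambda>g. Ps g (c g) (v g)" and ?R = "\<lambda>g. Rho g (Low g (c g) (v g))"
  and ?U = "\<lambda>g. Up g (c g) (v g)" and ?S = "\<lambda>g. St g (c g)" and ?E = "\<lambda>g. Ee g (c g)" and ?X = "\<lambda>g. Exc g (c g)"
  and ?h = "\<lambda>g. hsh (Q g) (Ee g (c g)) (A g) (Rho g (Low g (c g) (v g)))"
 note w = good_wd[OF G] and sc = good_scalars[OF G]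
 have cN: "c g \<le> n g * K g" if g: "g \<in> G" for g
 proof -
  interpret e: elems_hash "n g" "K g" "b g" "X g" "J g" "p g" "p2 g" "Q g" "A g" "sd g" "l g" by(rule good_eh[OF G g])
  show ?thesis using e.As_sub b[OF g] by auto
 qed
 have rA: "c2 G (\<lambda>g. rank (SA g) (c g))" by(rule c_rank_A[OF G c cN])
 have F: "?E g \<le> Q g" "?E g \<le> b g" "Q g \<le> Wd g" "b g < Wd g" "rank (SA g) (c g) \<le> ?S g"
  "?X g = ?S g - rank (SA g) (c g)" "?U g < 2^?E g"
  "4 * ?X g \<le> ?B g" "?B g < 4 * EE g" "EE g \<le> n g"
  "Rho g x = x mod p g mod p2 g" "Low g y t = t mod 2^(b g - Ee g y)" "Up g y t = t div 2^(b g - Ee g y)"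
  "?B g = 4 * ?X g + (?U g + ?h g) mod 2^?E g"
  "Zz g (Suc i) = Zz g i + 2^l g i" "l g i \<le> Q g" "Zz g (4 * EE g) \<le> 200 * EE g"
  "Ps g y t = Zz g (Bk g y t) + hsh (Q g) (l g (Bk g y t)) (sd g (l g (Bk g y t))) (Rho g (Low g y t))"
  "?P g < Zz g (4 * EE g)" "z \<le> 4 * EE g \<Longrightarrow> Zz g z \<le> Zz g (4 * EE g)"
  "Cand g y t = St g y + (rank (SZ g) (Ps g y t) - rank (SZ g) (Zz g (4 * Exc g y)))"
  "rank (SZ g) (Zz g (4 * ?X g)) \<le> rank (SZ g) (?P g)" "St g y \<le> n g"
  "rank (SZ g) (Ps g y t) \<le> n g"
  if g: "g \<in> G" for g x y t i z
 proof -
  interpret e: elems_hash "n g" "K g" "b g" "X g" "J g" "p g" "p2 g" "Q g" "A g" "sd g" "l g" by(rule good_eh[OF G g])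
  show "?E g \<le> Q g" using e.red unfolding e.reduction_def by blast
  show "?E g \<le> b g" by(rule e.ee_le)
  show "Q g \<le> Wd g" "b g < Wd g" using good1[OF G g] by(auto simp: good1_def)
  show "rank (SA g) (c g) \<le> ?S g" by(rule e.rank_As_le)
  show "?X g = ?S g - rank (SA g) (c g)" by(rule e.ex_def)
  show "?U g < 2^?E g" using b[OF g] by(intro e.up_less) simp
  show ex: "4 * ?X g \<le> ?B g" by(rule e.bk_range)
  show bk: "?B g < 4 * EE g" using b[OF g] by(intro e.bk_less) auto
  show "EE g \<le> n g" by(simp add: e.E_def e.r_def)
  show "Rho g x = x mod p g mod p2 g" by(rule e.rho_def)
  show "Low g y t = t mod 2^(b g - Ee g y)" by(rule e.low_def)
  show "Up g y t = t div 2^(b g - Ee g y)" by(rule e.up_def)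
  show "?B g = 4 * ?X g + (?U g + ?h g) mod 2^?E g"
   by(simp add: e.bk_def e.bkt_def)
  show "Zz g (Suc i) = Zz g i + 2^l g i" by(rule e.z_Suc)
  show "l g i \<le> Q g" by(rule e.hok'(4))
  show "Zz g (4 * EE g) \<le> 200 * EE g" by(rule e.hok'(6))
  show "Ps g y t = Zz g (Bk g y t) + hsh (Q g) (l g (Bk g y t)) (sd g (l g (Bk g y t))) (Rho g (Low g y t))" by(rule e.ps_def)
  show "?P g < Zz g (4 * EE g)"
   using e.ps_range(2)[of "c g" "v g"] e.z_mono[of "Suc (e.bk (c g) (v g))" "4 * e.E"] bk by simp
  show "z \<le> 4 * EE g \<Longrightarrow> Zz g z \<le> Zz g (4 * EE g)" by(rule e.z_mono)
  show "Cand g y t = St g y + (rank (SZ g) (Ps g y t) - rank (SZ g) (Zz g (4 * Exc g y)))" by(rule e.candidate_def)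
  show "rank (SZ g) (Zz g (4 * ?X g)) \<le> rank (SZ g) (?P g)"
   by(rule rank_mono) (use e.z_mono[OF ex] e.ps_range(1)[of "c g" "v g"] in simp)
  show "St g y \<le> n g" using e.start_le[of y] by(simp add: e.r_def)
  have "card (SZ g) \<le> card e.H" unfolding e.Zs_def by(rule card_image_le) simp
  also have "... \<le> card {..<e.r}" by(rule card_mono) (auto simp: e.H_def)
  finally show "rank (SZ g) (Ps g y t) \<le> n g" using rank_le_card[of "SZ g" "Ps g y t"] by(simp add: e.r_def)
 qed
 have B2: "200 * n g + 3 < 2^(2 * Wd g)" if "g \<in> G" for g using good_caps(9,11)[OF G that] by linarith
 have four: "c1 G (\<lambda>_. 4)" by(rule c1_const[OF w(2)]) simp
 have one: "c2 G (\<lambda>_. 1)" by(rule c2_const[OF w(1)]) simp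
 have b4: "4 < (2::nat)^(Wd g div 2)" if "g \<in> G" for g
  using small_two_words[OF w(2) that, of 4] w(2) that by(auto simp: ok_def)
 have be: "c1 G (\<lambda>g. b g - ?E g)" by(rule c1_sub[OF sc(5) ee]) (use F in auto)
 have up: "c1 G (\<lambda>g. ?U g)" by(rule c1_cong[OF c1_shr[OF v be]]) (simp add: F(13))
 have rho: "c1 G (\<lambda>g. ?R g)"
  by(rule c1_cong[OF c1_mod[OF c1_mod[OF lw sc(6)] sc(7)]]) (simp add: F(11))
 have h1: "c1 G (\<lambda>g. ?h g)"
  by(rule c1_hsh[OF sc(8) ee sc(9) rho]) (use F in blast)
 have beta: "c1 G (\<lambda>g. (?U g + ?h g) mod 2^?E g)"
 proof(rule c1_modpow[OF c1_add[OF up h1] ee])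
  fix g assume g: "g \<in> G"
  have "?h g < 2^?E g" by(rule hsh_less[OF F(1)[OF g]])
  hence "?U g + ?h g < 2^Suc (?E g)"
   using F(7)[OF g] by simp
  also have "(2::nat)^Suc (?E g) \<le> 2^Wd g" using F(2,4)[OF g] by(intro power_increasing) auto
  finally show "?U g + ?h g < 2^Wd g" .
  show "?E g \<le> Wd g" using F(2,4)[OF g] by simp
 qed
 have ex: "c2 G (\<lambda>g. ?X g)" by(rule c2_cong[OF c2_sub[OF st rA]]) (use F(5,6) in auto)
 have ex4: "c2 G (\<lambda>g. ?X g * 4)"
 proof(rule c2_mul[OF ex four b4])
  fix g assume g: "g \<in> G"
  show "?X g * 4 < 2^(2 * Wd g)" using F(8-10)[OF g] B2[OF g] by linarith
 qed
 have bk: "c2 G (\<lambda>g. ?B g)"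
 proof(rule c2_cong[OF c2_add[OF ex4 c2_of_c1[OF w(1) beta]]])
  fix g assume g: "g \<in> G"
  show e: "?X g * 4 + (?U g + ?h g) mod 2^?E g =
    ?B g" using F(14)[OF g] by simp
  show "?X g * 4 + (?U g + ?h g) mod 2^?E g <
    2^(2 * Wd g)" unfolding e using F(9,10)[OF g] B2[OF g] by linarith
 qed
 have bk1: "c2 G (\<lambda>g. ?B g + 1)"
 proof(rule c2_add[OF bk one])
  fix g assume g: "g \<in> G"
  show "?B g + 1 < 2^(2 * Wd g)" using F(9,10)[OF g] B2[OF g] by linarith
 qed
 have z0: "c2 G (\<lambda>g. Zz g (?B g))" by(rule c_z[OF G bk]) (use F(9) less_imp_le in blast)
 have z1: "c2 G (\<lambda>g. Zz g (?B g + 1))" by(rule c_z[OF G bk1]) (use F(9) in \<open>simp add: Suc_leI\<close>)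
 \<comment> \<open>The exponent of a table size is not stored: it is the logarithm of the difference
   of two neighbouring table starts.\<close>
 have zd: "Zz g (?B g + 1) - Zz g (?B g) = 2^l g (?B g)" if "g \<in> G" for g
  using F(15)[OF that] by simp
 have len: "c1 G (\<lambda>g. 2^l g (?B g))"
 proof(rule c1_cong[OF c1_of_c2[OF c2_sub[OF z1 z0]]])
  fix g assume g: "g \<in> G"
  show "Zz g (?B g) \<le> Zz g (?B g + 1)" using F(15)[OF g] by simp
  have "l g (?B g) < Wd g" using F(16)[OF g] good1[OF G g] F(4)[OF g] unfolding good1_def by(meson le_less_trans le_trans)
  thus "Zz g (?B g + 1) - Zz g (?B g) < 2^Wd g" unfolding zd[OF g] by simp
  show "Zz g (?B g + 1) - Zz g (?B g) = 2^l g (?B g)" by(rule zd[OF g])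
 qed
 have "c1 G (\<lambda>g. ceillog2 (2^l g (?B g)))"
 proof(rule c_ceillog2[OF good_par[OF G] len])
  fix g assume g: "g \<in> G"
  have "2^l g (?B g) \<le> Zz g (Suc (?B g))" using F(15)[OF g] by simp
  also have "... \<le> Zz g (4 * EE g)" using F(9)[OF g] by(intro F(20)[OF g]) simp
  also have "... \<le> 200 * EE g" by(rule F(17)[OF g])
  \<comment> \<open>From \<open>n g \<le> 2^(s g * 8)\<close>, \<open>200 \<le> 2^8\<close> and
    \<open>3 \<le> s g\<close> it follows that twelve rounds of \<open>s g\<close> bits suffice for
    the logarithm.\<close>
  also have "... \<le> 2^8 * 2^(s g * 8)" using F(10)[OF g] good1[OF G g] unfolding good1_def by(intro mult_le_mono) auto
  also have "... = 2^(8 + s g * 8)" by(simp add: power_add)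
  also have "... \<le> 2^(s g * 12)" using good1[OF G g] unfolding good1_def by(intro power_increasing) auto
  finally show "2^l g (?B g) \<le> (2::nat)^(s g * 12)" .
 qed
 hence ll: "c1 G (\<lambda>g. l g (?B g))" by simp
 have sdl: "c1 G (\<lambda>g. sd g (l g (?B g)))" by(rule c_seed[OF G ll]) (rule F(16))
 have h2: "c1 G (\<lambda>g. hsh (Q g) (l g (?B g)) (sd g (l g (?B g))) (?R g))"
  by(rule c1_hsh[OF sc(8) ll sdl rho]) (intro conjI F(3) F(16))
 have ps: "c2 G (\<lambda>g. ?P g)"
 proof(rule c2_cong[OF c2_add[OF z0 c2_of_c1[OF w(1) h2]]])
  fix g assume g: "g \<in> G"
  show e: "Zz g (?B g) + hsh (Q g) (l g (?B g)) (sd g (l g (?B g))) (?R g) =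
   ?P g" using F(18)[OF g] by simp
  show "Zz g (?B g) + hsh (Q g) (l g (?B g)) (sd g (l g (?B g))) (?R g) <
   2^(2 * Wd g)" unfolding e using F(19)[OF g] F(17)[OF g] F(10)[OF g] B2[OF g] by linarith
 qed
 show "cb G (\<lambda>g. ?P g \<in> SZ g)" by(rule cb_mem_Z[OF G ps]) (rule F(19))
 have r1: "c2 G (\<lambda>g. rank (SZ g) (?P g))" by(rule c_rank_Z[OF G ps]) (use F(19) less_imp_le in blast)
 have ex4': "c2 G (\<lambda>g. 4 * ?X g)" using ex4 by(simp add: mult.commute)
 have exE: "4 * ?X g \<le> 4 * EE g" if "g \<in> G" for g using F(8,9)[OF that] by linarith
 have r0: "c2 G (\<lambda>g. rank (SZ g) (Zz g (4 * ?X g)))"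
  by(rule c_rank_Z[OF G c_z[OF G ex4' exE]]) (assumption | rule F(20)[OF _ exE])+
 show "c2 G (\<lambda>g. Cand g (c g) (v g))"
 proof(rule c2_cong[OF c2_add[OF st c2_sub[OF r1 r0]]])
  fix g assume g: "g \<in> G"
  show "rank (SZ g) (Zz g (4 * ?X g)) \<le> rank (SZ g) (?P g)" by(rule F(22)[OF g])
  show "?S g + (rank (SZ g) (?P g) - rank (SZ g) (Zz g (4 * ?X g))) = Cand g (c g) (v g)"
   using F(21)[OF g] by simp
  show "?S g + (rank (SZ g) (?P g) - rank (SZ g) (Zz g (4 * ?X g))) < 2^(2 * Wd g)"
   using F(23)[OF g, of "c g"] F(24)[OF g, of "c g" "v g"] B2[OF g] by linarith
 qed
qed

lemma c_lookup:
 assumes G: "good G" and c: "c2 G c" and v: "c1 G v"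
  and b: "\<And>g. g \<in> G \<Longrightarrow> c g \<in> SA g \<and> v g < 2^b g"
 shows "cb G (\<lambda>g. Hit g (c g) (v g))"
  "c2 {g \<in> G. Hit g (c g) (v g)} (\<lambda>g. St g (c g) + Rcd g (Place g (c g) (v g)) div 2^(b g - Ee g (c g)))"
proof -
 let ?R = "\<lambda>g. Rcd g (Place g (c g) (v g))" and ?C = "\<lambda>g. Cnt g (c g)" and ?S = "\<lambda>g. St g (c g)"
  and ?P = "\<lambda>g. Place g (c g) (v g)" and ?Q = "\<lambda>g. Present g (c g) (v g)" and ?E = "\<lambda>g. Ee g (c g)"
  and ?H = "\<lambda>g. Hit g (c g) (v g)" and ?L = "\<lambda>g. Low g (c g) (v g)"
 note w = good_wd[OF G] and sc = good_scalars[OF G]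
 have F: "c g + 1 \<le> n g * K g" "?C g = St g (c g + 1) - ?S g" "?S g \<le> St g (c g + 1)"
  "?C g < n g" "?E g = ceillog2 (?C g)" "?E g \<le> b g" "b g < Wd g" "0 < ?C g"
  "Low g (c g) t = t mod 2^(b g - ?E g)" "?S g \<le> n g"
  "?Q g = (?C g = 1 \<or> Ps g (c g) (v g) \<in> SZ g)"
  "?P g = (if ?C g = 1 then ?S g else Cand g (c g) (v g))"
  "?H g = (?Q g \<and> ?R g mod 2^(b g - ?E g) = ?L g)"
  "?Q g \<Longrightarrow> ?P g < rr g"
  if g: "g \<in> G" for g t
 proof -
  interpret e: elems_hash "n g" "K g" "b g" "X g" "J g" "p g" "p2 g" "Q g" "A g" "sd g" "l g" by(rule good_eh[OF G g])
  show "c g + 1 \<le> n g * K g" using e.As_sub b[OF g] by auto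
  show "?C g = St g (c g + 1) - ?S g" by(simp add: e.cnt_def)
  show "?S g \<le> St g (c g + 1)" by(rule e.start_mono) simp
  show "?C g < n g" by(rule e.cnt_less)
  show "?E g = ceillog2 (?C g)" by(rule e.ee_def)
  show "?E g \<le> b g" by(rule e.ee_le)
  show "b g < Wd g" using good1[OF G g] by(auto simp: good1_def)
  show "0 < ?C g" using e.cnt_pos_iff b[OF g] by blast
  show "Low g (c g) t = t mod 2^(b g - ?E g)" by(rule e.low_def)
  show "?S g \<le> n g" using e.start_le[of "c g"] by(simp add: e.r_def)
  show "?Q g = (?C g = 1 \<or> Ps g (c g) (v g) \<in> SZ g)" by(simp add: e.present_def)
  show "?P g = (if ?C g = 1 then ?S g else Cand g (c g) (v g))" by(rule e.place_def)
  show "?H g = (?Q g \<and> ?R g mod 2^(b g - ?E g) = ?L g)"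
   by(rule e.hit_def)
  show "?Q g \<Longrightarrow> ?P g < rr g" using e.place_less b[OF g] by blast
 qed
 have one: "c2 G (\<lambda>_. 1)" by(rule c2_const[OF w(1)]) simp
 have st: "c2 G (\<lambda>g. ?S g)" by(rule c_start_cell[OF G c]) (use F(1) in fastforce)
 have c': "c2 G (\<lambda>g. c g + 1)"
 proof(rule c2_add[OF c one])
  fix g assume g: "g \<in> G"
  show "c g + 1 < 2^(2 * Wd g)" using F(1)[OF g] good_caps(8,11)[OF G g] by linarith
 qed
 have st1: "c2 G (\<lambda>g. St g (c g + 1))" by(rule c_start_cell[OF G c' F(1)])
 have cnt: "c1 G (\<lambda>g. ?C g)"
 proof(rule c1_cong[OF c1_of_c2[OF c2_sub[OF st1 st F(3)]]])
  fix g assume g: "g \<in> G"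
  have "n g < 2^Wd g" using good1[OF G g] by(simp add: good1_def)
  thus "St g (c g + 1) - ?S g < 2^Wd g" using F(2,4)[OF g] by linarith
 qed (simp_all add: F(2))
 have ee: "c1 G (\<lambda>g. ?E g)"
 proof(rule c1_cong[OF c_ceillog2[OF good_par[OF G] cnt, where j = 8]])
  fix g assume g: "g \<in> G"
  show "?C g \<le> 2^(s g * 8)" using F(4)[OF g] good1[OF G g] unfolding good1_def by linarith
 qed (simp add: F(5))
 have be: "c1 G (\<lambda>g. b g - ?E g)" by(rule c1_sub[OF sc(5) ee]) (use F in auto)
 have lw: "c1 G (\<lambda>g. ?L g)"
  by(rule c1_cong[OF c1_modpow[OF v be]]) (use F(7,9) in \<open>auto intro: less_imp_le less_imp_diff_less\<close>)
 have eq1: "cb G (\<lambda>g. ?C g = 1)" by(rule cb_eq[OF c2_of_c1[OF w(1) cnt] one])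
 let ?GH = "{g \<in> G. \<not> ?C g = 1}"
 have GH: "good ?GH" by(rule good_mono[OF G]) auto
 have bH: "c g \<in> SA g \<and> 2 \<le> ?C g \<and> v g < 2^b g" if "g \<in> ?GH" for g
  using b[of g] F(8)[of g] that by auto
 have sub: "?GH \<subseteq> G" by auto
 note hv = c_heavy[OF GH c2_mono[OF c sub] c1_mono[OF v sub] bH c2_mono[OF st sub] c1_mono[OF ee sub] c1_mono[OF lw sub]]
 have pr: "cb G (\<lambda>g. ?Q g)"
  by(rule cb_cong[OF cb_or[OF eq1 hv(1)]]) (use F(11) in auto)
 have pl: "c2 G (\<lambda>g. ?P g)"
  by(rule c2_cong[OF c2_ite[OF eq1 w(1) c2_mono[OF st] hv(2)]]) (use F(12) in auto)
 let ?GP = "{g \<in> G. ?Q g}"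
 have GP: "good ?GP" and sP: "?GP \<subseteq> G" using good_mono[OF G] by auto
 have rc: "c1 ?GP (\<lambda>g. ?R g)"
  by(rule c_rcd[OF GP c2_mono[OF pl sP]]) (use F(14) in auto)
 have tst: "cb ?GP (\<lambda>g. ?R g mod 2^(b g - ?E g) = ?L g)"
  by(rule cb_eq1[OF c1_modpow[OF rc c1_mono[OF be sP]] c1_mono[OF lw sP]]) (use F(7) in \<open>auto intro: less_imp_le less_imp_diff_less\<close>)
 show "cb G (\<lambda>g. ?H g)"
  by(rule cb_cong[OF cb_and[OF pr tst]]) (use F(13) in auto)
 let ?T = "{g \<in> G. ?H g}"
 have sT: "?T \<subseteq> ?GP" "?T \<subseteq> G" using F(13) by auto
 have q: "c1 ?T (\<lambda>g. ?R g div 2^(b g - ?E g))"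
  by(rule c1_shr[OF c1_mono[OF rc sT(1)] c1_mono[OF be sT(2)]])
 show "c2 ?T (\<lambda>g. ?S g + ?R g div 2^(b g - ?E g))"
 proof(rule c2_add[OF c2_mono[OF st sT(2)] c2_of_c1[OF c1_mono[OF w(1) sT(2)] q]])
  fix g assume g: "g \<in> ?T"
  hence gG: "g \<in> G" by blast
  have "?R g div 2^(b g - ?E g) < 2^Wd g" by(rule c1_less[OF q g])
  moreover have "?S g < 2^Wd g" using F(10)[OF gG] good1[OF G gG] by(simp add: good1_def)
  moreover have "(2::nat)^Wd g + 2^Wd g \<le> 2^(2 * Wd g)"
  proof -
   have "(2::nat)^Wd g + 2^Wd g = 2^Suc (Wd g)" by simp
   also have "... \<le> 2^(2 * Wd g)" using w(2) gG by(intro power_increasing) (auto simp: ok_def)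
   finally show ?thesis .
  qed
  ultimately show "?S g + ?R g div 2^(b g - ?E g) < 2^(2 * Wd g)" by linarith
 qed
qed

lemma c_find:
 assumes G: "good G" and x: "c2 G x" and j: "c1 G j" and b: "\<And>g. g \<in> G \<Longrightarrow> x g < n g"
 shows "cb G (\<lambda>g. \<exists>a<rr g. X g a = x g \<and> J g a = j g)"
  "\<exists>F. c2 {g \<in> G. \<exists>a<rr g. X g a = x g \<and> J g a = j g} F \<and>
   (\<forall>g\<in>G. \<forall>a<rr g. X g a = x g \<and> J g a = j g \<longrightarrow> F g = a)"
proof -
 let ?P = "\<lambda>g. \<exists>a<rr g. X g a = x g \<and> J g a = j g"
 note w = good_wd[OF G] and sc = good_scalars[OF G]
 define hi where "hi g = j g div 2^b g" for g
 define v where "v g = j g mod 2^b g" for g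
 define c where "c g = x g * K g + hi g" for g
 have hi: "c1 G hi" unfolding hi_def by(rule c1_shr[OF j sc(5)])
 have v: "c1 G v" unfolding v_def by(rule c1_modpow[OF j sc(5)]) (use good1[OF G] in \<open>auto simp: good1_def less_imp_le\<close>)
 have h1: "cb G (\<lambda>g. hi g < K g)" by(rule cb_less1[OF hi sc(4)])
 let ?G1 = "{g \<in> G. hi g < K g}"
 have s1: "?G1 \<subseteq> G" and G1: "good ?G1" using good_mono[OF G] by auto
 have cN: "c g < n g * K g" if "g \<in> ?G1" for g
 proof -
  have "(x g + 1) * K g \<le> n g * K g" using b[of g] that by(intro mult_le_mono1) auto
  thus ?thesis using that by(simp add: c_def)
 qed
 have xK: "c2 G (\<lambda>g. x g * K g)" by(rule c_first_child(1)[OF G x]) (use b less_imp_le in blast)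
 have c: "c2 ?G1 c" unfolding c_def
 proof(rule c2_add[OF c2_mono[OF xK s1] c2_of_c1[OF c1_mono[OF w(1) s1] c1_mono[OF hi s1]]])
  fix g assume g: "g \<in> ?G1"
  show "x g * K g + hi g < 2^(2 * Wd g)"
   using cN[OF g] good_caps(8,11)[OF G1 g] unfolding c_def by linarith
 qed
 have one: "c2 ?G1 (\<lambda>_. 1)" by(rule c2_const[OF good_wd(1)[OF G1]]) simp
 have c1': "c2 ?G1 (\<lambda>g. c g + 1)"
 proof(rule c2_add[OF c one])
  fix g assume g: "g \<in> ?G1"
  show "c g + 1 < 2^(2 * Wd g)" using cN[OF g] good_caps(8,11)[OF G1 g] by linarith
 qed
 have "cb ?G1 (\<lambda>g. rank (SA g) (c g) < rank (SA g) (c g + 1))"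
  by(intro cb_less c_rank_A[OF G1 c] c_rank_A[OF G1 c1']) (use cN in \<open>auto intro: less_imp_le Suc_leI\<close>)
 hence mA: "cb ?G1 (\<lambda>g. c g \<in> SA g)" by(rule cb_cong) (simp add: rank_Suc)
 let ?G2 = "{g \<in> ?G1. c g \<in> SA g}"
 have s2: "?G2 \<subseteq> ?G1" "?G2 \<subseteq> G" and G2: "good ?G2" using good_mono[OF G] by auto
 have b2: "c g \<in> SA g \<and> v g < 2^b g" if "g \<in> ?G2" for g using that by(simp add: v_def)
 note lk = c_lookup[OF G2 c2_mono[OF c s2(1)] c1_mono[OF v s2(2)] b2]
 have ht: "cb G (\<lambda>g. hi g < K g \<and> c g \<in> SA g \<and> Hit g (c g) (v g))" by(intro cb_and h1 mA lk(1))
 have iff: "(hi g < K g \<and> c g \<in> SA g \<and> Hit g (c g) (v g)) = ?P g"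
  and res: "a < rr g \<Longrightarrow> X g a = x g \<Longrightarrow> J g a = j g \<Longrightarrow> St g (c g) + Rcd g (Place g (c g) (v g)) div 2^(b g - Ee g (c g)) = a"
  if g: "g \<in> G" for g a
 proof -
  interpret e: elems_hash "n g" "K g" "b g" "X g" "J g" "p g" "p2 g" "Q g" "A g" "sd g" "l g" by(rule good_eh[OF G g])
  have jj: "e.lo a = v g \<and> e.C a = c g \<and> hi g < K g" if "a < rr g" "X g a = x g" "J g a = j g" for a
   using that e.hi_less[OF that(1)] by(simp add: e.lo_def e.C_def v_def c_def hi_def)
  show "a < rr g \<Longrightarrow> X g a = x g \<Longrightarrow> J g a = j g \<Longrightarrow> St g (c g) + Rcd g (Place g (c g) (v g)) div 2^(b g - Ee g (c g)) = a"
   using e.lookup_complete(3)[of a] jj[of a] by auto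
  show "(hi g < K g \<and> c g \<in> SA g \<and> Hit g (c g) (v g)) = ?P g"
  proof
   assume "?P g"
   then obtain a where a: "a < rr g" "X g a = x g" "J g a = j g" by blast
   have "e.C a \<in> e.As" unfolding e.As_def using a(1) by blast
   thus "hi g < K g \<and> c g \<in> SA g \<and> Hit g (c g) (v g)"
    using e.lookup_complete(1)[OF a(1)] jj[OF a] by auto
  next
   assume h: "hi g < K g \<and> c g \<in> SA g \<and> Hit g (c g) (v g)"
   then obtain a where a: "a < e.r" "e.C a = c g" "e.lo a = v g"
    using e.lookup_sound[of "c g" "v g"] by(auto simp: v_def)
   have "X g a = x g \<and> J g a div 2^b g = hi g"
    using e.C_eq_iff[OF a(1), of "hi g" "x g"] h a(2) by(simp add: c_def)
   moreover from this have "J g a = j g" using a(3) unfolding e.lo_def v_def hi_def by(metis div_mult_mod_eq)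
   ultimately show "?P g" using a(1) by blast
  qed
 qed
 show "cb G (\<lambda>g. ?P g)" by(rule cb_cong[OF ht]) (rule iff)
 have "{g \<in> G. ?P g} \<subseteq> {g \<in> ?G2. Hit g (c g) (v g)}" using iff by blast
 from c2_mono[OF lk(2) this] res
 show "\<exists>F. c2 {g \<in> G. ?P g} F \<and>
   (\<forall>g\<in>G. \<forall>a<rr g. X g a = x g \<and> J g a = j g \<longrightarrow> F g = a)" by blast
qed

end

section \<open>Space\<close>

lemma div_le_divide: "real (N div s) \<le> real N / real s"
proof(cases "s = 0")
 case False
 have "real (N div s * s) \<le> real N" by(simp only: of_nat_le_iff div_times_less_eq_dividend)
 thus ?thesis using False by(simp add: pos_le_divide_eq)
qed simp

section \<open>Entropy of the compressed bit vectors\<close>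

lemma choose_mult_le: "(a choose i) * (b choose j) \<le> (a + b) choose (i + j)"
proof -
 have "(a choose i) * (b choose (i + j - i)) \<le> (\<Sum>k\<le>i + j. (a choose k) * (b choose (i + j - k)))"
  by(rule member_le_sum) auto
 thus ?thesis by(simp add: vandermonde)
qed

text \<open>Independent choices inside the blocks give distinct subsets of the union with a fixed
  total number of ones, so the block counts multiply to at most the count for the whole.\<close>

lemma prod_choose_blocks: "(\<Prod>bi<m. s choose popc (bval s S bi)) \<le> (m * s) choose rank S (m * s)"
proof(induction m)
 case (Suc m)
 have r: "rank S (Suc m * s) = rank S (m * s) + popc (bval s S m)"
  using popc_bval_full[of s S m] rank_mono[of "m * s" "Suc m * s" S] by simp
 have "(\<Prod>bi<Suc m. s choose popc (bval s S bi)) \<le> ((m * s) choose rank S (m * s)) * (s choose popc (bval s S m))"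
  using Suc by simp
 also have "... \<le> (m * s + s) choose (rank S (m * s) + popc (bval s S m))" by(rule choose_mult_le)
 finally show ?case unfolding r by(simp add: add.commute)
qed simp

lemma prod_choose_le:
 assumes "S \<subseteq> {..<N}" "m * s \<le> N"
 shows "(\<Prod>bi<m. s choose popc (bval s S bi)) \<le> N choose card S"
proof -
 define d where "d = N - m * s"
 have N: "N = m * s + d" using assms by(simp add: d_def)
 define j where "j = card S - rank S (m * s)"
 have rN: "rank S N = card S" by(rule rank_card[OF assms(1)]) simp
 have j: "card S = rank S (m * s) + j" "j \<le> d"
  using rank_diff_le[of S "m * s" d] rank_mono[of "m * s" N S] rN N by(auto simp: j_def)
 have "1 \<le> d choose j" using j(2) zero_less_binomial[of j d] by linarith
 hence "(m * s choose rank S (m * s)) \<le> (m * s choose rank S (m * s)) * (d choose j)"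
  using mult_le_mono2[of 1 "d choose j" "m * s choose rank S (m * s)"] by(simp only: mult_1_right)
 also have "... \<le> (m * s + d) choose (rank S (m * s) + j)" by(rule choose_mult_le)
 finally show ?thesis using prod_choose_blocks[of s S m] unfolding j(1) N by linarith
qed

lemma popc_le_s: "popc (bval s S bi) \<le> s"
 by(rule popc_le[OF bval_less])

lemma blen_le_log: "real (blen s S bi) \<le> log 2 (real (s choose popc (bval s S bi))) + 1"
proof -
 have p: "0 < s choose popc (bval s S bi)" using popc_le_s by simp
 from ceillog2_less_log[OF p] show ?thesis by(simp add: blen_def)
qed

text \<open>Rounding costs one bit per block. The last block may reach beyond \<open>N\<close>;
  instead of being compared with the binomial coefficient it is charged \<open>s\<close>
  bits.\<close>

lemma sum_blen_log:
 assumes "S \<subseteq> {..<N}" "0 < s"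
 shows "(\<Sum>bi<N div s + 1. real (blen s S bi)) \<le> log 2 (real (N choose card S)) + real (N div s) + real s"
proof -
 let ?c = "\<lambda>bi. s choose popc (bval s S bi)"
 have pos: "0 < ?c bi" for bi using popc_le_s by simp
 have "(\<Sum>bi<N div s. real (blen s S bi)) \<le> (\<Sum>bi<N div s. log 2 (real (?c bi)) + 1)"
  by(intro sum_mono blen_le_log)
 also have "... = (\<Sum>bi<N div s. log 2 (real (?c bi))) + real (N div s)"
  by(simp add: sum.distrib)
 also have "(\<Sum>bi<N div s. log 2 (real (?c bi))) = log 2 (\<Prod>bi<N div s. real (?c bi))"
 proof -
  have "ln (\<Prod>bi<N div s. real (?c bi)) = (\<Sum>bi<N div s. ln (real (?c bi)))"
  proof(rule ln_prod)
   fix i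
   show "real (s choose popc (bval s S i)) \<noteq> 0" unfolding of_nat_eq_0_iff using pos[of i] by linarith
  qed simp
  thus ?thesis by(simp only: log_def sum_divide_distrib)
 qed
 also have "(\<Prod>bi<N div s. real (?c bi)) = real (\<Prod>bi<N div s. ?c bi)" by simp
 also have "log 2 \<dots> \<le> log 2 (real (N choose card S))"
 proof -
  have "(\<Prod>bi<N div s. ?c bi) \<le> N choose card S"
   by(rule prod_choose_le[OF assms(1)]) simp
  moreover have "0 < (\<Prod>bi<N div s. ?c bi)" using pos by(simp add: prod_pos)
  ultimately have "real (\<Prod>bi<N div s. ?c bi) \<le> real (N choose card S)"
   "0 < real (\<Prod>bi<N div s. ?c bi)" by(simp_all only: of_nat_le_iff of_nat_0_less_iff)
  thus ?thesis by(intro log_mono) auto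
 qed
 finally have "(\<Sum>bi<N div s. real (blen s S bi)) \<le> log 2 (real (N choose card S)) + real (N div s)" by simp
 moreover have "real (blen s S (N div s)) \<le> real s" using blen_le by simp
 ultimately show ?thesis by simp
qed

lemma tot_rankd_bound:
 assumes "S \<subseteq> {..<N}" "0 < s" "s \<le> lam"
 shows "real (tot (rankd s lam mu S N)) \<le>
  log 2 (real (N choose card S)) + (real N / real s + 2) * (2 * real mu + 3) + 7 * real lam"
proof -
 define m where "m = N div s + 1"
 have lm: "real (lam * (m div lam)) \<le> real m" by(simp add: mult.commute flip: of_nat_mult)
 have ms: "real m \<le> real N / real s + 1" unfolding m_def using div_le_divide[of N s] by simp
 have m1: "real m = real (N div s) + 1" by(simp add: m_def)
 have "real (tot (rankd s lam mu S N)) = 2 * real lam + 2 * (real lam + real (lam * (m div lam)) + real lam + real mu * (real m + 1)) +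
   (\<Sum>i<N div s + 1. real (blen s S i))"
  unfolding tot_rankd m_def by(simp add: algebra_simps)
 also have "... \<le> 6 * real lam + 2 * real m + 2 * real mu * (real m + 1) +
   (log 2 (real (N choose card S)) + real (N div s) + real s)"
  using lm sum_blen_log[OF assms(1,2)] by(simp add: algebra_simps)
 also have "... \<le> 7 * real lam + 3 * (real m + 1) + 2 * real mu * (real m + 1) + log 2 (real (N choose card S))"
  using assms(3) m1 by simp
 also have "... = 7 * real lam + (real m + 1) * (2 * real mu + 3) + log 2 (real (N choose card S))"
  by(simp add: algebra_simps)
 also have "(real m + 1) * (2 * real mu + 3) \<le> (real N / real s + 2) * (2 * real mu + 3)"
  using ms by(intro mult_right_mono) auto
 finally show ?thesis by simp
qed

lemma log2_one_plus: "0 \<le> y \<Longrightarrow> log 2 (1 + y) \<le> 2 * y" for y :: real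
proof -
 assume y: "0 \<le> y"
 have "(exp (1 / 2 :: real))\<^sup>2 = exp 1" by(simp add: power2_eq_square flip: exp_add)
 hence "(exp (1 / 2 :: real))\<^sup>2 \<le> 2\<^sup>2" using exp_le by simp
 hence "exp (1 / 2 :: real) \<le> 2" by(rule power2_le_imp_le) simp
 hence l2: "1 / 2 \<le> ln (2::real)" using ln_ge_iff[of 2 "1 / 2"] by(simp only: zero_less_numeral)
 have "ln (1 + y) \<le> y" using y by(rule ln_add_one_self_le_self)
 also have "y \<le> 2 * y * ln 2" using l2 y mult_left_mono[of "1/2" "ln 2" "2 * y"] by simp
 finally show ?thesis using l2 by(simp add: log_def divide_le_eq)
qed

text \<open>One term of a binomial expansion with a free weight \<open>y\<close>. The weights
  \<open>1 / s\<close>, \<open>2^c / (K - 1)\<close> and \<open>1 / k\<close> yield the bounds for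
  sparse vectors, for the payment by excess elements and for the number of trees.\<close>

lemma choose_weighted:
 fixes y :: real
 assumes y: "0 \<le> y"
 shows "real (N choose x) * y^x \<le> (1 + y)^N"
proof(cases "x \<le> N")
 case True
 have "real (N choose x) * y^x \<le> (\<Sum>k\<le>N. real (N choose k) * y^k)"
  using True y by(intro member_le_sum[of x _ "\<lambda>k. real (N choose k) * y^k"]) auto
 also have "... = (1 + y)^N" using binomial_ring[of y 1 N] by(simp add: add.commute)
 finally show ?thesis .
qed (use y in \<open>simp add: binomial_eq_0\<close>)

lemma log_choose_sparse:
 assumes "0 < s" "x \<le> N"
 shows "log 2 (real (N choose x)) \<le> 2 * real N / real s + real x * log 2 (real s)"
proof -
 have pos: "0 < real (N choose x)" using assms by simp
 have "real (N choose x) * (1 / real s)^x \<le> (1 + 1 / real s)^N" by(rule choose_weighted) simp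
 hence "real (N choose x) \<le> (1 + 1 / real s)^N * real s^x"
  using assms by(simp add: power_one_over field_simps)
 hence "log 2 (real (N choose x)) \<le> log 2 ((1 + 1 / real s)^N * real s^x)" using pos by(intro log_mono) auto
 also have "... = real N * log 2 (1 + 1 / real s) + real x * log 2 (real s)"
 proof -
  have "0 < 1 + 1 / real s" by(simp add: add_pos_nonneg)
  thus ?thesis using assms by(simp add: log_mult log_nat_power)
 qed
 also have "real N * log 2 (1 + 1 / real s) \<le> real N * (2 * (1 / real s))"
  by(intro mult_left_mono log2_one_plus) auto
 finally show ?thesis by(simp add: mult.commute)
qed

lemma choose_le_pow: "real (N choose x) \<le> 2^N"
 using choose_weighted[of 1 N x] by simp

lemma log_choose_le: "x \<le> N \<Longrightarrow> log 2 (real (N choose x)) \<le> real N"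
proof -
 assume "x \<le> N"
 hence "log 2 (real (N choose x)) \<le> log 2 (2^N)"
  using choose_le_pow[of N x] by(intro log_mono) auto
 thus ?thesis by(simp add: log_nat_power)
qed

text \<open>Only the top vector is charged its entropy. \<open>Wset s S\<close> may have up to
  \<open>N\<close> positions but only about \<open>N / s\<close> ones, so the sparse estimate
  applies to it; the vectors of the second level have length about \<open>N / s\<close> and are
  charged one bit per position.\<close>

lemma tot_seld_bound:
 assumes S: "S \<subseteq> {..<N}" and s: "0 < s" "s \<le> lam" "lam \<le> 30 * s" "s * lam < 2^mu"
 shows "real (tot (seld s lam mu 2 S N)) \<le>
  log 2 (real (N choose card S)) + (real N / real s + 3) * (9 * real mu + 50) + 60 * real lam"
proof -
 define M where "M = N div s + 1"
 define W where "W = Wset s S"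
 define Oc where "Oc = Occ s S"
 define W2 where "W2 = Wset s Oc"
 define O2 where "O2 = Occ s Oc"
 have fS: "finite S" using S finite_subset by blast
 have cS: "card S \<le> N" using card_mono[OF _ S] by simp
 have OcM: "Oc \<subseteq> {..<M}" unfolding Oc_def M_def by(rule Occ_sub[OF S])
 have fO: "finite Oc" using OcM finite_subset by blast
 have cO: "card Oc \<le> M" using card_mono[OF _ OcM] by simp
 have WS: "W \<subseteq> {..<card S}" unfolding W_def by(rule Wset_sub[OF fS s(1)])
 have cW: "card W = card Oc" "card W \<le> card S"
  unfolding W_def Oc_def using card_Wset[OF s(1)] card_mono[OF _ WS] by(auto simp: W_def)
 have W2S: "W2 \<subseteq> {..<card Oc}" unfolding W2_def by(rule Wset_sub[OF fO s(1)])
 have O2M: "O2 \<subseteq> {..<M div s + 1}" unfolding O2_def by(rule Occ_sub[OF OcM])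
 have cO2: "card O2 \<le> M div s + 1" using card_mono[OF _ O2M] by simp
 have cW2: "card W2 \<le> card Oc" using card_mono[OF _ W2S] by simp
 define q where "q = real N / real s"
 have q0: "0 \<le> q" by(simp add: q_def)
 have Mq: "real M \<le> q + 1" unfolding M_def q_def using div_le_divide[of N s] by simp
 have s1: "1 \<le> real s" using s(1) by simp
 have Msq: "real M / real s \<le> q + 1"
 proof -
  have "real M / real s \<le> real M" using s1 by(simp add: divide_le_eq mult_le_cancel_left1)
  thus ?thesis using Mq by linarith
 qed
 have mu1: "log 2 (real s) \<le> real mu"
 proof -
  have "s \<le> s * lam" using s by simp
  hence "real s \<le> real (2^mu)" using s(4) by(simp only: of_nat_le_iff)
  hence "log 2 (real s) \<le> log 2 (real (2^mu))" using s(1) by(intro log_mono) auto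
  thus ?thesis by(simp add: log_nat_power)
 qed
 define Rr where "Rr = (q + 3) * (2 * real mu + 3) + 7 * real lam"
 have r: "(x + 2) * (2 * real mu + 3) + 7 * real lam \<le> Rr" if "x \<le> q + 1" for x
  unfolding Rr_def using mult_right_mono[of "x + 2" "q + 3" "2 * real mu + 3"] that by simp
 have t1: "real (tot (rankd s lam mu S N)) \<le> log 2 (real (N choose card S)) + Rr"
  using tot_rankd_bound[OF S s(1,2), of mu] r[of q] by(simp add: q_def)
 have t2: "real (tot (rankd s lam mu W (card S))) \<le> 2 * q + (q + 1) * real mu + Rr"
 proof -
  have "real (card S) / real s \<le> q" unfolding q_def using cS by(intro divide_right_mono) auto
  hence "real (tot (rankd s lam mu W (card S))) \<le> log 2 (real (card S choose card W)) + Rr"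
   using tot_rankd_bound[OF WS s(1,2), of mu] r[of "real (card S) / real s"] by simp
  moreover have "log 2 (real (card S choose card W)) \<le> 2 * real (card S) / real s + real (card W) * log 2 (real s)"
   by(rule log_choose_sparse[OF s(1) cW(2)])
  moreover have "2 * real (card S) / real s \<le> 2 * q" using \<open>real (card S) / real s \<le> q\<close> by simp
  moreover have "real (card W) * log 2 (real s) \<le> (q + 1) * real mu"
   using cW cO Mq mu1 s1 by(intro mult_mono) auto
  ultimately show ?thesis by linarith
 qed
 have t3: "real (tot (rankd s lam mu Oc M)) \<le> (q + 1) + Rr"
  using tot_rankd_bound[OF OcM s(1,2), of mu] r[OF Msq] log_choose_le[OF cO] Mq by linarith
 have t4: "real (tot (rankd s lam mu W2 (card Oc))) \<le> (q + 1) + Rr"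
 proof -
  have "real (card Oc) / real s \<le> real M / real s" using cO by(intro divide_right_mono) auto
  hence x: "real (card Oc) / real s \<le> q + 1" using Msq by linarith
  show ?thesis using tot_rankd_bound[OF W2S s(1,2), of mu] r[OF x] log_choose_le[OF cW2] cO Mq by linarith
 qed
 have t5: "real (lam * card O2) \<le> 30 * (q + 1) + real lam"
 proof -
  have 1: "real (lam * card O2) \<le> real (lam * (M div s + 1))" using cO2 by(intro of_nat_mono mult_le_mono2)
  have "lam * (M div s) \<le> 30 * s * (M div s)" using s(3) by(rule mult_le_mono1)
  also have "... \<le> 30 * M" by(simp add: mult.assoc)
  finally have 2: "real (lam * (M div s)) \<le> real (30 * M)" by(rule of_nat_mono)
  have "real (lam * (M div s + 1)) = real (lam * (M div s)) + real lam" by simp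
  thus ?thesis using 1 2 Mq by simp
 qed
 have T: "tot (seld s lam mu 2 S N) = 4 * lam + tot (rankd s lam mu S N) + tot (rankd s lam mu W (card S)) +
   tot (rankd s lam mu Oc M) + tot (rankd s lam mu W2 (card Oc)) + lam * card O2"
  by(simp add: numeral_2_eq_2 W_def Oc_def W2_def O2_def M_def)
 have "real (tot (seld s lam mu 2 S N)) \<le> 4 * real lam + (log 2 (real (N choose card S)) + Rr) + (2 * q + (q + 1) * real mu + Rr) +
   ((q + 1) + Rr) + ((q + 1) + Rr) + (30 * (q + 1) + real lam)"
  unfolding T using t1 t2 t3 t4 t5 by simp
 also have "... \<le> log 2 (real (N choose card S)) + (q + 3) * (9 * real mu + 50) + 60 * real lam"
  using q0 by(simp add: Rr_def algebra_simps)
 finally show ?thesis by(simp add: q_def)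
qed

section \<open>Savings by excess elements and loss by rounding the arity\<close>

lemma choose_shift_down:
 assumes "2 \<le> K" "r < n" "E \<le> r"
 shows "real (n * K choose (r - E)) * (real K - 1)^E \<le> real (n * K choose r)"
 using assms(3)
proof(induction E)
 case (Suc E)
 define i where "i = r - Suc E"
 have i: "r - E = Suc i" "Suc i \<le> r" using Suc.prems by(auto simp: i_def)
 have M: "n + n \<le> n * K" using assms(1) by(metis mult_2_right mult_le_mono2)
 have "Suc i * (n * K choose Suc i) = (n * K - i) * (n * K choose i)"
  using binomial_absorption[of i "n * K"] binomial_absorb_comp[of "n * K" i] by(simp add: mult.commute)
 hence eq: "real (Suc i) * real (n * K choose Suc i) = real (n * K - i) * real (n * K choose i)"
  by(metis of_nat_mult)
 \<comment> \<open>As \<open>i < n\<close>, the quotient of neighbouring binomial coefficients is at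
   least \<open>(n * K - n) / n = K - 1\<close>: each nonempty cell fewer divides the number of cell
   vectors by at least that much.\<close>
 have "real (n * K choose i) * (real K - 1) * real n = real (n * K choose i) * (real n * real K - real n)" by(simp add: algebra_simps)
 also have "... \<le> real (n * K choose i) * real (n * K - i)"
 proof(intro mult_left_mono)
  have "i \<le> n" "i \<le> n * K" using i assms(2) M by auto
  thus "real n * real K - real n \<le> real (n * K - i)" by(simp add: of_nat_diff)
 qed simp
 also have "... = real (Suc i) * real (n * K choose Suc i)" using eq by simp
 also have "... \<le> real n * real (n * K choose Suc i)" using i assms(2) by(intro mult_right_mono) auto
 finally have "real (n * K choose i) * (real K - 1) \<le> real (n * K choose Suc i)" using assms(2) by(simp add: mult.commute)
 hence "real (n * K choose i) * (real K - 1) * (real K - 1)^E \<le> real (n * K choose Suc i) * (real K - 1)^E"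
  using assms(1) by(intro mult_right_mono) auto
 also have "... \<le> real (n * K choose r)" using Suc.IH Suc.prems i(1) by simp
 finally show ?case by(simp add: i_def mult.assoc)
qed simp

text \<open>
 Every element beyond the first of its cell saves about \<open>log 2 K\<close> bits; bounding a single term of the
 binomial expansion of \<open>(1 + y)^n\<close> shows that this pays for the bits spent on it.
\<close>

lemma excess_pays:
 assumes K: "2 \<le> K" and r: "r < n" "E \<le> r"
 shows "log 2 (real (n * K choose (r - E))) + log 2 (real (n choose E)) + real (c * E) \<le>
  log 2 (real (n * K choose r)) + 2 * real n * (2^c / (real K - 1))"
proof -
 define y where "y = 2^c / (real K - 1)"
 have K1: "0 < real K - 1" using K by simp
 have y: "0 < y" using K1 by(simp add: y_def)
 have nK: "r \<le> n * K" using K r(1) by(metis le_trans less_imp_le mult_le_mono2 mult.right_neutral one_le_numeral)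
 have pos: "0 < real (n * K choose (r - E))" "0 < real (n choose E)" "0 < real (n * K choose r)" using nK r by auto
 have "real (n * K choose (r - E)) * real (n choose E) * 2^(c * E) =
   (real (n * K choose (r - E)) * (real K - 1)^E) * (real (n choose E) * y^E)"
  using K1 by(simp add: y_def power_divide power_mult[symmetric] field_simps)
 also have "... \<le> real (n * K choose r) * (1 + y)^n"
  using choose_shift_down[OF K r] choose_weighted[of y n E] y K1 by(intro mult_mono) auto
 finally have "log 2 (real (n * K choose (r - E)) * real (n choose E) * 2^(c * E)) \<le> log 2 (real (n * K choose r) * (1 + y)^n)"
  using pos y by(intro log_mono) auto
 moreover have "log 2 (real (n * K choose (r - E)) * real (n choose E) * 2^(c * E)) =
   log 2 (real (n * K choose (r - E))) + log 2 (real (n choose E)) + real (c * E)"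
  using pos by(simp add: log_mult log_nat_power)
 moreover have "log 2 (real (n * K choose r) * (1 + y)^n) = log 2 (real (n * K choose r)) + real n * log 2 (1 + y)"
  using pos y by(simp add: log_mult log_nat_power)
 moreover have "real n * log 2 (1 + y) \<le> real n * (2 * y)" using y by(intro mult_left_mono log2_one_plus) auto
 moreover have "real n * (2 * y) = 2 * real n * (2^c / (real K - 1))" by(simp add: y_def)
 ultimately show ?thesis by linarith
qed

lemma choose_step: "Suc i * (M choose Suc i) = (M - i) * (M choose i)"
 using binomial_absorption[of i M] binomial_absorb_comp[of M i] by(simp add: mult.commute)

lemma choose_scale: "0 < m \<Longrightarrow> (N choose r) * m^r \<le> (N * m) choose r"
proof(induction r)
 case (Suc r)
 have "Suc r * ((N choose Suc r) * m^Suc r) = ((N - r) * m) * ((N choose r) * m^r)"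
  using choose_step[of r N] by(simp only: power_Suc mult.assoc[symmetric]) (simp only: mult_ac)
 also have "... \<le> (N * m - r) * ((N * m) choose r)"
 proof(rule mult_le_mono[OF _ Suc.IH[OF Suc.prems]])
  show "(N - r) * m \<le> N * m - r" using Suc.prems by(simp add: diff_mult_distrib diff_le_mono2)
 qed
 also have "... = Suc r * ((N * m) choose Suc r)" by(rule choose_step[symmetric])
 finally show ?case by(simp only: Suc_mult_le_cancel1)
qed simp

lemma choose_ratio:
 fixes dl :: real
 assumes "0 \<le> dl" "\<And>i. i < r \<Longrightarrow> real (M - i) \<le> (1 + dl) * real (N - i)"
 shows "real (M choose r) \<le> real (N choose r) * (1 + dl)^r"
 using assms(2)
proof(induction r)
 case (Suc r)
 have st: "real (Suc r) * real (Z choose Suc r) = real (Z - r) * real (Z choose r)" for Z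
  using choose_step[of r Z] by(metis of_nat_mult)
 have "real (Suc r) * real (M choose Suc r) = real (M - r) * real (M choose r)" by(rule st)
 also have "... \<le> ((1 + dl) * real (N - r)) * (real (N choose r) * (1 + dl)^r)"
  using Suc assms(1) by(intro mult_mono) auto
 also have "... = (real (N - r) * real (N choose r)) * (1 + dl)^Suc r" by(simp add: mult_ac)
 also have "... = real (Suc r) * (real (N choose Suc r) * (1 + dl)^Suc r)" unfolding st[symmetric] by(simp only: mult.assoc)
 finally show ?case by(simp only: mult_le_cancel_left_pos of_nat_0_less_iff zero_less_Suc)
qed simp

text \<open>Storing \<open>b\<close> label bits in full amounts to rounding the arity up to
  \<open>K * 2^b\<close>. Because of \<open>(K - 1) * 2^b < k\<close>, each factor of the binomial
  coefficient grows by at most \<open>1 + 1 / (K - 1)\<close>.\<close>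

lemma label_rounding:
 assumes K: "2 \<le> K" "(K - 1) * 2^b < k" and r: "r < n"
 shows "log 2 (real (n * K choose r)) + real (b * r) \<le> log 2 (real (n * k choose r)) + 2 * real n / (real K - 1)"
proof -
 define dl where "dl = 1 / (real K - 1)"
 have K1: "0 < real K - 1" using K by simp
 have dl: "0 < dl" using K1 by(simp add: dl_def)
 have k1: "1 \<le> k" using K by simp
 have Kk: "(real K - 1) * 2^b \<le> real k - 1"
 proof -
  have "(K - 1) * 2^b \<le> k - 1" using K(2) by simp
  hence "real ((K - 1) * 2^b) \<le> real (k - 1)" by(rule of_nat_mono)
  thus ?thesis using K k1 by(simp add: of_nat_diff)
 qed
 have "real (n * K choose r) * 2^(b * r) = real ((n * K choose r) * (2^b)^r)" by(simp add: power_mult)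
 also have "... \<le> real (n * K * 2^b choose r)" using choose_scale[of "2^b" "n * K" r] by(intro of_nat_mono) simp
 also have "... \<le> real (n * k choose r) * (1 + dl)^r"
 proof(rule choose_ratio)
  fix i assume i: "i < r"
  have ink: "i \<le> n * k" using i r k1 by(metis less_imp_le less_le_trans le_trans mult.right_neutral mult_le_mono2)
  have "real (n * K * 2^b - i) \<le> real n * real K * 2^b - real i \<or> real (n * K * 2^b - i) = 0"
   by(cases "i \<le> n * K * 2^b") (auto simp: of_nat_diff)
  moreover have "real n * real K * 2^b - real i \<le> (1 + dl) * (real (n * k) - real i)"
  proof -
   have "real n * 2^b = dl * (real n * ((real K - 1) * 2^b))" using K1 by(simp add: dl_def)
   also have "... \<le> dl * (real n * (real k - 1))" using dl Kk by(intro mult_left_mono) auto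
   also have "... \<le> dl * (real (n * k) - real i)" using dl i r by(intro mult_left_mono) (auto simp: algebra_simps)
   finally have 1: "real n * 2^b \<le> dl * (real (n * k) - real i)" .
   have "real n * real K * 2^b = real n * ((real K - 1) * 2^b) + real n * 2^b" by(simp add: algebra_simps)
   also have "real n * ((real K - 1) * 2^b) \<le> real n * real k" using Kk by(intro mult_left_mono) auto
   finally have 2: "real n * real K * 2^b \<le> real (n * k) + real n * 2^b" by simp
   have "(1 + dl) * (real (n * k) - real i) = (real (n * k) - real i) + dl * (real (n * k) - real i)"
    by(simp only: distrib_right mult_1)
   thus ?thesis using 1 2 by linarith
  qed
  moreover have "0 \<le> (1 + dl) * (real (n * k) - real i)" using dl ink by(intro mult_nonneg_nonneg) (auto simp flip: of_nat_mult)
  ultimately show "real (n * K * 2^b - i) \<le> (1 + dl) * real (n * k - i)" using ink by(auto simp: of_nat_diff)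
 qed (use dl in simp)
 finally have le: "real (n * K choose r) * 2^(b * r) \<le> real (n * k choose r) * (1 + dl)^r" .
 have rK: "r \<le> n * K" "r \<le> n * k" using r K k1
  by(metis le_trans less_imp_le mult_le_mono2 mult.right_neutral one_le_numeral, metis le_trans less_imp_le mult_le_mono2 mult.right_neutral)
 hence pos: "0 < real (n * K choose r)" "0 < real (n * k choose r)" by auto
 have "log 2 (real (n * K choose r)) + real (b * r) = log 2 (real (n * K choose r) * 2^(b * r))"
  using pos by(simp add: log_mult log_nat_power)
 also have "... \<le> log 2 (real (n * k choose r) * (1 + dl)^r)" using le pos by(intro log_mono) auto
 also have "... = log 2 (real (n * k choose r)) + real r * log 2 (1 + dl)" using pos dl by(simp add: log_mult log_nat_power)
 also have "real r * log 2 (1 + dl) \<le> real n * (2 * dl)" using r dl log2_one_plus[of dl] by(intro mult_mono) auto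
 finally show ?thesis by(simp add: dl_def mult.commute)
qed

text \<open>The quotient inside \<open>tree_bits\<close> equals
  \<open>(n * k choose (n - 1)) / n\<close>, so a vector that marks the \<open>n - 1\<close> edges
  among all \<open>n * k\<close> positions wastes only \<open>log 2 n\<close> bits.\<close>

lemma tree_bits_lower:
 assumes "1 \<le> n" "1 \<le> k"
 shows "log 2 (real (n * k choose (n - 1))) - log 2 (real n) \<le> of_int (tree_bits n k)"
proof -
 have "Suc (n - 1) * (k * n + 1 choose Suc (n - 1)) = (k * n + 1) * (k * n choose (n - 1))"
  using binomial_absorption[of "n - 1" "k * n + 1"] by simp
 hence "n * (k * n + 1 choose n) = (k * n + 1) * (n * k choose (n - 1))" using assms by(simp add: mult.commute)
 hence "real n * real (k * n + 1 choose n) = real (k * n + 1) * real (n * k choose (n - 1))" by(metis of_nat_mult)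
 hence e: "1 / real (k * n + 1) * real (k * n + 1 choose n) = real (n * k choose (n - 1)) / real n"
 proof -
  have *: "1 / u * v = x / y" if "u \<noteq> 0" "y \<noteq> 0" "y * v = u * x" for u v x y :: real
   using that by(simp add: field_simps)
  show ?thesis
  proof(rule *)
   show "real (k * n + 1) \<noteq> 0" unfolding of_nat_eq_0_iff by simp
   show "real n \<noteq> 0" using assms by simp
  qed fact
 qed
 have "n \<le> n * k" using assms by simp
 hence "n - 1 \<le> n * k" by linarith
 hence pos: "0 < real (n * k choose (n - 1))" by simp
 have "log 2 (real (n * k choose (n - 1))) - log 2 (real n) = log 2 (real (n * k choose (n - 1)) / real n)"
  using pos assms by(simp add: log_divide)
 also have "... \<le> of_int (tree_bits n k)" unfolding tree_bits_def e by(rule le_of_int_ceiling)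
 finally show ?thesis .
qed

section \<open>Breadth-first numbering\<close>

text \<open>
 The order of the nodes is defined on reversed label lists, so that it compares the parents first:
 this makes the numbers of all children increase with the pair (number of parent, label).
\<close>

fun rless :: "nat list \<Rightarrow> nat list \<Rightarrow> bool" where
 "rless [] [] = False"
| "rless [] (y # ys) = True"
| "rless (x # xs) [] = False"
| "rless (x # xs) (y # ys) = (rless xs ys \<or> xs = ys \<and> x < y)"

lemma rless_irrefl: "\<not> rless xs xs"
 by(induction xs) auto

lemma rless_total: "rless xs ys \<or> xs = ys \<or> rless ys xs"
 by(induction xs ys rule: rless.induct) auto

lemma rless_trans: "rless xs ys \<Longrightarrow> rless ys zs \<Longrightarrow> rless xs zs"
proof(induction xs ys arbitrary: zs rule: rless.induct)
 case (2 y ys) thus ?case by(cases zs) auto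
next
 case (4 x xs y ys) thus ?case by(cases zs) auto
qed auto

lemma rless_Cons: "rless xs (x # xs)"
 by(induction xs arbitrary: x) auto

definition nless :: "nat list \<Rightarrow> nat list \<Rightarrow> bool" where
 "nless x y = rless (rev x) (rev y)"

lemma nless_snoc [simp]: "nless (x @ [i]) (y @ [j]) \<longleftrightarrow> nless x y \<or> x = y \<and> i < j"
 by(simp add: nless_def)

lemma nless_Nil: "nless [] (x @ [i])" "\<not> nless x []"
 by(cases "rev x"; simp add: nless_def)+

lemma nless_irrefl: "\<not> nless x x"
 by(simp add: nless_def rless_irrefl)

lemma nless_total: "nless x y \<or> x = y \<or> nless y x"
 using rless_total[of "rev x" "rev y"] by(auto simp: nless_def)

lemma nless_trans: "nless x y \<Longrightarrow> nless y z \<Longrightarrow> nless x z"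
 unfolding nless_def by(rule rless_trans)

lemma nless_child: "nless x (x @ [i])"
 by(simp add: nless_def rless_Cons)

definition num :: "nat list set \<Rightarrow> nat list \<Rightarrow> nat" where
 "num Tr x = card {y \<in> Tr. nless y x}"

locale tree =
 fixes k :: nat and Tr :: "nat list set"
 assumes ct: "cardinal_tree k Tr"
begin

lemma fin [simp]: "finite Tr" and root: "[] \<in> Tr" and up: "x @ [j] \<in> Tr \<Longrightarrow> x \<in> Tr \<and> j < k"
 using ct by(auto simp: cardinal_tree_def)

abbreviation "n \<equiv> card Tr"

lemma n_pos: "1 \<le> n"
 using root by(metis One_nat_def Suc_leI card_gt_0_iff empty_iff fin)

lemma num_less: "x \<in> Tr \<Longrightarrow> num Tr x < n"
 unfolding num_def using nless_irrefl by(intro psubset_card_mono psubsetI fin) blast+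

lemma num_mono: assumes "x \<in> Tr" "nless x y" shows "num Tr x < num Tr y"
 unfolding num_def
proof(intro psubset_card_mono psubsetI)
 show "{z \<in> Tr. nless z x} \<subseteq> {z \<in> Tr. nless z y}" using nless_trans assms by blast
 show "{z \<in> Tr. nless z x} \<noteq> {z \<in> Tr. nless z y}" using assms nless_irrefl by blast
qed simp

lemma num_less_iff: "x \<in> Tr \<Longrightarrow> y \<in> Tr \<Longrightarrow> num Tr x < num Tr y \<longleftrightarrow> nless x y"
 using num_mono[of x y] num_mono[of y x] nless_total[of x y] by(metis less_asym less_irrefl)

lemma num_inj: "inj_on (num Tr) Tr"
 by(rule inj_onI) (metis less_irrefl nless_total num_mono)

lemma num_bij: "bij_betw (num Tr) Tr {0..<n}"
proof -
 have "num Tr ` Tr \<subseteq> {0..<n}" using num_less by auto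
 moreover have "card (num Tr ` Tr) = card {0..<n}" by(simp add: card_image num_inj)
 ultimately have "num Tr ` Tr = {0..<n}" by(intro card_subset_eq) auto
 thus ?thesis using num_inj by(simp add: bij_betw_def)
qed

lemma num_root: "num Tr [] = 0"
 by(simp add: num_def nless_Nil)

lemma num_eq_0: "x \<in> Tr \<Longrightarrow> num Tr x = 0 \<longleftrightarrow> x = []"
 using num_inj root num_root by(metis inj_onD)

definition "nd i = inv_into Tr (num Tr) i"

lemma nd: assumes "i < n" shows "nd i \<in> Tr" "num Tr (nd i) = i"
proof -
 have "i \<in> num Tr ` Tr" using num_bij assms by(simp add: bij_betw_def)
 thus "nd i \<in> Tr" "num Tr (nd i) = i" by(simp_all add: nd_def inv_into_into f_inv_into_f)
qed

lemma nd_num: "x \<in> Tr \<Longrightarrow> nd (num Tr x) = x"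
 by(simp add: nd_def num_inj)

text \<open>Indexed by \<open>a\<close> for the node \<open>a + 1\<close>, as the root has neither a
  parent nor a label.\<close>

definition "PX a = num Tr (butlast (nd (Suc a)))"
definition "LJ a = last (nd (Suc a))"

lemma nd_Suc:
 assumes "a < n - 1"
 shows "nd (Suc a) = nd (PX a) @ [LJ a]" "PX a < n" "LJ a < k" "PX a \<le> a" "nd (Suc a) \<in> Tr" "butlast (nd (Suc a)) \<in> Tr"
proof -
 have a: "Suc a < n" using assms by simp
 have y: "nd (Suc a) \<in> Tr" "num Tr (nd (Suc a)) = Suc a" using nd[OF a] by auto
 hence ne: "nd (Suc a) \<noteq> []" using num_root by auto
 have e: "nd (Suc a) = butlast (nd (Suc a)) @ [last (nd (Suc a))]" using ne by simp
 have u: "butlast (nd (Suc a)) \<in> Tr" "last (nd (Suc a)) < k" using up[of "butlast (nd (Suc a))" "last (nd (Suc a))"] y e by auto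
 have "nd (PX a) = butlast (nd (Suc a))" unfolding PX_def by(rule nd_num[OF u(1)])
 thus "nd (Suc a) = nd (PX a) @ [LJ a]" using e by(simp add: LJ_def)
 show "PX a < n" unfolding PX_def by(rule num_less[OF u(1)])
 show "LJ a < k" using u by(simp add: LJ_def)
 have "num Tr (butlast (nd (Suc a))) < num Tr (nd (Suc a))" using num_mono[OF u(1), of "nd (Suc a)"] e nless_child by metis
 thus "PX a \<le> a" using y by(simp add: PX_def)
 show "nd (Suc a) \<in> Tr" "butlast (nd (Suc a)) \<in> Tr" using y u by auto
qed

lemma PX_LJ_lex:
 assumes "a < a'" "a' < n - 1"
 shows "PX a < PX a' \<or> PX a = PX a' \<and> LJ a < LJ a'"
proof -
 have a: "a < n - 1" using assms by simp
 note A = nd_Suc[OF a] and B = nd_Suc[OF assms(2)]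
 have "num Tr (nd (Suc a)) < num Tr (nd (Suc a'))" using nd(2)[of "Suc a"] nd(2)[of "Suc a'"] assms by simp
 hence "nless (nd (Suc a)) (nd (Suc a'))" using num_less_iff A B by blast
 hence "nless (nd (PX a)) (nd (PX a')) \<or> nd (PX a) = nd (PX a') \<and> LJ a < LJ a'" unfolding A(1) B(1) by simp
 thus ?thesis
 proof
  assume "nless (nd (PX a)) (nd (PX a'))"
  hence "num Tr (nd (PX a)) < num Tr (nd (PX a'))" by(rule num_mono[OF nd(1)[OF A(2)]])
  thus ?thesis unfolding nd(2)[OF A(2)] nd(2)[OF B(2)] ..
 next
  assume *: "nd (PX a) = nd (PX a') \<and> LJ a < LJ a'"
  hence "num Tr (nd (PX a)) = num Tr (nd (PX a'))" by(simp only:)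
  thus ?thesis unfolding nd(2)[OF A(2)] nd(2)[OF B(2)] using * by(intro disjI2 conjI) simp_all
 qed
qed

lemma PX_LJ_inj:
 assumes "a < n - 1" "a' < n - 1" "PX a = PX a'" "LJ a = LJ a'"
 shows "a = a'"
proof(rule ccontr)
 assume "a \<noteq> a'"
 then consider "a < a'" | "a' < a" by linarith
 thus False
 proof cases
  case 1 from PX_LJ_lex[OF this assms(2)] assms(3,4) show False by linarith
 next
  case 2 from PX_LJ_lex[OF this assms(1)] assms(3,4) show False by linarith
 qed
qed

lemma child_elem:
 assumes "x \<in> Tr"
 shows "x @ [j] \<in> Tr \<longleftrightarrow> (\<exists>a<n - 1. PX a = num Tr x \<and> LJ a = j)"
  "a < n - 1 \<Longrightarrow> PX a = num Tr x \<Longrightarrow> LJ a = j \<Longrightarrow> num Tr (x @ [j]) = Suc a"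
proof -
 show 1: "a < n - 1 \<Longrightarrow> PX a = num Tr x \<Longrightarrow> LJ a = j \<Longrightarrow> num Tr (x @ [j]) = Suc a"
 proof -
  assume a: "a < n - 1" "PX a = num Tr x" "LJ a = j"
  hence "nd (Suc a) = x @ [j]" using nd_Suc(1)[OF a(1)] nd_num[OF assms] by simp
  thus ?thesis using nd(2)[of "Suc a"] a(1) by simp
 qed
 show "x @ [j] \<in> Tr \<longleftrightarrow> (\<exists>a<n - 1. PX a = num Tr x \<and> LJ a = j)"
 proof
  assume xj: "x @ [j] \<in> Tr"
  define a where "a = num Tr (x @ [j]) - 1"
  have "num Tr (x @ [j]) \<noteq> 0" using num_eq_0[OF xj] by simp
  hence a: "Suc a = num Tr (x @ [j])" by(simp add: a_def)
  hence "a < n - 1" using num_less[OF xj] by simp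
  moreover have "nd (Suc a) = x @ [j]" unfolding a by(rule nd_num[OF xj])
  ultimately show "\<exists>a<n - 1. PX a = num Tr x \<and> LJ a = j" by(intro exI[of _ a]) (auto simp: PX_def LJ_def)
 next
  assume "\<exists>a<n - 1. PX a = num Tr x \<and> LJ a = j"
  then obtain a where a: "a < n - 1" "PX a = num Tr x" "LJ a = j" by blast
  hence "nd (Suc a) = x @ [j]" using nd_Suc(1)[OF a(1)] nd_num[OF assms] by simp
  thus "x @ [j] \<in> Tr" using nd_Suc(5)[OF a(1)] by simp
 qed
qed

text \<open>In breadth-first order the children of node \<open>v\<close> are the nodes
  \<open>sx v + 1\<close> to \<open>sx (v + 1)\<close>; three of the five queries are expressed by
  this function.\<close>

definition "sx v = card {a. a < n - 1 \<and> PX a < v}"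

lemma labels_finite [simp]: "finite (child_labels Tr x)"
proof -
 have "child_labels Tr x \<subseteq> {..<k}" using up by(auto simp: child_labels_def)
 thus ?thesis using finite_subset by blast
qed

lemma num_child:
 assumes "x @ [j] \<in> Tr"
 shows "num Tr (x @ [j]) = sx (num Tr x) + rank (child_labels Tr x) j + 1"
proof -
 let ?A = "{a. a < n - 1 \<and> PX a < num Tr x}" and ?B = "{a. a < n - 1 \<and> PX a = num Tr x \<and> LJ a < j}"
 have x: "x \<in> Tr" using up[OF assms] by simp
 obtain a where a: "a < n - 1" "PX a = num Tr x" "LJ a = j" using child_elem(1)[OF x] assms by blast
 have na: "num Tr (x @ [j]) = Suc a" by(rule child_elem(2)[OF x a])
 have ord: "PX a' < num Tr x \<or> PX a' = num Tr x \<and> LJ a' < j \<longleftrightarrow> a' < a" if "a' < n - 1" for a'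
 proof -
  consider "a' < a" | "a' = a" | "a < a'" by linarith
  thus ?thesis
  proof cases
   case 1 from PX_LJ_lex[OF this a(1)] show ?thesis using 1 a(2,3) by linarith
  next
   case 2 thus ?thesis using a(2,3) by simp
  next
   case 3 from PX_LJ_lex[OF this that] show ?thesis using 3 a(2,3) by linarith
  qed
 qed
 have "{..<a} = ?A \<union> ?B"
 proof(intro equalityI subsetI)
  fix u assume "u \<in> {..<a}"
  hence u: "u < a" "u < n - 1" using a(1) by auto
  hence "PX u < num Tr x \<or> PX u = num Tr x \<and> LJ u < j" using ord[OF u(2)] by blast
  thus "u \<in> ?A \<union> ?B" using u(2) by blast
 next
  fix u assume "u \<in> ?A \<union> ?B"
  thus "u \<in> {..<a}" using ord[of u] by blast
 qed
 moreover have "card (?A \<union> ?B) =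
   sx (num Tr x) + card ?B"
  unfolding sx_def
 proof(rule card_Un_disjoint)
  show "finite ?A" "finite ?B" by simp_all
  show "?A \<inter> ?B = {}" by fastforce
 qed
 ultimately have "card {..<a} = sx (num Tr x) + card ?B" by(simp only:)
 moreover have "card ?B = card (child_labels Tr x \<inter> {..<j})"
 proof(rule bij_betw_same_card[of LJ], rule bij_betw_imageI)
  show "inj_on LJ ?B"
  proof(rule inj_onI)
   fix u v assume "u \<in> ?B" "v \<in> ?B" "LJ u = LJ v"
   thus "u = v" using PX_LJ_inj[of u v] by simp
  qed
  show "LJ ` ?B = child_labels Tr x \<inter> {..<j}"
   using child_elem(1)[OF x] by(auto simp: child_labels_def)
 qed
 ultimately show ?thesis using na by(simp add: rank_def)
qed

lemma sx_Suc: assumes "x \<in> Tr" shows "sx (num Tr x + 1) = sx (num Tr x) + degree Tr x"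
proof -
 let ?A = "{a. a < n - 1 \<and> PX a < num Tr x}" and ?B = "{a. a < n - 1 \<and> PX a = num Tr x}"
 have "{a. a < n - 1 \<and> PX a < num Tr x + 1} = ?A \<union> ?B" by auto
 hence "sx (num Tr x + 1) = card (?A \<union> ?B)"
  unfolding sx_def by(rule arg_cong)
 also have "... = sx (num Tr x) + card ?B"
  unfolding sx_def
 proof(rule card_Un_disjoint)
  show "finite ?A" "finite ?B" by simp_all
  show "?A \<inter> ?B = {}" by fastforce
 qed
 finally have "sx (num Tr x + 1) = sx (num Tr x) + card ?B" .
 moreover have "card ?B = card (child_labels Tr x)"
 proof(rule bij_betw_same_card[of LJ], rule bij_betw_imageI)
  show "inj_on LJ ?B"
  proof(rule inj_onI)
   fix u v assume "u \<in> ?B" "v \<in> ?B" "LJ u = LJ v"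
   thus "u = v" using PX_LJ_inj[of u v] by simp
  qed
  show "LJ ` ?B = child_labels Tr x"
   using child_elem(1)[OF assms] by(auto simp: child_labels_def)
 qed
 ultimately show ?thesis by(simp add: degree_def)
qed

lemma ith_child_num:
 assumes "x \<in> Tr"
 shows "map_option (num Tr) (ith_child Tr x i) =
  (if 1 \<le> i \<and> i \<le> sx (num Tr x + 1) - sx (num Tr x) then Some (sx (num Tr x) + i) else None)"
proof -
 have d: "sx (num Tr x + 1) - sx (num Tr x) = degree Tr x" using sx_Suc[OF assms] by simp
 show ?thesis
 proof(cases "1 \<le> i \<and> i \<le> degree Tr x")
  case True
  define j where "j = sorted_list_of_set (child_labels Tr x) ! (i - 1)"
  have i: "i - 1 < card (child_labels Tr x)" using True by(auto simp: degree_def)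
  have r: "rank (child_labels Tr x) j = i - 1" unfolding j_def by(rule rank_nth_sorted_list[OF _ i]) simp
  have "j \<in> child_labels Tr x" unfolding j_def using i nth_mem[of "i - 1" "sorted_list_of_set (child_labels Tr x)"] by simp
  hence "x @ [j] \<in> Tr" by(simp add: child_labels_def)
  from num_child[OF this] r True have "num Tr (x @ [j]) = sx (num Tr x) + i" by simp
  thus ?thesis using True unfolding d by(simp add: ith_child_def j_def)
 next
  case False
  thus ?thesis unfolding d ith_child_def by(simp only: if_False option.map)
 qed
qed

lemma ordinal_num:
 assumes "x @ [j] \<in> Tr"
 shows "ordinal_position Tr (x @ [j]) = num Tr (x @ [j]) - sx (num Tr x)"
proof -
 have "left_siblings Tr (x @ [j]) = (\<lambda>j'. x @ [j']) ` (child_labels Tr x \<inter> {..<j})"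
  by(auto simp: left_siblings_def child_labels_def)
 hence "card (left_siblings Tr (x @ [j])) = rank (child_labels Tr x) j"
  by(simp add: card_image inj_on_def rank_def)
 thus ?thesis using num_child[OF assms] by(simp add: ordinal_position_def)
qed

end

text \<open>A parent has a smaller number than its child, so parents and labels determine the nodes
  one after the other.\<close>

lemma tree_eqI:
 assumes "tree k Tr" "tree k' Tr'" "card Tr = card Tr'"
  and "\<And>a. a < card Tr - 1 \<Longrightarrow> tree.PX Tr a = tree.PX Tr' a \<and> tree.LJ Tr a = tree.LJ Tr' a"
 shows "Tr = Tr'"
proof -
 interpret t: tree k Tr by fact
 interpret u: tree k' Tr' by fact
 have nd: "t.nd i = u.nd i" if "i < card Tr" for i using that
 proof(induction i rule: less_induct)
  case (less i)
  show ?case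
  proof(cases i)
   case 0
   thus ?thesis using t.nd_num[OF t.root] u.nd_num[OF u.root] t.num_root u.num_root by simp
  next
   case (Suc a)
   hence a: "a < card Tr - 1" "a < card Tr' - 1" using less.prems assms(3) by auto
   have "t.PX a < i" using t.nd_Suc(4)[OF a(1)] Suc by simp
   hence "t.nd (t.PX a) = u.nd (t.PX a)" using less by simp
   thus ?thesis using t.nd_Suc(1)[OF a(1)] u.nd_Suc(1)[OF a(2)] assms(4)[OF a(1)] Suc by simp
  qed
 qed
 have "Tr = t.nd ` {..<card Tr}" using t.nd(1) t.nd_num t.num_less by(auto intro!: image_eqI)
 moreover have "Tr' = u.nd ` {..<card Tr'}" using u.nd(1) u.nd_num u.num_less by(auto intro!: image_eqI)
 ultimately show ?thesis using nd assms(3) by(metis (no_types, lifting) image_cong lessThan_iff)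
qed

section \<open>Choice of the parameters\<close>

definition lg :: "nat \<Rightarrow> nat" where "lg n = floorlog 2 n"
text \<open>Block length: with an eighth of \<open>lg n\<close> the lookup table has about the
  eighth root of \<open>n\<close> many columns, and four blocks fit into a word.\<close>

definition blk :: "nat \<Rightarrow> nat" where "blk n = lg n div 8 + 3"
text \<open>Width of addresses and full directory entries, about \<open>3/2 * lg n\<close>: the
  extra half absorbs all logarithmic factors in the lengths (\<open>params_size\<close>), yet the
  width stays within two words.\<close>

definition wide :: "nat \<Rightarrow> nat" where "wide n = lg n + lg n div 2 + 60"
definition narrow :: "nat \<Rightarrow> nat" where "narrow n = ceillog2 (blk n * wide n + 1)"
text \<open>The target for \<open>K\<close>, about lg lg n: it tends to infinity, as the losses of
  order \<open>n / K\<close> require, while \<open>n * K * narrow n / blk n\<close> remains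
  o(n).\<close>

definition kap :: "nat \<Rightarrow> nat" where "kap n = ceillog2 (lg n) + 2"

lemma lg_bounds: assumes "1 \<le> n" shows "n < 2^lg n" "2^lg n \<le> 2 * n" "1 \<le> lg n"
proof -
 have b: "2^(lg n - 1) \<le> n" "n < 2^lg n" using floorlog_bounds[of n 2] assms by(auto simp: lg_def)
 show "n < 2^lg n" by fact
 show l: "1 \<le> lg n" using floorlog_eq_zero_iff[of 2 n] assms by(simp add: lg_def)
 then obtain m where "lg n = Suc m" by(cases "lg n") auto
 thus "2^lg n \<le> 2 * n" using b(1) by simp
qed

lemma ceillog2_le_self: "ceillog2 x \<le> x"
proof(cases "x = 0")
 case False
 thus ?thesis using ceillog2_le_iff[of x x] less_exp[of x] by simp
qed simp

lemma square_le_pow: "(m::nat) * m \<le> 2^(m + 1)"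
proof(induction m rule: less_induct)
 case (less m)
 show ?case
 proof(cases "m \<le> 3")
  case True
  then consider "m = 0" | "m = 1" | "m = 2" | "m = 3" by linarith
  thus ?thesis by cases simp_all
 next
  case False
  then obtain q where q: "m = Suc q" "3 \<le> q" by(cases m) auto
  have "q * q \<le> 2^(q + 1)" using less q by simp
  moreover have "2 * q + 1 \<le> q * q" using mult_le_mono1[of 3 q q] q by linarith
  ultimately show ?thesis using q by simp
 qed
qed

lemma linear_le_pow: "16 * (m::nat) \<le> 2^(m - 1) + 112"
proof(cases "m \<le> 7")
 case False
 hence "8 \<le> m" by simp
 thus ?thesis
 proof(induction m rule: dec_induct)
  case (step m)
  hence "(2::nat)^4 \<le> 2^(m - 1)" by(intro power_increasing) auto
  moreover have "(2::nat)^m = 2 * 2^(m - 1)" using step by(cases m) auto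
  ultimately show ?case using step by simp
 qed simp
qed simp

lemma ceillog2_square: "ceillog2 x * ceillog2 x \<le> 4 * x"
proof(cases "x = 0")
 case False
 hence "2^ceillog2 x < 2 * x" by(intro two_power_ceillog2_gt) simp
 thus ?thesis using square_le_pow[of "ceillog2 x"] by simp
qed simp

lemma ceillog2_linear: "16 * ceillog2 x \<le> x + 112"
proof(cases "x \<le> 1")
 case False
 hence g: "2^ceillog2 x < 2 * x" by(intro two_power_ceillog2_gt) simp
 have "ceillog2 x \<noteq> 0" using ceillog2_le_iff[of x 0] False by simp
 then obtain m where "ceillog2 x = Suc m" by(cases "ceillog2 x") auto
 thus ?thesis using g linear_le_pow[of "Suc m"] by simp
qed simp

lemma params:
 shows "3 \<le> blk n" "blk n \<le> wide n" "wide n \<le> 30 * blk n" "blk n * wide n < 2^narrow n" "narrow n \<le> wide n"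
  "lg n \<le> blk n * 8" "2 \<le> kap n"
proof -
 show "3 \<le> blk n" "lg n \<le> blk n * 8" "2 \<le> kap n" by(simp_all add: blk_def kap_def)
 have l8: "lg n \<le> 8 * (lg n div 8) + 7" "8 * (lg n div 8) \<le> lg n" "2 * (lg n div 2) \<le> lg n" by simp_all
 show bw: "blk n \<le> wide n" unfolding blk_def wide_def using l8 by linarith
 have "x + h + 60 \<le> 30 * (d + 3)" if "x \<le> 8 * d + 7" "2 * h \<le> x" for x d h :: nat
 proof -
  have "h \<le> 4 * d + 3" using that by linarith
  thus ?thesis using that by simp
 qed
 from this[OF l8(1,3)] show "wide n \<le> 30 * blk n" unfolding blk_def wide_def .
 show "blk n * wide n < 2^narrow n" using le_two_power_ceillog2[of "blk n * wide n + 1"] by(simp add: narrow_def)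
 have "4 * blk n \<le> wide n" unfolding blk_def wide_def distrib_left using l8 by linarith
 hence "4 * blk n * wide n \<le> wide n * wide n" by(rule mult_le_mono1)
 hence "4 * (blk n * wide n) \<le> 2^(wide n + 1)" using square_le_pow[of "wide n"] unfolding mult.assoc by linarith
 moreover have "(2::nat)^1 \<le> 2^wide n" by(rule power_increasing) (simp_all add: wide_def)
 ultimately have "blk n * wide n + 1 \<le> 2^wide n" by simp
 thus "narrow n \<le> wide n" unfolding narrow_def using ceillog2_le_iff[of "blk n * wide n + 1" "wide n"] by simp
qed

lemma params_size:
 assumes n: "1 \<le> n" and K: "K \<le> 2 * kap n"
 shows "64 * (n * (K + 200) + 16) * (wide n + narrow n + 1) < 2^wide n"
proof -
 define q where "q = lg n div 2"
 have l: "lg n \<le> 2 * q + 1" "wide n = lg n + q + 60" "wide n \<le> 3 * q + 61" by(auto simp: q_def wide_def)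
 have "kap n \<le> 2 * q + 3" using ceillog2_le_self[of "lg n"] l(1) by(simp add: kap_def)
 hence K': "K + 216 \<le> 4 * q + 222" using K by simp
 have "n * (K + 200) + 16 \<le> n * (K + 216)" using n by(simp add: algebra_simps)
 also have "... \<le> n * (222 * (q + 1))" using K' by(intro mult_le_mono2) simp
 finally have 1: "n * (K + 200) + 16 \<le> n * (222 * (q + 1))" .
 have 2: "wide n + narrow n + 1 \<le> 123 * (q + 1)" using params(5)[of n] l by simp
 have "64 * (n * (K + 200) + 16) * (wide n + narrow n + 1) \<le> 64 * (n * (222 * (q + 1))) * (123 * (q + 1))"
  using 1 2 by(intro mult_le_mono mult_le_mono2) auto
 \<comment> \<open>\<open>1747584 = 64 * 222 * 123\<close> is below \<open>2^58\<close>. The summand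
   60 of \<open>wide\<close> provides these 58 bits and the 2 in the exponent of the bound on the
   square.\<close>
 also have "... = n * 1747584 * ((q + 1) * (q + 1))" by(simp add: algebra_simps)
 also have "... \<le> n * 1747584 * 2^(q + 2)" using square_le_pow[of "q + 1"] by(intro mult_le_mono2) simp
 also have "... < 2^lg n * 2^58 * 2^(q + 2)"
  using lg_bounds(1)[OF n] by(intro mult_strict_right_mono mult_less_le_imp_less) auto
 also have "... = 2^wide n" unfolding l(2) power_add[symmetric] by(rule arg_cong[of _ _ "power 2"]) simp
 finally show ?thesis .
qed

text \<open>Both \<open>b\<close> and then \<open>K\<close> are chosen minimal. Minimality of
  \<open>b\<close> forces \<open>K > kp\<close>, and minimality of \<open>K\<close> gives
  \<open>(K - 1) * 2^b < k\<close>. For a small arity there are no low bits, and the cells are the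
  possible edges.\<close>

lemma ex_cells:
 fixes k kp :: nat
 assumes "1 \<le> k" "2 \<le> kp"
 shows "\<exists>b K. 1 \<le> K \<and> K \<le> 2 * kp \<and> k \<le> K * 2^b \<and> (b = 0 \<and> K = k \<or> 0 < b \<and> kp \<le> K \<and> (K - 1) * 2^b < k)"
proof(cases "k \<le> 2 * kp")
 case True
 thus ?thesis using assms by(intro exI[of _ 0] exI[of _ k]) simp
next
 case False
 define b where "b = (LEAST b. k \<le> 2 * kp * 2^b)"
 have "k \<le> 2 * kp * 2^k"
 proof -
  have "1 * k \<le> (2 * kp) * 2^k" using assms less_exp[of k] by(intro mult_le_mono) auto
  thus ?thesis by simp
 qed
 hence b: "k \<le> 2 * kp * 2^b" unfolding b_def by(rule LeastI)
 have b0: "0 < b" using b False by(cases b) auto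
 then obtain b' where b': "b = Suc b'" by(cases b) auto
 have "\<not> k \<le> 2 * kp * 2^b'" unfolding b_def by(rule not_less_Least) (simp add: b' flip: b_def)
 hence low: "kp * 2^b < k" using b' by simp
 define K where "K = (LEAST K. k \<le> K * 2^b)"
 have K: "k \<le> K * 2^b" unfolding K_def by(rule LeastI) (rule b)
 have K2: "K \<le> 2 * kp" unfolding K_def by(rule Least_le) (rule b)
 have "kp * 2^b < K * 2^b" using low K by linarith
 hence Kk: "kp < K" by simp
 have "K - 1 < K" using Kk by simp
 hence "\<not> k \<le> (K - 1) * 2^b" unfolding K_def by(rule not_less_Least)
 thus ?thesis using K K2 Kk b0 assms by(intro exI[of _ b] exI[of _ K]) auto
qed

context elems begin

lemma log_modulus: "ceillog2 (2 * (c * (n * n)) + 5) \<le> ceillog2 (c + 2) + 2 * lg n + 2"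
proof -
 have nn: "n * n \<le> 2^lg n * 2^lg n" using lg_bounds(1)[OF n_pos] by(intro mult_le_mono) auto
 have "1 * 1 \<le> n * n" using n_pos by(intro mult_le_mono)
 moreover have "2 * (c * v) + 5 \<le> 4 * ((c + 2) * v)" if "1 * 1 \<le> v" for v :: nat using that by(simp add: algebra_simps)
 ultimately have "2 * (c * (n * n)) + 5 \<le> 4 * ((c + 2) * (n * n))" by blast
 also have "... \<le> 4 * (2^ceillog2 (c + 2) * (2^lg n * 2^lg n))"
  by(intro mult_le_mono2 mult_le_mono le_two_power_ceillog2 nn)
 also have "... = 2^(ceillog2 (c + 2) + 2 * lg n + 2)" by(simp add: power_add mult_2)
 finally show ?thesis using ceillog2_le_iff[of "2 * (c * (n * n)) + 5"] by simp
qed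

lemma log_P1: "ceillog2 (P1 + 1) \<le> ceillog2 (b + 2) + 2 * lg n + 2"
 using log_modulus[of b] by(simp add: P1_def add.commute)

lemma log_P2: "ceillog2 (P2 + 1) \<le> ceillog2 (ceillog2 (P1 + 1) + 2) + 2 * lg n + 2"
 using log_modulus[of "ceillog2 (P1 + 1)"] by(simp add: P2_def add.commute)

text \<open>All seeds together take \<open>Q * (Q + 1)\<close> bits. \<open>Qsmall\<close> contains
  the iterated logarithm \<open>ceillog2 (c + 2)\<close>, whose square is at most
  \<open>4 * (c + 2)\<close>, and \<open>c\<close> is only about lg lg k + 2 lg n. If the keys are
  not reduced, \<open>b\<close> is bounded by O(lg b + lg n) and is therefore O(lg n)
  itself.\<close>

lemma Q_bound:
 assumes "reduction p p2 Q"
 shows "Q * (Q + 1) \<le> 16 * ceillog2 (b + 2) + 1458 * ((lg n + 1) * (lg n + 1))"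
proof -
 define L where "L = lg n"
 define bi where "bi = ceillog2 (b + 2)"
 define c where "c = ceillog2 (P1 + 1)"
 define \<gamma> where "\<gamma> = ceillog2 (c + 2)"
 have c: "c \<le> bi + 2 * L + 2" unfolding c_def bi_def L_def by(rule log_P1)
 have "ceillog2 n \<le> L" using ceillog2_le_iff[of n L] lg_bounds[OF n_pos] n_pos by(simp add: L_def)
 hence Qs: "Qsmall \<le> \<gamma> + 3 * L + 3" unfolding Qsmall_def using log_P2 by(simp add: \<gamma>_def c_def L_def)
 have gg: "\<gamma> * \<gamma> \<le> 4 * (c + 2)" unfolding \<gamma>_def by(rule ceillog2_square)
 have QQ: "Q * (Q + 1) \<le> 2 * (Q * Q)" by(cases Q) simp_all
 from assms have "Q = Qsmall \<or> Q = b \<and> b \<le> c + Qsmall" by(simp add: reduction_def c_def)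
 thus ?thesis
 proof
  assume "Q = Qsmall"
  hence Q: "Q \<le> \<gamma> + 3 * (L + 1)" using Qs by simp
  have "Q * Q \<le> (\<gamma> + 3 * (L + 1)) * (\<gamma> + 3 * (L + 1))" using Q by(intro mult_le_mono)
  also have "... \<le> 2 * (\<gamma> * \<gamma>) + 2 * (3 * (L + 1) * (3 * (L + 1)))"
  proof -
   have "2 * (x * y) \<le> x * x + y * y" for x y :: nat
    using sum_squares_bound[of "int x" "int y"] by(simp add: power2_eq_square mult.assoc flip: of_nat_mult of_nat_add)
   from this[of \<gamma> "3 * (L + 1)"] show ?thesis
    using power2_sum[of \<gamma> "3 * (L + 1)"] unfolding power2_eq_square by linarith
  qed
  also have "3 * (L + 1) * (3 * (L + 1)) = 9 * ((L + 1) * (L + 1))" by(simp add: algebra_simps)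
  finally have "Q * (Q + 1) \<le> 4 * (\<gamma> * \<gamma>) + 36 * ((L + 1) * (L + 1))" using QQ by linarith
  also have "4 * (\<gamma> * \<gamma>) \<le> 16 * bi + 64 * (L + 1)" using gg c by simp
  also have "64 * (L + 1) \<le> 64 * ((L + 1) * (L + 1))" by simp
  finally show ?thesis by(simp add: bi_def L_def)
 next
  assume "Q = b \<and> b \<le> c + Qsmall"
  hence "Q = b" "b \<le> bi + 5 * L + 5 + \<gamma>" using c Qs by auto
  moreover have "\<gamma> \<le> bi + 2 * L + 4" unfolding \<gamma>_def using ceillog2_le_self[of "c + 2"] c by simp
  \<comment> \<open>This resolves \<open>b \<le> 2 * bi + 7 * L + 9\<close>, in which
    \<open>bi\<close> is about the logarithm of \<open>b\<close>, for \<open>b\<close>.\<close>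
  moreover have "16 * bi \<le> b + 114" unfolding bi_def using ceillog2_linear[of "b + 2"] by simp
  ultimately have "Q \<le> 27 * (L + 1)" by simp
  hence "Q * Q \<le> 27 * (L + 1) * (27 * (L + 1))" by(intro mult_le_mono)
  also have "... = 729 * ((L + 1) * (L + 1))" by(simp add: algebra_simps)
  finally show ?thesis using QQ unfolding L_def[symmetric] by linarith
 qed
qed

end

section \<open>The size of the representation\<close>

text \<open>The bit vectors \<open>Ys\<close> and \<open>Zs\<close> have length at most \<open>200 * E + 1\<close> and \<open>200 * E\<close>.\<close>

definition gam :: nat where "gam = 400"

text \<open>The cell vector, the vector of starts, \<open>c\<close> bits per excess element and the
  label bits in the records together stay near the entropy of the tree: \<open>excess_pays\<close>
  and \<open>label_rounding\<close> each lose O(n / kp). If \<open>b = 0\<close>, the cells are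
  single edges and there is no excess.\<close>

lemma cell_entropy:
 assumes kp: "2 \<le> kp" and K: "b = 0 \<and> K = k \<or> 0 < b \<and> kp \<le> K \<and> (K - 1) * 2^b < k"
  and r: "r < n" "E \<le> r" and b: "0 < E \<Longrightarrow> 0 < b"
 shows "log 2 (real (n * K choose (r - E))) + log 2 (real (n choose E)) + real (c * E) + real (b * r) \<le>
  log 2 (real (n * k choose r)) + 2 * real n * ((2^c + 1) / (real kp - 1))"
proof(cases "b = 0")
 case True
 hence "E = 0" "K = k" using b K by auto
 moreover have "0 \<le> 2 * real n * ((2^c + 1) / (real kp - 1))" using kp by simp
 ultimately show ?thesis using True by simp
next
 case False
 hence K: "2 \<le> K" "kp \<le> K" "(K - 1) * 2^b < k" using K kp by auto
 have "log 2 (real (n * K choose (r - E))) + log 2 (real (n choose E)) + real (c * E) + real (b * r) \<le>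
  log 2 (real (n * k choose r)) + (2 * real n * (2^c / (real K - 1)) + 2 * real n / (real K - 1))"
  using excess_pays[OF K(1) r, of c] label_rounding[OF K(1,3) r(1)] by linarith
 also have "2 * real n * (2^c / (real K - 1)) + 2 * real n / (real K - 1) = 2 * real n * ((2^c + 1) / (real K - 1))"
  by(simp add: algebra_simps add_divide_distrib)
 also have "... \<le> 2 * real n * ((2^c + 1) / (real kp - 1))"
  using K kp by(intro mult_left_mono divide_left_mono) auto
 finally show ?thesis by simp
qed

lemma seg_bound:
 fixes s lam mu N M :: nat
 assumes s: "1 \<le> s" and M: "64 * (M + 16) * (lam + mu + 1) < 2^lam" "N \<le> M + 3"
  and x: "x \<le> real N + (real N / real s + 3) * (9 * real mu + 50) + 60 * real lam"
 shows "x < 2^lam"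
proof -
 have "real N / real s \<le> real N" using s by(simp add: divide_le_eq mult_le_cancel_left1)
 hence "x \<le> real N + (real N + 3) * (9 * real mu + 50) + 60 * real lam"
  using x by(smt (verit) mult_right_mono of_nat_0_le_iff)
 also have "... \<le> real (64 * (M + 16) * (lam + mu + 1))"
 proof -
  have "N + (N + 3) * (9 * mu + 50) + 60 * lam \<le> 60 * ((N + 4) * (lam + mu + 1))" by(simp add: algebra_simps)
  also have "... \<le> 64 * ((M + 16) * (lam + mu + 1))" using M(2) by(intro mult_le_mono) auto
  finally show ?thesis unfolding mult.assoc by(metis (mono_tags, lifting) of_nat_add of_nat_le_iff of_nat_mult of_nat_numeral)
 qed
 also have "... < 2^lam" using M(1) by(metis of_nat_less_iff of_nat_numeral of_nat_power)
 finally show ?thesis .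
qed

context tree_fid begin

definition "fits k g \<longleftrightarrow> elems_hash (n g) (K g) (b g) (X g) (J g) (p g) (p2 g) (Q g) (A g) (sd g) (l g) \<and>
 s g = blk (n g) \<and> lam g = wide (n g) \<and> mu g = narrow (n g) \<and> 1 \<le> K g \<and> K g \<le> 2 * kap (n g) \<and>
 (b g = 0 \<and> K g = k \<or> 0 < b g \<and> kap (n g) \<le> K g \<and> (K g - 1) * 2^b g < k) \<and>
 eta g = (LEAST e. \<forall>v\<in>set (hdr g). v < 2^e)"

lemma eta_Least:
 assumes "fits k g"
 shows "v \<in> set (hdr g) \<Longrightarrow> v < 2^eta g" "(\<And>v. v \<in> set (hdr g) \<Longrightarrow> v < 2^e) \<Longrightarrow> eta g \<le> e"
proof -
 have e: "eta g = (LEAST e. \<forall>v\<in>set (hdr g). v < 2^e)" using assms by(simp add: fits_def)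
 have "\<forall>v\<in>set (hdr g). v < 2^sum_list (hdr g)"
 proof
  fix v assume "v \<in> set (hdr g)"
  hence "v \<le> sum_list (hdr g)" by(intro member_le_sum_list) auto
  thus "v < 2^sum_list (hdr g)" using less_exp[of "sum_list (hdr g)"] by linarith
 qed
 hence "\<exists>e. \<forall>v\<in>set (hdr g). v < 2^e" by blast
 hence "\<forall>v\<in>set (hdr g). v < 2^eta g" unfolding e by(rule LeastI_ex)
 thus "v \<in> set (hdr g) \<Longrightarrow> v < 2^eta g" by blast
 show "(\<And>v. v \<in> set (hdr g) \<Longrightarrow> v < 2^e) \<Longrightarrow> eta g \<le> e" unfolding e by(rule Least_le) blast
qed

lemma hdr_bound:
 assumes f: "fits k g" and U: "lam g < 2^U" "mu g < 2^U" "K g < 2^U" "b g < 2^U" "p g < 2^U" "p2 g < 2^U"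
  "Q g \<le> U"
 shows "eta g \<le> U"
proof(rule eta_Least(2)[OF f])
 interpret e: elems_hash "n g" "K g" "b g" "X g" "J g" "p g" "p2 g" "Q g" "A g" "sd g" "l g" using f by(simp add: fits_def)
 have "s g \<le> lam g" using f params(2) by(simp add: fits_def)
 moreover have "(2::nat)^Q g \<le> 2^U" using U(7) by(intro power_increasing) auto
 ultimately have 1: "s g < 2^U" "Q g < 2^U" "A g < 2^U" using U(1) e.hok'(1) less_exp[of "Q g"] by linarith+
 fix v assume "v \<in> set (hdr g)"
 thus "v < 2^U" using 1 U by(auto simp: hdr_def)
qed

lemma seg_sizes:
 assumes f: "fits k g"
 shows "real (tot (segA g)) \<le> log 2 (real (n g * K g choose (rr g - EE g))) +
   (real (n g * K g) / real (s g) + 3) * (9 * real (mu g) + 50) + 60 * real (lam g)"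
  "real (tot (segB g)) \<le> log 2 (real (n g choose EE g)) +
   (real (n g) / real (s g) + 3) * (9 * real (mu g) + 50) + 60 * real (lam g)"
  "real (tot (segY g)) \<le> real (200 * EE g + 1) +
   (real (200 * n g + 1) / real (s g) + 3) * (9 * real (mu g) + 50) + 60 * real (lam g)"
  "real (tot (segZ g)) \<le> real (200 * EE g) +
   (real (200 * n g) / real (s g) + 3) * (9 * real (mu g) + 50) + 60 * real (lam g)"
  "EE g \<le> rr g" "rr g < n g" "rr g = n g - 1"
proof -
 let ?M = "9 * real (mu g) + 50" and ?L = "60 * real (lam g)"
 interpret e: elems_hash "n g" "K g" "b g" "X g" "J g" "p g" "p2 g" "Q g" "A g" "sd g" "l g" using f by(simp add: fits_def)
 have pr: "0 < s g" "s g \<le> lam g" "lam g \<le> 30 * s g" "s g * lam g < 2^mu g" using f params[of "n g"] by(auto simp: fits_def)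
 show E: "EE g \<le> rr g" and r: "rr g < n g" "rr g = n g - 1" using e.n_pos by(auto simp: e.E_def e.r_def)
 have A: "card e.As = e.r - e.E" using e.card_As by(simp add: e.E_def)
 show "real (tot (segA g)) \<le> log 2 (real (n g * K g choose (rr g - EE g))) +
   (real (n g * K g) / real (s g) + 3) * ?M + ?L"
  unfolding segA_def using tot_seld_bound[OF e.As_sub pr] unfolding A .
 have B: "card e.Bs = n g - e.E" using e.card_Bs A E r by linarith
 \<comment> \<open>The positions outside \<open>Bs\<close> number \<open>E\<close>, so the vector of
   starts has the entropy of \<open>n g choose E\<close>, which \<open>cell_entropy\<close>
   covers.\<close>
 have "(n g choose card e.Bs) = (n g choose e.E)" unfolding B using E r by(intro binomial_symmetric[symmetric]) linarith
 thus "real (tot (segB g)) \<le> log 2 (real (n g choose EE g)) +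
   (real (n g) / real (s g) + 3) * ?M + ?L"
  unfolding segB_def using tot_seld_bound[OF e.Bs_sub pr] by simp
 have z: "e.z (4 * e.E) \<le> 200 * e.E" by(rule e.hok')
 have z': "e.z (4 * e.E) \<le> 200 * n g" using z E r by linarith
 have fr: "(real u / real (s g) + 3) * ?M \<le> (real v / real (s g) + 3) * ?M" if "u \<le> v" for u v
  using that by(intro mult_right_mono add_right_mono divide_right_mono) auto
 have "card e.Ys \<le> e.z (4 * e.E) + 1" using card_mono[OF _ e.Ys_sub] by simp
 hence "log 2 (real (e.z (4 * e.E) + 1 choose card e.Ys)) \<le> real (e.z (4 * e.E) + 1)" by(rule log_choose_le)
 moreover have "real (e.z (4 * e.E) + 1) \<le> real (200 * e.E + 1)" using z by(intro of_nat_mono) simp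
 moreover have "(real (e.z (4 * e.E) + 1) / real (s g) + 3) * ?M \<le> (real (200 * n g + 1) / real (s g) + 3) * ?M"
  using z' by(intro fr) simp
 ultimately show "real (tot (segY g)) \<le> real (200 * EE g + 1) +
   (real (200 * n g + 1) / real (s g) + 3) * ?M + ?L"
  unfolding segY_def using tot_seld_bound[OF e.Ys_sub pr] by linarith
 have Zs: "e.Zs \<subseteq> {..<e.z (4 * e.E)}" by(rule e.Zs_sub)
 hence "card e.Zs \<le> e.z (4 * e.E)" using card_mono[OF _ Zs] by simp
 hence "log 2 (real (e.z (4 * e.E) choose card e.Zs)) \<le> real (e.z (4 * e.E))" by(rule log_choose_le)
 moreover have "real (e.z (4 * e.E)) \<le> real (200 * e.E)" using z by(intro of_nat_mono) simp
 moreover have "(real (e.z (4 * e.E)) / real (s g) + 2) * (2 * real (mu g) + 3) \<le> (real (e.z (4 * e.E)) / real (s g) + 3) * ?M"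
  by(intro mult_mono) auto
 moreover have "(real (e.z (4 * e.E)) / real (s g) + 3) * ?M \<le> (real (200 * n g) / real (s g) + 3) * ?M"
  using z' by(intro fr) simp
 moreover have "0 \<le> real (lam g)" by simp
 ultimately show "real (tot (segZ g)) \<le> real (200 * EE g) +
   (real (200 * n g) / real (s g) + 3) * ?M + ?L"
  unfolding segZ_def using tot_rankd_bound[OF Zs pr(1,2), of "mu g"] by linarith
qed

lemma tot_tabseg: "tot (tabseg g) = s g * ((2 * s g + 3) * 2^s g)"
 by(simp add: tabseg_def tabs_def)


lemma fits_good1:
 assumes f: "fits k g" and W: "120 \<le> Wd g" "k + n g \<le> 2^Wd g" "1 \<le> k" and st: "stored g (off g) (main g)"
 shows "good1 g"
proof -
 interpret e: elems_hash "n g" "K g" "b g" "X g" "J g" "p g" "p2 g" "Q g" "A g" "sd g" "l g" using f by(simp add: fits_def)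
 have par: "s g = blk (n g)" "lam g = wide (n g)" "mu g = narrow (n g)" "1 \<le> K g" "K g \<le> 2 * kap (n g)"
  "b g = 0 \<and> K g = k \<or> 0 < b g \<and> kap (n g) \<le> K g \<and> (K g - 1) * 2^b g < k"
  using f by(auto simp: fits_def)
 have n: "n g < 2^Wd g" "k < 2^Wd g" using W e.n_pos by linarith+
 have lW: "lg (n g) \<le> Wd g" unfolding lg_def by(rule floorlog_leI) (use n in auto)
 have w2: "Wd g * Wd g < 2^(Wd g div 2)"
 proof -
  interpret r: ram Wd Bm "\<lambda>_ _. 0" .
  have "r.ok {g}" using W by(simp add: r.ok_def)
  thus ?thesis by(rule r.word_small) simp
 qed
 have wp: "(2::nat)^(Wd g div 2) \<le> 2^Wd g" by(rule power_increasing) auto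
 have ww: "120 * Wd g \<le> Wd g * Wd g" using W(1) by(rule mult_le_mono1)
 have h2: "2 * (lg (n g) div 2) \<le> lg (n g)" "8 * (lg (n g) div 8) \<le> lg (n g)" by simp_all
 have s4: "4 * s g \<le> Wd g" unfolding par blk_def distrib_left using h2 lW W(1) by linarith
 have l2: "lam g \<le> 2 * Wd g" unfolding par wide_def using h2 lW W(1) by linarith
 have m: "mu g \<le> Wd g"
 proof -
  have "4 * s g * lam g \<le> Wd g * (2 * Wd g)" using s4 l2 by(rule mult_le_mono)
  hence "s g * lam g + 1 \<le> 2^Wd g" using w2 wp by linarith
  thus ?thesis unfolding par narrow_def using ceillog2_le_iff[of "blk (n g) * wide (n g) + 1" "Wd g"] by(simp add: par)
 qed
 have KW: "K g \<le> Wd g"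
 proof -
  have hp: "(2::nat)^(Wd g div 2) = 2^(Wd g div 2 - 2) * 4"
  proof -
   have "Wd g div 2 = (Wd g div 2 - 2) + 2" using W(1) by simp
   hence "(2::nat)^(Wd g div 2) = 2^((Wd g div 2 - 2) + 2)" by(rule arg_cong)
   thus ?thesis by(simp only: power_add) simp
  qed
  have "lg (n g) \<le> 2^(Wd g div 2 - 2)" using w2 ww lW W(1) unfolding hp by linarith
  hence "ceillog2 (lg (n g)) \<le> Wd g div 2 - 2"
   using lg_bounds(3)[OF e.n_pos] ceillog2_le_iff[of "lg (n g)"] by simp
  hence "kap (n g) \<le> Wd g div 2" using W(1) by(simp add: kap_def)
  thus ?thesis using par(5) by linarith
 qed
 have bk: "b g = 0 \<or> 2^b g < k"
 proof(cases "b g = 0")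
  case False
  hence "2 \<le> K g" "(K g - 1) * 2^b g < k" using par(6) params(7)[of "n g"] by auto
  moreover from this have "1 * 2^b g \<le> (K g - 1) * 2^b g" by(intro mult_le_mono1) simp
  ultimately show ?thesis by linarith
 qed simp
 have bW: "b g < Wd g"
 proof(cases "b g = 0")
  case False
  hence "(2::nat)^b g < 2^Wd g" using bk n(2) by linarith
  thus ?thesis by simp
 qed (use W in simp)
 have red: "p g < 2^b g" "p2 g < 2^b g" "Q g \<le> b g" using e.red by(auto simp: e.reduction_def)
 have bp: "(2::nat)^b g \<le> 2^Wd g" using bW by(intro power_increasing) auto
 have eW: "eta g \<le> Wd g"
 proof(rule hdr_bound[OF f])
  have "2 * Wd g < 2^Wd g" using ww w2 wp W(1) by linarith
  thus "lam g < 2^Wd g" "mu g < 2^Wd g" "K g < 2^Wd g" "b g < 2^Wd g" using l2 m KW bW W(1) by linarith+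
  show "p g < 2^Wd g" "p2 g < 2^Wd g" "Q g \<le> Wd g" using red bp bW by linarith+
 qed
 have size: "64 * (n g * (K g + 200) + 16) * (lam g + mu g + 1) < 2^lam g"
  unfolding par(2,3) by(rule params_size[OF e.n_pos par(5)])
 have capI: "cap (lam g) (mu g) N" if "N \<le> n g * (K g + 200) + 3" for N
  unfolding cap_def
 proof(rule le_less_trans[OF _ size])
  show "4 * (N + 4) * (lam g + mu g + 1) \<le> 64 * (n g * (K g + 200) + 16) * (lam g + mu g + 1)"
   using that by(intro mult_le_mono) auto
 qed
 have nK: "n g * (K g + 200) = n g * K g + 200 * n g" by(simp add: algebra_simps)
 have pr: "3 \<le> s g" "s g \<le> lam g" "s g * lam g < 2^mu g" "n g \<le> 2^(s g * 8)"
 proof -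
  have "(2::nat)^lg (n g) \<le> 2^(s g * 8)" unfolding par using params(6) by(intro power_increasing) auto
  thus "n g \<le> 2^(s g * 8)" using lg_bounds(1)[OF e.n_pos] by linarith
 qed (use params[of "n g"] par in auto)
 have s1: "1 \<le> s g" using pr by simp
 note sz = seg_sizes[OF f] and sb = seg_bound[OF s1 size]
 have rE: "rr g - EE g \<le> n g * K g" "EE g \<le> n g"
 proof -
  have "n g * 1 \<le> n g * K g" using par(4) by(intro mult_le_mono2)
  thus "rr g - EE g \<le> n g * K g" "EE g \<le> n g" using sz(5,6) by linarith+
 qed
 have "real (tot (segA g)) < 2^lam g"
  by(rule sb[of "n g * K g"]) (use nK sz(1) log_choose_le[OF rE(1)] in \<open>simp_all add: add.assoc\<close>)
 moreover have "real (tot (segB g)) < 2^lam g"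
  by(rule sb[of "n g"]) (use nK sz(2) log_choose_le[OF rE(2)] in \<open>simp_all add: add.assoc\<close>)
 moreover have "real (tot (segY g)) < 2^lam g"
  by(rule sb[of "200 * n g + 1"]) (use nK sz(3) rE(2) in \<open>simp_all add: add.assoc\<close>)
 moreover have "real (tot (segZ g)) < 2^lam g"
  by(rule sb[of "200 * n g"]) (use nK sz(4) rE(2) in \<open>simp_all add: add.assoc\<close>)
 moreover have "tot (tabseg g) < 2^lam g"
 proof -
  have "s g * (2 * s g + 3) \<le> 3 * (s g * s g)" using pr(1) mult_le_mono1[of 3 "s g" "s g"] by(simp add: algebra_simps)
  also have "... \<le> 3 * 2^(s g + 1)" by(intro mult_le_mono2 square_le_pow)
  finally have "s g * (2 * s g + 3) * 2^s g \<le> 3 * 2^(s g + 1) * 2^s g" by(rule mult_le_mono1)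
  also have "... < 2^(s g + s g + 3)" by(simp only: power_add) simp
  also have "... \<le> 2^lam g" unfolding par blk_def wide_def by(intro power_increasing) (use h2 in linarith)+
  finally show ?thesis by(simp add: tot_tabseg mult.assoc)
 qed
 ultimately have t: "tot (tabseg g) < 2^lam g" "tot (segA g) < 2^lam g" "tot (segB g) < 2^lam g"
  "tot (segY g) < 2^lam g" "tot (segZ g) < 2^lam g" by simp_all
 have cp: "cap (lam g) (mu g) (n g * K g + 2)" "cap (lam g) (mu g) (200 * n g + 3)"
  by(rule capI, unfold nK, use e.n_pos in linarith)+
 show ?thesis
  unfolding good1_def using e.elems_hash_axioms pr s4 l2 m KW bW eW red(3) n(1) par(4) st eta_Least(1)[OF f] cp t
  by(intro conjI ballI)
qed

text \<open>The summand \<open>4 * eta g\<close> prepays the outer header, in which the width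
  \<open>eta g\<close> is recorded. Apart from the entropy, \<open>k\<close> enters only through
  \<open>ceillog2 (b g + 2)\<close>, which is at most about lg lg k.\<close>

lemma fits_space:
 assumes f: "fits k g"
 shows "real (tot (main g) + 4 * eta g) \<le> log 2 (real (n g * k choose (n g - 1))) +
  2 * real (n g) * ((2^gam + 1) / (real (kap (n g)) - 1)) +
  (real (n g) * (2 * real (kap (n g)) + 402) / real (blk (n g)) + 20) * (9 * real (narrow (n g)) + 50) +
  300 * real (wide (n g)) + real (blk (n g) * ((2 * blk (n g) + 3) * 2^blk (n g))) +
  263 * real (ceillog2 (b g + 2)) + 22128 * (real (lg (n g)) + 1)\<^sup>2"
proof -
 let ?N = "real (n g)" and ?k = "2 * real (kap (n g)) + 402"
 interpret e: elems_hash "n g" "K g" "b g" "X g" "J g" "p g" "p2 g" "Q g" "A g" "sd g" "l g" using f by(simp add: fits_def)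
 have par: "s g = blk (n g)" "lam g = wide (n g)" "mu g = narrow (n g)" "1 \<le> K g" "K g \<le> 2 * kap (n g)"
  "b g = 0 \<and> K g = k \<or> 0 < b g \<and> kap (n g) \<le> K g \<and> (K g - 1) * 2^b g < k"
  using f by(auto simp: fits_def)
 define L where "L = lg (n g)"
 define bi where "bi = ceillog2 (b g + 2)"
 have T: "tot (main g) = 9 * eta g + Q g * (Q g + 1) + 5 * lam g + tot (tabseg g) + tot (segA g) + tot (segB g) + tot (segY g) +
   tot (segZ g) + b g * rr g"
  by(simp add: main_def body_def seeds_def recs_def)
 have QQ: "Q g * (Q g + 1) \<le> 16 * bi + 1458 * ((L + 1) * (L + 1))"
  unfolding bi_def L_def by(rule e.Q_bound[OF e.red])
 define c1 where "c1 = ceillog2 (e.P1 + 1)"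
 define c2 where "c2 = ceillog2 (e.P2 + 1)"
 have c1: "c1 \<le> bi + 2 * L + 2" unfolding c1_def bi_def L_def by(rule e.log_P1)
 have "c2 \<le> ceillog2 (c1 + 2) + 2 * L + 2" unfolding c1_def c2_def L_def by(rule e.log_P2)
 hence c2: "c2 \<le> bi + 4 * L + 6" using c1 ceillog2_le_self[of "c1 + 2"] by linarith
 define U where "U = lam g + mu g + K g + bi + c1 + c2 + Q g"
 have pw: "x < 2^U" if "x < 2^y" "y \<le> U" for x y :: nat
  using that power_increasing[of y U "2::nat"] by(meson less_le_trans one_le_numeral)
 have red: "p g \<le> e.P1" "p2 g \<le> e.P2" using e.red by(auto simp: e.reduction_def)
 have "eta g \<le> U"
 proof(rule hdr_bound[OF f])
  show "lam g < 2^U" "mu g < 2^U" "K g < 2^U" by(rule pw[OF less_exp]; simp add: U_def)+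
  show "b g < 2^U" by(rule pw[of _ bi]) (use le_two_power_ceillog2[of "b g + 2"] in \<open>simp_all add: bi_def U_def\<close>)
  show "p g < 2^U" by(rule pw[OF e.less_pow_ceillog2[OF red(1)]]) (simp add: c1_def U_def)
  show "p2 g < 2^U" by(rule pw[OF e.less_pow_ceillog2[OF red(2)]]) (simp add: c2_def U_def)
 qed (simp add: U_def)
 moreover have "lam g + mu g + K g \<le> 3 * L + 120 + 2 * L + 4"
 proof -
  have "mu g \<le> lam g" unfolding par by(rule params)
  moreover have "2 * lam g \<le> 3 * L + 120" unfolding par wide_def L_def by simp
  moreover have "K g \<le> 2 * L + 4" using par(5) ceillog2_le_self[of L] by(simp add: kap_def L_def)
  ultimately show ?thesis by linarith
 qed
 ultimately have "eta g \<le> 3 * bi + Q g + 132 * (L + 1)" using c1 c2 unfolding U_def distrib_left by linarith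
 moreover have "Q g \<le> Q g * (Q g + 1)" "L + 1 \<le> (L + 1) * (L + 1)" by simp_all
 moreover have "13 * h + q' \<le> 263 * bi + 22128 * v"
  if "h \<le> 3 * bi + q + 132 * u" "q \<le> q'" "u \<le> v" "q' \<le> 16 * bi + 1458 * v" for h q q' u v :: nat using that by linarith
 ultimately have "13 * eta g + Q g * (Q g + 1) \<le> 263 * bi + 22128 * ((L + 1) * (L + 1))" using QQ by blast
 hence "real (13 * eta g + Q g * (Q g + 1)) \<le> real (263 * bi + 22128 * ((L + 1) * (L + 1)))" by(rule of_nat_mono)
 moreover have "real ((L + 1) * (L + 1)) = (real L + 1)\<^sup>2" unfolding power2_eq_square of_nat_mult by(simp add: add.commute)
 ultimately have H: "real (13 * eta g + Q g * (Q g + 1)) \<le> 263 * real bi + 22128 * (real L + 1)\<^sup>2"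
  by(simp only: of_nat_add[of "263 * bi"] of_nat_mult[of 263] of_nat_mult[of 22128])
 note sz = seg_sizes[OF f]
 have ent: "log 2 (real (n g * K g choose (rr g - EE g))) + log 2 (real (n g choose EE g)) + real (gam * EE g) + real (b g * rr g) \<le>
  log 2 (real (n g * k choose rr g)) + 2 * ?N * ((2^gam + 1) / (real (kap (n g)) - 1))"
  by(rule cell_entropy[OF params(7) par(6) sz(6,5) e.b_pos])
 define M where "M = 9 * real (mu g) + 50"
 define S where "S = real (s g)"
 have S: "0 < S" using params(1)[of "n g"] by(simp add: S_def par)
 have "real (n g * K g) / S + 3 + (?N / S + 3) + (real (200 * n g + 1) / S + 3) + (real (200 * n g) / S + 3)
   = real (n g * K g + n g + (200 * n g + 1) + 200 * n g) / S + 12" by(simp add: add_divide_distrib)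
 also have "... \<le> ?N * (?k) / S + 20"
 proof -
  have "n g * K g \<le> n g * (2 * kap (n g))" using par(5) by(rule mult_le_mono2)
  hence "n g * K g + n g + (200 * n g + 1) + 200 * n g \<le> n g * (2 * kap (n g) + 402)"
   using e.n_pos unfolding distrib_left by linarith
  hence "real (n g * K g + n g + (200 * n g + 1) + 200 * n g) \<le> real (n g * (2 * kap (n g) + 402))" by(rule of_nat_mono)
  also have "... = ?N * (?k)" by simp
  finally have "real (n g * K g + n g + (200 * n g + 1) + 200 * n g) / S \<le> ?N * (?k) / S"
   using S by(intro divide_right_mono) auto
  thus ?thesis by linarith
 qed
 finally have "(real (n g * K g) / S + 3 + (?N / S + 3) + (real (200 * n g + 1) / S + 3) + (real (200 * n g) / S + 3)) * M
   \<le> (?N * (?k) / S + 20) * M" by(rule mult_right_mono) (simp add: M_def)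
 hence fr: "(real (n g * K g) / S + 3) * M + (?N / S + 3) * M + (real (200 * n g + 1) / S + 3) * M + (real (200 * n g) / S + 3) * M
   \<le> (?N * (?k) / S + 20) * M" by(simp only: distrib_right)
 have one: "1 \<le> real (lam g)" using params(1,2)[of "n g"] par by simp
 have E4: "real (200 * EE g + 1) + real (200 * EE g) = real (gam * EE g) + 1" by(simp add: gam_def)
 have "real (tot (main g) + 4 * eta g) = real (13 * eta g + Q g * (Q g + 1)) + 5 * real (lam g) + real (tot (tabseg g)) + real (tot (segA g)) +
   real (tot (segB g)) + real (tot (segY g)) + real (tot (segZ g)) + real (b g * rr g)" unfolding T by simp
 also have "... \<le> (263 * real bi + 22128 * (real L + 1)\<^sup>2) + 300 * real (lam g) + real (tot (tabseg g)) +
   (log 2 (real (n g * k choose rr g)) + 2 * ?N * ((2^gam + 1) / (real (kap (n g)) - 1))) +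
   (?N * (?k) / S + 20) * M"
  using H ent fr one E4 sz(1-4)[folded M_def S_def] by linarith
 finally show ?thesis unfolding M_def S_def par tot_tabseg bi_def L_def sz(7) by simp
qed

end

section \<open>The overhead is of lower order\<close>

definition ovh :: "nat \<Rightarrow> real" where
 "ovh n = 2 * real n * ((2^gam + 1) / (real (kap n) - 1)) +
  (real n * (2 * real (kap n) + 402) / real (blk n) + 20) * (9 * real (narrow n) + 50) +
  300 * real (wide n) + real (blk n * ((2 * blk n + 3) * 2^blk n)) + 22128 * (real (lg n) + 1)\<^sup>2"

text \<open>A bound for \<open>ovh n / real n\<close> in terms of \<open>x = lg n\<close>. Summands
  without a factor \<open>n\<close> are multiplied by \<open>2 * 2 powr (- x)\<close>, which is at
  least \<open>1 / n\<close> because of \<open>2^lg n \<le> 2 * n\<close>.\<close>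

definition phi :: "real \<Rightarrow> real" where
 "phi x = 2 * (2^gam + 1) * (1 / (log 2 x + 1)) +
  (((2 * (log 2 x + 3) + 402) * 8 / x + 40 * 2 powr (- x)) * (9 * (log 2 ((x + 3) * (2 * x + 60) + 1) + 1) + 50) +
  (600 * (2 * x + 60) + 2 * ((x + 3) * ((2 * x + 9) * (8 * 2 powr (x / 8)))) + 44256 * (x + 1)\<^sup>2) * 2 powr (- x))"

lemma phi_tendsto: "(phi \<longlongrightarrow> 0) at_top"
proof -
 have "((\<lambda>x::real. 1 / (log 2 x + 1)) \<longlongrightarrow> 0) at_top" by real_asymp
 hence 1: "((\<lambda>x::real. 2 * (2^gam + 1) * (1 / (log 2 x + 1))) \<longlongrightarrow> 0) at_top" by(rule tendsto_mult_right_zero)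
 have 2: "((\<lambda>x::real. ((2 * (log 2 x + 3) + 402) * 8 / x + 40 * 2 powr (- x)) * (9 * (log 2 ((x + 3) * (2 * x + 60) + 1) + 1) + 50) +
  (600 * (2 * x + 60) + 2 * ((x + 3) * ((2 * x + 9) * (8 * 2 powr (x / 8)))) + 44256 * (x + 1)\<^sup>2) * 2 powr (- x)) \<longlongrightarrow> 0) at_top"
  by real_asymp
 show ?thesis unfolding phi_def using tendsto_add[OF 1 2] by simp
qed

lemma ovh_nonneg: "0 \<le> ovh n"
proof -
 have "0 \<le> (2^gam + 1) / (real (kap n) - 1)" using params(7)[of n] by simp
 thus ?thesis unfolding ovh_def by(intro add_nonneg_nonneg mult_nonneg_nonneg) auto
qed

lemma ovh_le: assumes n: "1 \<le> n" shows "ovh n \<le> real n * phi (real (lg n))"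
proof -
 define x where "x = real (lg n)"
 define N where "N = real n"
 note lb = lg_bounds[OF n]
 have x1: "1 \<le> x" using lb(3) by(simp add: x_def)
 have N1: "1 \<le> N" using n by(simp add: N_def)
 have "real (2^lg n) \<le> real (2 * n)" using lb(2) by(rule of_nat_mono)
 hence P: "2 powr x \<le> 2 * N" by(simp add: x_def N_def powr_realpow)
 have one: "1 \<le> 2 * N * 2 powr (- x)" using P by(simp add: powr_minus divide_simps)
 define kp where "kp = real (kap n)"
 have k: "log 2 x + 2 \<le> kp" "kp \<le> log 2 x + 3" unfolding kp_def kap_def x_def
  using ceillog2_ge_log[of "lg n"] ceillog2_less_log[of "lg n"] lb(3) by simp_all
 have lx: "0 \<le> log 2 x" using x1 by simp
 define bi where "bi = real (blk n)"
 have b: "x / 8 \<le> bi" "bi \<le> x + 3"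
 proof -
  have "lg n \<le> blk n * 8" by(rule params)
  hence "real (lg n) \<le> real (blk n * 8)" by(rule of_nat_mono)
  thus "x / 8 \<le> bi" by(simp add: x_def bi_def)
  have "blk n \<le> lg n + 3" by(simp add: blk_def)
  hence "real (blk n) \<le> real (lg n + 3)" by(rule of_nat_mono)
  thus "bi \<le> x + 3" by(simp add: x_def bi_def)
 qed
 have w: "real (wide n) \<le> 2 * x + 60"
 proof -
  have "wide n \<le> 2 * lg n + 60" by(simp add: wide_def)
  hence "real (wide n) \<le> real (2 * lg n + 60)" by(rule of_nat_mono)
  thus ?thesis by(simp add: x_def)
 qed
 have m: "real (narrow n) \<le> log 2 ((x + 3) * (2 * x + 60) + 1) + 1"
 proof -
  have "real (narrow n) \<le> log 2 (real (blk n * wide n + 1)) + 1"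
   unfolding narrow_def using ceillog2_less_log[of "blk n * wide n + 1"] by simp
  moreover have "real (blk n * wide n + 1) \<le> (x + 3) * (2 * x + 60) + 1"
   using b(2) w x1 by(simp add: bi_def mult_mono)
  moreover have "0 < real (blk n * wide n + 1)" by(simp only: of_nat_0_less_iff)
  ultimately have "log 2 (real (blk n * wide n + 1)) \<le> log 2 ((x + 3) * (2 * x + 60) + 1)"
   by(intro log_mono) simp_all
  with \<open>real (narrow n) \<le> _\<close> show ?thesis by simp
 qed
 have p: "(2::real)^blk n \<le> 8 * 2 powr (x / 8)"
 proof -
  have "real (lg n div 8) \<le> x / 8" using div_le_divide[of "lg n" 8] by(simp add: x_def)
  hence "2 powr real (lg n div 8) \<le> 2 powr (x / 8)" by(simp add: powr_mono)
  thus ?thesis by(simp add: blk_def power_add powr_realpow)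
 qed
 have 1: "2 * N * ((2^gam + 1) / (kp - 1)) \<le> N * (2 * (2^gam + 1) * (1 / (log 2 x + 1)))"
 proof -
  have "(2^gam + 1) / (kp - 1) \<le> (2^gam + 1) / (log 2 x + 1)"
   using k lx by(intro divide_left_mono) (auto intro: add_nonneg_pos)
  hence "2 * N * ((2^gam + 1) / (kp - 1)) \<le> 2 * N * ((2^gam + 1) / (log 2 x + 1))"
   using N1 by(intro mult_left_mono) auto
  thus ?thesis by(simp only: mult.assoc mult.left_commute[of N 2] times_divide_eq_right mult.right_neutral)
 qed
 have 2: "(N * (2 * kp + 402) / bi + 20) * (9 * real (narrow n) + 50) \<le>
  N * (((2 * (log 2 x + 3) + 402) * 8 / x + 40 * 2 powr (- x)) * (9 * (log 2 ((x + 3) * (2 * x + 60) + 1) + 1) + 50))"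
 proof -
  have "N * (2 * kp + 402) / bi \<le> N * (2 * (log 2 x + 3) + 402) / (x / 8)"
   using k lx b x1 N1 by(intro frac_le mult_left_mono) auto
  moreover have "20 \<le> N * (40 * 2 powr (- x))" using one by simp
  ultimately have "N * (2 * kp + 402) / bi + 20 \<le> N * ((2 * (log 2 x + 3) + 402) * 8 / x + 40 * 2 powr (- x))"
   by(simp add: distrib_left mult.assoc)
  moreover have "0 \<le> N * ((2 * (log 2 x + 3) + 402) * 8 / x + 40 * 2 powr (- x))" using N1 lx x1 by simp
  ultimately have "(N * (2 * kp + 402) / bi + 20) * (9 * real (narrow n) + 50) \<le>
    N * ((2 * (log 2 x + 3) + 402) * 8 / x + 40 * 2 powr (- x)) * (9 * (log 2 ((x + 3) * (2 * x + 60) + 1) + 1) + 50)"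
   using m by(intro mult_mono) auto
  thus ?thesis by(simp only: mult.assoc)
 qed
 have 3: "300 * real (wide n) + bi * ((2 * bi + 3) * 2^blk n) + 22128 * (x + 1)\<^sup>2 \<le>
  N * ((600 * (2 * x + 60) + 2 * ((x + 3) * ((2 * x + 9) * (8 * 2 powr (x / 8)))) + 44256 * (x + 1)\<^sup>2) * 2 powr (- x))"
 proof -
  define Z where "Z = 300 * (2 * x + 60) + (x + 3) * ((2 * x + 9) * (8 * 2 powr (x / 8))) + 22128 * (x + 1)\<^sup>2"
  have "0 \<le> bi" by(simp add: bi_def)
  hence "bi * ((2 * bi + 3) * 2^blk n) \<le> (x + 3) * ((2 * x + 9) * (8 * 2 powr (x / 8)))"
   using b(2) x1 p by(intro mult_mono mult_nonneg_nonneg) auto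
  hence "300 * real (wide n) + bi * ((2 * bi + 3) * 2^blk n) + 22128 * (x + 1)\<^sup>2 \<le> Z" unfolding Z_def using w by simp
  also have "... \<le> Z * (2 * N * 2 powr (- x))"
  proof -
   have "0 \<le> Z" using x1 by(simp add: Z_def)
   thus ?thesis using one mult_left_mono[of 1 "2 * N * 2 powr (- x)" Z] by simp
  qed
  also have "... = N * ((2 * Z) * 2 powr (- x))" by simp
  finally show ?thesis by(simp add: Z_def distrib_left)
 qed
 have "ovh n = 2 * N * ((2^gam + 1) / (kp - 1)) + (N * (2 * kp + 402) / bi + 20) * (9 * real (narrow n) + 50) +
   (300 * real (wide n) + bi * ((2 * bi + 3) * 2^blk n) + 22128 * (x + 1)\<^sup>2)"
  by(simp add: ovh_def N_def kp_def bi_def x_def)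
 also have "... \<le> N * phi x" unfolding phi_def distrib_left using 1 2 3 by(simp only: distrib_left)
 finally show ?thesis by(simp add: N_def x_def)
qed

lemma lg_ge_log: "1 \<le> n \<Longrightarrow> log 2 (real n) \<le> real (lg n)"
proof -
 assume n: "1 \<le> n"
 have "real n \<le> real (2^lg n)" using lg_bounds(1)[OF n] by(intro of_nat_mono) simp
 hence "log 2 (real n) \<le> log 2 (2^lg n)" using n by(intro log_mono) simp_all
 thus ?thesis by(simp add: log_nat_power)
qed

lemma lg_le_log: "1 \<le> n \<Longrightarrow> real (lg n) \<le> log 2 (real n) + 1"
proof -
 assume n: "1 \<le> n"
 have "real (2^lg n) \<le> real (2 * n)" using lg_bounds(2)[OF n] by(rule of_nat_mono)
 hence "log 2 (2^lg n) \<le> log 2 (2 * real n)" by(intro log_mono) simp_all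
 thus ?thesis using n by(simp add: log_nat_power log_mult)
qed

lemma lg_at_top: "filterlim (\<lambda>n. real (lg n)) at_top sequentially"
proof(rule filterlim_at_top_mono)
 show "filterlim (\<lambda>n. log 2 (real n)) at_top sequentially" by real_asymp
 show "eventually (\<lambda>n. log 2 (real n) \<le> real (lg n)) sequentially"
  using eventually_ge_at_top[of 1] by eventually_elim (rule lg_ge_log)
qed

lemma ovh_smallo: "ovh \<in> o(\<lambda>n. real n)"
proof(rule smalloI_tendsto)
 show "eventually (\<lambda>n. real n \<noteq> 0) sequentially" using eventually_gt_at_top[of 0] by eventually_elim simp
 have ph: "((\<lambda>n. phi (real (lg n))) \<longlongrightarrow> 0) sequentially" by(rule filterlim_compose[OF phi_tendsto lg_at_top])
 show "((\<lambda>n. ovh n / real n) \<longlongrightarrow> 0) sequentially"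
 proof(rule tendsto_sandwich[OF _ _ tendsto_const ph])
  show "eventually (\<lambda>n. 0 \<le> ovh n / real n) sequentially" by(simp add: ovh_nonneg)
  show "eventually (\<lambda>n. ovh n / real n \<le> phi (real (lg n))) sequentially"
   using eventually_ge_at_top[of 1]
  proof eventually_elim
   case (elim n)
   thus ?case using ovh_le[OF elim] by(simp add: divide_le_eq mult.commute)
  qed
 qed
qed

lemma lg_smallo: "(\<lambda>n. real (lg n)) \<in> o(\<lambda>n. real n)"
proof(rule landau_o.big_small_trans)
 show "(\<lambda>n. real (lg n)) \<in> O(\<lambda>n. log 2 (real n) + 1)"
 proof(rule bigoI[where c = 1])
  show "eventually (\<lambda>n. norm (real (lg n)) \<le> 1 * norm (log 2 (real n) + 1)) sequentially"
   using eventually_ge_at_top[of 1] by eventually_elim (use lg_le_log in force)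
 qed
 show "(\<lambda>n. log 2 (real n) + 1) \<in> o(\<lambda>n. real n)" by real_asymp
qed

text \<open>The capacity of the memory has to be checked for every \<open>n\<close>, so the finitely
  many exceptions of the asymptotic bound are collected in a constant.\<close>

lemma smallo_linear:
 fixes f :: "nat \<Rightarrow> real"
 assumes "f \<in> o(\<lambda>n. real n)"
 shows "\<exists>c0. \<forall>n. f n \<le> real n / 8 + c0"
proof -
 have "eventually (\<lambda>n. norm (f n) \<le> 1 / 8 * norm (real n)) sequentially" by(rule landau_o.smallD[OF assms]) simp
 then obtain N where N: "\<And>n. n \<ge> N \<Longrightarrow> \<bar>f n\<bar> \<le> 1 / 8 * real n" by(auto simp: eventually_at_top_linorder)
 define c0 where "c0 = (\<Sum>n<N. \<bar>f n\<bar>)"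
 have c0: "0 \<le> c0" unfolding c0_def by(rule sum_nonneg) simp
 have "f n \<le> real n / 8 + c0" for n
 proof(cases "n < N")
  case True
  hence "\<bar>f n\<bar> \<le> c0" unfolding c0_def by(intro member_le_sum) auto
  thus ?thesis by simp
 next
  case False
  thus ?thesis using N[of n] c0 by simp
 qed
 thus ?thesis by blast
qed

section \<open>Counting trees\<close>

lemma exp_1_le: "(1 + 1 / real k)^k \<le> 4"
proof(cases "k = 0")
 case False
 have "1 + 1 / real k \<le> exp (1 / real k)" by(rule exp_ge_add_one_self)
 hence "(1 + 1 / real k)^k \<le> exp (1 / real k)^k" by(rule power_mono) simp
 also have "... = exp 1" using False by(simp flip: exp_of_nat_mult)
 also have "... \<le> 4" using exp_le by simp
 finally show ?thesis .
qed simp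

lemma choose_tree_le:
 assumes "1 \<le> k" "1 \<le> n"
 shows "real (n * k choose (n - 1)) \<le> 4^n * real k^(n - 1)"
proof -
 have "real (n * k choose (n - 1)) * (1 / real k)^(n - 1) \<le> (1 + 1 / real k)^(n * k)"
  by(rule choose_weighted) simp
 also have "... = ((1 + 1 / real k)^k)^n" by(simp add: power_mult mult.commute)
 also have "... \<le> 4^n" by(rule power_mono[OF exp_1_le]) simp
 finally show ?thesis using assms by(simp add: power_divide divide_le_eq mult.commute)
qed

lemma tree_entropy_le:
 assumes k: "1 \<le> k" and n: "1 \<le> n"
 shows "log 2 (real (n * k choose (n - 1))) \<le> 2 * real n + real n * log 2 (real k)"
proof -
 have "n - 1 \<le> n * k" using k by(metis diff_le_self le_trans mult.right_neutral mult_le_mono2)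
 hence pos: "0 < real (n * k choose (n - 1))" by simp
 have "real (n * k choose (n - 1)) \<le> 4^n * real k^(n - 1)" by(rule choose_tree_le[OF k n])
 also have "... \<le> 4^n * real k^n" using k by(intro mult_left_mono power_increasing) auto
 finally have "log 2 (real (n * k choose (n - 1))) \<le> log 2 (4^n * real k^n)" by(intro log_mono pos) simp_all
 also have "... = log 2 (4^n) + log 2 (real k^n)" using k by(simp add: log_mult)
 also have "log 2 (4^n) = 2 * real n"
 proof -
  have "(4::real)^n = 2^(2 * n)" by(simp add: power_mult)
  thus ?thesis by(simp add: log_nat_power)
 qed
 also have "log 2 (real k^n) = real n * log 2 (real k)" using k by(simp add: log_nat_power)
 finally show ?thesis .
qed

text \<open>For the smallest word sizes a tree is stored as its number, which has to fit into
  \<open>w * 2^w\<close> bits; hence a bound with almost no slack. With \<open>W = 2^w\<close> it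
  reduces to \<open>4^n * k^(n - 1) \<le> W^k * W^(n - 1)\<close>. The factor \<open>4^n\<close> is
  absorbed by the gap between \<open>k\<close> and \<open>W\<close> for small \<open>k\<close>, by
  \<open>W^k\<close> for large \<open>k\<close>, and half by each in between.\<close>

lemma choose_tree_word:
 fixes w n :: nat
 assumes w: "1 \<le> w" and n: "1 \<le> n" "n < 2^w"
 shows "n * (2^w - n) choose (n - 1) \<le> (2^w)^(2^w - 1)"
proof(cases "w = 1")
 case True
 hence "n = 1" using n by simp
 thus ?thesis by simp
next
 case False
 define W where "W = (2::nat)^w"
 define k where "k = W - n"
 have w2: "2 \<le> w" using False w by simp
 hence "(2::nat)^2 \<le> W" unfolding W_def by(intro power_increasing) auto
 hence W4: "4 \<le> W" by simp
 have k: "1 \<le> k" "n + k = W" using n by(auto simp: k_def W_def)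
 have Wk: "W^k = 2^(w * k)" by(simp add: W_def power_mult)
 have kw: "2 * k \<le> w * k" using w2 by(rule mult_le_mono1)
 obtain m where m: "n = Suc m" using n(1) by(cases n) auto
 have "real (n * k choose (n - 1)) \<le> 4^n * real k^(n - 1)" by(rule choose_tree_le[OF k(1) n(1)])
 also have "... = real (4^n * k^(n - 1))" by simp
 finally have "n * k choose (n - 1) \<le> 4^n * k^(n - 1)" by(simp only: of_nat_le_iff)
 also have "... \<le> W^k * W^(n - 1)"
 proof -
  consider "4 * k \<le> W" | "2 * k \<le> W" "W < 4 * k" | "W < 2 * k" by linarith
  thus ?thesis
  proof cases
   case 1
   have "4^n * k^(n - 1) = 4 * (4 * k)^m" by(simp add: m power_mult_distrib)
   also have "... \<le> W^k * W^m"
   proof(rule mult_le_mono)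
    have "W^1 \<le> W^k" using k(1) W4 by(intro power_increasing) auto
    thus "4 \<le> W^k" using W4 by simp
    show "(4 * k)^m \<le> W^m" using 1 by(rule power_mono) simp
   qed
   finally show ?thesis by(simp add: m)
  next
   case 2
   have "n + 1 \<le> w * k"
   proof(cases "w = 2")
    case True
    hence "W = 4" by(simp add: W_def)
    hence "1 < k" using 2 by linarith
    hence "2 \<le> k" by simp
    thus ?thesis using \<open>W = 4\<close> k unfolding True by linarith
   next
    case False
    hence "3 * k \<le> w * k" using w2 by(intro mult_le_mono1) simp
    thus ?thesis using 2 k by linarith
   qed
   hence *: "(2::nat)^(n + 1) \<le> W^k" unfolding Wk by(intro power_increasing) auto
   have "(4::nat)^n = 2^n * 2^n" by(simp flip: power_mult_distrib)
   hence "4^n * k^(n - 1) = 2^(n + 1) * (2 * k)^m" by(simp add: m power_mult_distrib)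
   also have "... \<le> W^k * W^m" using * 2(1) by(intro mult_le_mono power_mono) auto
   finally show ?thesis by(simp add: m)
  next
   case 3
   hence "2 * n \<le> w * k" using k kw by linarith
   hence "(2::nat)^(2 * n) \<le> W^k" unfolding Wk by(intro power_increasing) auto
   hence "4^n \<le> W^k" by(simp add: power_mult)
   thus ?thesis using k by(intro mult_le_mono power_mono) auto
  qed
 qed
 also have "... = W^(W - 1)" using k n(1) by(simp flip: power_add)
 finally show ?thesis by(simp add: W_def k_def)
qed

definition word_trees :: "nat \<Rightarrow> nat list set set" where
 "word_trees W = {Tr. \<exists>k. 1 \<le> k \<and> cardinal_tree k Tr \<and> k + card Tr \<le> W}"

lemma cardinal_tree_mono: "cardinal_tree k Tr \<Longrightarrow> k \<le> k' \<Longrightarrow> cardinal_tree k' Tr"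
 by(auto simp: cardinal_tree_def) (metis less_le_trans)

lemma image_strict_mono_eq:
 fixes f g :: "nat \<Rightarrow> nat"
 assumes f: "\<And>a a'. a < a' \<Longrightarrow> a' < m \<Longrightarrow> f a < f a'" and g: "\<And>a a'. a < a' \<Longrightarrow> a' < m \<Longrightarrow> g a < g a'"
  and eq: "f ` {..<m} = g ` {..<m}" and a: "a < m"
 shows "f a = g a"
proof -
 have *: "sorted_list_of_set (h ` {..<m}) = map h [0..<m]" if h: "\<And>a a'. a < a' \<Longrightarrow> a' < m \<Longrightarrow> h a < h a'" for h :: "nat \<Rightarrow> nat"
 proof -
  have "sorted_wrt (<) (map h [0..<m])" unfolding sorted_wrt_map by(rule sorted_wrt_mono_rel[OF _ sorted_wrt_upt]) (use h in auto)
  hence "sorted (map h [0..<m])" "distinct (map h [0..<m])" by(simp_all only: strict_sorted_iff)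
  hence "sorted_list_of_set (set (map h [0..<m])) = map h [0..<m]" by(rule sorted_list_of_set.idem_if_sorted_distinct)
  thus ?thesis by(simp add: lessThan_atLeast0)
 qed
 have "map f [0..<m] = map g [0..<m]"
  using *[of f, OF f] *[of g, OF g] unfolding eq by(rule trans[OF sym])
 hence "map f [0..<m] ! a = map g [0..<m] ! a" by(rule arg_cong)
 thus ?thesis using a by simp
qed

text \<open>The positions \<open>PX * k + LJ\<close> of the edges form a set of \<open>n - 1\<close>
  numbers below \<open>n * k\<close>. They increase with the number of the node, so the set
  determines parents and labels and thereby the tree.\<close>

lemma card_trees:
 "finite {Tr. cardinal_tree k Tr \<and> card Tr = n} \<and> card {Tr. cardinal_tree k Tr \<and> card Tr = n} \<le> n * k choose (n - 1)"
proof -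
 define S where "S = {Tr. cardinal_tree k Tr \<and> card Tr = n}"
 define h where "h Tr a = tree.PX Tr a * k + tree.LJ Tr a" for Tr a
 define B where "B = {U. U \<subseteq> {..<n * k} \<and> card U = n - 1}"
 have mono: "h Tr a < h Tr a'" if T: "Tr \<in> S" and a: "a < a'" "a' < n - 1" for Tr a a'
 proof -
  interpret t: tree k Tr using T by unfold_locales (simp add: S_def)
  have a': "a < card Tr - 1" "a' < card Tr - 1" using T a by(auto simp: S_def)
  have l: "t.LJ a < k" using t.nd_Suc(3)[OF a'(1)] .
  from t.PX_LJ_lex[OF a(1) a'(2)] show ?thesis
  proof
   assume "t.PX a < t.PX a'"
   hence "(t.PX a + 1) * k \<le> t.PX a' * k" by(intro mult_le_mono1) simp
   thus ?thesis using l by(simp add: h_def)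
  qed (simp add: h_def)
 qed
 have into: "h Tr ` {..<n - 1} \<in> B" if T: "Tr \<in> S" for Tr
 proof -
  interpret t: tree k Tr using T by unfold_locales (simp add: S_def)
  have n: "card Tr = n" using T by(simp add: S_def)
  have "h Tr a < n * k" if "a < n - 1" for a
  proof -
   have a: "a < card Tr - 1" using that n by simp
   have "(t.PX a + 1) * k \<le> n * k" using t.nd_Suc(2)[OF a] n by(intro mult_le_mono1) simp
   thus ?thesis using t.nd_Suc(3)[OF a] by(simp add: h_def)
  qed
  moreover have "inj_on (h Tr) {..<n - 1}"
   by(rule linorder_inj_onI) (use mono[OF T] in auto, force)
  ultimately show ?thesis unfolding B_def by(auto simp: card_image)
 qed
 have inj: "inj_on (\<lambda>Tr. h Tr ` {..<n - 1}) S"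
 proof(rule inj_onI)
  fix Tr Tr' assume T: "Tr \<in> S" "Tr' \<in> S" and eq: "h Tr ` {..<n - 1} = h Tr' ` {..<n - 1}"
  interpret t: tree k Tr using T by unfold_locales (simp add: S_def)
  interpret u: tree k Tr' using T by unfold_locales (simp add: S_def)
  have n: "card Tr = n" "card Tr' = n" using T by(auto simp: S_def)
  show "Tr = Tr'"
  proof(rule tree_eqI[OF t.tree_axioms u.tree_axioms])
   fix a assume a: "a < card Tr - 1"
   hence a': "a < n - 1" "a < card Tr' - 1" using n by simp_all
   have e: "h Tr a = h Tr' a" by(rule image_strict_mono_eq[OF mono[OF T(1)] mono[OF T(2)] eq a'(1)])
   have l: "t.LJ a < k" "u.LJ a < k" using t.nd_Suc(3)[OF a] u.nd_Suc(3)[OF a'(2)] .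
   have "t.PX a = h Tr a div k" "u.PX a = h Tr' a div k" "t.LJ a = h Tr a mod k" "u.LJ a = h Tr' a mod k"
    using l by(simp_all add: h_def)
   thus "t.PX a = u.PX a \<and> t.LJ a = u.LJ a" using e by simp
  qed (simp add: n)
 qed
 have fB: "finite B" unfolding B_def by(rule finite_subset[of _ "Pow {..<n * k}"]) auto
 have cB: "card B = n * k choose (n - 1)" unfolding B_def using n_subsets[of "{..<n * k}" "n - 1"] by simp
 have "(\<lambda>Tr. h Tr ` {..<n - 1}) ` S \<subseteq> B" using into by blast
 thus ?thesis using inj_on_finite[OF inj _ fB] card_inj_on_le[OF inj _ fB] cB by(simp add: S_def)
qed

text \<open>A tree with \<open>n\<close> nodes may be given the largest arity \<open>W - n\<close>;
  then there are fewer than \<open>W\<close> sizes with at most \<open>W^(W - 1)\<close> trees each,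
  and \<open>W^W = 2^(w * W)\<close>.\<close>

lemma ex_tree_code:
 fixes w :: nat
 assumes w: "1 \<le> w"
 shows "\<exists>code. inj_on code (word_trees (2^w)) \<and> (\<forall>Tr\<in>word_trees (2^w). code Tr < (2::nat)^(w * 2^w))" and "finite (word_trees (2^w))"
proof -
 define W where "W = (2::nat)^w"
 define S where "S n = {Tr. cardinal_tree (W - n) Tr \<and> card Tr = n}" for n
 have sub: "word_trees W \<subseteq> (\<Union>n\<in>{1..<W}. S n)"
 proof
  fix Tr assume "Tr \<in> word_trees W"
  then obtain k where k: "1 \<le> k" "cardinal_tree k Tr" "k + card Tr \<le> W" by(auto simp: word_trees_def)
  interpret t: tree k Tr by unfold_locales (rule k)
  have "cardinal_tree (W - card Tr) Tr" by(rule cardinal_tree_mono[OF k(2)]) (use k in simp)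
  moreover have "card Tr \<in> {1..<W}" using k t.n_pos by simp
  ultimately show "Tr \<in> (\<Union>n\<in>{1..<W}. S n)" unfolding S_def by blast
 qed
 have fin: "finite (\<Union>n\<in>{1..<W}. S n)" unfolding S_def using card_trees by blast
 thus "finite (word_trees (2^w))" using sub finite_subset unfolding W_def by blast
 have "card (word_trees W) \<le> card (\<Union>n\<in>{1..<W}. S n)" by(rule card_mono[OF fin sub])
 also have "... \<le> (\<Sum>n\<in>{1..<W}. card (S n))" by(rule card_UN_le) simp
 also have "... \<le> (\<Sum>n\<in>{1..<W}. W^(W - 1))"
 proof(rule sum_mono)
  fix n assume "n \<in> {1..<W}"
  hence "1 \<le> n" "n < 2^w" by(auto simp: W_def)
  from choose_tree_word[OF w this] show "card (S n) \<le> W^(W - 1)"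
   using card_trees[of "W - n" n] unfolding S_def W_def by linarith
 qed
 also have "... = (W - 1) * W^(W - 1)" by simp
 also have "... \<le> W * W^(W - 1)" by(rule mult_le_mono1) simp
 also have "... = W^W" by(metis W_def power_eq_if power_not_zero zero_neq_numeral)
 also have "... = 2^(w * W)" by(simp add: W_def power_mult)
 finally have "card (word_trees W) \<le> card {..<(2::nat)^(w * W)}" by simp
 then obtain f where "f ` word_trees W \<subseteq> {..<(2::nat)^(w * W)}" "inj_on f (word_trees W)"
  using card_le_inj[OF finite_subset[OF sub fin] finite_lessThan] by blast
 thus "\<exists>code. inj_on code (word_trees (2^w)) \<and> (\<forall>Tr\<in>word_trees (2^w). code Tr < (2::nat)^(w * 2^w))"
  unfolding W_def by(intro exI[of _ f]) auto
qed

section \<open>Finite tables\<close>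

lemma ev_all_ones: "1 \<le> w \<Longrightarrow> ev w m a (Bin Sub (Cst 0) (Cst 1)) = 2^w - 1"
proof -
 assume "1 \<le> w"
 hence "1 < (2::nat)^w" by(intro one_less_power) auto
 thus ?thesis by simp
qed

text \<open>Inputs are added one at a time. The value at the new input \<open>t\<close> must not
  disturb the earlier ones, so for each of these the expression is guarded by some \<open>d\<close>
  that tells it from \<open>t\<close>.\<close>

lemma table_one:
 assumes "finite S" "\<And>t. t \<in> S \<Longrightarrow> F t < 2^w"
  and "\<And>t u. t \<in> S \<Longrightarrow> u \<in> S \<Longrightarrow> t \<noteq> u \<Longrightarrow>
   \<exists>d. ev w (fst t) (snd t) d \<noteq> ev w (fst u) (snd u) d \<and> ev w (fst t) (snd t) d < 2^w"
 shows "\<exists>e. \<forall>t\<in>S. ev w (fst t) (snd t) e = F t"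
 using assms
proof(induction S rule: finite_induct)
 case (insert t S)
 obtain e where e: "\<forall>u\<in>S. ev w (fst u) (snd u) e = F u" using insert by blast
 have "R \<subseteq> S \<Longrightarrow> \<exists>e'. ev w (fst t) (snd t) e' = F t \<and> (\<forall>u\<in>R. ev w (fst u) (snd u) e' = ev w (fst u) (snd u) e)"
  if "finite R" for R
  using that
 proof(induction R rule: finite_induct)
  case empty
  show ?case using insert.prems(1)[of t] by(intro exI[of _ "Cst (F t)"]) simp
 next
  case (insert u R)
  obtain e' where e': "ev w (fst t) (snd t) e' = F t" "\<forall>u\<in>R. ev w (fst u) (snd u) e' = ev w (fst u) (snd u) e"
   using insert by blast
  have "u \<in> S" "t \<noteq> u" using insert.prems \<open>t \<notin> S\<close> by auto
  then obtain d where d: "ev w (fst t) (snd t) d \<noteq> ev w (fst u) (snd u) d" "ev w (fst t) (snd t) d < 2^w"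
   using insert.prems(1) \<open>\<And>t' u'. t' \<in> insert t S \<Longrightarrow> u' \<in> insert t S \<Longrightarrow> t' \<noteq> u' \<Longrightarrow> _\<close>[of t u] by blast
  define v where "v = ev w (fst t) (snd t) d"
  \<comment> \<open>Two comparisons with \<open><\<close> express the test that \<open>d\<close> has
    the value \<open>v\<close>.\<close>
  define e'' where "e'' = Iflt d (Cst v) e (Iflt (Cst v) d e e')"
  have v: "v mod 2^w = v" using d(2) by(simp add: v_def)
  have E: "ev w m a e'' = (if ev w m a d = v then ev w m a e' else ev w m a e)" for m a
   unfolding e''_def by(simp add: v)
  show ?case
  proof(intro exI[of _ e''] conjI ballI)
   show "ev w (fst t) (snd t) e'' = F t" using e' by(simp add: E v_def)
   fix r assume "r \<in> insert u R"
   thus "ev w (fst r) (snd r) e'' = ev w (fst r) (snd r) e" using e'(2) d(1) by(auto simp: E v_def)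
  qed
 qed
 from this[OF insert.hyps(1)] obtain e' where
  "ev w (fst t) (snd t) e' = F t" "\<forall>u\<in>S. ev w (fst u) (snd u) e' = ev w (fst u) (snd u) e" by blast
 thus ?case using e by(intro exI[of _ e']) auto
qed simp

text \<open>A constant is truncated to the word size: \<open>2^W - 1\<close> becomes the largest
  word if \<open>w \<le> W\<close> and stays below it otherwise. In this way a program can compare
  its own word size with a constant.\<close>

lemma word_split:
 assumes "1 \<le> w"
 shows "ev w m a (Iflt (Cst (2^W - 1)) (Bin Sub (Cst 0) (Cst 1)) e e') = (if W < w then ev w m a e else ev w m a e')"
proof(cases "W < w")
 case True
 hence "(2::nat)^W < 2^w" by simp
 moreover have "0 < (2::nat)^W" by simp
 ultimately have "2^W - 1 < (2::nat)^w" "(2::nat)^W - 1 < 2^w - 1" by linarith+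
 thus ?thesis using True ev_all_ones[OF assms, of m a] by(simp del: ev.simps(3))
next
 case False
 have "(2^W - 1) mod (2::nat)^w = 2^w - 1"
 proof -
  have "(mask W :: nat) mod 2^w = mask w" using False by(simp flip: take_bit_eq_mod)
  thus ?thesis by(simp add: mask_eq_exp_minus_1)
 qed
 thus ?thesis using False ev_all_ones[OF assms, of m a] by(simp del: ev.simps(3))
qed

text \<open>Finitely many inputs can be answered by one expression as soon as the input determines
  the answer. Distinct inputs of equal word size differ in an argument or in a memory word at an
  address below \<open>2^wd t\<close>, so some expression tells them apart; different word sizes are
  separated by \<open>word_split\<close>.\<close>

lemma table:
 fixes I :: "'i set" and W :: nat and wd :: "'i \<Rightarrow> nat" and mm aa :: "'i \<Rightarrow> nat \<Rightarrow> nat"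
 assumes fin: "finite I" and w: "\<And>t. t \<in> I \<Longrightarrow> 1 \<le> wd t \<and> wd t \<le> W \<and> F t < 2^wd t"
  and bnd: "\<And>t i. t \<in> I \<Longrightarrow> mm t i < 2^wd t \<and> aa t i < 2^wd t"
  and zero: "\<And>t i. t \<in> I \<Longrightarrow> (2^wd t \<le> i \<longrightarrow> mm t i = 0) \<and> (2 \<le> i \<longrightarrow> aa t i = 0)"
  and det: "\<And>t u. t \<in> I \<Longrightarrow> u \<in> I \<Longrightarrow> wd t = wd u \<Longrightarrow> mm t = mm u \<Longrightarrow> aa t = aa u \<Longrightarrow> F t = F u"
 shows "\<exists>e. \<forall>t\<in>I. ev (wd t) (mm t) (aa t) e = F t"
proof -
 have one: "\<exists>e. \<forall>t\<in>I. wd t = v \<longrightarrow> ev v (mm t) (aa t) e = F t" for v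
 proof -
  define S where "S = (\<lambda>t. (mm t, aa t)) ` {t \<in> I. wd t = v}"
  define h where "h s = (SOME t. t \<in> I \<and> wd t = v \<and> (mm t, aa t) = s)" for s
  have h: "h s \<in> I \<and> wd (h s) = v \<and> (mm (h s), aa (h s)) = s" if "s \<in> S" for s
  proof -
   have "\<exists>t. t \<in> I \<and> wd t = v \<and> (mm t, aa t) = s" using that unfolding S_def by blast
   thus ?thesis unfolding h_def by(rule someI_ex)
  qed
  have "\<exists>e. \<forall>s\<in>S. ev v (fst s) (snd s) e = F (h s)"
  proof(rule table_one)
   show "finite S" using fin by(simp add: S_def)
   show "F (h s) < 2^v" if "s \<in> S" for s using h[OF that] w[of "h s"] by blast
   fix s s' assume s: "s \<in> S" "s' \<in> S" "s \<noteq> s'"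
   obtain t where t: "t \<in> I" "wd t = v" "s = (mm t, aa t)" using h[OF s(1)] by metis
   obtain u where u: "u \<in> I" "wd u = v" "s' = (mm u, aa u)" using h[OF s(2)] by metis
   show "\<exists>d. ev v (fst s) (snd s) d \<noteq> ev v (fst s') (snd s') d \<and> ev v (fst s) (snd s) d < 2^v"
   proof(cases "mm t = mm u")
    case False
    then obtain i where i: "mm t i \<noteq> mm u i" by blast
    hence "\<not> 2^v \<le> i" using zero[OF t(1), of i] zero[OF u(1), of i] t(2) u(2) by auto
    thus ?thesis using i bnd[OF t(1), of i] t u by(intro exI[of _ "Mem (Cst i)"]) simp
   next
    case True
    then obtain i where i: "aa t i \<noteq> aa u i" using s(3) t u by auto
    hence "\<not> 2 \<le> i" using zero[OF t(1), of i] zero[OF u(1), of i] by auto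
    thus ?thesis using i bnd[OF t(1), of i] t u by(intro exI[of _ "Arg i"]) simp
   qed
  qed
  then obtain e where e: "\<forall>s\<in>S. ev v (fst s) (snd s) e = F (h s)" by blast
  show ?thesis
  proof(intro exI[of _ e] ballI impI)
   fix t assume t: "t \<in> I" "wd t = v"
   hence s: "(mm t, aa t) \<in> S" by(auto simp: S_def)
   have "F (h (mm t, aa t)) = F t" using h[OF s] t by(intro det) auto
   thus "ev v (mm t) (aa t) e = F t" using e s by fastforce
  qed
 qed
 have "\<exists>e. \<forall>t\<in>I. wd t \<le> V \<longrightarrow> ev (wd t) (mm t) (aa t) e = F t" for V
 proof(induction V)
  case 0
  show ?case using w by(intro exI[of _ "Cst 0"]) fastforce
 next
  case (Suc V)
  obtain e where e: "\<forall>t\<in>I. wd t \<le> V \<longrightarrow> ev (wd t) (mm t) (aa t) e = F t" using Suc by blast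
  obtain e' where e': "\<forall>t\<in>I. wd t = Suc V \<longrightarrow> ev (Suc V) (mm t) (aa t) e' = F t" using one by blast
  show ?case
  proof(intro exI[of _ "Iflt (Cst (2^V - 1)) (Bin Sub (Cst 0) (Cst 1)) e' e"] ballI impI)
   fix t assume t: "t \<in> I" "wd t \<le> Suc V"
   have "1 \<le> wd t" using w[OF t(1)] by blast
   thus "ev (wd t) (mm t) (aa t) (Iflt (Cst (2^V - 1)) (Bin Sub (Cst 0) (Cst 1)) e' e) = F t"
    unfolding word_split[OF \<open>1 \<le> wd t\<close>]
   proof(cases "V < wd t")
    case True
    hence "wd t = Suc V" using t(2) by simp
    thus "(if V < wd t then ev (wd t) (mm t) (aa t) e' else ev (wd t) (mm t) (aa t) e) = F t" using e' t(1) by simp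
   next
    case False
    thus "(if V < wd t then ev (wd t) (mm t) (aa t) e' else ev (wd t) (mm t) (aa t) e) = F t" using e t(1) by simp
   qed
  qed
 qed
 from this[of W] obtain e where e: "\<forall>t\<in>I. wd t \<le> W \<longrightarrow> ev (wd t) (mm t) (aa t) e = F t" by blast
 thus ?thesis using w by(intro exI[of _ e]) blast
qed

section \<open>Bit strings\<close>

definition bits :: "nat \<Rightarrow> nat \<Rightarrow> bool list" where
 "bits N B = map (bit B) [0..<N]"

lemma length_bits [simp]: "length (bits N B) = N"
 by(simp add: bits_def)

lemma packed_bits: assumes "B < 2^N" shows "packed w (bits N B) a = fld B (a * w) w"
proof -
 have "horner_sum of_bool 2 (bits N B) = take_bit N B" unfolding bits_def by(rule horner_sum_bit_eq_take_bit)
 thus ?thesis using assms by(simp add: packed_eq_fld take_bit_eq_mod)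
qed

lemma bit_fld: "bit (fld B p l) i \<longleftrightarrow> i < l \<and> bit B (p + i)"
 unfolding fld_def by(simp add: bit_take_bit_iff bit_drop_bit_eq flip: take_bit_eq_mod drop_bit_eq_div)

lemma fld_eqI: assumes "1 \<le> w" "\<And>a. fld B (a * w) w = fld B' (a * w) w" shows "B = B'"
proof(rule bit_eqI)
 fix i
 have i: "i div w * w + i mod w = i" by simp
 have "i mod w < w" using assms(1) by simp
 hence "bit B i \<longleftrightarrow> bit (fld B (i div w * w) w) (i mod w)" "bit B' i \<longleftrightarrow> bit (fld B' (i div w * w) w) (i mod w)"
  unfolding bit_fld i by simp_all
 thus "bit B i \<longleftrightarrow> bit B' i" using assms(2) by simp
qed

lemma fld_beyond: assumes "B < 2^N" "N \<le> p" shows "fld B p l = 0"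
proof -
 have "(2::nat)^N \<le> 2^p" using assms(2) by(rule power_increasing) simp
 hence "B < 2^p" using assms(1) by linarith
 thus ?thesis by(simp add: fld_def)
qed

lemma fld_word: "p + l \<le> w \<Longrightarrow> fld (fld B 0 w) p l = fld B p l"
 by(rule bit_eqI) (auto simp: bit_fld)

text \<open>Adding 1 sets the lowest zero and clears the ones below it; subtracting what
  \<open>m\<close> and \<open>m + 1\<close> share isolates that bit. A unary number is decoded in
  this way without a loop.\<close>

lemma lowest_zero:
 fixes m u :: nat
 assumes "m mod 2^(u + 1) = 2^u - 1"
 shows "(m + 1) - Bit_Operations.and (m + 1) m = 2^u" "Bit_Operations.and (m + 1) m \<le> m + 1"
proof -
 define h where "h = m div 2^(u + 1)"
 have m: "m = push_bit (u + 1) h + mask u"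
  using div_mult_mod_eq[of m "2^(u + 1)"] assms by(simp add: h_def push_bit_eq_mult mask_eq_exp_minus_1)
 have m1: "m + 1 = push_bit (u + 1) h + 2^u" unfolding m by(simp add: mask_eq_exp_minus_1)
 have a1: "Bit_Operations.and (push_bit (u + 1) h) (mask u) = 0" by(rule bit_eqI) (auto simp: bit_simps)
 have a2: "Bit_Operations.and (push_bit (u + 1) h) (2^u) = 0"
  by(rule bit_eqI, unfold bit_and_iff bit_push_bit_iff bit_exp_iff) auto
 have "Bit_Operations.and (m + 1) m = push_bit (u + 1) h"
  unfolding m1 unfolding m disjunctive_add_eq_or[OF a1] disjunctive_add_eq_or[OF a2]
  by(rule bit_eqI) (auto simp: bit_simps)
 thus "(m + 1) - Bit_Operations.and (m + 1) m = 2^u" "Bit_Operations.and (m + 1) m \<le> m + 1" unfolding m1 by simp_all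
qed

lemma holds_enc: "holds (enc xs) 0 xs"
 using enc_less[of xs] by(simp add: holds_def fld_def)

lemma holds_single: "holds B p [(l, v)] \<longleftrightarrow> fld B p l = v mod 2^l"
 by(simp add: holds_def)

context ram begin

lemma c1_and: "c1 G F \<Longrightarrow> c1 G F' \<Longrightarrow> c1 G (\<lambda>g. Bit_Operations.and (F g) (F' g))"
 using c1_bin[of G F F' And] by simp

text \<open>The whole header lies in the word at address 0, which can be read before the word size
  is known. What becomes available is the power \<open>2^u g\<close> rather than \<open>u g\<close>,
  so the fields are extracted by division and remainder with products of this power.\<close>

lemma mini_decode:
 fixes u v0 v1 v2 :: "'g \<Rightarrow> nat"
 assumes ok: "ok G" and W: "\<And>g. g \<in> G \<Longrightarrow> 4 * u g + 1 \<le> Wd g"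
  and h: "\<And>g. g \<in> G \<Longrightarrow> holds (Bm g) 0 [(u g, 2^u g - 1), (1, 0), (u g, v0 g), (u g, v1 g), (u g, v2 g)]"
  and v: "\<And>g. g \<in> G \<Longrightarrow> v0 g < 2^u g \<and> v1 g < 2^u g \<and> v2 g < 2^u g"
 shows "c1 G v0" "c1 G v1" "c1 G v2"
proof -
 define m where "m g = fld (Bm g) 0 (Wd g)" for g
 have zero: "c1 G (\<lambda>_. 0)" and one: "c1 G (\<lambda>_. 1)" and two: "c1 G (\<lambda>_. 2)" by(rule c1_const[OF ok]; simp)+
 have m: "c1 G m" unfolding m_def using c1_mem[OF zero] by simp
 have F: "fld (Bm g) 0 (u g) = 2^u g - 1" "fld (Bm g) (u g) 1 = 0" "fld (Bm g) (u g + 1) (u g) = v0 g"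
  "fld (Bm g) (u g + 1 + u g) (u g) = v1 g" "fld (Bm g) (u g + 1 + u g + u g) (u g) = v2 g" if "g \<in> G" for g
 proof -
  have "holds (Bm g) 0 ([(u g, 2^u g - 1)] @ [(1, 0)] @ [(u g, v0 g)] @ [(u g, v1 g)] @ [(u g, v2 g)])" using h[OF that] by simp
  hence "holds (Bm g) 0 [(u g, 2^u g - 1)]" "holds (Bm g) (u g) [(1, 0)]" "holds (Bm g) (u g + 1) [(u g, v0 g)]"
   "holds (Bm g) (u g + 1 + u g) [(u g, v1 g)]" "holds (Bm g) (u g + 1 + u g + u g) [(u g, v2 g)]"
   unfolding holds_append by(simp_all add: add.assoc)
  thus "fld (Bm g) 0 (u g) = 2^u g - 1" "fld (Bm g) (u g) 1 = 0" "fld (Bm g) (u g + 1) (u g) = v0 g"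
   "fld (Bm g) (u g + 1 + u g) (u g) = v1 g" "fld (Bm g) (u g + 1 + u g + u g) (u g) = v2 g"
   unfolding holds_single using v[OF that] by simp_all
 qed
 have mm: "m g mod 2^(u g + 1) = 2^u g - 1" if "g \<in> G" for g
 proof -
  have "m g mod 2^(u g + 1) = fld (m g) 0 (u g + 1)" by(simp add: fld_def)
  also have "... = fld (Bm g) 0 (u g + 1)" unfolding m_def using W[OF that] by(intro fld_word) simp
  also have "... = 2^u g - 1" unfolding fld_split using F(1,2)[OF that] by simp
  finally show ?thesis .
 qed
 have m1: "m g + 1 < 2^Wd g" if "g \<in> G" for g
 proof -
  have "\<not> bit (m g) (u g)"
  proof -
   have "\<not> bit (fld (Bm g) (u g) 1) 0" using F(2)[OF that] by simp
   thus ?thesis by(simp add: bit_fld m_def)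
  qed
  moreover have "bit (mask (Wd g) :: nat) (u g)" using W[OF that] by(simp add: bit_mask_iff)
  hence "bit (2^Wd g - 1 :: nat) (u g)" unfolding mask_eq_exp_minus_1 .
  ultimately have "m g \<noteq> 2^Wd g - 1" by metis
  thus ?thesis using fld_less[of "Bm g" 0 "Wd g"] unfolding m_def by linarith
 qed
 have mp: "c1 G (\<lambda>g. m g + 1)" by(rule c1_add[OF m one m1])
 define P where "P g = (2::nat)^u g" for g
 have P: "c1 G P"
 proof(rule c1_cong)
  show "c1 G (\<lambda>g. (m g + 1) - Bit_Operations.and (m g + 1) (m g))"
   by(intro c1_sub mp c1_and m) (use lowest_zero(2)[OF mm] in auto)
  show "(m g + 1) - Bit_Operations.and (m g + 1) (m g) = P g" if "g \<in> G" for g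
   unfolding P_def by(rule lowest_zero(1)[OF mm[OF that]])
 qed
 have pw: "P g * 2 = 2^(u g + 1)" "P g * 2 * P g = 2^(u g + 1 + u g)" "P g * 2 * P g * P g = 2^(u g + 1 + u g + u g)" for g
  by(simp_all add: P_def power_add)
 have lt': "P g * 2 < 2^Wd g" "P g * 2 * P g < 2^Wd g" "P g * 2 * P g * P g < 2^Wd g" if "g \<in> G" for g
 proof -
  have "(2::nat)^(u g + 1 + u g + u g) < 2^Wd g"
  proof(rule power_strict_increasing)
   have "40 \<le> Wd g" using ok that by(simp add: ok_def)
   thus "u g + 1 + u g + u g < Wd g" using W[OF that] by(cases "u g = 0") auto
  qed simp
  moreover have "(2::nat)^(u g + 1) \<le> 2^(u g + 1 + u g + u g)" "(2::nat)^(u g + 1 + u g) \<le> 2^(u g + 1 + u g + u g)"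
   by(intro power_increasing; simp)+
  ultimately have "(2::nat)^(u g + 1) < 2^Wd g" "(2::nat)^(u g + 1 + u g) < 2^Wd g" "(2::nat)^(u g + 1 + u g + u g) < 2^Wd g"
   by linarith+
  thus "P g * 2 < 2^Wd g" "P g * 2 * P g < 2^Wd g" "P g * 2 * P g * P g < 2^Wd g"
   by(simp_all only: pw(1)[of g, symmetric] pw(2)[of g, symmetric] pw(3)[of g, symmetric])
 qed
 have c: "c1 G (\<lambda>g. P g * 2)" by(rule c1_mul[OF P two lt'(1)])
 have d: "c1 G (\<lambda>g. P g * 2 * P g)" by(rule c1_mul[OF c P lt'(2)])
 have e: "c1 G (\<lambda>g. P g * 2 * P g * P g)" by(rule c1_mul[OF d P lt'(3)])
 have get: "m g div 2^q mod 2^u g = fld (Bm g) q (u g)" if "g \<in> G" "q + u g \<le> Wd g" for g q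
  using fld_word[OF that(2), of "Bm g"] unfolding m_def[symmetric] by(simp add: fld_def)
 show "c1 G v0"
 proof(rule c1_cong)
  show "c1 G (\<lambda>g. m g div (P g * 2) mod P g)" by(intro c1_mod c1_div m c P)
  show "m g div (P g * 2) mod P g = v0 g" if "g \<in> G" for g
   unfolding pw(1) unfolding P_def using get[OF that, of "u g + 1"] F(3)[OF that] W[OF that] by simp
 qed
 show "c1 G v1"
 proof(rule c1_cong)
  show "c1 G (\<lambda>g. m g div (P g * 2 * P g) mod P g)" by(intro c1_mod c1_div m d P)
  show "m g div (P g * 2 * P g) mod P g = v1 g" if "g \<in> G" for g
   unfolding pw(2) unfolding P_def using get[OF that, of "u g + 1 + u g"] F(4)[OF that] W[OF that] by simp
 qed
 show "c1 G v2"
 proof(rule c1_cong)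
  show "c1 G (\<lambda>g. m g div (P g * 2 * P g * P g) mod P g)" by(intro c1_mod c1_div m e P)
  show "m g div (P g * 2 * P g * P g) mod P g = v2 g" if "g \<in> G" for g
   unfolding pw(3) unfolding P_def using get[OF that, of "u g + 1 + u g + u g"] F(5)[OF that] W[OF that] by simp
 qed
qed

end

section \<open>The representation\<close>

definition cfg_ok :: "nat \<Rightarrow> nat list set \<Rightarrow> nat \<times> nat \<times> nat \<times> nat \<times> nat \<times> nat \<times> (nat \<Rightarrow> nat) \<times> (nat \<Rightarrow> nat) \<Rightarrow> bool" where
 "cfg_ok k Tr = (\<lambda>(K, b, p, p2, Q, A, sd, l).
   elems_hash (card Tr) K b (tree.PX Tr) (tree.LJ Tr) p p2 Q A sd l \<and> 1 \<le> K \<and> K \<le> 2 * kap (card Tr) \<and>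
   (b = 0 \<and> K = k \<or> 0 < b \<and> kap (card Tr) \<le> K \<and> (K - 1) * 2^b < k))"

lemma ex_cfg:
 assumes "tree k Tr" "1 \<le> k"
 shows "\<exists>c. cfg_ok k Tr c"
proof -
 interpret t: tree k Tr by fact
 obtain b K where K: "1 \<le> K" "K \<le> 2 * kap (card Tr)" "k \<le> K * 2^b"
  "b = 0 \<and> K = k \<or> 0 < b \<and> kap (card Tr) \<le> K \<and> (K - 1) * 2^b < k"
  using ex_cells[OF assms(2) params(7)] by blast
 interpret e: elems "card Tr" K b t.PX t.LJ
 proof
  show "1 \<le> card Tr" by(rule t.n_pos)
  show "t.PX a < card Tr \<and> t.LJ a < K * 2^b" if "a < card Tr - 1" for a
   using t.nd_Suc(2,3)[OF that] K(3) by linarith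
 qed (rule t.PX_LJ_lex)
 obtain p p2 Q where r: "e.reduction p p2 Q" using e.ex_reduction by blast
 have "0 < Q \<or> e.E = 0"
  using r e.b_pos by(auto simp: e.reduction_def e.Qsmall_def)
 moreover have "inj_on (\<lambda>x. x mod p mod p2) e.lowH"
  "\<And>c v. e.ee c \<le> Q \<and> e.low c v mod p mod p2 < 2^(Q - e.ee c)" using r by(auto simp: e.reduction_def)
 ultimately obtain A sd l where "e.hash_ok Q (\<lambda>x. x mod p mod p2) A sd l" using e.ex_hash by blast
 hence "elems_hash (card Tr) K b t.PX t.LJ p p2 Q A sd l" using r by unfold_locales
 thus ?thesis using K by(intro exI[of _ "(K, b, p, p2, Q, A, sd, l)"]) (simp add: cfg_ok_def)
qed

text \<open>One configuration is fixed per tree, so that all queries to a tree refer to the same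
  memory.\<close>

definition "cfg k Tr = (SOME c. cfg_ok k Tr c)"

lemma cfg: "tree k Tr \<Longrightarrow> 1 \<le> k \<Longrightarrow> cfg_ok k Tr (cfg k Tr)"
 unfolding cfg_def by(rule someI_ex) (rule ex_cfg)

text \<open>A query: a tree with its arity, a word size, a node number and a second argument.\<close>

datatype inst = Inst (ik: nat) (iT: "nat list set") (iw: nat) (ix: nat) (ia: nat)

definition "gn g = card (iT g)"
definition "gK g = fst (cfg (ik g) (iT g))"
definition "gb g = fst (snd (cfg (ik g) (iT g)))"
definition "gp g = fst (snd (snd (cfg (ik g) (iT g))))"
definition "gp2 g = fst (snd (snd (snd (cfg (ik g) (iT g)))))"
definition "gQ g = fst (snd (snd (snd (snd (cfg (ik g) (iT g))))))"
definition "gA g = fst (snd (snd (snd (snd (snd (cfg (ik g) (iT g)))))))"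
definition "gsd g = fst (snd (snd (snd (snd (snd (snd (cfg (ik g) (iT g))))))))"
definition "gl g = snd (snd (snd (snd (snd (snd (snd (cfg (ik g) (iT g))))))))"
definition "gs g = blk (gn g)"
definition "glam g = wide (gn g)"
definition "gmu g = narrow (gn g)"
definition "gX g = tree.PX (iT g)"
definition "gJ g = tree.LJ (iT g)"
definition "geta g = (LEAST e. \<forall>v\<in>set (tree_fid.hdr gK gb gp gp2 gQ gA gs glam gmu g). v < 2^e)"
definition "gmain g = tree_fid.main gn gK gb gp gp2 gQ gA gs glam gmu geta gX gJ gsd gl g"

definition valid :: "inst \<Rightarrow> bool" where
 "valid g \<longleftrightarrow> 1 \<le> ik g \<and> cardinal_tree (ik g) (iT g) \<and> ik g + card (iT g) \<le> 2^iw g \<and> ix g < card (iT g) \<and> ia g < 2^iw g"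

lemma valid_tree: "valid g \<Longrightarrow> tree (ik g) (iT g)"
 by(simp add: valid_def tree_def)

lemma valid_n: assumes "valid g" shows "1 \<le> gn g" "gn g < 2^iw g" "ix g < gn g" "ia g < 2^iw g" "1 \<le> iw g"
proof -
 interpret t: tree "ik g" "iT g" by(rule valid_tree[OF assms])
 show n: "1 \<le> gn g" unfolding gn_def by(rule t.n_pos)
 show "gn g < 2^iw g" "ix g < gn g" "ia g < 2^iw g" using assms by(auto simp: valid_def gn_def)
 thus "1 \<le> iw g" using n by(cases "iw g") auto
qed

text \<open>The header starts with a block of ones, whose length is the width of the three numbers that follow it.
 The word size is stored only if it exceeds \<open>w1\<close>; the third argument replaces it otherwise.\<close>

locale rep = fixes w1 :: nat
begin

definition "wst g = (if w1 < iw g then iw g else 0)"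
text \<open>The summand 5 makes \<open>4 * gu g + 1\<close>, the length of the header, a number of
  \<open>gu g\<close> bits (\<open>linear_less_pow\<close>).\<close>

definition "gu g = 5 + ceillog2 (wst g + 1) + ceillog2 (geta g + 1)"
definition "goff g = 4 * gu g + 1"
definition "mini g = [(gu g, 2^gu g - 1), (1, 0), (gu g, wst g), (gu g, geta g), (gu g, goff g)]"
definition "gB g = enc (mini g @ gmain g)"
definition "glen g = goff g + tot (gmain g)"
definition "gAr g (i::nat) = (if i = 0 then ix g else if i = 1 then ia g else if i = 2 \<and> iw g \<le> w1 then iw g else 0)"

sublocale tree_fid iw gB gAr gn gK gb gp gp2 gQ gA gs glam gmu geta goff gX gJ gsd gl .

lemma tot_mini: "tot (mini g) = goff g"
 by(simp add: mini_def goff_def)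

lemma gB_less: "gB g < 2^glen g"
 using enc_less[of "mini g @ gmain g"] by(simp add: gB_def glen_def tot_mini)

lemma main_eq: "main g = gmain g"
 by(simp only: gmain_def)

lemma holds_gB: "holds (gB g) 0 (mini g)" "holds (gB g) (goff g) (gmain g)"
proof -
 have "holds (gB g) 0 (mini g @ gmain g)" unfolding gB_def by(rule holds_enc)
 thus "holds (gB g) 0 (mini g)" "holds (gB g) (goff g) (gmain g)" unfolding holds_append by(simp_all add: tot_mini)
qed

lemma fitsI: assumes "valid g" shows "fits (ik g) g"
proof -
 have "cfg_ok (ik g) (iT g) (cfg (ik g) (iT g))" using valid_tree[OF assms] assms by(intro cfg) (simp_all add: valid_def)
 thus ?thesis
  unfolding fits_def cfg_ok_def gn_def gK_def gb_def gp_def gp2_def gQ_def gA_def gsd_def gl_def gX_def gJ_def gs_def glam_def gmu_def geta_def[symmetric]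
  by(simp add: case_prod_beta)
qed

definition "sound G \<longleftrightarrow> (\<forall>g\<in>G. valid g \<and> 160 \<le> iw g \<and> glen g < iw g * 2^iw g)"

lemma sound_good1: assumes "sound G" "g \<in> G" shows "good1 g"
proof(rule fits_good1)
 have v: "valid g" "160 \<le> iw g" "glen g < iw g * 2^iw g" using assms by(auto simp: sound_def)
 show "fits (ik g) g" by(rule fitsI[OF v(1)])
 show "120 \<le> iw g" "ik g + gn g \<le> 2^iw g" "1 \<le> ik g" using v by(auto simp: valid_def gn_def)
 show "stored g (goff g) (main g)" using v(3) holds_gB(2) unfolding main_eq by(simp add: stored_def glen_def)
qed

lemma sound_ok: assumes "sound G" shows "ok G"
 unfolding ok_def
proof
 fix g assume g: "g \<in> G"
 have v: "valid g" "160 \<le> iw g" using assms g by(auto simp: sound_def)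
 have "gAr g i < 2^iw g" for i using valid_n[OF v(1)] less_exp[of "iw g"] by(auto simp: gAr_def)
 thus "40 \<le> iw g \<and> (\<forall>i. gAr g i < 2^iw g)" using v(2) by(intro conjI allI) (linarith, blast)
qed

lemma linear_less_pow: "5 \<le> u \<Longrightarrow> 4 * u + 1 < (2::nat)^u"
proof(induction u rule: dec_induct)
 case (step u)
 thus ?case by simp
qed simp

lemma sound_header:
 assumes G: "sound G"
 shows "c1 G wst" "c1 G geta" "c1 G goff"
proof -
 have e: "geta g \<le> iw g" "wst g \<le> iw g" "160 \<le> iw g" if "g \<in> G" for g
  using sound_good1[OF G that] G that by(auto simp: good1_def wst_def sound_def)
 have W: "4 * gu g + 1 \<le> iw g" if "g \<in> G" for g
  using e[OF that] ceillog2_linear[of "wst g + 1"] ceillog2_linear[of "geta g + 1"] unfolding gu_def distrib_left by linarith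
 have pw: "x < 2^gu g" if "ceillog2 (x + 1) \<le> gu g" for x g
 proof -
  have "(2::nat)^ceillog2 (x + 1) \<le> 2^gu g" using that by(intro power_increasing) auto
  thus ?thesis using le_two_power_ceillog2[of "x + 1"] by linarith
 qed
 have v: "wst g < 2^gu g \<and> geta g < 2^gu g \<and> goff g < 2^gu g" for g
 proof(intro conjI)
  show "wst g < 2^gu g" "geta g < 2^gu g" by(rule pw, simp add: gu_def)+
  show "goff g < 2^gu g" unfolding goff_def by(rule linear_less_pow) (simp add: gu_def)
 qed
 have h: "holds (gB g) 0 [(gu g, 2^gu g - 1), (1, 0), (gu g, wst g), (gu g, geta g), (gu g, goff g)]" for g
  using holds_gB(1)[of g] by(simp add: mini_def)
 show "c1 G wst" "c1 G geta" "c1 G goff" by(rule mini_decode[OF sound_ok[OF G] W h v]; assumption)+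
qed

text \<open>The word size comes either from the header or from the third argument; a set of queries
  served by one expression must not mix the two sources.\<close>

definition "uniform G \<longleftrightarrow> (\<forall>g\<in>G. w1 < iw g) \<or> (\<forall>g\<in>G. iw g \<le> w1)"

lemma sound_good: assumes G: "sound G" "uniform G" shows "good G"
proof -
 have w: "c1 G iw" using G(2) unfolding uniform_def
 proof
  assume "\<forall>g\<in>G. w1 < iw g"
  thus ?thesis by(intro c1_cong[OF sound_header(1)[OF G(1)]]) (simp add: wst_def)
 next
  assume "\<forall>g\<in>G. iw g \<le> w1"
  thus ?thesis by(intro c1_cong[OF c1_arg[OF sound_ok[OF G(1)], of 2]]) (simp_all add: gAr_def)
 qed
 thus ?thesis unfolding good_def using sound_header[OF G(1)] sound_good1[OF G(1)] c2_of_c1[OF w] by blast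
qed

section \<open>The five queries\<close>

definition "node g = tree.nd (iT g) (ix g)"

definition "ans_ith g = map_option (num (iT g)) (ith_child (iT g) (node g) (ia g))"
definition "ans_labeled g = map_option (num (iT g)) (child_labeled (iT g) (node g) (ia g))"
definition "ans_parent g = map_option (num (iT g)) (parent (node g))"
definition "ans_degree g = Some (degree (iT g) (node g))"
definition "ans_ordinal g = Some (ordinal_position (iT g) (node g))"

definition "sx g = tree.sx (iT g)"

lemma start_sx: assumes "valid g" shows "St g (v * gK g) = sx g v"
proof -
 interpret t: tree "ik g" "iT g" by(rule valid_tree[OF assms])
 interpret e: elems_hash "gn g" "gK g" "gb g" "gX g" "gJ g" "gp g" "gp2 g" "gQ g" "gA g" "gsd g" "gl g"
  using fitsI[OF assms] by(simp add: fits_def)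
 have "e.C a < v * gK g \<longleftrightarrow> gX g a < v" if a: "a < e.r" for a
 proof
  assume c: "e.C a < v * gK g"
  show "gX g a < v"
  proof(rule ccontr)
   assume "\<not> gX g a < v"
   hence "v * gK g \<le> gX g a * gK g" by(intro mult_le_mono1) simp
   thus False using c unfolding e.C_def by linarith
  qed
 next
  assume "gX g a < v"
  hence "(gX g a + 1) * gK g \<le> v * gK g" by(intro mult_le_mono1) simp
  thus "e.C a < v * gK g" using e.hi_less[OF a] by(simp add: e.C_def)
 qed
 hence "{a. a < e.r \<and> e.C a < v * gK g} = {a. a < e.r \<and> gX g a < v}" by blast
 moreover have "e.r = card (iT g) - 1" using e.r_def by(simp add: gn_def)
 ultimately show ?thesis unfolding e.start_def sx_def t.sx_def by(simp only: gX_def)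
qed

lemma sx_less: assumes "valid g" shows "sx g v < gn g"
proof -
 interpret t: tree "ik g" "iT g" by(rule valid_tree[OF assms])
 have "sx g v \<le> card {..<card (iT g) - 1}" unfolding sx_def t.sx_def by(intro card_mono) auto
 thus ?thesis using t.n_pos by(simp add: gn_def)
qed

lemma node_facts:
 assumes "valid g"
 shows "node g \<in> iT g" "num (iT g) (node g) = ix g" "ix g = 0 \<longleftrightarrow> node g = []"
  "sx g (ix g + 1) = sx g (ix g) + degree (iT g) (node g)"
  "ix g \<noteq> 0 \<Longrightarrow> node g = tree.nd (iT g) (gX g (ix g - 1)) @ [gJ g (ix g - 1)]"
  "ix g \<noteq> 0 \<Longrightarrow> gX g (ix g - 1) < gn g" "ix g \<noteq> 0 \<Longrightarrow> ix g - 1 < gn g - 1"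
proof -
 interpret t: tree "ik g" "iT g" by(rule valid_tree[OF assms])
 have x: "ix g < card (iT g)" using assms by(simp add: valid_def)
 show nd: "node g \<in> iT g" "num (iT g) (node g) = ix g" unfolding node_def by(rule t.nd[OF x])+
 show "ix g = 0 \<longleftrightarrow> node g = []" using t.num_eq_0[OF nd(1)] nd(2) by simp
 show "sx g (ix g + 1) = sx g (ix g) + degree (iT g) (node g)" using t.sx_Suc[OF nd(1)] unfolding nd(2) sx_def .
 assume x0: "ix g \<noteq> 0"
 hence a: "ix g - 1 < card (iT g) - 1" "Suc (ix g - 1) = ix g" using x by auto
 show "node g = tree.nd (iT g) (gX g (ix g - 1)) @ [gJ g (ix g - 1)]" "gX g (ix g - 1) < gn g"
  using t.nd_Suc(1,2)[OF a(1)] unfolding a(2) node_def gX_def gJ_def gn_def by auto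
 show "ix g - 1 < gn g - 1" using a by(simp add: gn_def)
qed

lemma ans_ith_eq: assumes "valid g"
 shows "ans_ith g = (if 0 < ia g \<and> \<not> sx g (ix g + 1) - sx g (ix g) < ia g then Some (sx g (ix g) + ia g) else None)"
proof -
 interpret t: tree "ik g" "iT g" by(rule valid_tree[OF assms])
 show ?thesis unfolding ans_ith_def using t.ith_child_num[OF node_facts(1)[OF assms], of "ia g"]
  unfolding node_facts(2)[OF assms] sx_def[symmetric] by(simp add: Suc_le_eq not_less del: One_nat_def)
qed

lemma ans_labeled_eq: assumes "valid g"
 shows "ans_labeled g \<noteq> None \<longleftrightarrow> (\<exists>a<rr g. gX g a = ix g \<and> gJ g a = ia g)"
  "a < rr g \<Longrightarrow> gX g a = ix g \<Longrightarrow> gJ g a = ia g \<Longrightarrow> ans_labeled g = Some (a + 1)"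
proof -
 interpret t: tree "ik g" "iT g" by(rule valid_tree[OF assms])
 interpret e: elems_hash "gn g" "gK g" "gb g" "gX g" "gJ g" "gp g" "gp2 g" "gQ g" "gA g" "gsd g" "gl g"
  using fitsI[OF assms] by(simp add: fits_def)
 have r: "e.r = card (iT g) - 1" using e.r_def by(simp add: gn_def)
 note nf = node_facts[OF assms] and ce = t.child_elem[OF node_facts(1)[OF assms], of "ia g"]
 show "ans_labeled g \<noteq> None \<longleftrightarrow> (\<exists>a<rr g. gX g a = ix g \<and> gJ g a = ia g)"
  using ce(1) unfolding nf(2) r gX_def gJ_def by(simp add: ans_labeled_def child_labeled_def child_labels_def)
 assume a: "a < rr g" "gX g a = ix g" "gJ g a = ia g"
 have a': "a < card (iT g) - 1" "t.PX a = num (iT g) (node g)" "t.LJ a = ia g" using a nf(2) by(auto simp: r gX_def gJ_def)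
 have "node g @ [ia g] \<in> iT g" using ce(1) a' by blast
 thus "ans_labeled g = Some (a + 1)" using t.child_elem(2)[OF nf(1) a'] by(simp add: ans_labeled_def child_labeled_def child_labels_def)
qed

lemma ans_parent_eq: assumes "valid g" shows "ans_parent g = (if ix g = 0 then None else Some (gX g (ix g - 1)))"
proof(cases "ix g = 0")
 case False
 interpret t: tree "ik g" "iT g" by(rule valid_tree[OF assms])
 note nf = node_facts[OF assms]
 have "num (iT g) (t.nd (gX g (ix g - 1))) = gX g (ix g - 1)" using nf(6)[OF False] by(intro t.nd) (simp add: gn_def)
 thus ?thesis using False nf(5)[OF False] by(simp add: ans_parent_def parent_def)
qed (use node_facts(3)[OF assms] in \<open>simp add: ans_parent_def parent_def\<close>)

lemma ans_degree_eq: "valid g \<Longrightarrow> ans_degree g = Some (sx g (ix g + 1) - sx g (ix g))"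
 using node_facts(4) by(simp add: ans_degree_def)

lemma ans_ordinal_eq: assumes "valid g"
 shows "ans_ordinal g = Some (if ix g = 0 then 1 else ix g - sx g (gX g (ix g - 1)))"
proof(cases "ix g = 0")
 case True
 thus ?thesis using node_facts(3)[OF assms] by(simp add: ans_ordinal_def ordinal_position_def left_siblings_def)
next
 case False
 interpret t: tree "ik g" "iT g" by(rule valid_tree[OF assms])
 note nf = node_facts[OF assms]
 have "num (iT g) (t.nd (gX g (ix g - 1))) = gX g (ix g - 1)" using nf(6)[OF False] by(intro t.nd) (simp add: gn_def)
 hence "ordinal_position (iT g) (node g) = num (iT g) (node g) - sx g (gX g (ix g - 1))"
  using t.ordinal_num[of "t.nd (gX g (ix g - 1))" "gJ g (ix g - 1)"] nf(1) unfolding nf(5)[OF False, symmetric] sx_def by simp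
 thus ?thesis using False nf(2) by(simp add: ans_ordinal_def)
qed

text \<open>The value has to be computed only where it exists; elsewhere the addresses to be read
  may be meaningless.\<close>

definition "co G ans \<longleftrightarrow> cb G (\<lambda>g. ans g \<noteq> None) \<and>
 (\<exists>F. c1 {g \<in> G. ans g \<noteq> None} F \<and> (\<forall>g\<in>G. \<forall>v. ans g = Some v \<longrightarrow> F g = v))"

context
 fixes G assumes G: "sound G" "uniform G"
begin

lemma G_facts: "good G" "ok G" "g \<in> G \<Longrightarrow> valid g"
 using sound_good[OF G] sound_ok[OF G(1)] G(1) by(auto simp: sound_def)

lemma c_args: "c1 G ix" "c1 G ia" "c2 G ix"
proof -
 show x: "c1 G ix" by(rule c1_cong[OF c1_arg[OF G_facts(2), of 0]]) (simp_all add: gAr_def)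
 show "c1 G ia" by(rule c1_cong[OF c1_arg[OF G_facts(2), of 1]]) (simp_all add: gAr_def)
 show "c2 G ix" by(rule c2_of_c1[OF good_wd(1)[OF G_facts(1)] x])
qed

lemma c_sx:
 assumes H: "H \<subseteq> G" and y: "c2 H y" "\<And>g. g \<in> H \<Longrightarrow> y g \<le> gn g"
 shows "c1 H (\<lambda>g. sx g (y g))"
proof(rule c1_of_c2)
 have "c2 H (\<lambda>g. St g (y g * gK g))" by(rule c_first_child(2)[OF good_mono[OF G_facts(1) H] y])
 thus "c2 H (\<lambda>g. sx g (y g))" by(rule c2_cong) (use H G_facts(3) start_sx in blast)
 fix g assume "g \<in> H"
 hence v: "valid g" using H G_facts(3) by blast
 show "sx g (y g) < 2^iw g" using sx_less[OF v, of "y g"] valid_n(2)[OF v] by linarith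
qed

lemma c_sx01: "c1 G (\<lambda>g. sx g (ix g))" "c1 G (\<lambda>g. sx g (ix g + 1))" "c1 G (\<lambda>g. sx g (ix g + 1) - sx g (ix g))"
proof -
 have le: "ix g + 1 \<le> gn g" if "g \<in> G" for g using valid_n(3)[OF G_facts(3)[OF that]] by simp
 show 1: "c1 G (\<lambda>g. sx g (ix g))" by(rule c_sx[OF subset_refl c_args(3)]) (use le in fastforce)
 have "c1 G (\<lambda>g. ix g + 1)"
  by(intro c1_add c_args c1_const G_facts) (use le valid_n(2)[OF G_facts(3)] in fastforce)+
 thus 2: "c1 G (\<lambda>g. sx g (ix g + 1))" by(intro c_sx[OF subset_refl] c2_of_c1 good_wd(1)[OF G_facts(1)] le)
 show "c1 G (\<lambda>g. sx g (ix g + 1) - sx g (ix g))" by(rule c1_sub[OF 2 1]) (use node_facts(4)[OF G_facts(3)] in simp)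
qed

lemma co_degree: "co G ans_degree"
 unfolding co_def
proof(intro conjI exI ballI allI impI)
 show "cb G (\<lambda>g. ans_degree g \<noteq> None)" by(simp add: ans_degree_def cb_true G_facts)
 show "c1 {g \<in> G. ans_degree g \<noteq> None} (\<lambda>g. sx g (ix g + 1) - sx g (ix g))" by(rule c1_mono[OF c_sx01(3)]) blast
 show "sx g (ix g + 1) - sx g (ix g) = v" if "g \<in> G" "ans_degree g = Some v" for g v
  using ans_degree_eq[OF G_facts(3)[OF that(1)]] that(2) by simp
qed

lemma co_ith: "co G ans_ith"
 unfolding co_def
proof(intro conjI exI ballI allI impI)
 have b: "cb G (\<lambda>g. 0 < ia g \<and> \<not> sx g (ix g + 1) - sx g (ix g) < ia g)"
  by(rule cb_and[OF cb_less1[OF c1_const[OF G_facts(2)] c_args(2)] cb_mono[OF cb_not[OF cb_less1[OF c_sx01(3) c_args(2)]]]]) auto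
 thus "cb G (\<lambda>g. ans_ith g \<noteq> None)" by(rule cb_cong) (use ans_ith_eq[OF G_facts(3)] in simp)
 show "c1 {g \<in> G. ans_ith g \<noteq> None} (\<lambda>g. sx g (ix g) + ia g)"
 proof(rule c1_add[OF c1_mono[OF c_sx01(1)] c1_mono[OF c_args(2)]])
  fix g assume g: "g \<in> {g \<in> G. ans_ith g \<noteq> None}"
  hence v: "valid g" using G_facts(3) by blast
  have "ia g \<le> sx g (ix g + 1) - sx g (ix g)" using g ans_ith_eq[OF v] by(auto split: if_splits)
  hence "sx g (ix g) + ia g \<le> sx g (ix g + 1)" using node_facts(4)[OF v] by simp
  thus "sx g (ix g) + ia g < 2^iw g" using sx_less[OF v, of "ix g + 1"] valid_n(2)[OF v] by linarith
 qed auto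
 show "sx g (ix g) + ia g = v" if "g \<in> G" "ans_ith g = Some v" for g v
  using ans_ith_eq[OF G_facts(3)[OF that(1)]] that(2) by(auto split: if_splits)
qed

lemma rr_eq: "rr g = gn g - 1" if "g \<in> G" for g
proof -
 interpret e: elems_hash "gn g" "gK g" "gb g" "gX g" "gJ g" "gp g" "gp2 g" "gQ g" "gA g" "gsd g" "gl g"
  using fitsI[OF G_facts(3)[OF that]] by(simp add: fits_def)
 show ?thesis by(rule e.r_def)
qed

lemma co_labeled: "co G ans_labeled"
proof -
 note f = c_find[OF G_facts(1) c_args(3,2) valid_n(3)[OF G_facts(3)]]
 have e: "ans_labeled g \<noteq> None \<longleftrightarrow> (\<exists>a<rr g. gX g a = ix g \<and> gJ g a = ia g)" if "g \<in> G" for g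
  by(rule ans_labeled_eq(1)[OF G_facts(3)[OF that]])
 let ?H = "{g \<in> G. ans_labeled g \<noteq> None}"
 have H: "?H = {g \<in> G. \<exists>a<rr g. gX g a = ix g \<and> gJ g a = ia g}" using e by blast
 from f(2) obtain F where F: "c2 ?H F" "\<forall>g\<in>G. \<forall>a<rr g. gX g a = ix g \<and> gJ g a = ia g \<longrightarrow> F g = a" unfolding H by blast
 have FF: "F g + 1 = v \<and> v < 2^iw g" if g: "g \<in> G" "ans_labeled g = Some v" for g v
 proof -
  obtain a where a: "a < rr g" "gX g a = ix g" "gJ g a = ia g" using e[OF g(1)] g(2) by auto
  hence "F g = a" using F(2) g(1) by blast
  moreover have "v = a + 1" using ans_labeled_eq(2)[OF G_facts(3)[OF g(1)] a] g(2) by simp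
  moreover have "a + 1 < 2^iw g" using a(1) rr_eq[OF g(1)] valid_n(1,2)[OF G_facts(3)[OF g(1)]] by linarith
  ultimately show ?thesis by simp
 qed
 have F1: "c1 ?H F"
 proof(rule c1_of_c2[OF F(1)])
  fix g assume "g \<in> ?H"
  then obtain v where "g \<in> G" "ans_labeled g = Some v" by blast
  thus "F g < 2^iw g" using FF[of g v] by linarith
 qed
 show ?thesis unfolding co_def
 proof(intro conjI exI ballI allI impI)
  show "cb G (\<lambda>g. ans_labeled g \<noteq> None)"
  proof(rule cb_cong[OF f(1)])
   show "(\<exists>a<rr g. gX g a = ix g \<and> gJ g a = ia g) \<longleftrightarrow> ans_labeled g \<noteq> None" if "g \<in> G" for g using e[OF that] by(rule sym)
  qed
  show "c1 ?H (\<lambda>g. F g + 1)"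
  proof(rule c1_add[OF F1 c1_const[OF c1_ok[OF F1]]])
   fix g assume "g \<in> ?H"
   then obtain v where "g \<in> G" "ans_labeled g = Some v" by blast
   thus "F g + 1 < 2^iw g" using FF[of g v] by linarith
  qed simp
  show "F g + 1 = v" if "g \<in> G" "ans_labeled g = Some v" for g v using FF[OF that] by blast
 qed
qed

lemma c_nonroot: "cb G (\<lambda>g. ix g = 0)" "c2 {g \<in> G. ix g \<noteq> 0} (\<lambda>g. gX g (ix g - 1))" "c1 {g \<in> G. ix g \<noteq> 0} (\<lambda>g. gX g (ix g - 1))"
proof -
 let ?H = "{g \<in> G. ix g \<noteq> 0}"
 show "cb G (\<lambda>g. ix g = 0)" by(rule cb_eq1[OF c_args(1) c1_const[OF G_facts(2)]]) simp
 have g: "good ?H" by(rule good_mono[OF G_facts(1)]) blast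
 have "c1 ?H (\<lambda>g. ix g - 1)" by(rule c1_sub[OF c1_mono[OF c_args(1)] c1_const[OF good_wd(2)[OF g]]]) auto
 hence "c2 ?H (\<lambda>g. ix g - 1)" by(rule c2_of_c1[OF good_wd(1)[OF g]])
 thus 2: "c2 ?H (\<lambda>g. gX g (ix g - 1))"
 proof(rule c_parent_elem[OF g])
  fix g assume "g \<in> ?H"
  thus "ix g - 1 < rr g" using node_facts(7)[OF G_facts(3), of g] rr_eq[of g] by simp
 qed
 show "c1 ?H (\<lambda>g. gX g (ix g - 1))"
 proof(rule c1_of_c2[OF 2])
  fix g assume "g \<in> ?H"
  hence v: "valid g" "ix g \<noteq> 0" using G_facts(3) by auto
  show "gX g (ix g - 1) < 2^iw g" using node_facts(6)[OF v] valid_n(2)[OF v(1)] by linarith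
 qed
qed

lemma co_parent: "co G ans_parent"
 unfolding co_def
proof(intro conjI exI ballI allI impI)
 have e: "ans_parent g \<noteq> None \<longleftrightarrow> ix g \<noteq> 0" if "g \<in> G" for g using ans_parent_eq[OF G_facts(3)[OF that]] by simp
 show "cb G (\<lambda>g. ans_parent g \<noteq> None)" by(rule cb_cong[OF cb_not[OF c_nonroot(1)]]) (use e in blast)
 show "c1 {g \<in> G. ans_parent g \<noteq> None} (\<lambda>g. gX g (ix g - 1))" by(rule c1_mono[OF c_nonroot(3)]) (use e in blast)
 show "gX g (ix g - 1) = v" if "g \<in> G" "ans_parent g = Some v" for g v
  using ans_parent_eq[OF G_facts(3)[OF that(1)]] that(2) by(auto split: if_splits)
qed

lemma co_ordinal: "co G ans_ordinal"
 unfolding co_def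
proof(intro conjI exI ballI allI impI)
 let ?H = "{g \<in> G. ix g \<noteq> 0}"
 show "cb G (\<lambda>g. ans_ordinal g \<noteq> None)" by(simp add: ans_ordinal_def cb_true G_facts)
 have s: "c1 ?H (\<lambda>g. sx g (gX g (ix g - 1)))"
 proof(rule c_sx[OF _ c_nonroot(2)])
  fix g assume "g \<in> ?H"
  thus "gX g (ix g - 1) \<le> gn g" using node_facts(6)[OF G_facts(3), of g] by simp
 qed blast
 have "c1 ?H (\<lambda>g. ix g - sx g (gX g (ix g - 1)))"
 proof(rule c1_sub[OF c1_mono[OF c_args(1)] s])
  fix g assume "g \<in> ?H"
  hence v: "valid g" "ix g \<noteq> 0" using G_facts(3) by auto
  hence "0 < ix g - sx g (gX g (ix g - 1))"
   using ans_ordinal_eq[OF v(1)] by(simp add: ans_ordinal_def ordinal_position_def)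
  thus "sx g (gX g (ix g - 1)) \<le> ix g" by simp
 qed blast
 hence "c1 G (\<lambda>g. if ix g = 0 then 1 else ix g - sx g (gX g (ix g - 1)))"
  by(intro c1_ite[OF c_nonroot(1)] c1_mono[OF c1_const[OF G_facts(2)]]) auto
 thus "c1 {g \<in> G. ans_ordinal g \<noteq> None} (\<lambda>g. if ix g = 0 then 1 else ix g - sx g (gX g (ix g - 1)))" by(rule c1_mono) blast
 show "(if ix g = 0 then 1 else ix g - sx g (gX g (ix g - 1))) = v" if "g \<in> G" "ans_ordinal g = Some v" for g v
  using ans_ordinal_eq[OF G_facts(3)[OF that(1)]] that(2) by simp
qed

end

end

text \<open>For \<open>k = 1\<close> the convention \<open>ln 0 = 0\<close> makes the iterated
  logarithm 0.\<close>

lemma loglog_nonneg: assumes "1 \<le> k" shows "0 \<le> log 2 (log 2 (real k))"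
proof(cases "k = 1")
 case False
 hence "log 2 2 \<le> log 2 (real k)" using assms by(intro log_mono) auto
 thus ?thesis by simp
qed (simp add: log_def)

context rep begin

text \<open>The representation must not depend on the arguments \<open>ix\<close> and
  \<open>ia\<close>, although these are components of an \<open>inst\<close>.\<close>

lemma gB_cong:
 assumes "ik g = ik g'" "iT g = iT g'" "iw g = iw g'"
 shows "gB g = gB g'" "glen g = glen g'"
proof -
 have 1: "gn g = gn g'" "gK g = gK g'" "gb g = gb g'" "gp g = gp g'" "gp2 g = gp2 g'" "gQ g = gQ g'" "gA g = gA g'"
  "gsd g = gsd g'" "gl g = gl g'" "gX g = gX g'" "gJ g = gJ g'"
  unfolding gn_def gK_def gb_def gp_def gp2_def gQ_def gA_def gsd_def gl_def gX_def gJ_def assms by(rule refl)+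
 have 2: "gs g = gs g'" "glam g = glam g'" "gmu g = gmu g'" unfolding gs_def glam_def gmu_def 1 by(rule refl)+
 have 3: "hdr g = hdr g'" unfolding hdr_def 1 2 ..
 have 4: "geta g = geta g'" unfolding geta_def 3 ..
 have 5: "gmain g = gmain g'"
  unfolding main_eq[symmetric] main_def 3 4 seeds_def body_def tabseg_def segA_def segB_def segY_def segZ_def recs_def 1 2 ..
 have 6: "wst g = wst g'" unfolding wst_def assms ..
 have 7: "gu g = gu g'" unfolding gu_def 4 6 ..
 show "gB g = gB g'" unfolding gB_def mini_def goff_def 4 5 6 7 ..
 show "glen g = glen g'" unfolding glen_def goff_def 5 7 ..
qed

lemma log_b_le: assumes "valid g" shows "real (ceillog2 (gb g + 2)) \<le> log 2 (log 2 (real (ik g))) + 3"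
proof(cases "gb g = 0")
 case True
 hence "ceillog2 (gb g + 2) = 1" by(simp only: add_0 ceillog2_2)
 thus ?thesis using loglog_nonneg[of "ik g"] assms by(simp add: valid_def)
next
 case False
 have "kap (gn g) \<le> gK g" "(gK g - 1) * 2^gb g < ik g" using fitsI[OF assms] False by(auto simp: fits_def)
 moreover from this have "1 * 2^gb g \<le> (gK g - 1) * 2^gb g" using params(7)[of "gn g"] by(intro mult_le_mono1) simp
 ultimately have "2^gb g \<le> ik g" by linarith
 hence "real (2^gb g) \<le> real (ik g)" by(rule of_nat_mono)
 hence "log 2 (2^gb g) \<le> log 2 (real (ik g))" by(intro log_mono) simp_all
 hence b: "real (gb g) \<le> log 2 (real (ik g))" by(simp add: log_nat_power)
 have b1: "1 \<le> real (gb g)" using False by simp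
 have "real (ceillog2 (gb g + 2)) \<le> log 2 (real (gb g + 2)) + 1" using ceillog2_less_log[of "gb g + 2"] by simp
 also have "log 2 (real (gb g + 2)) \<le> log 2 (4 * real (gb g))" using b1 by(intro log_mono) auto
 also have "log 2 (4 * real (gb g)) = log 2 (2^2) + log 2 (real (gb g))" using b1 by(simp add: log_mult)
 also have "log 2 (2^2) = (2::real)" by(simp only: log_nat_power) simp
 also have "log 2 (real (gb g)) \<le> log 2 (log 2 (real (ik g)))" using b b1 by(intro log_mono) auto
 finally show ?thesis by simp
qed

text \<open>The constant is \<open>810 = 21 + 263 * 3\<close>, where the 3 stems from
  \<open>log_b_le\<close>.\<close>

lemma glen_le:
 assumes "valid g"
 shows "real (glen g) \<le> 810 + 4 * real (ceillog2 (wst g + 1)) +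
  log 2 (real (gn g * ik g choose (gn g - 1))) + ovh (gn g) + 263 * log 2 (log 2 (real (ik g)))"
proof -
 have "ceillog2 (geta g + 1) \<le> geta g" using ceillog2_le_iff[of "geta g + 1" "geta g"] less_exp[of "geta g"] by simp
 hence "glen g \<le> 21 + 4 * ceillog2 (wst g + 1) + (tot (main g) + 4 * geta g)"
  unfolding glen_def goff_def gu_def main_eq distrib_left by linarith
 hence "real (glen g) \<le> real (21 + 4 * ceillog2 (wst g + 1) + (tot (main g) + 4 * geta g))" by(rule of_nat_mono)
 also have "... = 21 + 4 * real (ceillog2 (wst g + 1)) + real (tot (main g) + 4 * geta g)" by simp
 finally show ?thesis using fits_space[OF fitsI[OF assms]] log_b_le[OF assms] unfolding ovh_def by linarith
qed

text \<open>With \<open>W = 2^iw g\<close>, the representation has at most about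
  \<open>2 * N + N * log 2 k + N / 8\<close> bits. Either \<open>16 * k \<le> W\<close>, and the
  logarithm falls short of the word size by 4, or \<open>N\<close> is at most
  \<open>15 / 16 * W\<close>; both leave \<open>15 / 8 * W\<close> bits for the constants and the
  terms linear in the word size.\<close>

lemma capacity:
 assumes v: "valid g" and o: "\<And>n. ovh n \<le> real n / 8 + c0" and w: "2000 + nat \<lceil>c0\<rceil> \<le> iw g"
 shows "glen g < iw g * 2^iw g"
proof -
 define w where "w = real (iw g)"
 define W where "W = (2::real)^iw g"
 define N where "N = real (gn g)"
 define k where "k = real (ik g)"
 have w2: "2000 \<le> w" "c0 \<le> w"
 proof -
  have "real (2000 + nat \<lceil>c0\<rceil>) \<le> w" unfolding w_def using w by(rule of_nat_mono)
  moreover have "c0 \<le> real (nat \<lceil>c0\<rceil>)" by(rule real_nat_ceiling_ge)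
  ultimately show "2000 \<le> w" "c0 \<le> w" by simp_all
 qed
 have k1: "1 \<le> k" using v by(simp add: k_def valid_def)
 have kN: "k + N \<le> W"
 proof -
  have "ik g + gn g \<le> 2^iw g" using v by(simp add: valid_def gn_def)
  hence "real (ik g + gn g) \<le> real (2^iw g)" by(rule of_nat_mono)
  thus ?thesis by(simp add: k_def N_def W_def)
 qed
 have N0: "0 \<le> N" by(simp add: N_def)
 have lk: "log 2 k \<le> w"
 proof -
  have "log 2 k \<le> log 2 W" using k1 kN N0 by(intro log_mono) auto
  thus ?thesis by(simp add: W_def w_def log_nat_power)
 qed
 have llk: "log 2 (log 2 k) \<le> w"
 proof(cases "log 2 k \<le> 0")
  case True
  hence "log 2 k = 0" using k1 by simp
  thus ?thesis using w2 by(simp add: log_def)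
 next
  case False
  hence "log 2 (log 2 k) \<le> log 2 w" using lk by(intro log_mono) auto
  also have "... \<le> w"
  proof -
   have "iw g < 2^iw g" by(rule less_exp)
   hence "w \<le> W" unfolding w_def W_def by(metis less_imp_le of_nat_le_iff of_nat_numeral of_nat_power)
   hence "log 2 w \<le> log 2 W" using w2 by(intro log_mono) auto
   thus ?thesis by(simp add: W_def w_def log_nat_power)
  qed
  finally show ?thesis .
 qed
 have main: "2 * N + N * log 2 k + N / 8 \<le> W * (w - 15 / 8)"
 proof(cases "16 * k \<le> W")
  case True
  have "log 2 (16 * k) \<le> log 2 W" using k1 True by(intro log_mono) auto
  moreover have "log 2 (16 * k) = log 2 (2^4) + log 2 k" using k1 by(simp add: log_mult)
  moreover have "log 2 (2^4) = (4::real)" by(simp only: log_nat_power) simp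
  moreover have "log 2 W = w" by(simp add: W_def w_def log_nat_power)
  ultimately have "log 2 k \<le> w - 4" by simp
  hence "N * (2 + log 2 k + 1 / 8) \<le> N * (w - 15 / 8)" using N0 by(intro mult_left_mono) auto
  also have "... \<le> W * (w - 15 / 8)" using kN k1 w2 by(intro mult_right_mono) auto
  finally show ?thesis by(simp add: algebra_simps)
 next
  case False
  hence "N \<le> 15 / 16 * W" using kN by linarith
  hence "N * (2 + log 2 k + 1 / 8) \<le> (15 / 16 * W) * (2 + w + 1 / 8)" using N0 lk k1 by(intro mult_mono) (auto simp: W_def)
  also have "... = W * (15 / 16 * (2 + w + 1 / 8))" by simp
  also have "... \<le> W * (w - 15 / 8)" using w2 by(intro mult_left_mono) (auto simp: W_def)
  finally show ?thesis by(simp add: algebra_simps)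
 qed
 have big: "810 + 4 * w + c0 + 263 * w < 15 / 8 * W"
 proof -
  have "iw g * iw g \<le> 2^(iw g + 1)" by(rule square_le_pow)
  hence "real (iw g * iw g) \<le> real (2^(iw g + 1))" by(rule of_nat_mono)
  hence "w * w \<le> 2 * W" by(simp add: w_def W_def)
  moreover have "2000 * w \<le> w * w" using w2 by(intro mult_right_mono) auto
  ultimately show ?thesis using w2 by linarith
 qed
 have cw: "real (ceillog2 (wst g + 1)) \<le> w"
 proof -
  have "wst g \<le> iw g" by(simp add: wst_def)
  moreover have "ceillog2 (wst g + 1) \<le> wst g" using ceillog2_le_iff[of "wst g + 1" "wst g"] less_exp[of "wst g"] by simp
  ultimately show ?thesis by(simp add: w_def)
 qed
 have "log 2 (real (gn g * ik g choose (gn g - 1))) \<le> 2 * N + N * log 2 k"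
  unfolding N_def k_def by(rule tree_entropy_le) (use v valid_n(1)[OF v] in \<open>auto simp: valid_def\<close>)
 hence "real (glen g) < W * w" using glen_le[OF v] o[of "gn g"] main big cw llk
  unfolding N_def[symmetric] k_def[symmetric] right_diff_distrib by linarith
 hence "real (glen g) < real (iw g * 2^iw g)" by(simp add: W_def w_def mult.commute)
 thus ?thesis by(simp only: of_nat_less_iff)
qed

end

section \<open>One program for all word sizes\<close>

locale rep_all = rep +
 fixes w0 :: nat and code :: "nat \<Rightarrow> nat list set \<Rightarrow> nat"
 assumes w01: "160 \<le> w0" "w0 \<le> w1"
  and code: "1 \<le> w \<Longrightarrow> inj_on (code w) (word_trees (2^w))"
   "1 \<le> w \<Longrightarrow> Tr \<in> word_trees (2^w) \<Longrightarrow> code w Tr < 2^(w * 2^w)"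
  and cap: "valid g \<Longrightarrow> w0 \<le> iw g \<Longrightarrow> glen g < iw g * 2^iw g"
begin

text \<open>Below \<open>w0\<close> the string is padded to the full memory. Its length is then
  bounded by a constant that \<open>f\<close> can absorb, because \<open>w0\<close> is chosen
  independently of \<open>c\<close>.\<close>

definition "Bn g = (if iw g < w0 then code (iw g) (iT g) else gB g)"
definition "Ln g = (if iw g < w0 then iw g * 2^iw g else glen g)"
definition "bs g = bits (Ln g) (Bn g)"
definition "ar g (i::nat) = (if i = 0 then ix g else if i = 1 then ia g else 0)"

lemma valid_word_tree: "valid g \<Longrightarrow> iT g \<in> word_trees (2^iw g)"
 unfolding word_trees_def valid_def by blast

lemma Bn_less: "valid g \<Longrightarrow> Bn g < 2^Ln g"
 unfolding Bn_def Ln_def using code(2) valid_word_tree valid_n(5) gB_less by auto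

lemma Ln_le: "valid g \<Longrightarrow> Ln g \<le> iw g * 2^iw g"
 unfolding Ln_def using cap[of g] by auto

lemma packed_bs: "valid g \<Longrightarrow> packed (iw g) (bs g) = (\<lambda>a. fld (Bn g) (a * iw g) (iw g))"
 unfolding bs_def using packed_bits[OF Bn_less] by blast

lemma finite_small: "finite {g. valid g \<and> iw g \<le> w1}"
proof -
 define S where "S = {..(2::nat)^w1} \<times> (\<Union>w\<in>{1..w1}. word_trees (2^w)) \<times> {..w1} \<times> {..<(2::nat)^w1} \<times> {..<(2::nat)^w1}"
 have "finite S" unfolding S_def using ex_tree_code(2) by(intro finite_cartesian_product finite_UN_I) auto
 moreover have "{g. valid g \<and> iw g \<le> w1} \<subseteq> (\<lambda>(k, T, w, x, i). Inst k T w x i) ` S"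
 proof
  fix g assume "g \<in> {g. valid g \<and> iw g \<le> w1}"
  hence v: "valid g" "iw g \<le> w1" by auto
  have p: "(2::nat)^iw g \<le> 2^w1" using v(2) by(intro power_increasing) auto
  have "ik g \<le> 2^iw g" using v(1) by(simp add: valid_def)
  hence "ik g \<le> 2^w1" "ix g < 2^w1" "ia g < 2^w1" using p valid_n[OF v(1)] by linarith+
  hence "(ik g, iT g, iw g, ix g, ia g) \<in> S"
   unfolding S_def using v valid_n(5)[OF v(1)] valid_word_tree[OF v(1)] by(intro SigmaI) auto
  thus "g \<in> (\<lambda>(k, T, w, x, i). Inst k T w x i) ` S" by(intro image_eqI[of _ _ "(ik g, iT g, iw g, ix g, ia g)"]) simp_all
 qed
 ultimately show ?thesis using finite_surj by blast
qed

lemma co_exps: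
 assumes "co G ans"
 shows "\<exists>e0 e1. \<forall>g\<in>G. evg e0 g = of_bool (ans g \<noteq> None) \<and> (\<forall>v. ans g = Some v \<longrightarrow> evg e1 g = v)"
proof -
 obtain F where F: "c1 {g \<in> G. ans g \<noteq> None} F" "\<forall>g\<in>G. \<forall>v. ans g = Some v \<longrightarrow> F g = v" and c: "cb G (\<lambda>g. ans g \<noteq> None)"
  using assms unfolding co_def by blast
 obtain e0 where e0: "\<forall>g\<in>G. evg e0 g = of_bool (ans g \<noteq> None)" using c unfolding cb_def c1_def by blast
 obtain e1 where e1: "\<forall>g\<in>{g \<in> G. ans g \<noteq> None}. evg e1 g = F g" using F(1) unfolding c1_def by blast
 show ?thesis
 proof(intro exI ballI conjI allI impI)
  fix g assume g: "g \<in> G"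
  show "evg e0 g = of_bool (ans g \<noteq> None)" using e0 g by blast
  fix v assume "ans g = Some v"
  thus "evg e1 g = v" using e1 F(2) g by auto
 qed
qed

definition "serves P t ans \<longleftrightarrow>
 (\<forall>g t' args. valid g \<longrightarrow> t \<le> t' \<longrightarrow> arg_regs args = ar g \<longrightarrow> answers (iw g) t' (bs g) P args (ans g))"

text \<open>Above \<open>w1\<close> the expressions run with the word size from the header. Up to
  \<open>w1\<close> there are finitely many queries, and a table answers them once it is known that
  equal memory and equal arguments have equal answers.\<close>

lemma op_program:
 assumes co: "\<And>G. sound G \<Longrightarrow> uniform G \<Longrightarrow> co G ans"
  and dep: "\<And>g g'. iT g = iT g' \<Longrightarrow> ix g = ix g' \<Longrightarrow> ia g = ia g' \<Longrightarrow> ans g = ans g'"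
  and bd: "\<And>g v. valid g \<Longrightarrow> ans g = Some v \<Longrightarrow> v < 2^iw g"
 shows "\<exists>P t. serves P t ans"
proof -
 let ?ev = "\<lambda>g. ev (iw g) (packed (iw g) (bs g)) (ar g)"
 define GL where "GL = {g. valid g \<and> w1 < iw g}"
 define GM where "GM = {g. valid g \<and> w0 \<le> iw g \<and> iw g \<le> w1}"
 define I where "I = {g. valid g \<and> iw g \<le> w1}"
 have "sound GL" "uniform GL" "sound GM" "uniform GM"
  unfolding sound_def uniform_def GL_def GM_def using w01 cap by auto
 note coL = co_exps[OF co[OF this(1,2)]] and coM = co_exps[OF co[OF this(3,4)]]
 obtain l0 l1 where L: "\<forall>g\<in>GL. evg l0 g = of_bool (ans g \<noteq> None) \<and> (\<forall>v. ans g = Some v \<longrightarrow> evg l1 g = v)"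
  using coL by blast
 obtain m0 m1 where M: "\<forall>g\<in>GM. evg m0 g = of_bool (ans g \<noteq> None) \<and> (\<forall>v. ans g = Some v \<longrightarrow> evg m1 g = v)"
  using coM by blast
 \<comment> \<open>Below \<open>w0\<close> the code is injective. Between \<open>w0\<close> and
   \<open>w1\<close> the expressions with the simulated third argument are never executed; their
   existence shows that the answer is a function of memory, arguments and word size.\<close>
 have det: "ans g = ans h" if g: "g \<in> I" and h: "h \<in> I"
  and eq: "iw g = iw h" "packed (iw g) (bs g) = packed (iw h) (bs h)" "ar g = ar h" for g h
 proof -
  have v: "valid g" "valid h" "iw g \<le> w1" using g h by(auto simp: I_def)
  have xi: "ix g = ix h" "ia g = ia h" using fun_cong[OF eq(3), of 0] fun_cong[OF eq(3), of 1] by(simp_all add: ar_def)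
  have fl: "fld (Bn g) (a * iw h) (iw h) = fld (Bn h) (a * iw h) (iw h)" for a
  proof -
   have "fld (Bn g) (a * iw g) (iw g) = fld (Bn h) (a * iw h) (iw h)"
    using fun_cong[OF eq(2), of a] unfolding packed_bs[OF v(1)] packed_bs[OF v(2)] .
   thus ?thesis unfolding eq(1) .
  qed
  have Bn: "Bn g = Bn h" by(rule fld_eqI[OF valid_n(5)[OF v(2)] fl])
  show ?thesis
  proof(cases "iw g < w0")
   case True
   have "code (iw h) (iT g) = code (iw h) (iT h)" using Bn True eq(1) by(simp add: Bn_def)
   hence "iT g = iT h"
    using inj_onD[OF code(1)[OF valid_n(5)[OF v(2)]]] valid_word_tree[OF v(1)] valid_word_tree[OF v(2)] eq(1) by auto
   thus ?thesis using dep xi by blast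
  next
   case False
   hence GM: "g \<in> GM" "h \<in> GM" using v eq(1) by(auto simp: GM_def)
   have "gB g = gB h" using Bn False eq(1) by(simp add: Bn_def)
   moreover have "gAr g = gAr h" unfolding gAr_def xi eq(1) ..
   ultimately have "evg e g = evg e h" for e unfolding evg_def eq(1) by simp
   hence e: "evg m0 g = evg m0 h" "evg m1 g = evg m1 h" by blast+
   show ?thesis
   proof(cases "ans g")
    case None
    hence "evg m0 g = 0" using M GM(1) by simp
    hence "ans h = None" using M GM(2) e(1) by(cases "ans h") auto
    thus ?thesis using None by simp
   next
    case (Some v)
    hence 1: "evg m0 g = 1" "evg m1 g = v" using M GM(1) by auto
    then obtain v' where "ans h = Some v'" using M GM(2) e(1) by(cases "ans h") auto
    moreover from this have "evg m1 h = v'" using M GM(2) by blast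
    ultimately show ?thesis using Some 1 e(2) by simp
   qed
  qed
 qed
 have tab: "\<exists>e. \<forall>g\<in>I. ?ev g e = F (ans g)" if F: "\<And>g. g \<in> I \<Longrightarrow> F (ans g) < 2^iw g" for F
 proof(rule table[where W = w1])
  show "finite I" unfolding I_def by(rule finite_small)
  show "1 \<le> iw g \<and> iw g \<le> w1 \<and> F (ans g) < 2^iw g" if "g \<in> I" for g using that valid_n(5) F by(auto simp: I_def)
  fix g i assume g: "g \<in> I"
  hence v: "valid g" by(simp add: I_def)
  show "packed (iw g) (bs g) i < 2^iw g \<and> ar g i < 2^iw g"
   unfolding packed_bs[OF v] using fld_less valid_n[OF v] by(auto simp: ar_def)
  show "(2^iw g \<le> i \<longrightarrow> packed (iw g) (bs g) i = 0) \<and> (2 \<le> i \<longrightarrow> ar g i = 0)"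
  proof(intro conjI impI)
   assume "2^iw g \<le> i"
   hence "iw g * 2^iw g \<le> i * iw g" by(simp add: mult.commute)
   hence "Ln g \<le> i * iw g" using Ln_le[OF v] by linarith
   thus "packed (iw g) (bs g) i = 0" unfolding packed_bs[OF v] by(rule fld_beyond[OF Bn_less[OF v]])
  qed (simp add: ar_def)
 next
  fix g h assume "g \<in> I" "h \<in> I" "iw g = iw h" "packed (iw g) (bs g) = packed (iw h) (bs h)" "ar g = ar h"
  from det[OF this] show "F (ans g) = F (ans h)" by simp
 qed
 have pos: "1 < (2::nat)^iw g" if "valid g" for g using valid_n(5)[OF that] by(intro one_less_power) auto
 obtain t0 where t0: "\<forall>g\<in>I. ?ev g t0 = of_bool (ans g \<noteq> None)"
 proof -
  have "\<exists>e. \<forall>g\<in>I. ?ev g e = of_bool (ans g \<noteq> None)"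
   by(rule tab[of "\<lambda>r. of_bool (r \<noteq> None)"]) (use pos in \<open>auto simp: I_def\<close>)
  thus thesis using that by blast
 qed
 obtain t1 where t1: "\<forall>g\<in>I. ?ev g t1 = (case ans g of None \<Rightarrow> 0 | Some v \<Rightarrow> v)"
 proof -
  have "\<exists>e. \<forall>g\<in>I. ?ev g e = (case ans g of None \<Rightarrow> 0 | Some v \<Rightarrow> v)"
   by(rule tab[of "\<lambda>r. case r of None \<Rightarrow> 0 | Some v \<Rightarrow> v"]) (use bd in \<open>auto simp: I_def split: option.splits\<close>)
  thus thesis using that by blast
 qed
 define q0 where "q0 = Iflt (Cst (2^w1 - 1)) (Bin Sub (Cst 0) (Cst 1)) l0 t0"
 define q1 where "q1 = Iflt (Cst (2^w1 - 1)) (Bin Sub (Cst 0) (Cst 1)) l1 t1"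
 have ok: "case ans g of None \<Rightarrow> ?ev g q0 = 0
   | Some v \<Rightarrow> ?ev g q0 = 1 \<and> ?ev g q1 = v"
  if v: "valid g" for g
 proof(cases "w1 < iw g")
  case True
  hence g: "g \<in> GL" using v by(simp add: GL_def)
  have "gAr g = ar g" using True by(auto simp: gAr_def ar_def fun_eq_iff)
  moreover have "Bn g = gB g" using True w01 by(simp add: Bn_def)
  ultimately have "evg e g = ?ev g e" for e unfolding evg_def packed_bs[OF v] by simp
  thus ?thesis using L g True unfolding q0_def q1_def word_split[OF valid_n(5)[OF v]] by(cases "ans g") auto
 next
  case False
  hence g: "g \<in> I" using v by(simp add: I_def)
  show ?thesis using t0 t1 g False unfolding q0_def q1_def word_split[OF valid_n(5)[OF v]] by(cases "ans g") auto
 qed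
 show ?thesis unfolding serves_def
 proof(intro exI allI impI)
  fix g t' args assume a: "valid g" "length (prog q0 q1) \<le> t'" "arg_regs args = ar g"
  show "answers (iw g) t' (bs g) (prog q0 q1) args (ans g)"
   by(rule prog_answers[OF _ a(2)], unfold a(3), rule ok[OF a(1)])
 qed
qed


lemma bs_cong: "ik g = ik g' \<Longrightarrow> iT g = iT g' \<Longrightarrow> iw g = iw g' \<Longrightarrow> bs g = bs g'"
 unfolding bs_def Ln_def Bn_def using gB_cong[of g g'] by simp

lemma ans_bounds:
 assumes v: "valid g"
 shows "ans_ith g = Some r \<Longrightarrow> r < 2^iw g" "ans_labeled g = Some r \<Longrightarrow> r < 2^iw g" "ans_parent g = Some r \<Longrightarrow> r < 2^iw g"
  "ans_degree g = Some r \<Longrightarrow> r < 2^iw g" "ans_ordinal g = Some r \<Longrightarrow> r < 2^iw g"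
proof -
 note n = valid_n[OF v] and s = sx_less[OF v, of "ix g + 1"] and nf = node_facts[OF v]
 show "ans_ith g = Some r \<Longrightarrow> r < 2^iw g"
 proof -
  assume "ans_ith g = Some r"
  hence "\<not> sx g (ix g + 1) - sx g (ix g) < ia g" "r = sx g (ix g) + ia g" using ans_ith_eq[OF v] by(auto split: if_splits)
  hence "r \<le> sx g (ix g + 1)" using nf(4) by linarith
  thus ?thesis using s n by linarith
 qed
 show "ans_labeled g = Some r \<Longrightarrow> r < 2^iw g"
 proof -
  assume r: "ans_labeled g = Some r"
  then obtain a where a: "a < rr g" "gX g a = ix g" "gJ g a = ia g" using ans_labeled_eq(1)[OF v] by auto
  have "rr g = gn g - 1" using seg_sizes(7)[OF fitsI[OF v]] .
  thus ?thesis using ans_labeled_eq(2)[OF v a] r a(1) n by simp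
 qed
 show "ans_parent g = Some r \<Longrightarrow> r < 2^iw g" using ans_parent_eq[OF v] nf(6) n by(auto split: if_splits)
 show "ans_degree g = Some r \<Longrightarrow> r < 2^iw g"
 proof -
  assume "ans_degree g = Some r"
  hence "r \<le> sx g (ix g + 1)" using ans_degree_eq[OF v] by simp
  thus ?thesis using s n by linarith
 qed
 show "ans_ordinal g = Some r \<Longrightarrow> r < 2^iw g"
 proof -
  assume "ans_ordinal g = Some r"
  hence "r \<le> max 1 (ix g)" using ans_ordinal_eq[OF v] by(auto split: if_splits)
  moreover have "1 < (2::nat)^iw g" using n(5) by(intro one_less_power) auto
  ultimately show ?thesis using n by linarith
 qed
qed

lemma ans_dep:
 assumes "iT g = iT g'" "ix g = ix g'" "ia g = ia g'"
 shows "ans_ith g = ans_ith g'" "ans_labeled g = ans_labeled g'" "ans_parent g = ans_parent g'"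
  "ans_degree g = ans_degree g'" "ans_ordinal g = ans_ordinal g'"
 unfolding ans_ith_def ans_labeled_def ans_parent_def ans_degree_def ans_ordinal_def node_def assms by(rule refl)+

lemmas programs = op_program[OF co_ith ans_dep(1) ans_bounds(1)] op_program[OF co_labeled ans_dep(2) ans_bounds(2)]
 op_program[OF co_parent ans_dep(3) ans_bounds(3)] op_program[OF co_degree ans_dep(4) ans_bounds(4)]
 op_program[OF co_ordinal ans_dep(5) ans_bounds(5)]

text \<open>Writing the word size \<open>w\<close> into the header must not cost lg c bits. With
  \<open>\<Lambda>\<close> the logarithm of \<open>k + n\<close>,
  \<open>w \<le> c * \<Lambda>\<close> and \<open>c^2 \<le> w\<close> imply
  \<open>w \<le> \<Lambda> * \<Lambda>\<close>, which is free of \<open>c\<close>; so about 2 lg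
  \<Lambda> bits suffice, and these are O(lg lg k) + O(lg n). The coefficient 271 is
  \<open>263 + 4 * 2\<close>.\<close>

lemma length_le:
 fixes c :: real
 assumes v: "valid g" and c: "real (iw g) \<le> c * log 2 (real (ik g + gn g))" "c\<^sup>2 \<le> real w1"
 shows "real (length (bs g)) \<le> of_int (tree_bits (gn g) (ik g)) +
  (ovh (gn g) + 10 * real (lg (gn g)) + (1000 + real (w0 * 2^w0))) + 271 * log 2 (log 2 (real (ik g)))"
proof -
 define LL where "LL = log 2 (log 2 (real (ik g)))"
 have k: "1 \<le> ik g" using v by(simp add: valid_def)
 have n: "1 \<le> gn g" by(rule valid_n[OF v])
 have LL: "0 \<le> LL" unfolding LL_def by(rule loglog_nonneg[OF k])
 have tb: "log 2 (real (gn g * ik g choose (gn g - 1))) - log 2 (real (gn g)) \<le> of_int (tree_bits (gn g) (ik g))"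
  by(rule tree_bits_lower[OF n k])
 have ln: "log 2 (real (gn g)) \<le> real (lg (gn g))" by(rule lg_ge_log[OF n])
 show ?thesis
 proof(cases "iw g < w0")
  case True
  have "gn g - 1 \<le> gn g * ik g" using k by(metis diff_le_self le_trans mult.right_neutral mult_le_mono2)
  hence "0 < gn g * ik g choose (gn g - 1)" by simp
  hence "1 \<le> gn g * ik g choose (gn g - 1)" by linarith
  hence "real 1 \<le> real (gn g * ik g choose (gn g - 1))" by(rule of_nat_mono)
  hence "log 2 1 \<le> log 2 (real (gn g * ik g choose (gn g - 1)))" by(intro log_mono) simp_all
  hence "0 \<le> log 2 (real (gn g * ik g choose (gn g - 1)))" by simp
  moreover have "real (length (bs g)) \<le> real (w0 * 2^w0)"
   unfolding bs_def Ln_def using True by(intro of_nat_mono) (auto intro!: mult_le_mono power_increasing)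
  ultimately show ?thesis using tb ln LL ovh_nonneg[of "gn g"] unfolding LL_def[symmetric] by simp
 next
  case False
  have cl: "real (ceillog2 (wst g + 1)) \<le> 4 + 2 * LL + 2 * real (lg (gn g))"
  proof(cases "w1 < iw g")
   case False
   thus ?thesis using LL by(simp add: wst_def)
  next
   case True
   define w where "w = real (iw g)"
   define \<Lambda> where "\<Lambda> = log 2 (real (ik g + gn g))"
   have w1: "1 \<le> w" using valid_n(5)[OF v] by(simp add: w_def)
   have "log 2 2 \<le> \<Lambda>" unfolding \<Lambda>_def using k n by(intro log_mono) auto
   hence \<Lambda>: "1 \<le> \<Lambda>" by simp
   have wc: "w \<le> c * \<Lambda>" using c(1) by(simp add: w_def \<Lambda>_def)
   have cw: "c\<^sup>2 \<le> w" using c(2) True by(simp add: w_def)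
   have "w * w \<le> (c * \<Lambda>) * (c * \<Lambda>)" using wc w1 by(intro mult_mono) auto
   also have "... = c\<^sup>2 * (\<Lambda> * \<Lambda>)" by(simp add: power2_eq_square)
   also have "... \<le> w * (\<Lambda> * \<Lambda>)" using cw \<Lambda> by(intro mult_right_mono) auto
   finally have "w \<le> \<Lambda> * \<Lambda>" using w1 by simp
   hence "log 2 w \<le> log 2 (\<Lambda> * \<Lambda>)" using w1 by(intro log_mono) auto
   also have "... = 2 * log 2 \<Lambda>" using \<Lambda> by(simp add: log_mult)
   also have "log 2 \<Lambda> \<le> 1 + LL + real (lg (gn g))"
   proof(cases "ik g < gn g")
    case True
    have "\<Lambda> \<le> log 2 (2 * real (gn g))" unfolding \<Lambda>_def using True k by(intro log_mono) auto
    also have "... = 1 + log 2 (real (gn g))" using n by(simp add: log_mult)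
    finally have "\<Lambda> \<le> 1 + real (lg (gn g))" using ln by simp
    hence "log 2 \<Lambda> \<le> log 2 (2 * real (lg (gn g)))" using \<Lambda> lg_bounds(3)[OF n] by(intro log_mono) auto
    also have "... = 1 + log 2 (real (lg (gn g)))" using lg_bounds(3)[OF n] by(simp add: log_mult)
    also have "log 2 (real (lg (gn g))) \<le> real (lg (gn g))"
    proof -
     have "real (lg (gn g)) \<le> 2^lg (gn g)" by(metis less_exp less_imp_le of_nat_le_iff of_nat_numeral of_nat_power)
     hence "log 2 (real (lg (gn g))) \<le> log 2 (2^lg (gn g))" using lg_bounds(3)[OF n] by(intro log_mono) auto
     thus ?thesis by(simp add: log_nat_power)
    qed
    finally show ?thesis using LL by simp
   next
    case F: False
    have "\<Lambda> \<le> log 2 (2 * real (ik g))" unfolding \<Lambda>_def using F n by(intro log_mono) auto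
    also have "... = 1 + log 2 (real (ik g))" using k by(simp add: log_mult)
    finally have L1: "\<Lambda> \<le> 1 + log 2 (real (ik g))" .
    show ?thesis
    proof(cases "ik g = 1")
     case True
     hence "\<Lambda> = 1" using L1 \<Lambda> by simp
     thus ?thesis using LL by simp
    next
     case False
     hence "log 2 2 \<le> log 2 (real (ik g))" using k by(intro log_mono) auto
     hence l1: "1 \<le> log 2 (real (ik g))" by simp
     hence "log 2 \<Lambda> \<le> log 2 (2 * log 2 (real (ik g)))" using L1 \<Lambda> by(intro log_mono) auto
     also have "... = 1 + LL" using l1 by(simp add: log_mult LL_def)
     finally show ?thesis by simp
    qed
   qed
   finally have lw: "log 2 w \<le> 2 * (1 + LL + real (lg (gn g)))" by simp
   have "real (ceillog2 (iw g + 1)) \<le> log 2 (real (iw g + 1)) + 1" using ceillog2_less_log[of "iw g + 1"] by simp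
   also have "log 2 (real (iw g + 1)) \<le> log 2 (2 * w)" using w1 by(intro log_mono) (auto simp: w_def)
   also have "log 2 (2 * w) = 1 + log 2 w" using w1 by(simp add: log_mult)
   finally show ?thesis using lw True by(simp add: wst_def)
  qed
  have "real (length (bs g)) = real (glen g)" using False by(simp add: bs_def Ln_def)
  moreover have "0 \<le> real (w0 * 2^w0)" by simp
  ultimately show ?thesis using glen_le[OF v] cl tb ln LL unfolding LL_def[symmetric] by linarith
 qed
qed

end

text \<open>\<open>f\<close>, \<open>C\<close> and the lower threshold \<open>w0\<close> are fixed
  before \<open>c\<close>; the upper threshold \<open>w1\<close>, the programs and their time bound
  may depend on \<open>c\<close>.\<close>

theorem theorem6p2:
 "\<exists>(f :: nat \<Rightarrow> real) (C :: real). f \<in> o(\<lambda>n. real n) \<and>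
  (\<forall>c :: real. \<exists>(t :: nat) P_ith P_labeled P_parent P_degree P_ordinal.
   \<forall>(k :: nat) (n :: nat) (w :: nat) Tr.
    k \<ge> 1 \<longrightarrow> cardinal_tree k Tr \<longrightarrow> card Tr = n \<longrightarrow>
    log 2 (real (k + n)) \<le> real w \<longrightarrow> real w \<le> c * log 2 (real (k + n)) \<longrightarrow>
    (\<exists>(bs :: bool list) (num :: nat list \<Rightarrow> nat).
     real (length bs) \<le> of_int (tree_bits n k) + f n + C * log 2 (log 2 (real k)) \<and>
     bij_betw num Tr {0..<n} \<and>
     (\<forall>x\<in>Tr.
      (\<forall>i < 2^w. answers w t bs P_ith [num x, i] (map_option num (ith_child Tr x i))) \<and>
      (\<forall>j < 2^w. answers w t bs P_labeled [num x, j] (map_option num (child_labeled Tr x j))) \<and>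
      answers w t bs P_parent [num x] (map_option num (parent x)) \<and>
      answers w t bs P_degree [num x] (Some (degree Tr x)) \<and>
      answers w t bs P_ordinal [num x] (Some (ordinal_position Tr x)))))"
proof -
 obtain c0 where c0: "\<And>n. ovh n \<le> real n / 8 + c0" using smallo_linear[OF ovh_smallo] by blast
 define w0 where "w0 = 2000 + nat \<lceil>c0\<rceil>"
 define code where "code w = (SOME h. inj_on h (word_trees (2^w)) \<and> (\<forall>Tr\<in>word_trees (2^w). h Tr < (2::nat)^(w * 2^w)))" for w :: nat
 have code: "inj_on (code w) (word_trees (2^w)) \<and> (\<forall>Tr\<in>word_trees (2^w). code w Tr < (2::nat)^(w * 2^w))" if "1 \<le> w" for w
  unfolding code_def by(rule someI_ex[OF ex_tree_code(1)[OF that]])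
 define f where "f n = ovh n + 10 * real (lg n) + (1000 + real (w0 * 2^w0))" for n
 have fo: "f \<in> o(\<lambda>n. real n)"
 proof -
  have 1: "(\<lambda>n. 10 * real (lg n)) \<in> o(\<lambda>n. real n)" using lg_smallo by simp
  have 2: "(\<lambda>_. 1000 + real (w0 * 2^w0)) \<in> o(\<lambda>n. real n)"
   by(intro smalloI_tendsto tendsto_divide_0[OF tendsto_const] filterlim_at_top_imp_at_infinity filterlim_real_sequentially eventually_mono[OF eventually_gt_at_top[of 0]]) auto
  show ?thesis unfolding f_def by(rule sum_in_smallo(1)[OF sum_in_smallo(1)[OF ovh_smallo 1] 2])
 qed
 show ?thesis
 proof(rule exI[of _ f], rule exI[of _ 271], intro conjI allI, goal_cases)
  case 1
  show ?case by(rule fo)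
 next
  case (2 c)
  \<comment> \<open>Beyond \<open>c^2\<close> the word size can be stored at a cost free of
    \<open>c\<close> (\<open>length_le\<close>).\<close>
  define w1 where "w1 = max w0 (nat \<lceil>c\<^sup>2\<rceil>)"
  interpret R: rep_all w1 w0 code
  proof
   show "160 \<le> w0" "w0 \<le> w1" by(simp_all add: w0_def w1_def)
   show "rep.glen w1 g < iw g * 2^iw g" if "valid g" "w0 \<le> iw g" for g
    using rep.capacity[OF that(1) c0] that(2) unfolding w0_def by blast
  qed (use code in auto)
  have cw1: "c\<^sup>2 \<le> real w1"
  proof -
   have "c\<^sup>2 \<le> real (nat \<lceil>c\<^sup>2\<rceil>)" by(rule real_nat_ceiling_ge)
   also have "... \<le> real w1" by(rule of_nat_mono) (simp add: w1_def)
   finally show ?thesis .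
  qed
  obtain P1 t1 where P1: "R.serves P1 t1 R.ans_ith" using R.programs(1) by blast
  obtain P2 t2 where P2: "R.serves P2 t2 R.ans_labeled" using R.programs(2) by blast
  obtain P3 t3 where P3: "R.serves P3 t3 R.ans_parent" using R.programs(3) by blast
  obtain P4 t4 where P4: "R.serves P4 t4 R.ans_degree" using R.programs(4) by blast
  obtain P5 t5 where P5: "R.serves P5 t5 R.ans_ordinal" using R.programs(5) by blast
  note S = R.serves_def[THEN iffD1, rule_format]
  \<comment> \<open>Each program answers at every time from its own bound on, so the sum is a common
    bound.\<close>
  define t where "t = t1 + t2 + t3 + t4 + t5"
  have t: "t1 \<le> t" "t2 \<le> t" "t3 \<le> t" "t4 \<le> t" "t5 \<le> t" by(simp_all add: t_def)
  show ?case
  proof(rule exI[of _ t], rule exI[of _ P1], rule exI[of _ P2], rule exI[of _ P3], rule exI[of _ P4], rule exI[of _ P5],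
    intro allI impI, goal_cases)
   case (1 k n w Tr)
   note k = 1(1) and T = 1(2) and n = 1(3) and w = 1(4,5)
   interpret tr: tree k Tr by unfold_locales (rule T)
   have W: "k + n \<le> 2^w"
   proof -
    have "real (k + n) \<le> 2 powr real w" using w(1) k by(simp add: log_le_iff)
    hence "real (k + n) \<le> real (2^w)" by(simp add: powr_realpow)
    thus ?thesis by(simp only: of_nat_le_iff)
   qed
   define inst where "inst x i = Inst k Tr w (num Tr x) i" for x i
   have v: "valid (inst x i)" if "x \<in> Tr" "i < 2^w" for x i
    unfolding valid_def inst_def using k T W n tr.num_less[OF that(1)] that(2) by simp
   define B where "B = R.bs (inst [] 0)"
   have Bs: "R.bs (inst x i) = B" for x i unfolding B_def by(rule R.bs_cong) (simp_all add: inst_def)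
   have z: "(0::nat) < 2^w" by simp
   \<comment> \<open>A missing second argument is read as 0, which matches the instance with second
     argument 0.\<close>
   have ar: "arg_regs [num Tr x, i] = R.ar (inst x i)" "arg_regs [num Tr x] = R.ar (inst x 0)" for x i
    by(auto simp: arg_regs_def R.ar_def inst_def fun_eq_iff nth_Cons')
   have nd: "R.node (inst x i) = x" if "x \<in> Tr" for x i using tr.nd_num[OF that] by(simp add: R.node_def inst_def)
   show ?case
   proof(rule exI[of _ B], rule exI[of _ "num Tr"], intro conjI ballI allI impI)
    have g: "gn (inst [] 0) = n" "ik (inst [] 0) = k" "iw (inst [] 0) = w" by(simp_all add: gn_def inst_def n)
    show "real (length B) \<le> of_int (tree_bits n k) + f n + 271 * log 2 (log 2 (real k))"
     using R.length_le[OF v[OF tr.root z], of c] w(2) cw1 unfolding g B_def f_def by simp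
    show "bij_betw (num Tr) Tr {0..<n}" using tr.num_bij n by simp
    fix x assume x: "x \<in> Tr"
    show "answers w t B P1 [num Tr x, i] (map_option (num Tr) (ith_child Tr x i))" if "i < 2^w" for i
     using S[OF P1 v[OF x that] t(1) ar(1)] nd[OF x] unfolding Bs R.ans_ith_def by(simp add: inst_def)
    show "answers w t B P2 [num Tr x, j] (map_option (num Tr) (child_labeled Tr x j))" if "j < 2^w" for j
     using S[OF P2 v[OF x that] t(2) ar(1)] nd[OF x] unfolding Bs R.ans_labeled_def by(simp add: inst_def)
    show "answers w t B P3 [num Tr x] (map_option (num Tr) (parent x))"
     using S[OF P3 v[OF x z] t(3) ar(2)] nd[OF x] unfolding Bs R.ans_parent_def by(simp add: inst_def)
    show "answers w t B P4 [num Tr x] (Some (degree Tr x))"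
     using S[OF P4 v[OF x z] t(4) ar(2)] nd[OF x] unfolding Bs R.ans_degree_def by(simp add: inst_def)
    show "answers w t B P5 [num Tr x] (Some (ordinal_position Tr x))"
     using S[OF P5 v[OF x z] t(5) ar(2)] nd[OF x] unfolding Bs R.ans_ordinal_def by(simp add: inst_def)
   qed
  qed
 qed
qed

end
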